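(* Let $E\subseteq\mathbf R^d$ be a non-degenerate parallelepiped, $s>0$, $t>0$, and $\phi\in\mathcal S_t^s(\mathbf R^d)\setminus\{0\}$ (resp. $\phi\in\Sigma_t^s(\mathbf R^d)\setminus\{0\}$). Let $f$ be an $E$-periodic Gelfand–Shilov distribution on $\mathbf R^d$ for which $V_\phi f$ is defined. Then: (1) $f\in(\mathcal E_s^E)'(\mathbf R^d)$ (resp. $f\in(\mathcal E_{0,s}^E)'(\mathbf R^d)$) if and only if $|V_\phi f(x,\xi)|\lesssim e^{r|\xi|^{1/s}}$ for every $r>0$ (resp. for some $r>0$); (2) $f\in\mathcal E_s^E(\mathbf R^d)$ (resp. $f\in\mathcal E_{0,s}^E(\mathbf R^d)$) if and only if $|V_\phi f(x,\xi)|\lesssim e^{-r|\xi|^{1/s}}$ for some $r>0$ (resp. for every $r>0$).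
   Context: Gelfand–Shilov spaces: for $s,t>0$, $\mathcal S_t^s(\mathbf R^d)$ is the set of $f\in C^\infty(\mathbf R^d)$ with $\sup_{\alpha,\beta,x}\frac{|x^\beta\partial^\alpha f(x)|}{h^{|\alpha+\beta|}\alpha!^s\beta!^t}<\infty$ for some $h>0$; $\Sigma_t^s(\mathbf R^d)$ requires this for every $h>0$; their duals are Gelfand–Shilov distribution spaces. A Gelfand–Shilov distribution here means an element of some such dual space (e.g. of $(\mathcal S_{t_0}^{s_0})'(\mathbf R^d)$ with $\mathcal S_t^s\subseteq\mathcal S_{t_0}^{s_0}$), so that $V_\phi f(x,\xi)=\mathscr F(f\,\overline{\phi(\cdot-x)})(\xi)$ is defined, where $\widehat g(\xi)=(2\pi)^{-d/2}\int g(x)e^{-i\langle x,\xi\rangle}dx$. $A\lesssim B$ means $A\le cB$ for a constant $c>0$ independent of $(x,\xi)$. $E=\{\sum x_ke_k:0\le x_k\le1\}$ for a basis $e_1,\dots,e_d$, $\Lambda_E=\sum\mathbf Ze_k$; $f$ is $E$-periodic if $f(\cdot+j)=f$ for all $j\in\Lambda_E$. Gevrey classes: for $s\ge0$, $\mathcal E_s(\mathbf R^d)$ (resp. $\mathcal E_{0,s}(\mathbf R^d)$) consists of $f\in C^\infty$ such that for every compact $K$, $\sup_\alpha\|\partial^\alpha f\|_{L^\infty(K)}/(h^{|\alpha|}\alpha!^s)<\infty$ for some (resp. every) $h>0$; $\mathcal E_s^E$, $\mathcal E_{0,s}^E$ denote their $E$-periodic elements and $(\mathcal E_s^E)'$,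 $(\mathcal E_{0,s}^E)'$ their duals. The dual $(\mathcal E_s^E)'$ (resp. $(\mathcal E_{0,s}^E)'$) is identified with formal series $\sum_{\alpha\in\Lambda'_E}c(\alpha)e^{i\langle\cdot,\alpha\rangle}$ ($\Lambda'_E$ the dual lattice, $\langle e_j,e'_k\rangle=2\pi\delta_{jk}$) with $|c(\alpha)|\lesssim e^{\varepsilon|\alpha|^{1/s}}$ for every (resp. some) $\varepsilon>0$, which act on $\phi$ as $\langle f,\phi\rangle=(2\pi)^{d/2}\sum_\alpha c(\alpha)\widehat\phi(-\alpha)$. *)

theory Defs
  imports "HOL-Analysis.Analysis"
begin

type_synonym 'n mi = "'n \<Rightarrow> nat"

definition mi_abs :: "'n::finite mi \<Rightarrow> nat" where
  "mi_abs \<alpha> = (\<Sum>i\<in>UNIV. \<alpha> i)"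

definition mi_fact :: "'n::finite mi \<Rightarrow> real" where
  "mi_fact \<alpha> = (\<Prod>i\<in>UNIV. fact (\<alpha> i))"

definition mon :: "real^'n::finite \<Rightarrow> 'n mi \<Rightarrow> real" where
  "mon x \<beta> = (\<Prod>i\<in>UNIV. (x $ i) ^ \<beta> i)"

definition dpart :: "'n::finite \<Rightarrow> (real^'n \<Rightarrow> complex) \<Rightarrow> real^'n \<Rightarrow> complex" where
  "dpart i f x = vector_derivative (\<lambda>t. f (x + t *\<^sub>R axis i 1)) (at 0)"

definition dlist :: "'n::finite list \<Rightarrow> (real^'n \<Rightarrow> complex) \<Rightarrow> real^'n \<Rightarrow> complex" where
  "dlist is f = foldr dpart is f"

definition idx_list :: "'n::finite list" where
  "idx_list = (SOME xs. distinct xs \<and> set xs = UNIV)"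

definition dmi :: "'n::finite mi \<Rightarrow> (real^'n \<Rightarrow> complex) \<Rightarrow> real^'n \<Rightarrow> complex" where
  "dmi \<alpha> f = dlist (concat (map (\<lambda>i. replicate (\<alpha> i) i) idx_list)) f"

definition smooth :: "(real^'n::finite \<Rightarrow> complex) \<Rightarrow> bool" where
  "smooth f \<longleftrightarrow> (\<forall>is. continuous_on UNIV (dlist is f) \<and>
      (\<forall>i x. (\<lambda>t. dlist is f (x + t *\<^sub>R axis i 1)) differentiable (at 0)))"

definition gs_bounded :: "real \<Rightarrow> real \<Rightarrow> real \<Rightarrow> real \<Rightarrow> (real^'n::finite \<Rightarrow> complex) \<Rightarrow> bool" where
  "gs_bounded s t h C f \<longleftrightarrow> (\<forall>\<alpha> \<beta> x.
      \<bar>mon x \<beta>\<bar> * norm (dmi \<alpha> f x)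
        \<le> C * h ^ (mi_abs \<alpha> + mi_abs \<beta>) * mi_fact \<alpha> powr s * mi_fact \<beta> powr t)"

definition GS_S :: "real \<Rightarrow> real \<Rightarrow> (real^'n::finite \<Rightarrow> complex) set" where
  "GS_S s t = {f. smooth f \<and> (\<exists>h>0. \<exists>C. gs_bounded s t h C f)}"

definition GS_Sigma :: "real \<Rightarrow> real \<Rightarrow> (real^'n::finite \<Rightarrow> complex) set" where
  "GS_Sigma s t = {f. smooth f \<and> (\<forall>h>0. \<exists>C. gs_bounded s t h C f)}"

definition GS_test :: "bool \<Rightarrow> real \<Rightarrow> real \<Rightarrow> (real^'n::finite \<Rightarrow> complex) set" where
  "GS_test b s t = (if b then GS_S s t else GS_Sigma s t)"

text \<open>u is an element of the dual of GS_test b s t: a linear functional which is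
continuous for the inductive limit topology (S case: bounded on each step space)
resp. projective limit topology (\<Sigma> case: bounded by one seminorm).\<close>
definition GS_dual :: "bool \<Rightarrow> real \<Rightarrow> real \<Rightarrow> ((real^'n::finite \<Rightarrow> complex) \<Rightarrow> complex) \<Rightarrow> bool" where
  "GS_dual b s t u \<longleftrightarrow>
     (\<forall>f\<in>GS_test b s t. \<forall>g\<in>GS_test b s t. \<forall>a c::complex.
         u (\<lambda>x. a * f x + c * g x) = a * u f + c * u g) \<and>
     (if b then (\<forall>h>0. \<exists>C\<ge>0. \<forall>f\<in>GS_test b s t. \<forall>B. gs_bounded s t h B f \<longrightarrow> norm (u f) \<le> C * B)
      else (\<exists>h>0. \<exists>C\<ge>0. \<forall>f\<in>GS_test b s t. \<forall>B. gs_bounded s t h B f \<longrightarrow> norm (u f) \<le> C * B))"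

definition lattice :: "('n::finite \<Rightarrow> real^'n) \<Rightarrow> (real^'n) set" where
  "lattice e = {(\<Sum>k\<in>UNIV. of_int (n k) *\<^sub>R e k) | n. True}"

definition dual_lattice :: "('n::finite \<Rightarrow> real^'n) \<Rightarrow> (real^'n) set" where
  "dual_lattice e = {\<alpha>. \<forall>j. \<exists>k::int. e j \<bullet> \<alpha> = 2 * pi * of_int k}"

definition periodic_fun :: "('n::finite \<Rightarrow> real^'n) \<Rightarrow> (real^'n \<Rightarrow> complex) \<Rightarrow> bool" where
  "periodic_fun e f \<longleftrightarrow> (\<forall>j\<in>lattice e. \<forall>x. f (x + j) = f x)"

text \<open>E-periodicity of a distribution: <f(.+j), \<psi>> = <f, \<psi>(.-j)> = <f, \<psi>>.\<close>
definition periodic_dist :: "('n::finite \<Rightarrow> real^'n) \<Rightarrow> bool \<Rightarrow> real \<Rightarrow> real \<Rightarrow>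
    ((real^'n \<Rightarrow> complex) \<Rightarrow> complex) \<Rightarrow> bool" where
  "periodic_dist e b s t u \<longleftrightarrow>
     (\<forall>j\<in>lattice e. \<forall>\<psi>\<in>GS_test b s t. u (\<lambda>y. \<psi> (y - j)) = u \<psi>)"

definition fourier :: "(real^'n::finite \<Rightarrow> complex) \<Rightarrow> real^'n \<Rightarrow> complex" where
  "fourier g \<xi> = complex_of_real ((2 * pi) powr (- real CARD('n) / 2)) *
      (LINT x|lborel. g x * cis (- (x \<bullet> \<xi>)))"

definition stft_window :: "(real^'n::finite \<Rightarrow> complex) \<Rightarrow> real^'n \<Rightarrow> real^'n \<Rightarrow> real^'n \<Rightarrow> complex" where
  "stft_window \<phi> x \<xi> = (\<lambda>y. cnj (\<phi> (y - x)) * cis (- (y \<bullet> \<xi>)))"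

definition stft :: "(real^'n::finite \<Rightarrow> complex) \<Rightarrow> ((real^'n \<Rightarrow> complex) \<Rightarrow> complex) \<Rightarrow>
    real^'n \<Rightarrow> real^'n \<Rightarrow> complex" where
  "stft \<phi> u x \<xi> = complex_of_real ((2 * pi) powr (- real CARD('n) / 2)) * u (stft_window \<phi> x \<xi>)"

definition gevrey :: "real \<Rightarrow> (real^'n::finite \<Rightarrow> complex) set" where
  "gevrey s = {f. smooth f \<and> (\<forall>K. compact K \<longrightarrow> (\<exists>h>0. \<exists>C. \<forall>\<alpha>. \<forall>x\<in>K.
       norm (dmi \<alpha> f x) \<le> C * h ^ mi_abs \<alpha> * mi_fact \<alpha> powr s))}"

definition gevrey0 :: "real \<Rightarrow> (real^'n::finite \<Rightarrow> complex) set" where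
  "gevrey0 s = {f. smooth f \<and> (\<forall>K. compact K \<longrightarrow> (\<forall>h>0. \<exists>C. \<forall>\<alpha>. \<forall>x\<in>K.
       norm (dmi \<alpha> f x) \<le> C * h ^ mi_abs \<alpha> * mi_fact \<alpha> powr s))}"

definition in_gevrey_per :: "bool \<Rightarrow> ('n::finite \<Rightarrow> real^'n) \<Rightarrow> real \<Rightarrow> bool \<Rightarrow> real \<Rightarrow> real \<Rightarrow>
    ((real^'n \<Rightarrow> complex) \<Rightarrow> complex) \<Rightarrow> bool" where
  "in_gevrey_per roum e s b s0 t0 u \<longleftrightarrow>
     (\<exists>g. g \<in> (if roum then gevrey s else gevrey0 s) \<and> periodic_fun e g \<and>
        (\<forall>\<psi>\<in>GS_test b s0 t0. u \<psi> = (LINT x|lborel. g x * \<psi> x)))"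

text \<open>u belongs to (E_s^E)' (roum = True; coefficient bound for every \<epsilon>) resp.
(E_{0,s}^E)' (roum = False; for some \<epsilon>): it is a formal Fourier series
sum c(\<alpha>) e^{i<.,\<alpha>>} over the dual lattice acting as (2\<pi>)^{d/2} sum c(\<alpha>) \<psi>^(-\<alpha>).\<close>
definition in_gevrey_per_dual :: "bool \<Rightarrow> ('n::finite \<Rightarrow> real^'n) \<Rightarrow> real \<Rightarrow> bool \<Rightarrow> real \<Rightarrow> real \<Rightarrow>
    ((real^'n \<Rightarrow> complex) \<Rightarrow> complex) \<Rightarrow> bool" where
  "in_gevrey_per_dual roum e s b s0 t0 u \<longleftrightarrow>
     (\<exists>c :: real^'n \<Rightarrow> complex.
        (if roum then (\<forall>\<epsilon>>0. \<exists>C. \<forall>\<alpha>\<in>dual_lattice e. norm (c \<alpha>) \<le> C * exp (\<epsilon> * norm \<alpha> powr (1 / s)))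
         else (\<exists>\<epsilon>>0. \<exists>C. \<forall>\<alpha>\<in>dual_lattice e. norm (c \<alpha>) \<le> C * exp (\<epsilon> * norm \<alpha> powr (1 / s)))) \<and>
        (\<forall>\<psi>\<in>GS_test b s0 t0.
           ((\<lambda>\<alpha>. complex_of_real ((2 * pi) powr (real CARD('n) / 2)) * c \<alpha> * fourier \<psi> (- \<alpha>))
              has_sum u \<psi>) (dual_lattice e)))"

end

theory Submission
  imports Defs "HOL-Real_Asymp.Real_Asymp"
begin

text \<open>
  Write \<open>\<tau>\<^sub>z \<psi> = \<psi>(\<cdot> - z)\<close>. For a periodic functional \<open>u\<close> the function \<open>z \<mapsto> u (\<tau>\<^sub>z \<psi>)\<close> is continuous
  and periodic. Its Fourier coefficient at a dual lattice point \<open>\<alpha>\<close> is, as a functional of \<open>\<psi>\<close>,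
  multiplied by a character under translations, hence equal to \<open>c(\<alpha>) \<integral> \<psi>(y) e\<^sup>i\<^sup>\<langle>\<^sup>y\<^sup>,\<^sup>\<alpha>\<^sup>\<rangle> dy\<close> for a constant
  \<open>c(\<alpha>)\<close>. Fourier inversion on the torus at \<open>z = 0\<close> gives \<open>u \<psi> = \<Sum>\<^sub>\<alpha> c(\<alpha>) \<integral> \<psi>(y) e\<^sup>i\<^sup>\<langle>\<^sup>y\<^sup>,\<^sup>\<alpha>\<^sup>\<rangle> dy\<close>.

  Inserting the windows of the short-time Fourier transform shows that, up to a unimodular factor,
  \<open>x \<mapsto> V u (x, \<xi>)\<close> has the Fourier coefficients \<open>c(\<alpha>) \<cdot> F(\<alpha> - \<xi>)\<close>, where \<open>F\<close> is the conjugate of the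
  Fourier transform of the window. Fixing \<open>\<eta>\<close> with \<open>F(-\<eta>) \<noteq> 0\<close> bounds \<open>c(\<alpha>)\<close> by the supremum of
  \<open>|V u (x, \<alpha> + \<eta>)|\<close> over \<open>x\<close>; conversely \<open>V u\<close> is bounded by a convolution of \<open>|c|\<close> with \<open>|F|\<close>,
  which decays like \<open>e\<close> to the power \<open>- r |\<cdot>|\<^sup>1\<^sup>/\<^sup>s\<close>. Growth and decay of \<open>V u\<close> are thus equivalent to
  growth and decay of \<open>c\<close>, and exponential decay of \<open>c\<close> characterizes the periodic Gevrey functions.
\<close>

section \<open>Integrals and mean value estimates\<close>

text \<open>The test spaces may contain no compactly supported function (small \<open>s0\<close>),
  and \<open>s0\<close>, \<open>t0\<close>, \<open>b\<close> are tied to \<open>s\<close>,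
  \<open>t\<close> only through the window, so \<open>u\<close> cannot be localized by cut-offs;
  everything is extracted by translation. That a functional multiplied by a character under
  translations is a multiple of one Fourier integral follows by evaluating it on a convolution in
  both orders. The multiples must be controlled uniformly in \<alpha>: the window at frequency
  \<alpha> + \<eta> has the Fourier integral \<open>cnj (ftrans \<phi> \<eta>)\<close> at \<alpha>,
  the same number for every \<alpha>, so a single divisor occurs. Absolute convergence of the
  expansion must be reached before any bound on c is known; passing from \<psi> to its derivatives
  trades powers of |\<alpha>| against boundedness of the periodic profile. Finally 1/s may exceed 1,
  where |.|^(1/s) is not subadditive; each comparison of \<alpha>, \<xi> and \<xi> - \<alpha> costs
  a factor 2^(1/s) in the rate, and the estimates are arranged so that the quantifiers over r absorb
  it.\<close>

lemma integrable_decay: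
  "integrable lborel (\<lambda>x::'a::euclidean_space. 1 / (1 + norm x) ^ (DIM('a) + 1))"
proof (rule integrableI_bounded)
  define m where "m = DIM('a) + 1"
  \<comment> \<open>Dyadic shells: for \<open>2^j \<le> 1 + norm x < 2^(j+1)\<close> the integrand
    is at most \<open>c j\<close>, while \<open>B j\<close> has volume of order
    \<open>2^(j d)\<close>. The exponent \<open>d + 1\<close> leaves a geometric series of ratio
    1/2.\<close>
  define c where "c j = (1/2::real) ^ (j * m)" for j
  define B where "B j = ball (0::'a) (2 ^ Suc j)" for j :: nat
  have [measurable]: "B j \<in> sets borel" for j by (simp add: B_def)
  have pt: "ennreal (norm (1 / (1 + norm x) ^ m)) \<le> (\<Sum>j. ennreal (c j) * indicator (B j) x)" for x :: 'a
  proof -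
    define k where "k = nat \<lfloor>1 + norm x\<rfloor>"
    have k: "real k \<le> 1 + norm x" "1 + norm x < real k + 1" "k \<ge> 1"
      using floor_correct[of "1 + norm x"] by (simp_all add: k_def le_nat_iff le_floor_iff)
    then obtain j where j1: "2 ^ j \<le> k" and j2: "k < 2 ^ (j + 1)"
      using ex_power_ivl1[of 2 k] by auto
    have "real (2 ^ j) \<le> real k" using j1 by (rule of_nat_mono)
    then have "2 ^ j \<le> real k" by (simp only: of_nat_power of_nat_numeral)
    moreover have "real (Suc k) \<le> real (2 ^ (j + 1))" using Suc_leI[OF j2] by (rule of_nat_mono)
    then have "real k + 1 \<le> 2 ^ (j + 1)" by (simp only: of_nat_power of_nat_numeral of_nat_Suc)
    ultimately have j: "2 ^ j \<le> 1 + norm x" "1 + norm x < 2 ^ Suc j" using k(1,2) unfolding Suc_eq_plus1 by linarith+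
    have "1 / (1 + norm x) ^ m \<le> 1 / (2 ^ j) ^ m"
      using j(1) by (intro divide_left_mono power_mono mult_pos_pos zero_less_power) (auto simp: add_pos_nonneg)
    also have "\<dots> = c j" by (simp add: c_def power_mult power_divide power_one_over)
    finally have "ennreal (norm (1 / (1 + norm x) ^ m)) \<le> ennreal (c j) * indicator (B j) x"
      using j(2) by (auto simp: B_def intro!: ennreal_leI)
    also have "\<dots> \<le> (\<Sum>j. ennreal (c j) * indicator (B j) x)"
    proof -
      have "f j \<le> (\<Sum>j. f j)" for f :: "nat \<Rightarrow> ennreal"
        using sum_le_suminf[of f "{j}"] by simp
      then show ?thesis .
    qed
    finally show ?thesis .
  qed
  have "(\<integral>\<^sup>+x. ennreal (norm (1 / (1 + norm (x::'a)) ^ m)) \<partial>lborel) \<le> (\<integral>\<^sup>+x. (\<Sum>j. ennreal (c j) * indicator (B j) x) \<partial>lborel)"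
    by (rule nn_integral_mono) (rule pt)
  also have "\<dots> = (\<Sum>j. \<integral>\<^sup>+x. ennreal (c j) * indicator (B j) x \<partial>lborel)"
    by (rule nn_integral_suminf) measurable
  also have "\<dots> = (\<Sum>j. ennreal (c j * (unit_ball_vol (real DIM('a)) * (2 ^ Suc j) ^ DIM('a))))"
    by (subst nn_integral_cmult_indicator) (auto simp: B_def emeasure_ball c_def ennreal_mult)
  also have "(\<lambda>j. c j * (unit_ball_vol (real DIM('a)) * (2 ^ Suc j) ^ DIM('a))) =
      (\<lambda>j. unit_ball_vol (real DIM('a)) * 2 ^ DIM('a) * (1/2) ^ j)"
    by (simp add: c_def m_def fun_eq_iff field_simps power_add power_mult power_mult_distrib power_one_over)
  also have "(\<Sum>j. ennreal (unit_ball_vol (real DIM('a)) * 2 ^ DIM('a) * (1/2) ^ j)) < \<infinity>"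
    by (subst suminf_ennreal2) (auto intro!: summable_mult summable_geometric)
  finally show "(\<integral>\<^sup>+x. ennreal (norm (1 / (1 + norm (x::'a)) ^ (DIM('a) + 1))) \<partial>lborel) < \<infinity>"
    by (simp add: m_def)
qed simp

text \<open>Difference quotients can be tested along sequences, which is the form in which dominated
  convergence applies.\<close>

lemma has_vector_derivative_quotient:
  "(f has_vector_derivative D) (at (0::real)) \<longleftrightarrow> ((\<lambda>h. (f h - f 0) /\<^sub>R h) \<longlongrightarrow> D) (at 0)"
proof -
  have "((\<lambda>h. norm (f h - f 0 - (h - 0) *\<^sub>R D) / norm (h - 0)) \<longlongrightarrow> 0) (at 0) \<longleftrightarrow>
      ((\<lambda>h. norm ((f h - f 0) /\<^sub>R h - D)) \<longlongrightarrow> 0) (at 0)"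
  proof (rule filterlim_cong[OF refl refl])
    have "norm (f h - f 0 - (h - 0) *\<^sub>R D) / norm (h - 0) = norm ((f h - f 0) /\<^sub>R h - D)" if "h \<noteq> 0" for h
    proof -
      have "(f h - f 0) /\<^sub>R h - D = (f h - f 0 - h *\<^sub>R D) /\<^sub>R h" using that by (simp add: scaleR_diff_right)
      then show ?thesis by (simp add: divide_inverse mult.commute)
    qed
    then show "\<forall>\<^sub>F h in at 0. norm (f h - f 0 - (h - 0) *\<^sub>R D) / norm (h - 0) = norm ((f h - f 0) /\<^sub>R h - D)"
      by (auto simp: eventually_at_filter)
  qed
  then show ?thesis
    unfolding has_vector_derivative_def has_derivative_iff_norm
    by (simp add: bounded_linear_scaleR_left tendsto_norm_zero_iff LIM_zero_iff)
qed

text \<open>The closed segment leaves the order of \<open>a\<close> and \<open>b\<close> open, so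
  increments of either sign are covered.\<close>

lemma vector_mvt_bound:
  fixes g :: "real \<Rightarrow> 'a::real_normed_vector"
  assumes "\<And>t. t \<in> closed_segment a b \<Longrightarrow> (g has_vector_derivative g' t) (at t)"
    and "\<And>t. t \<in> closed_segment a b \<Longrightarrow> norm (g' t) \<le> B"
  shows "norm (g b - g a) \<le> B * \<bar>b - a\<bar>"
proof -
  have "norm (g b - g a) \<le> B * norm (b - a)"
  proof (rule differentiable_bound[where S = "closed_segment a b" and f' = "\<lambda>t h. h *\<^sub>R g' t"])
    fix t assume t: "t \<in> closed_segment a b"
    show "(g has_derivative (\<lambda>h. h *\<^sub>R g' t)) (at t within closed_segment a b)"
      using assms(1)[OF t] unfolding has_vector_derivative_def by (rule has_derivative_at_withinI)
    show "onorm (\<lambda>h. h *\<^sub>R g' t) \<le> B"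
      using assms(2)[OF t] by (intro onorm_le) (simp add: mult.commute[of B] mult_left_mono)
  qed auto
  then show ?thesis by simp
qed

text \<open>Dominated convergence for difference quotients, which the mean value estimate bounds by
  \<open>G\<close>. The derivative is measurable as a limit of measurable quotients.\<close>

lemma has_vector_derivative_integral:
  fixes F :: "real \<Rightarrow> 'a \<Rightarrow> 'b::{banach, second_countable_topology}"
  assumes int: "\<And>t. \<bar>t\<bar> \<le> 1 \<Longrightarrow> integrable M (F t)"
    and der: "\<And>t z. \<bar>t\<bar> \<le> 1 \<Longrightarrow> ((\<lambda>t. F t z) has_vector_derivative F' t z) (at t)"
    and bd: "\<And>t z. \<bar>t\<bar> \<le> 1 \<Longrightarrow> norm (F' t z) \<le> G z"
    and G: "integrable M G"
  shows "((\<lambda>t. LINT z|M. F t z) has_vector_derivative (LINT z|M. F' 0 z)) (at 0)"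
    and "F' 0 \<in> borel_measurable M"
proof -
  have mI: "F t \<in> borel_measurable M" if "\<bar>t\<bar> \<le> 1" for t
    using int[OF that] by auto
  have conv: "(\<lambda>n. (F (X n) z - F 0 z) /\<^sub>R X n) \<longlonglongrightarrow> F' 0 z"
    if "\<And>n. X n \<noteq> 0" "X \<longlonglongrightarrow> 0" for X z
    using der[of 0 z, unfolded has_vector_derivative_quotient tendsto_at_iff_sequentially] that
    by (auto simp: o_def)
  show m: "F' 0 \<in> borel_measurable M"
  proof (rule borel_measurable_LIMSEQ_metric)
    show "(\<lambda>n. (F (1 / Suc n) z - F 0 z) /\<^sub>R (1 / Suc n)) \<longlonglongrightarrow> F' 0 z" for z
      by (rule conv) (use LIMSEQ_inverse_real_of_nat in \<open>simp_all add: inverse_eq_divide\<close>)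
    show "(\<lambda>z. (F (1 / Suc n) z - F 0 z) /\<^sub>R (1 / Suc n)) \<in> borel_measurable M" for n
      using mI[of "1 / Suc n"] mI[of 0] by simp
  qed
  have "(\<lambda>n. ((LINT z|M. F (X n) z) - (LINT z|M. F 0 z)) /\<^sub>R X n) \<longlonglongrightarrow> (LINT z|M. F' 0 z)"
    if X: "\<And>n. X n \<noteq> 0" "X \<longlonglongrightarrow> 0" for X
  proof -
    \<comment> \<open>The majorant is available only for steps in [-1, 1]; \<open>Y\<close> replaces
      the finitely many larger steps by 1.\<close>
    define Y where "Y n = (if \<bar>X n\<bar> \<le> 1 then X n else 1)" for n
    have ev: "\<forall>\<^sub>F n in sequentially. Y n = X n"
      using order_tendstoD[OF tendsto_rabs[OF X(2)], of 1] by (auto simp: Y_def elim!: eventually_mono)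
    have Y: "Y n \<noteq> 0" "\<bar>Y n\<bar> \<le> 1" for n using X by (auto simp: Y_def)
    have Y0: "Y \<longlonglongrightarrow> 0" using X(2) filterlim_cong[OF refl refl ev] by blast
    have "(\<lambda>n. LINT z|M. (F (Y n) z - F 0 z) /\<^sub>R Y n) \<longlonglongrightarrow> (LINT z|M. F' 0 z)"
    proof (rule integral_dominated_convergence[OF m _ G])
      show "(\<lambda>z. (F (Y n) z - F 0 z) /\<^sub>R Y n) \<in> borel_measurable M" for n
        using mI[of 0] mI[OF Y(2)[of n]] by simp
      show "AE z in M. (\<lambda>n. (F (Y n) z - F 0 z) /\<^sub>R Y n) \<longlonglongrightarrow> F' 0 z"
        using conv[OF Y(1) Y0] by simp
      have "norm (F (Y n) z - F 0 z) \<le> G z * \<bar>Y n - 0\<bar>" for z n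
      proof (rule vector_mvt_bound)
        fix t assume "t \<in> closed_segment 0 (Y n)"
        then have "\<bar>t\<bar> \<le> 1" using Y(2)[of n] by (auto simp: closed_segment_eq_real_ivl split: if_splits)
        then show "((\<lambda>t. F t z) has_vector_derivative F' t z) (at t)" "norm (F' t z) \<le> G z"
          using der bd by auto
      qed
      then show "AE z in M. norm ((F (Y n) z - F 0 z) /\<^sub>R Y n) \<le> G z" for n
        using Y(1)[of n] by (simp add: divide_simps)
    qed
    moreover have "(LINT z|M. (F (Y n) z - F 0 z) /\<^sub>R Y n) = ((LINT z|M. F (Y n) z) - (LINT z|M. F 0 z)) /\<^sub>R Y n" for n
      using int[of 0] int[OF Y(2)[of n]] by simp
    ultimately have "(\<lambda>n. ((LINT z|M. F (Y n) z) - (LINT z|M. F 0 z)) /\<^sub>R Y n) \<longlonglongrightarrow> (LINT z|M. F' 0 z)"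
      by (simp only:)
    then show ?thesis
      by (rule Lim_transform_eventually) (use ev in \<open>auto elim!: eventually_mono\<close>)
  qed
  then show "((\<lambda>t. LINT z|M. F t z) has_vector_derivative (LINT z|M. F' 0 z)) (at 0)"
    unfolding has_vector_derivative_quotient tendsto_at_iff_sequentially by (auto simp: o_def)
qed

lemma lborel_integral_translate:
  fixes f :: "'a::euclidean_space \<Rightarrow> 'b::{banach, second_countable_topology}"
  assumes [measurable]: "f \<in> borel_measurable borel"
  shows "(LINT x|lborel. f (x + c)) = (LINT x|lborel. f x)"
    and "integrable lborel (\<lambda>x. f (x + c)) \<longleftrightarrow> integrable lborel f"
proof -
  show "(LINT x|lborel. f (x + c)) = (LINT x|lborel. f x)"
    by (subst (2) lborel_distr_plus[symmetric, of c]) (simp add: integral_distr add.commute)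
  show "integrable lborel (\<lambda>x. f (x + c)) \<longleftrightarrow> integrable lborel f"
    by (subst (2) lborel_distr_plus[symmetric, of c]) (simp add: integrable_distr_eq add.commute)
qed

lemma lborel_integral_affine:
  fixes f :: "'a::euclidean_space \<Rightarrow> 'b::{banach, second_countable_topology}"
  assumes [measurable]: "f \<in> borel_measurable borel" and c: "c \<noteq> 0"
  shows "(LINT x|lborel. f x) = \<bar>c\<bar> ^ DIM('a) *\<^sub>R (LINT x|lborel. f (t + c *\<^sub>R x))"
    and "integrable lborel (\<lambda>x. f (t + c *\<^sub>R x)) \<longleftrightarrow> integrable lborel f"
proof -
  show "(LINT x|lborel. f x) = \<bar>c\<bar> ^ DIM('a) *\<^sub>R (LINT x|lborel. f (t + c *\<^sub>R x))"
    by (subst lborel_affine[OF c, of t]) (simp add: integral_density integral_distr)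
  show "integrable lborel (\<lambda>x. f (t + c *\<^sub>R x)) \<longleftrightarrow> integrable lborel f"
  proof
    assume "integrable lborel (\<lambda>x. f (t + c *\<^sub>R x))"
    then show "integrable lborel f"
      by (subst lborel_affine[OF c, of t]) (simp add: integrable_density integrable_distr_eq)
  next
    assume "integrable lborel f"
    then have "integrable lborel (\<lambda>x. \<bar>c\<bar> ^ DIM('a) *\<^sub>R f (t + c *\<^sub>R x))"
      by (subst (asm) lborel_affine[OF c, of t]) (simp add: integrable_density integrable_distr_eq)
    then have "integrable lborel (\<lambda>x. (1 / \<bar>c\<bar> ^ DIM('a)) *\<^sub>R \<bar>c\<bar> ^ DIM('a) *\<^sub>R f (t + c *\<^sub>R x))"
      by (rule integrable_scaleR_right)
    then show "integrable lborel (\<lambda>x. f (t + c *\<^sub>R x))" using c by simp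
  qed
qed

text \<open>Integration by parts without boundary: by translation invariance the integral of
  \<open>F (y + t e)\<close> does not depend on \<open>t\<close>, and its derivative at 0 is the
  integral of \<open>F'\<close>.\<close>

lemma integral_partial_zero:
  fixes F :: "'a::euclidean_space \<Rightarrow> complex"
  assumes m: "F \<in> borel_measurable borel" and F: "integrable lborel F" and e: "norm e \<le> 1"
    and der: "\<And>y. ((\<lambda>t. F (y + t *\<^sub>R e)) has_vector_derivative F' y) (at 0)"
    and bd: "\<And>y. norm (F' y) \<le> K / (1 + norm y) ^ (DIM('a) + 1)"
  shows "(LINT y|lborel. F' y) = 0"
proof -
  have K: "K \<ge> 0" using order_trans[OF norm_ge_zero bd[of 0]] by simp
  have der': "((\<lambda>t. F (y + t *\<^sub>R e)) has_vector_derivative F' (y + t *\<^sub>R e)) (at t)" for y t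
  proof -
    have "((\<lambda>r. r - t) has_vector_derivative 1) (at t)" by (auto intro!: derivative_eq_intros)
    then have "((\<lambda>s. F ((y + t *\<^sub>R e) + s *\<^sub>R e)) \<circ> (\<lambda>r. r - t) has_vector_derivative 1 *\<^sub>R F' (y + t *\<^sub>R e)) (at t)"
      by (rule vector_diff_chain_at) (use der in simp)
    then show ?thesis by (simp add: o_def algebra_simps)
  qed
  have "((\<lambda>t. LINT y|lborel. F (y + t *\<^sub>R e)) has_vector_derivative (LINT y|lborel. F' (y + 0 *\<^sub>R e))) (at 0)"
  proof (rule has_vector_derivative_integral(1)[where G = "\<lambda>y. K * 2 ^ (DIM('a) + 1) * (1 / (1 + norm y) ^ (DIM('a) + 1))"])
    fix t :: real and z :: 'a assume t: "\<bar>t\<bar> \<le> 1"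
    show "integrable lborel (\<lambda>y. F (y + t *\<^sub>R e))" using F by (simp add: lborel_integral_translate(2)[OF m])
    show "((\<lambda>t. F (z + t *\<^sub>R e)) has_vector_derivative F' (z + t *\<^sub>R e)) (at t)" by (rule der')
    have "norm (t *\<^sub>R e) \<le> 1" using t e by (simp add: mult_le_one)
    \<comment> \<open>A shift by at most 1 changes \<open>1 + norm\<close> by at most a factor 2, so
      one majorant serves all \<open>t\<close> in [-1, 1]; this is the source of
      \<open>2 ^ (d + 1)\<close>.\<close>
    have "1 + norm z \<le> 2 * (1 + norm (z + t *\<^sub>R e))"
    proof -
      have "norm z \<le> norm (z + t *\<^sub>R e) + norm (t *\<^sub>R e)"
        using norm_triangle_ineq4[of "z + t *\<^sub>R e" "t *\<^sub>R e"] by simp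
      then have "norm z \<le> norm (z + t *\<^sub>R e) + 1" using \<open>norm (t *\<^sub>R e) \<le> 1\<close> by linarith
      then show ?thesis using norm_ge_zero[of "z + t *\<^sub>R e"] by argo
    qed
    then have "(1 + norm z) ^ (DIM('a) + 1) \<le> 2 ^ (DIM('a) + 1) * (1 + norm (z + t *\<^sub>R e)) ^ (DIM('a) + 1)"
      using power_mono[of "1 + norm z" "2 * (1 + norm (z + t *\<^sub>R e))" "DIM('a) + 1"] by (simp only: power_mult_distrib) simp
    then have "1 / (1 + norm (z + t *\<^sub>R e)) ^ (DIM('a) + 1) \<le> 2 ^ (DIM('a) + 1) * (1 / (1 + norm z) ^ (DIM('a) + 1))"
      by (simp add: divide_simps add_pos_nonneg)
    from mult_left_mono[OF this K] bd[of "z + t *\<^sub>R e"]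
    show "norm (F' (z + t *\<^sub>R e)) \<le> K * 2 ^ (DIM('a) + 1) * (1 / (1 + norm z) ^ (DIM('a) + 1))"
      by simp
  next
    show "integrable lborel (\<lambda>y. K * 2 ^ (DIM('a) + 1) * (1 / (1 + norm (y::'a)) ^ (DIM('a) + 1)))"
      by (intro integrable_mult_right integrable_decay)
  qed
  then have "((\<lambda>t. LINT y|lborel. F y) has_vector_derivative (LINT y|lborel. F' y)) (at (0::real))"
    by (simp add: lborel_integral_translate(1)[OF m])
  moreover have "((\<lambda>t. LINT y|lborel. F y) has_vector_derivative 0) (at (0::real))" by simp
  ultimately show ?thesis by (rule vector_derivative_unique_at)
qed

text \<open>Both bases lie in [-1, 1], so their M-th powers differ by at most M times the difference
  of the bases. At \<open>x = a / sqrt M\<close> that difference is of smaller order than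
  \<open>x^2\<close>, while \<open>M = a^2 / x^2\<close>.\<close>

lemma cos_power_limit: "(\<lambda>M. (cos (a / sqrt (real M)) ^ 2) ^ M) \<longlonglongrightarrow> exp (- a\<^sup>2)"
proof (cases "a = 0")
  case False
  have l0: "((\<lambda>x::real. \<bar>((cos x)\<^sup>2 - exp (- x\<^sup>2)) / x\<^sup>2\<bar>) \<longlongrightarrow> 0) (at 0)"
    by real_asymp
  have "filterlim (\<lambda>M. a / sqrt (real M)) (at 0) sequentially"
  proof (rule filterlim_atI)
    show "(\<lambda>M. a / sqrt (real M)) \<longlonglongrightarrow> 0" by real_asymp
    show "\<forall>\<^sub>F M in sequentially. a / sqrt (real M) \<noteq> 0"
      using eventually_gt_at_top[of 0] by eventually_elim (use False in simp)
  qed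
  from tendsto_mult_right_zero[OF filterlim_compose[OF l0 this], of "a\<^sup>2"]
  have l: "(\<lambda>M. a\<^sup>2 * \<bar>((cos (a / sqrt (real M)))\<^sup>2 - exp (- (a / sqrt (real M))\<^sup>2)) / (a / sqrt (real M))\<^sup>2\<bar>) \<longlonglongrightarrow> 0" .
  show ?thesis
  proof (rule LIM_zero_cancel, rule Lim_null_comparison[OF _ l])
    show "\<forall>\<^sub>F M in sequentially. norm ((cos (a / sqrt (real M)) ^ 2) ^ M - exp (- a\<^sup>2))
      \<le> a\<^sup>2 * \<bar>((cos (a / sqrt (real M)))\<^sup>2 - exp (- (a / sqrt (real M))\<^sup>2)) / (a / sqrt (real M))\<^sup>2\<bar>"
      using eventually_gt_at_top[of 0]
    proof eventually_elim
      case (elim M)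
      have "exp (- a\<^sup>2) = exp (- (a / sqrt (real M))\<^sup>2) ^ M"
        using elim by (simp add: power_divide flip: exp_of_nat_mult)
      moreover have "norm ((cos (a / sqrt (real M)) ^ 2) ^ M - exp (- (a / sqrt (real M))\<^sup>2) ^ M) \<le>
        M * norm (cos (a / sqrt (real M)) ^ 2 - exp (- (a / sqrt (real M))\<^sup>2))"
        by (rule norm_power_diff) (auto simp: abs_square_le_1)
      moreover have "real M = a\<^sup>2 / (a / sqrt (real M))\<^sup>2" using elim False by (simp add: power_divide)
      moreover have "a\<^sup>2 * \<bar>D / (a / sqrt (real M))\<^sup>2\<bar> = a\<^sup>2 / (a / sqrt (real M))\<^sup>2 * norm D" for D :: real
        by (simp add: abs_divide)
      ultimately show ?case by metis
    qed
  qed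
qed simp

section \<open>Injectivity of the Fourier transform\<close>

lemma measurable_cis_inner [measurable]: "(\<lambda>y::'a::euclidean_space. cis (y \<bullet> \<eta>)) \<in> borel_measurable borel"
  by (intro borel_measurable_continuous_onI continuous_intros)

lemma integrable_mult_bounded:
  fixes \<phi> p :: "'a::euclidean_space \<Rightarrow> complex"
  assumes "integrable lborel \<phi>" and [measurable]: "p \<in> borel_measurable borel" and "\<And>y. norm (p y) \<le> K"
  shows "integrable lborel (\<lambda>y. \<phi> y * p y)"
proof (rule Bochner_Integration.integrable_bound[where f = "\<lambda>y. of_real K * \<phi> y"])
  show "integrable lborel (\<lambda>y. of_real K * \<phi> y)" using assms(1) by simp
  have [measurable]: "\<phi> \<in> borel_measurable borel" using assms(1) by auto
  show "(\<lambda>y. \<phi> y * p y) \<in> borel_measurable lborel" by measurable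
  have "norm (p y) \<le> \<bar>K\<bar>" for y using assms(3)[of y] by linarith
  then show "AE y in lborel. norm (\<phi> y * p y) \<le> norm (of_real K * \<phi> y)"
    by (simp add: norm_mult mult.commute[of "\<bar>K\<bar>"] mult_left_mono)
qed

lemma integrable_mult_cis:
  fixes \<phi> :: "'a::euclidean_space \<Rightarrow> complex"
  shows "integrable lborel \<phi> \<Longrightarrow> integrable lborel (\<lambda>y. \<phi> y * cis (y \<bullet> \<eta>))"
  by (rule integrable_mult_bounded[where K = 1]) auto

lemma cos_squared_cis: "complex_of_real ((cos \<theta>)\<^sup>2) = 1/2 + cis (2 * \<theta>) / 4 + cis (- (2 * \<theta>)) / 4"
proof -
  have 1: "cis a + cis (- a) = complex_of_real (2 * cos a)" for a
    by (rule complex_eqI) auto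
  have "complex_of_real ((cos \<theta>)\<^sup>2) = complex_of_real (1/2 + (2 * cos (2 * \<theta>)) / 4)"
    by (rule arg_cong[where f = complex_of_real]) (simp only: cos_double_cos, algebra)
  also have "\<dots> = 1/2 + complex_of_real (2 * cos (2 * \<theta>)) / 4"
    by (simp only: of_real_add of_real_divide of_real_numeral of_real_1)
  finally show ?thesis unfolding 1[symmetric] by (simp only: add_divide_distrib add.assoc)
qed

text \<open>A product of squared cosines is a trigonometric polynomial, so it is annihilated by
every function all of whose Fourier coefficients vanish.\<close>

lemma trig_kernel_list:
  fixes \<phi> :: "'a::euclidean_space \<Rightarrow> complex"
  assumes "integrable lborel \<phi>" and "\<And>\<eta>. \<eta> \<in> H \<Longrightarrow> (LINT y|lborel. \<phi> y * cis (y \<bullet> \<eta>)) = 0"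
    and add: "\<And>a b. a \<in> H \<Longrightarrow> b \<in> H \<Longrightarrow> a + b \<in> H" and neg: "\<And>a. a \<in> H \<Longrightarrow> - a \<in> H"
    and "\<And>b. b \<in> set bs \<Longrightarrow> 2 *\<^sub>R b \<in> H" and "\<eta> \<in> H"
  shows "(LINT y|lborel. \<phi> y * complex_of_real (\<Prod>b\<leftarrow>bs. (cos ((y - x) \<bullet> b))\<^sup>2) * cis (y \<bullet> \<eta>)) = 0"
  using assms(1,2,5,6)
proof (induction bs arbitrary: \<phi> \<eta>)
  case (Cons b bs)
  define \<psi> where "\<psi> y = \<phi> y * complex_of_real ((cos ((y - x) \<bullet> b))\<^sup>2)" for y
  have i: "integrable lborel \<psi>"
    unfolding \<psi>_def
    by (rule integrable_mult_bounded[where K = 1, OF Cons.prems(1)])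
      (auto intro!: borel_measurable_continuous_onI continuous_intros simp: norm_power abs_square_le_1 simp flip: power_abs)
  have b: "2 *\<^sub>R b \<in> H" using Cons.prems(3) by simp
  have z: "(LINT y|lborel. \<psi> y * cis (y \<bullet> \<eta>)) = 0" if "\<eta> \<in> H" for \<eta>
  proof -
    \<comment> \<open>The factor for \<open>b\<close> moves the frequency \<eta> by 0 and by plus or
      minus \<open>2 b\<close>. All three frequencies stay in \<open>H\<close>, and the centre
      \<open>x\<close> contributes only unimodular constants.\<close>
    have e: "\<psi> y * cis (y \<bullet> \<eta>) = 1/2 * (\<phi> y * cis (y \<bullet> \<eta>)) +
       (cis (- 2 * (x \<bullet> b)) / 4 * (\<phi> y * cis (y \<bullet> (\<eta> + 2 *\<^sub>R b))) +
        cis (2 * (x \<bullet> b)) / 4 * (\<phi> y * cis (y \<bullet> (\<eta> + - (2 *\<^sub>R b)))))" for y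
    proof -
      have "2 * ((y - x) \<bullet> b) + y \<bullet> \<eta> = - 2 * (x \<bullet> b) + y \<bullet> (\<eta> + 2 *\<^sub>R b)"
        "- (2 * ((y - x) \<bullet> b)) + y \<bullet> \<eta> = 2 * (x \<bullet> b) + y \<bullet> (\<eta> + - (2 *\<^sub>R b))"
        by (simp_all add: inner_diff_left inner_add_right inner_diff_right)
      then have "cis (2 * ((y - x) \<bullet> b)) * cis (y \<bullet> \<eta>) = cis (- 2 * (x \<bullet> b)) * cis (y \<bullet> (\<eta> + 2 *\<^sub>R b))"
        "cis (- (2 * ((y - x) \<bullet> b))) * cis (y \<bullet> \<eta>) = cis (2 * (x \<bullet> b)) * cis (y \<bullet> (\<eta> + - (2 *\<^sub>R b)))"
        unfolding cis_mult by simp_all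
      then have "(1/2 + cis (2 * ((y - x) \<bullet> b)) / 4 + cis (- (2 * ((y - x) \<bullet> b))) / 4) * cis (y \<bullet> \<eta>) =
        1/2 * cis (y \<bullet> \<eta>) + cis (- 2 * (x \<bullet> b)) * cis (y \<bullet> (\<eta> + 2 *\<^sub>R b)) / 4 +
        cis (2 * (x \<bullet> b)) * cis (y \<bullet> (\<eta> + - (2 *\<^sub>R b))) / 4"
        by (simp only: ring_distribs times_divide_eq_left)
      then have "\<phi> y * ((1/2 + cis (2 * ((y - x) \<bullet> b)) / 4 + cis (- (2 * ((y - x) \<bullet> b))) / 4) * cis (y \<bullet> \<eta>)) =
        \<phi> y * (1/2 * cis (y \<bullet> \<eta>) + cis (- 2 * (x \<bullet> b)) * cis (y \<bullet> (\<eta> + 2 *\<^sub>R b)) / 4 +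
        cis (2 * (x \<bullet> b)) * cis (y \<bullet> (\<eta> + - (2 *\<^sub>R b))) / 4)" by (rule arg_cong)
      then show ?thesis unfolding \<psi>_def cos_squared_cis by (simp only: ring_distribs times_divide_eq_left times_divide_eq_right mult.assoc mult.left_commute add.assoc)
    qed
    have "(LINT y|lborel. \<psi> y * cis (y \<bullet> \<eta>)) = 1/2 * (LINT y|lborel. \<phi> y * cis (y \<bullet> \<eta>)) +
       (cis (- 2 * (x \<bullet> b)) / 4 * (LINT y|lborel. \<phi> y * cis (y \<bullet> (\<eta> + 2 *\<^sub>R b))) +
        cis (2 * (x \<bullet> b)) / 4 * (LINT y|lborel. \<phi> y * cis (y \<bullet> (\<eta> + - (2 *\<^sub>R b)))))"
      unfolding e
      by (simp only: Bochner_Integration.integral_add integrable_mult_cis[OF Cons.prems(1)] integrable_mult_right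
        Bochner_Integration.integrable_add integral_mult_right_zero)
    then show ?thesis
      by (simp only: Cons.prems(2)[OF that] Cons.prems(2)[OF add[OF that b]] Cons.prems(2)[OF add[OF that neg[OF b]]]) simp
  qed
  have "(LINT y|lborel. \<psi> y * complex_of_real (\<Prod>b\<leftarrow>bs. (cos ((y - x) \<bullet> b))\<^sup>2) * cis (y \<bullet> \<eta>)) = 0"
    by (rule Cons.IH[OF i z]) (use Cons.prems in auto)
  then show ?case by (simp add: \<psi>_def mult_ac)
qed simp

text \<open>The frequency group \<open>H\<close> is kept abstract to serve both injectivity proofs:
  the whole space for the Fourier integral, and \<open>2 pi\<close> times the integer vectors for
  the torus.\<close>

lemma trig_kernel_zero:
  fixes \<phi> :: "real^'n::finite \<Rightarrow> complex"
  assumes "integrable lborel \<phi>" and "\<And>\<eta>. \<eta> \<in> H \<Longrightarrow> (LINT y|lborel. \<phi> y * cis (y \<bullet> \<eta>)) = 0"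
    and "\<And>a b. a \<in> H \<Longrightarrow> b \<in> H \<Longrightarrow> a + b \<in> H" and "\<And>a. a \<in> H \<Longrightarrow> - a \<in> H" and "0 \<in> H"
    and "\<And>i. (2 * a) *\<^sub>R axis i 1 \<in> H"
  shows "(LINT y|lborel. \<phi> y * complex_of_real ((\<Prod>i\<in>UNIV. (cos (a * (y $ i - x $ i)))\<^sup>2) ^ N)) = 0"
proof -
  obtain js :: "'n list" where "set js = UNIV" "distinct js" using finite_distinct_list[of "UNIV :: 'n set"] by auto
  \<comment> \<open>Each scaled axis vector is repeated \<open>N\<close> times, so that the product
    over the list is the N-th power of the kernel.\<close>
  define bs where "bs = concat (replicate N (map (\<lambda>i. a *\<^sub>R axis i (1::real) :: real^'n) js))"
  have "(\<Prod>b\<leftarrow>bs. (cos ((y - x) \<bullet> b))\<^sup>2) = (\<Prod>i\<in>UNIV. (cos (a * (y $ i - x $ i)))\<^sup>2) ^ N" for y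
  proof -
    have "(\<Prod>b\<leftarrow>bs. (cos ((y - x) \<bullet> b))\<^sup>2) = (\<Prod>i\<leftarrow>js. (cos (a * (y $ i - x $ i)))\<^sup>2) ^ N"
      unfolding bs_def by (induction N) (simp_all add: o_def inner_axis)
    also have "(\<Prod>i\<leftarrow>js. (cos (a * (y $ i - x $ i)))\<^sup>2) = (\<Prod>i\<in>UNIV. (cos (a * (y $ i - x $ i)))\<^sup>2)"
      using prod.distinct_set_conv_list[OF \<open>distinct js\<close>, of "\<lambda>i. (cos (a * (y $ i - x $ i)))\<^sup>2"]
      unfolding \<open>set js = UNIV\<close> by (rule sym)
    finally show ?thesis .
  qed
  moreover have "2 *\<^sub>R b \<in> H" if "b \<in> set bs" for b
    using that assms(6) by (auto simp: bs_def split: if_splits)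
  ultimately show ?thesis using trig_kernel_list[OF assms(1-4), of bs 0 x] assms(5) by simp
qed

text \<open>Central limit scaling: the exponent \<open>N\<close> against arguments of size
  \<open>1 / sqrt N\<close> turns trigonometric polynomials into a Gaussian.\<close>

lemma trig_kernel_limit:
  "(\<lambda>N. (\<Prod>i\<in>UNIV. (cos (w $ i / sqrt (real N)))\<^sup>2) ^ N) \<longlonglongrightarrow> exp (- (norm (w :: real^'n::finite))\<^sup>2)"
proof -
  have "(\<lambda>N. \<Prod>i\<in>UNIV. ((cos (w $ i / sqrt (real N)))\<^sup>2) ^ N) \<longlonglongrightarrow> (\<Prod>i\<in>UNIV. exp (- (w $ i)\<^sup>2))"
    by (intro tendsto_prod cos_power_limit)
  moreover have "(\<Prod>i\<in>UNIV. exp (- (w $ i)\<^sup>2)) = exp (- (norm w)\<^sup>2)"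
    by (simp only: power2_norm_eq_inner inner_vec_def inner_real_def flip: exp_sum) (simp add: sum_negf power2_eq_square flip: exp_sum)
  ultimately show ?thesis by (simp add: prod_power_distrib)
qed

lemma power_le_fact_exp: "0 \<le> (x::real) \<Longrightarrow> x ^ k \<le> fact k * exp x"
proof -
  assume x: "0 \<le> x"
  have "(\<Sum>n\<in>{k}. x ^ n /\<^sub>R fact n) \<le> (\<Sum>n. x ^ n /\<^sub>R fact n)"
    by (rule sum_le_suminf) (use x in \<open>auto simp: summable_exp\<close>)
  then show ?thesis by (simp add: exp_def field_simps)
qed

lemma integrable_gaussian: "integrable lborel (\<lambda>w::'a::euclidean_space. exp (- (norm w)\<^sup>2))"
proof (rule Bochner_Integration.integrable_bound)
  let ?m = "DIM('a) + 1"
  show "integrable lborel (\<lambda>w::'a. fact ?m * exp 2 * (1 / (1 + norm w) ^ ?m))"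
    by (intro integrable_mult_right integrable_decay)
  show "(\<lambda>w::'a. exp (- (norm w)\<^sup>2)) \<in> borel_measurable lborel" by simp
  have "exp (- r\<^sup>2) \<le> fact ?m * exp 2 * (1 / (1 + r) ^ ?m)" if r: "r \<ge> 0" for r :: real
  proof -
    have "(1 + r) ^ ?m * exp (- r\<^sup>2) \<le> (fact ?m * exp (1 + r)) * exp (- r\<^sup>2)"
      using power_le_fact_exp[of "1 + r" ?m] r by (intro mult_right_mono) auto
    also have "\<dots> = fact ?m * exp (1 + r - r\<^sup>2)" by (simp add: mult_exp_exp)
    also have "\<dots> \<le> fact ?m * exp 2"
    proof -
      have "0 \<le> (r - 1)\<^sup>2 + r" using r by simp
      then have "1 + r - r\<^sup>2 \<le> 2" by (simp add: power2_eq_square algebra_simps)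
      then show ?thesis by simp
    qed
    finally show ?thesis using r by (simp add: field_simps add_pos_nonneg)
  qed
  then show "AE w in lborel. norm (exp (- (norm w)\<^sup>2)) \<le> norm (fact ?m * exp 2 * (1 / (1 + norm (w::'a)) ^ ?m))"
    by (simp add: order_trans[OF _ abs_ge_self])
qed

lemma gaussian_integral_nonzero: "(LINT w|lborel. exp (- (norm (w::'a::euclidean_space))\<^sup>2)) \<noteq> 0"
proof
  assume "(LINT w|lborel. exp (- (norm (w::'a))\<^sup>2)) = 0"
  then have "AE w in lborel. exp (- (norm (w::'a))\<^sup>2) = 0"
    by (subst (asm) integral_nonneg_eq_0_iff_AE[OF integrable_gaussian]) auto
  then have "AE w::'a in lborel. False" by simp
  then show False by (simp add: AE_iff_null null_sets_def)
qed

text \<open>Vanishing Fourier integrals annihilate all trigonometric kernels centred at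
  \<open>x\<close>, hence in the limit all Gaussians centred at \<open>x\<close>. Letting these
  concentrate isolates \<phi>(x) times a nonzero integral.\<close>

lemma fourier_injective:
  fixes \<phi> :: "real^'n::finite \<Rightarrow> complex"
  assumes c: "continuous_on UNIV \<phi>" and i: "integrable lborel \<phi>" and bd: "\<And>y. norm (\<phi> y) \<le> B"
    and z: "\<And>\<eta>. (LINT y|lborel. \<phi> y * cis (y \<bullet> \<eta>)) = 0"
  shows "\<phi> x = 0"
proof -
  have [measurable]: "\<phi> \<in> borel_measurable borel" using c by (rule borel_measurable_continuous_onI)
  have gau: "(LINT y|lborel. \<phi> y * of_real (exp (- (norm (a *\<^sub>R (y - x)))\<^sup>2))) = 0" for a
  proof -
    have "(\<lambda>N. LINT y|lborel. \<phi> y * complex_of_real ((\<Prod>i\<in>UNIV. (cos (a / sqrt (real N) * (y $ i - x $ i)))\<^sup>2) ^ N)) \<longlonglongrightarrow>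
       (LINT y|lborel. \<phi> y * of_real (exp (- (norm (a *\<^sub>R (y - x)))\<^sup>2)))"
    proof (rule integral_dominated_convergence[where w = "\<lambda>y. norm (\<phi> y)"])
      show "(\<lambda>y. \<phi> y * of_real (exp (- (norm (a *\<^sub>R (y - x)))\<^sup>2))) \<in> borel_measurable lborel" by measurable
      show "(\<lambda>y. \<phi> y * complex_of_real ((\<Prod>i\<in>UNIV. (cos (a / sqrt (real N) * (y $ i - x $ i)))\<^sup>2) ^ N)) \<in> borel_measurable lborel" for N
        by (intro borel_measurable_times) (auto intro!: borel_measurable_continuous_onI continuous_intros)
      show "integrable lborel (\<lambda>y. norm (\<phi> y))" using i by simp
      have "(\<lambda>N. \<phi> y * complex_of_real ((\<Prod>i\<in>UNIV. (cos (a / sqrt (real N) * (y $ i - x $ i)))\<^sup>2) ^ N)) \<longlonglongrightarrow>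
         \<phi> y * of_real (exp (- (norm (a *\<^sub>R (y - x)))\<^sup>2))" for y
        using tendsto_mult_left[OF tendsto_of_real[OF trig_kernel_limit[of "a *\<^sub>R (y - x)"]], of "\<phi> y"] by simp
      then show "AE y in lborel. (\<lambda>N. \<phi> y * complex_of_real ((\<Prod>i\<in>UNIV. (cos (a / sqrt (real N) * (y $ i - x $ i)))\<^sup>2) ^ N)) \<longlonglongrightarrow>
         \<phi> y * of_real (exp (- (norm (a *\<^sub>R (y - x)))\<^sup>2))" by simp
      have le1: "\<bar>(\<Prod>i\<in>UNIV. (cos (c i))\<^sup>2) ^ N\<bar> \<le> 1" for N and c :: "'n \<Rightarrow> real"
        unfolding power_abs abs_prod by (intro power_le_one prod_nonneg prod_le_1) (simp_all add: abs_square_le_1)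
      then show "AE y in lborel. norm (\<phi> y * complex_of_real ((\<Prod>i\<in>UNIV. (cos (a / sqrt (real N) * (y $ i - x $ i)))\<^sup>2) ^ N)) \<le> norm (\<phi> y)" for N
        by (simp only: norm_mult norm_of_real) (intro AE_I2 mult_left_le le1 norm_ge_zero)
    qed
    moreover have "(LINT y|lborel. \<phi> y * complex_of_real ((\<Prod>i\<in>UNIV. (cos (a / sqrt (real N) * (y $ i - x $ i)))\<^sup>2) ^ N)) = 0" for N
      by (rule trig_kernel_zero[OF i, of UNIV]) (simp_all add: z)
    ultimately show ?thesis by (simp add: LIMSEQ_const_iff)
  qed
  \<comment> \<open>Substitution \<open>y = x + v / (n + 1)\<close>: the Gaussian becomes fixed and
    the concentration moves into the argument of \<phi>.\<close>
  have sc: "(LINT v|lborel. \<phi> (x + (1 / real (Suc n)) *\<^sub>R v) * of_real (exp (- (norm v)\<^sup>2))) = 0" for n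
  proof -
    have "(LINT y|lborel. \<phi> y * of_real (exp (- (norm (real (Suc n) *\<^sub>R (y - x)))\<^sup>2))) =
      \<bar>1 / real (Suc n)\<bar> ^ DIM(real^'n) *\<^sub>R (LINT v|lborel. \<phi> (x + (1 / real (Suc n)) *\<^sub>R v) * 
        of_real (exp (- (norm (real (Suc n) *\<^sub>R ((x + (1 / real (Suc n)) *\<^sub>R v) - x)))\<^sup>2)))"
      by (rule lborel_integral_affine(1)) measurable
    then show ?thesis unfolding gau by simp
  qed
  have "(\<lambda>n. LINT v|lborel. \<phi> (x + (1 / real (Suc n)) *\<^sub>R v) * of_real (exp (- (norm v)\<^sup>2))) \<longlonglongrightarrow>
     (LINT v|lborel. \<phi> x * of_real (exp (- (norm (v::real^'n))\<^sup>2)))"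
  proof (rule integral_dominated_convergence[where w = "\<lambda>v. B * exp (- (norm v)\<^sup>2)"])
    show "integrable lborel (\<lambda>v::real^'n. B * exp (- (norm v)\<^sup>2))" by (intro integrable_mult_right integrable_gaussian)
    show "(\<lambda>v. \<phi> (x + (1 / real (Suc n)) *\<^sub>R v) * of_real (exp (- (norm v)\<^sup>2))) \<in> borel_measurable lborel" for n by measurable
    show "(\<lambda>v::real^'n. \<phi> x * of_real (exp (- (norm v)\<^sup>2))) \<in> borel_measurable lborel" by measurable
    have "(\<lambda>n. \<phi> (x + (1 / real (Suc n)) *\<^sub>R v)) \<longlonglongrightarrow> \<phi> x" for v
    proof (rule continuous_on_tendsto_compose[OF c])
      have "(\<lambda>n. x + (1 / real (Suc n)) *\<^sub>R v) \<longlonglongrightarrow> x + 0 *\<^sub>R v"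
        using LIMSEQ_inverse_real_of_nat by (intro tendsto_intros) (simp add: inverse_eq_divide)
      then show "(\<lambda>n. x + (1 / real (Suc n)) *\<^sub>R v) \<longlonglongrightarrow> x" by simp
    qed auto
    then show "AE v in lborel. (\<lambda>n. \<phi> (x + (1 / real (Suc n)) *\<^sub>R v) * of_real (exp (- (norm v)\<^sup>2))) \<longlonglongrightarrow>
       \<phi> x * of_real (exp (- (norm v)\<^sup>2))" by (intro AE_I2 tendsto_mult_right)
    show "AE v in lborel. norm (\<phi> (x + (1 / real (Suc n)) *\<^sub>R v) * of_real (exp (- (norm v)\<^sup>2))) \<le> B * exp (- (norm v)\<^sup>2)" for n
      by (simp add: norm_mult bd)
  qed
  then have "(LINT v|lborel. \<phi> x * of_real (exp (- (norm (v::real^'n))\<^sup>2))) = 0"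
    unfolding sc by (simp add: LIMSEQ_const_iff)
  then have "\<phi> x * of_real (LINT v|lborel. exp (- (norm (v::real^'n))\<^sup>2)) = 0"
    by (subst integral_complex_of_real[symmetric]) (subst integral_mult_right_zero[symmetric], assumption)
  then show ?thesis using gaussian_integral_nonzero[where 'a = "real^'n"] by simp
qed

section \<open>Fourier analysis on the torus\<close>

definition zvec :: "('n::finite \<Rightarrow> int) \<Rightarrow> real^'n" where
  "zvec k = (\<chi> i. of_int (k i))"

definition zperiodic :: "(real^'n::finite \<Rightarrow> complex) \<Rightarrow> bool" where
  "zperiodic P \<longleftrightarrow> (\<forall>k t. P (t + zvec k) = P t)"

text \<open>Half-open, so that the integer translates cover every point exactly once.\<close>

definition ucube :: "real^'n::finite \<Rightarrow> (real^'n) set" where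
  "ucube z = {t. \<forall>i. z $ i \<le> t $ i \<and> t $ i < z $ i + 1}"

definition cube_integral :: "(real^'n::finite \<Rightarrow> complex) \<Rightarrow> complex" where
  "cube_integral P = (LINT t|lborel. indicator (ucube 0) t *\<^sub>R P t)"

lemma zvec_nth [simp]: "zvec k $ i = of_int (k i)"
  by (simp add: zvec_def)

lemma zvec_add: "zvec a + zvec b = zvec (\<lambda>i. a i + b i)"
  and zvec_minus: "- zvec a = zvec (\<lambda>i. - a i)"
  and zvec_axis: "axis i 1 = zvec (\<lambda>j. if j = i then 1 else 0)"
  by (simp_all add: vec_eq_iff axis_def)

lemma zvec_inner: "zvec a \<bullet> zvec b = of_int (\<Sum>i\<in>UNIV. a i * b i)"
  by (simp add: inner_vec_def)

lemma cis_2pi_zvec [simp]: "cis (2 * pi * (zvec a \<bullet> zvec b)) = 1"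
  unfolding zvec_inner by (rule cis_multiple_2pi) (rule Ints_of_int)

lemma zperiodicD: "zperiodic P \<Longrightarrow> P (t + zvec k) = P t"
  by (simp add: zperiodic_def)

lemma ucube_subset: "ucube z \<subseteq> cbox z (z + 1)"
  by (auto simp: ucube_def mem_box_cart less_imp_le)

lemma box_subset_ucube: "box z (z + 1) \<subseteq> ucube z"
  by (auto simp: ucube_def mem_box_cart less_imp_le)

lemma ucube_borel [measurable]: "ucube z \<in> sets borel"
  unfolding ucube_def by measurable

lemma emeasure_ucube: "emeasure lborel (ucube (z :: real^'n::finite)) = 1"
proof (rule antisym)
  have Basis: "(z + 1 - z) \<bullet> b = 1" if "b \<in> Basis" for b :: "real^'n"
    using that by (auto simp: Basis_vec_def inner_axis)
  have le: "\<And>b. b \<in> Basis \<Longrightarrow> z \<bullet> b \<le> (z + 1) \<bullet> b"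
    using Basis by (smt (verit) inner_diff_left)
  have "emeasure lborel (ucube z) \<le> emeasure lborel (cbox z (z + 1))"
    by (rule emeasure_mono[OF ucube_subset]) simp
  also have "\<dots> = 1" using le Basis by (simp only: emeasure_lborel_cbox) simp
  finally show "emeasure lborel (ucube z) \<le> 1" .
  have "1 = emeasure lborel (box z (z + 1))" using le Basis by (simp only: emeasure_lborel_box) simp
  also have "\<dots> \<le> emeasure lborel (ucube z)" by (rule emeasure_mono[OF box_subset_ucube]) simp
  finally show "1 \<le> emeasure lborel (ucube z)" .
qed

lemma integrable_ucube:
  fixes P :: "real^'n::finite \<Rightarrow> 'b::{banach, second_countable_topology}"
  assumes "P \<in> borel_measurable borel" "\<And>t. t \<in> ucube z \<Longrightarrow> norm (P t) \<le> B"
  shows "integrable lborel (\<lambda>t. indicator (ucube z) t *\<^sub>R P t)"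
  by (rule integrableI_bounded_set_indicator[where B = B]) (use assms in \<open>auto simp: emeasure_ucube\<close>)

lemma cube_integral_norm_le:
  fixes P :: "real^'n::finite \<Rightarrow> complex"
  assumes "P \<in> borel_measurable borel" "\<And>t. t \<in> ucube 0 \<Longrightarrow> norm (P t) \<le> B"
  shows "norm (cube_integral P) \<le> B"
proof -
  have B: "0 \<le> B" using assms(2)[of 0] order_trans[OF norm_ge_zero] by (auto simp: ucube_def)
  have "norm (cube_integral P) \<le> (LINT t|lborel. norm (indicator (ucube 0) t *\<^sub>R P t))"
    unfolding cube_integral_def by (rule integral_norm_bound)
  also have "\<dots> \<le> (LINT t|lborel. indicator (ucube (0::real^'n)) t *\<^sub>R B)"
  proof (rule Bochner_Integration.integral_mono)
    show "integrable lborel (\<lambda>t. norm (indicator (ucube 0) t *\<^sub>R P t))"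
      by (rule integrable_norm[OF integrable_ucube[OF assms]])
    show "integrable lborel (\<lambda>t. indicator (ucube (0::real^'n)) t *\<^sub>R B)"
      by (rule integrable_ucube[where B = B]) (use B in auto)
  qed (auto simp: assms(2) B indicator_def)
  also have "\<dots> = B" using emeasure_ucube[of "0::real^'n"] by (simp add: measure_def)
  finally show ?thesis .
qed

lemma zperiodic_cube_reduce:
  assumes "zperiodic P"
  shows "\<exists>s\<in>ucube 0. P t = P s"
proof
  show "P t = P (t + zvec (\<lambda>i. - \<lfloor>t $ i\<rfloor>))" using assms by (simp add: zperiodicD)
  show "t + zvec (\<lambda>i. - \<lfloor>t $ i\<rfloor>) \<in> ucube 0"
  proof -
    have "0 \<le> t $ i - of_int \<lfloor>t $ i\<rfloor>" "t $ i - of_int \<lfloor>t $ i\<rfloor> < 1" for i by linarith+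
    then show ?thesis by (simp add: ucube_def)
  qed
qed

lemma zperiodic_bounded:
  assumes "zperiodic P" "continuous_on UNIV P"
  shows "\<exists>B. \<forall>t. norm (P t) \<le> B"
proof -
  have "compact (P ` cbox 0 1)"
    using assms(2) by (intro compact_continuous_image) (auto intro: continuous_on_subset)
  then have "bounded (P ` cbox 0 1)" by (rule compact_imp_bounded)
  then obtain B where B: "\<And>s. s \<in> cbox 0 1 \<Longrightarrow> norm (P s) \<le> B"
    unfolding bounded_iff by blast
  have "norm (P t) \<le> B" for t
    using zperiodic_cube_reduce[OF assms(1), of t] B ucube_subset[of 0] by auto
  then show ?thesis by blast
qed

text \<open>The one translate that meets the half-open cube is found coordinatewise by the ceiling
  of \<open>z - y\<close>. The bound \<open>N\<close> provides a finite index set independent of the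
  point.\<close>

lemma ucube_tiling:
  fixes N :: int and y z :: "real^'n::finite"
  assumes N: "\<And>i. \<bar>z $ i - y $ i\<bar> \<le> of_int N"
  shows "(\<Sum>k\<in>{k. \<forall>i. \<bar>k i\<bar> \<le> N}. indicator (ucube z) (y + zvec k)) = (1::real)" (is ?a)
    and "(\<Sum>k\<in>{k. \<forall>i. \<bar>k i\<bar> \<le> N}. indicator (ucube z) (y - zvec k)) = (1::real)" (is ?b)
proof -
  define k0 where "k0 = (\<lambda>i. \<lceil>z $ i - y $ i\<rceil>)"
  have k0: "k0 \<in> {k. \<forall>i. \<bar>k i\<bar> \<le> N}"
  proof -
    have "- N \<le> \<lceil>z $ i - y $ i\<rceil>" "\<lceil>z $ i - y $ i\<rceil> \<le> N" for i
      using N[of i] by (simp_all add: ceiling_le_iff le_ceiling_iff)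
    then show ?thesis by (simp add: k0_def abs_le_iff minus_le_iff)
  qed
  have ind: "indicator (ucube z) (y + zvec k) = (if k = k0 then 1 else 0 :: real)" for k
  proof -
    have "y + zvec k \<in> ucube z \<longleftrightarrow> (\<forall>i. k i = k0 i)"
    proof -
      have "\<lceil>z $ i - y $ i\<rceil> = m \<longleftrightarrow> z $ i \<le> y $ i + of_int m \<and> y $ i + of_int m < z $ i + 1" for i m
        unfolding ceiling_eq_iff by linarith
      then show ?thesis by (simp add: ucube_def k0_def eq_commute[of "k i" for i])
    qed
    then show ?thesis by (auto simp: indicator_def fun_eq_iff)
  qed
  have "{k::'n \<Rightarrow> int. \<forall>i. \<bar>k i\<bar> \<le> N} = PiE UNIV (\<lambda>_. {-N..N})" by (auto simp: PiE_UNIV_domain abs_le_iff minus_le_iff)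
  then have fin: "finite {k::'n \<Rightarrow> int. \<forall>i. \<bar>k i\<bar> \<le> N}" by (simp add: finite_PiE)
  show ?a unfolding ind using k0 fin by (simp add: sum.delta)
  have *: "(\<Sum>k\<in>{k. \<forall>i. \<bar>k i\<bar> \<le> N}. indicator (ucube z) (y - zvec k)) =
    (\<Sum>k\<in>{k. \<forall>i. \<bar>k i\<bar> \<le> N}. indicator (ucube z) (y + zvec k) :: real)"
    by (rule sum.reindex_bij_witness[where i = "\<lambda>k i. - k i" and j = "\<lambda>k i. - k i"])
      (simp_all flip: zvec_minus)
  show ?b by (rule trans[OF * \<open>?a\<close>])
qed

text \<open>Cut the shifted cube along the integer translates of the unit cube and reassemble.\<close>

lemma cube_integral_shift:
  fixes P :: "real^'n::finite \<Rightarrow> complex"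
  assumes per: "zperiodic P" and c: "continuous_on UNIV P"
  shows "(LINT t|lborel. indicator (ucube z) t *\<^sub>R P (t + y)) = cube_integral P"
proof -
  have *: "(LINT t|lborel. indicator (ucube z) t *\<^sub>R P t) = cube_integral P" for z
  proof -
    have [measurable]: "P \<in> borel_measurable borel" using c by (rule borel_measurable_continuous_onI)
    obtain B where B: "\<And>t. norm (P t) \<le> B" using zperiodic_bounded[OF per c] by blast
    \<comment> \<open>Bounds the coordinate distance from the corner of either cube to the points of
      the other, so that one index set serves both decompositions.\<close>
    define N where "N = \<lceil>norm z + 1\<rceil>"
    define K where "K = {k::'n \<Rightarrow> int. \<forall>i. \<bar>k i\<bar> \<le> N}"
    have zN: "\<bar>z $ i\<bar> + 1 \<le> of_int N" for i
      using component_le_norm_cart[of z i] le_of_int_ceiling[of "norm z + 1"] unfolding N_def by linarith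
    have bb: "B \<ge> 0" using order_trans[OF norm_ge_zero B] .
    have i1: "integrable lborel (\<lambda>t. indicator (ucube z) t *\<^sub>R (indicator (ucube 0) (t + zvec k) *\<^sub>R P t))" for k
      by (rule integrable_ucube[where B = B]) (use B bb in \<open>auto simp: indicator_def\<close>)
    have i2: "integrable lborel (\<lambda>t. indicator (ucube 0) t *\<^sub>R (indicator (ucube z) (t - zvec k) *\<^sub>R P t))" for k
      by (rule integrable_ucube[where B = B]) (use B bb in \<open>auto simp: indicator_def\<close>)
    have "(LINT t|lborel. indicator (ucube z) t *\<^sub>R P t) =
        (LINT t|lborel. (\<Sum>k\<in>K. indicator (ucube z) t *\<^sub>R (indicator (ucube 0) (t + zvec k) *\<^sub>R P t)))"
    proof (rule Bochner_Integration.integral_cong[OF refl])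
      fix t
      show "indicator (ucube z) t *\<^sub>R P t = (\<Sum>k\<in>K. indicator (ucube z) t *\<^sub>R (indicator (ucube 0) (t + zvec k) *\<^sub>R P t))"
      proof (cases "t \<in> ucube z")
        case True
        have "\<bar>0 $ i - t $ i\<bar> \<le> of_int N" for i
        proof -
          have "z $ i \<le> t $ i" "t $ i < z $ i + 1" using True by (auto simp: ucube_def)
          then show ?thesis using zN[of i] by simp
        qed
        from ucube_tiling(1)[OF this]
        have "(\<Sum>k\<in>K. indicator (ucube 0) (t + zvec k) :: real) = 1" by (simp only: K_def)
        then show ?thesis by (simp only: scaleR_one flip: scaleR_sum_left scaleR_sum_right)
      qed simp
    qed
    also have "\<dots> = (\<Sum>k\<in>K. LINT t|lborel. indicator (ucube z) t *\<^sub>R (indicator (ucube 0) (t + zvec k) *\<^sub>R P t))"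
      by (rule Bochner_Integration.integral_sum) (rule i1)
    also have "\<dots> = (\<Sum>k\<in>K. LINT t|lborel. indicator (ucube 0) t *\<^sub>R (indicator (ucube z) (t - zvec k) *\<^sub>R P t))"
    proof (rule sum.cong[OF refl])
      fix k
      \<comment> \<open>Translating by \<open>zvec k\<close> exchanges the roles of the two cubes,
        and periodicity leaves \<open>P\<close> unchanged.\<close>
      have "(LINT t|lborel. indicator (ucube 0) (t + zvec k) *\<^sub>R (indicator (ucube z) (t + zvec k - zvec k) *\<^sub>R P (t + zvec k))) =
        (LINT t|lborel. indicator (ucube 0) t *\<^sub>R (indicator (ucube z) (t - zvec k) *\<^sub>R P t))"
        by (rule lborel_integral_translate(1)) measurable
      then show "(LINT t|lborel. indicator (ucube z) t *\<^sub>R (indicator (ucube 0) (t + zvec k) *\<^sub>R P t)) =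
        (LINT t|lborel. indicator (ucube 0) t *\<^sub>R (indicator (ucube z) (t - zvec k) *\<^sub>R P t))"
        by (simp add: zperiodicD[OF per] mult.commute)
    qed
    also have "\<dots> = (LINT t|lborel. (\<Sum>k\<in>K. indicator (ucube 0) t *\<^sub>R (indicator (ucube z) (t - zvec k) *\<^sub>R P t)))"
      by (rule Bochner_Integration.integral_sum[symmetric]) (rule i2)
    also have "\<dots> = (LINT t|lborel. indicator (ucube 0) t *\<^sub>R P t)"
    proof (rule Bochner_Integration.integral_cong[OF refl])
      fix t
      show "(\<Sum>k\<in>K. indicator (ucube 0) t *\<^sub>R (indicator (ucube z) (t - zvec k) *\<^sub>R P t)) = indicator (ucube 0) t *\<^sub>R P t"
      proof (cases "t \<in> ucube 0")
        case True
        have "\<bar>z $ i - t $ i\<bar> \<le> of_int N" for i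
        proof -
          have "0 \<le> t $ i" "t $ i < 1" using True by (auto simp: ucube_def)
          then show ?thesis using zN[of i] by simp
        qed
        from ucube_tiling(2)[OF this]
        have "(\<Sum>k\<in>K. indicator (ucube z) (t - zvec k) :: real) = 1" by (simp only: K_def)
        then show ?thesis by (simp only: scaleR_one flip: scaleR_sum_left scaleR_sum_right)
      qed simp
    qed
    finally show ?thesis by (simp add: cube_integral_def)
  qed
  have "(LINT t|lborel. indicator (ucube (z + y)) (t + y) *\<^sub>R P (t + y)) = (LINT t|lborel. indicator (ucube (z + y)) t *\<^sub>R P t)"
  proof (rule lborel_integral_translate(1))
    have [measurable]: "P \<in> borel_measurable borel" using c by (rule borel_measurable_continuous_onI)
    show "(\<lambda>t. indicator (ucube (z + y)) t *\<^sub>R P t) \<in> borel_measurable borel" by measurable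
  qed
  moreover have "indicator (ucube (z + y)) (t + y) = (indicator (ucube z) t :: real)" for t
    by (simp add: indicator_def ucube_def)
  ultimately show ?thesis by (simp only: *)
qed

text \<open>Gaussian majorant for the kernel on one period. It rests on
  \<open>sin \<theta> \<ge> \<theta> / 2\<close> for \<open>0 \<le> \<theta> \<le> pi / 2\<close>,
  that is, on \<open>cos^2 \<theta> \<le> 1 - \<theta>^2 / 4\<close>.\<close>

lemma cos_squared_le_exp:
  assumes "\<bar>\<theta>\<bar> \<le> pi / 2"
  shows "(cos \<theta>)\<^sup>2 \<le> exp (- \<theta>\<^sup>2 / 4)"
proof -
  have sc: "x * cos x \<le> sin x" if "0 \<le> x" "x \<le> pi / 2" for x
  proof (cases "x = 0")
    case False
    have x: "0 < x" using False that by simp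
    obtain z where z: "0 < z" "z < x" "sin x - sin 0 = (x - 0) * cos z"
      using MVT2[OF x, of sin cos] DERIV_sin by blast
    have "cos x \<le> cos z" by (rule cos_monotone_0_pi_le) (use z that pi_gt_zero in linarith)+
    then have "x * cos x \<le> x * cos z" using x by (intro mult_left_mono) auto
    also have "\<dots> = sin x" using z(3) by simp
    finally show ?thesis .
  qed simp
  \<comment> \<open>Double angle: \<open>sin \<theta> = 2 sin (\<theta>/2) cos (\<theta>/2) \<ge>
    \<theta> cos^2 (\<theta>/2)\<close>, and \<open>cos^2 (\<theta>/2) \<ge> 1/2\<close> because
    \<open>cos \<theta> \<ge> 0\<close>.\<close>
  have s: "\<theta> / 2 \<le> sin \<theta>" if "0 \<le> \<theta>" "\<theta> \<le> pi / 2" for \<theta>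
  proof -
    have "\<theta> / 2 * cos (\<theta> / 2) \<le> sin (\<theta> / 2)" by (rule sc) (use that in linarith)+
    moreover have "0 \<le> cos (\<theta> / 2)" "0 \<le> cos \<theta>" by (rule cos_ge_zero; use that in linarith)+
    ultimately have "2 * (\<theta> / 2 * cos (\<theta> / 2)) * cos (\<theta> / 2) \<le> 2 * sin (\<theta> / 2) * cos (\<theta> / 2)"
      by (intro mult_right_mono) auto
    also have "\<dots> = sin \<theta>" using sin_double[of "\<theta> / 2"] by simp
    finally have "\<theta> * (cos (\<theta> / 2))\<^sup>2 \<le> sin \<theta>" by (simp add: power2_eq_square mult_ac)
    moreover have "\<theta> * (1/2) \<le> \<theta> * (cos (\<theta> / 2))\<^sup>2"
      using cos_double_cos[of "\<theta> / 2"] \<open>0 \<le> cos \<theta>\<close> that by (intro mult_left_mono) auto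
    ultimately show ?thesis by simp
  qed
  have "(\<bar>\<theta>\<bar> / 2)\<^sup>2 \<le> (sin \<bar>\<theta>\<bar>)\<^sup>2"
    using s[of "\<bar>\<theta>\<bar>"] assms by (intro power_mono) auto
  moreover have "(sin \<bar>\<theta>\<bar>)\<^sup>2 = (sin \<theta>)\<^sup>2" by (simp add: abs_if)
  ultimately have "\<theta>\<^sup>2 / 4 \<le> (sin \<theta>)\<^sup>2" by (simp add: power_divide)
  then have "(cos \<theta>)\<^sup>2 \<le> 1 + (- \<theta>\<^sup>2 / 4)" using sin_cos_squared_add[of \<theta>] by linarith
  also have "\<dots> \<le> exp (- \<theta>\<^sup>2 / 4)" by (rule exp_ge_add_one_self)
  finally show ?thesis .
qed

lemma zperiodic_cis: "zperiodic (\<lambda>t. cis (t \<bullet> ((2 * pi) *\<^sub>R zvec k)))"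
  unfolding zperiodic_def inner_scaleR_right inner_add_left distrib_left cis_mult[symmetric] by simp

lemma zperiodic_mult: "zperiodic P \<Longrightarrow> zperiodic Q \<Longrightarrow> zperiodic (\<lambda>t. P t * Q t)"
  by (simp add: zperiodic_def)

text \<open>The kernel with \<open>a = pi\<close> has period 1, so its frequencies are those of the
  torus. On a period cube centred at \<open>x\<close> it peaks only at the centre; rescaled by
  \<open>sqrt N\<close> it tends to a Gaussian there, and the vanishing coefficients force
  \<open>P x\<close> times its integral to be 0.\<close>

lemma torus_fourier_injective:
  fixes P :: "real^'n::finite \<Rightarrow> complex"
  assumes per: "zperiodic P" and c: "continuous_on UNIV P"
    and z: "\<And>k. cube_integral (\<lambda>t. P t * cis (t \<bullet> ((2 * pi) *\<^sub>R zvec k))) = 0"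
  shows "P x = 0"
proof -
  have [measurable]: "P \<in> borel_measurable borel" using c by (rule borel_measurable_continuous_onI)
  obtain B where B: "\<And>t. norm (P t) \<le> B" using zperiodic_bounded[OF per c] by blast
  have B0: "0 \<le> B" using order_trans[OF norm_ge_zero B] .
  \<comment> \<open>Corner of the unit cube centred at the origin, so that 0 is an interior point
    and every coordinate is at most 1/2 in modulus.\<close>
  define h :: "real^'n" where "h = (\<chi> i. - 1/2)"
  define f where "f v = indicator (ucube h) v *\<^sub>R P (x + v)" for v
  have [measurable]: "f \<in> borel_measurable borel" unfolding f_def by measurable
  define H where "H = range (\<lambda>k. (2 * pi) *\<^sub>R zvec k :: real^'n)"
  have i: "integrable lborel f"
    unfolding f_def by (rule integrable_ucube[where B = B]) (use B in auto)
  have f0: "(LINT v|lborel. f v * cis (v \<bullet> \<eta>)) = 0" if "\<eta> \<in> H" for \<eta>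
  proof -
    from that obtain k where \<eta>: "\<eta> = (2 * pi) *\<^sub>R zvec k" by (auto simp: H_def)
    let ?G = "\<lambda>t. P t * cis (t \<bullet> \<eta>)"
    have "(LINT v|lborel. indicator (ucube h) v *\<^sub>R ?G (v + x)) = 0"
    proof -
      have "zperiodic ?G" unfolding \<eta> by (intro zperiodic_mult per zperiodic_cis)
      moreover have "continuous_on UNIV ?G" by (intro continuous_intros c)
      ultimately have "(LINT v|lborel. indicator (ucube h) v *\<^sub>R ?G (v + x)) = cube_integral ?G"
        by (rule cube_integral_shift)
      then show ?thesis unfolding \<eta> z .
    qed
    then have "cis (- (x \<bullet> \<eta>)) * (LINT v|lborel. indicator (ucube h) v *\<^sub>R ?G (v + x)) = 0" by simp
    moreover have "cis (- (x \<bullet> \<eta>)) * (indicator (ucube h) v *\<^sub>R ?G (v + x)) = f v * cis (v \<bullet> \<eta>)" for v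
    proof -
      have "cis (- (x \<bullet> \<eta>)) * cis ((v + x) \<bullet> \<eta>) = cis (v \<bullet> \<eta>)" by (simp add: cis_mult inner_add_left)
      then have "P (v + x) * (cis (- (x \<bullet> \<eta>)) * cis ((v + x) \<bullet> \<eta>)) = P (v + x) * cis (v \<bullet> \<eta>)" by simp
      then show ?thesis by (simp add: f_def add.commute[of x] indicator_def mult.left_commute)
    qed
    ultimately show ?thesis by (simp flip: integral_mult_right_zero)
  qed
  \<comment> \<open>The integrand after \<open>v = w / sqrt (N + 1)\<close>; using
    \<open>Suc N\<close> avoids a division by zero at \<open>N = 0\<close>.\<close>
  define g where "g N w = f ((1 / sqrt (real (Suc N))) *\<^sub>R w) *
      complex_of_real ((\<Prod>i\<in>UNIV. (cos ((pi *\<^sub>R w) $ i / sqrt (real (Suc N))))\<^sup>2) ^ Suc N)" for N w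
  have km [measurable]: "(\<lambda>w::real^'n. complex_of_real ((\<Prod>i\<in>UNIV. (cos ((pi *\<^sub>R w) $ i / sqrt (real (Suc N))))\<^sup>2) ^ Suc N)) \<in> borel_measurable borel" for N
    by (intro borel_measurable_continuous_onI continuous_intros) auto
  have gm [measurable]: "g N \<in> borel_measurable borel" for N unfolding g_def by measurable
  have g0: "(LINT w|lborel. g N w) = 0" for N
  proof -
    have "(LINT v|lborel. f v * complex_of_real ((\<Prod>i\<in>UNIV. (cos (pi * (v $ i - 0 $ i)))\<^sup>2) ^ Suc N)) = 0"
    proof (rule trig_kernel_zero[OF i f0])
      show "a + b \<in> H" if "a \<in> H" "b \<in> H" for a b
        using that by (auto simp: H_def zvec_add simp flip: scaleR_add_right)
      show "- a \<in> H" if "a \<in> H" for a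
        using that by (auto simp: H_def zvec_minus simp flip: scaleR_minus_right)
      show "0 \<in> H" unfolding H_def by (rule image_eqI[of _ _ "\<lambda>_. 0"]) (auto simp: vec_eq_iff)
      show "(2 * pi) *\<^sub>R axis i 1 \<in> H" for i unfolding H_def zvec_axis by blast
    qed
    moreover have "(LINT v|lborel. f v * complex_of_real ((\<Prod>i\<in>UNIV. (cos (pi * (v $ i - 0 $ i)))\<^sup>2) ^ Suc N)) =
      \<bar>1 / sqrt (real (Suc N))\<bar> ^ DIM(real^'n) *\<^sub>R (LINT v|lborel. f (0 + (1 / sqrt (real (Suc N))) *\<^sub>R v) *
        complex_of_real ((\<Prod>i\<in>UNIV. (cos (pi * ((0 + (1 / sqrt (real (Suc N))) *\<^sub>R v) $ i - 0 $ i)))\<^sup>2) ^ Suc N))"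
    proof (rule lborel_integral_affine(1))
      have "(\<lambda>v::real^'n. complex_of_real ((\<Prod>i\<in>UNIV. (cos (pi * (v $ i - 0 $ i)))\<^sup>2) ^ Suc N)) \<in> borel_measurable borel"
        by (intro borel_measurable_continuous_onI continuous_intros)
      then show "(\<lambda>v. f v * complex_of_real ((\<Prod>i\<in>UNIV. (cos (pi * (v $ i - 0 $ i)))\<^sup>2) ^ Suc N)) \<in> borel_measurable borel"
        by (intro borel_measurable_times) auto
    qed simp
    ultimately show ?thesis by (simp add: g_def)
  qed
  have "(\<lambda>N. LINT w|lborel. g N w) \<longlonglongrightarrow> (LINT w|lborel. P x * of_real (exp (- (norm (pi *\<^sub>R (w::real^'n)))\<^sup>2)))"
  proof (rule integral_dominated_convergence[where w = "\<lambda>w. B * exp (- (norm w)\<^sup>2)"])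
    show "integrable lborel (\<lambda>w::real^'n. B * exp (- (norm w)\<^sup>2))" by (intro integrable_mult_right integrable_gaussian)
    show "g N \<in> borel_measurable lborel" for N using gm by simp
    show "(\<lambda>w::real^'n. P x * of_real (exp (- (norm (pi *\<^sub>R w))\<^sup>2))) \<in> borel_measurable lborel" by measurable
    have "(\<lambda>N. g N w) \<longlonglongrightarrow> P x * of_real (exp (- (norm (pi *\<^sub>R w))\<^sup>2))" for w
      unfolding g_def
    proof (intro tendsto_mult tendsto_of_real)
      show "(\<lambda>N. (\<Prod>i\<in>UNIV. (cos ((pi *\<^sub>R w) $ i / sqrt (real (Suc N))))\<^sup>2) ^ Suc N) \<longlonglongrightarrow> exp (- (norm (pi *\<^sub>R w))\<^sup>2)"
        using trig_kernel_limit[of "pi *\<^sub>R w"] by (rule LIMSEQ_Suc)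
      have "(\<lambda>N. 1 / sqrt (real (Suc N))) \<longlonglongrightarrow> 0" by real_asymp
      from tendsto_scaleR[OF this tendsto_const[of w]]
      have l: "(\<lambda>N. (1 / sqrt (real (Suc N))) *\<^sub>R w) \<longlonglongrightarrow> 0" by simp
      have "(0::real^'n) \<in> box h (h + 1)" by (simp add: h_def mem_box_cart)
      then have "\<forall>\<^sub>F N in sequentially. (1 / sqrt (real (Suc N))) *\<^sub>R w \<in> box h (h + 1)"
        by (intro topological_tendstoD[OF l] open_box)
      then have ev: "\<forall>\<^sub>F N in sequentially. P (x + (1 / sqrt (real (Suc N))) *\<^sub>R w) = f ((1 / sqrt (real (Suc N))) *\<^sub>R w)"
        by eventually_elim (use box_subset_ucube in \<open>auto simp: f_def indicator_def\<close>)
      have "(\<lambda>N. P (x + (1 / sqrt (real (Suc N))) *\<^sub>R w)) \<longlonglongrightarrow> P x"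
        by (rule continuous_on_tendsto_compose[OF c]) (use tendsto_add[OF tendsto_const[of x] l] in auto)
      then show "(\<lambda>N. f ((1 / sqrt (real (Suc N))) *\<^sub>R w)) \<longlonglongrightarrow> P x"
        by (rule Lim_transform_eventually) (rule ev)
    qed
    then show "AE w in lborel. (\<lambda>N. g N w) \<longlonglongrightarrow> P x * of_real (exp (- (norm (pi *\<^sub>R w))\<^sup>2))" by simp
    have "norm (g N w) \<le> B * exp (- (norm w)\<^sup>2)" for N w
    proof (cases "(1 / sqrt (real (Suc N))) *\<^sub>R w \<in> ucube h")
      case True
      define q where "q = sqrt (real (Suc N))"
      have q: "q > 0" "q\<^sup>2 = real (Suc N)" by (simp_all add: q_def)
      \<comment> \<open>Inside the centred cube the angle \<open>pi w_i / q\<close> stays within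
        \<open>pi / 2\<close>, the range of the Gaussian majorant; \<open>(pi / 2)^2 \<ge> 1\<close>
        then gives the rate 1.\<close>
      have wi: "\<bar>w $ i / q\<bar> \<le> 1/2" for i
      proof -
        have "- 1 / 2 \<le> w $ i / q" "w $ i / q < - 1 / 2 + 1" using True by (auto simp: ucube_def h_def q_def)
        then show ?thesis unfolding abs_le_iff by linarith
      qed
      have "((cos ((pi *\<^sub>R w) $ i / q))\<^sup>2) ^ Suc N \<le> exp (- (w $ i)\<^sup>2)" for i
      proof -
        have "\<bar>(pi *\<^sub>R w) $ i / q\<bar> = pi * \<bar>w $ i / q\<bar>" by (simp add: abs_mult)
        also have "\<dots> \<le> pi * (1/2)" using wi by (intro mult_left_mono) auto
        finally have "(cos ((pi *\<^sub>R w) $ i / q))\<^sup>2 \<le> exp (- ((pi *\<^sub>R w) $ i / q)\<^sup>2 / 4)"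
          by (intro cos_squared_le_exp) simp
        then have "((cos ((pi *\<^sub>R w) $ i / q))\<^sup>2) ^ Suc N \<le> exp (- ((pi *\<^sub>R w) $ i / q)\<^sup>2 / 4) ^ Suc N"
          by (rule power_mono) simp
        also have "\<dots> = exp (real (Suc N) * (- ((pi *\<^sub>R w) $ i / q)\<^sup>2 / 4))" by (rule exp_of_nat_mult[symmetric])
        also have "real (Suc N) * (- ((pi *\<^sub>R w) $ i / q)\<^sup>2 / 4) = - ((pi / 2)\<^sup>2 * (w $ i)\<^sup>2)"
          unfolding q(2)[symmetric] using q(1) by (simp add: power_divide power_mult_distrib)
        also have "exp \<dots> \<le> exp (- (w $ i)\<^sup>2)"
        proof -
          have "1\<^sup>2 \<le> (pi / 2)\<^sup>2" using pi_ge_two by (intro power_mono) auto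
          from mult_right_mono[OF this, of "(w $ i)\<^sup>2"] show ?thesis by simp
        qed
        finally show ?thesis .
      qed
      then have "(\<Prod>i\<in>UNIV. ((cos ((pi *\<^sub>R w) $ i / q))\<^sup>2) ^ Suc N) \<le> (\<Prod>i\<in>UNIV. exp (- (w $ i)\<^sup>2))"
        by (intro prod_mono conjI) (simp_all del: power_Suc)
      also have "\<dots> = exp (- (norm w)\<^sup>2)"
        by (simp only: power2_norm_eq_inner inner_vec_def inner_real_def flip: exp_sum) (simp add: sum_negf power2_eq_square flip: exp_sum)
      finally have "(\<Prod>i\<in>UNIV. (cos ((pi *\<^sub>R w) $ i / q))\<^sup>2) ^ Suc N \<le> exp (- (norm w)\<^sup>2)"
        by (simp only: prod_power_distrib)
      moreover have "0 \<le> (\<Prod>i\<in>UNIV. (cos ((pi *\<^sub>R w) $ i / q))\<^sup>2) ^ Suc N" by (rule zero_le_power, rule prod_nonneg) simp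
      moreover have "norm (f ((1 / q) *\<^sub>R w)) \<le> B" using B B0 by (simp add: f_def indicator_def)
      ultimately show ?thesis unfolding g_def q_def[symmetric] norm_mult norm_of_real
        using B0 by (intro mult_mono) auto
    qed (simp add: g_def f_def B0)
    then show "AE w in lborel. norm (g N w) \<le> B * exp (- (norm w)\<^sup>2)" for N by simp
  qed
  then have "(LINT w|lborel. P x * of_real (exp (- (norm (pi *\<^sub>R (w::real^'n)))\<^sup>2))) = 0"
    unfolding g0 by (simp add: LIMSEQ_const_iff)
  then have "P x * of_real (LINT w|lborel. exp (- (norm (pi *\<^sub>R (w::real^'n)))\<^sup>2)) = 0"
    by (subst integral_complex_of_real[symmetric]) (subst integral_mult_right_zero[symmetric], assumption)
  moreover have "(LINT w|lborel. exp (- (norm (w::real^'n))\<^sup>2)) =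
    \<bar>pi\<bar> ^ DIM(real^'n) *\<^sub>R (LINT w|lborel. exp (- (norm (0 + pi *\<^sub>R (w::real^'n)))\<^sup>2))"
    by (rule lborel_integral_affine(1)) simp_all
  ultimately show ?thesis using gaussian_integral_nonzero[where 'a = "real^'n"] by auto
qed

section \<open>Iterated partial derivatives and Gelfand--Shilov seminorms\<close>

lemma dlist_Nil [simp]: "dlist [] f = f"
  by (simp add: dlist_def)

lemma dlist_Cons [simp]: "dlist (i # is) f = dpart i (dlist is f)"
  by (simp add: dlist_def)

lemma dlist_append: "dlist (is @ js) f = dlist is (dlist js f)"
  by (simp add: dlist_def)

lemma smooth_dlist: "smooth f \<Longrightarrow> smooth (dlist js f)"
  unfolding smooth_def by (auto simp flip: dlist_append)

lemma smooth_dpart: "smooth f \<Longrightarrow> smooth (dpart i f)"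
  using smooth_dlist[of f "[i]"] by simp

lemma smooth_continuous: "smooth f \<Longrightarrow> continuous_on UNIV f"
  unfolding smooth_def by (metis dlist_Nil)

lemma smooth_measurable: "smooth f \<Longrightarrow> f \<in> borel_measurable borel"
  by (simp add: borel_measurable_continuous_onI smooth_continuous)

lemma has_vector_derivative_shift0:
  assumes "((\<lambda>s. g (t + s)) has_vector_derivative D) (at (0::real))"
  shows "(g has_vector_derivative D) (at t)"
proof -
  have "((\<lambda>r. r - t) has_vector_derivative 1) (at t)"
    by (auto intro!: derivative_eq_intros)
  then have "((\<lambda>s. g (t + s)) \<circ> (\<lambda>r. r - t) has_vector_derivative 1 *\<^sub>R D) (at t)"
    by (rule vector_diff_chain_at) (use assms in simp)
  then show ?thesis by (simp add: o_def)
qed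

lemma smooth_has_vector_derivative:
  assumes "smooth f"
  shows "((\<lambda>t. f (x + t *\<^sub>R axis i 1)) has_vector_derivative dpart i f (x + t *\<^sub>R axis i 1)) (at t)"
proof (rule has_vector_derivative_shift0)
  have "(\<lambda>s. f ((x + t *\<^sub>R axis i 1) + s *\<^sub>R axis i 1)) differentiable (at 0)"
    using assms unfolding smooth_def by (metis dlist_Nil)
  then have "((\<lambda>s. f ((x + t *\<^sub>R axis i 1) + s *\<^sub>R axis i 1)) has_vector_derivative
      dpart i f (x + t *\<^sub>R axis i 1)) (at 0)"
    unfolding dpart_def by (simp add: vector_derivative_works)
  then show "((\<lambda>s. f (x + (t + s) *\<^sub>R axis i 1)) has_vector_derivative
      dpart i f (x + t *\<^sub>R axis i 1)) (at 0)"
    by (simp add: algebra_simps)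
qed

lemma dpart_eqI:
  assumes "((\<lambda>t. f (x + t *\<^sub>R axis i 1)) has_vector_derivative D) (at 0)"
  shows "dpart i f x = D"
  using assms unfolding dpart_def by (rule vector_derivative_at)

text \<open>\<open>smooth\<close> speaks only of derivatives along the axes; continuity of these
  upgrades them to a total derivative, which differentiation along arbitrary segments requires. The
  increment is built up one coordinate at a time.\<close>

lemma smooth_has_derivative:
  fixes f :: "real^'n::finite \<Rightarrow> complex"
  assumes f: "smooth f"
  shows "(f has_derivative (\<lambda>v. \<Sum>i\<in>UNIV. (v $ i) *\<^sub>R dpart i f x)) (at x)"
proof -
  define pr where "pr S v = (\<Sum>i\<in>S. (v $ i) *\<^sub>R (axis i 1 :: real^'n))" for S v
  have prn: "norm (pr S v) \<le> real CARD('n) * norm v" for S v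
  proof -
    have "norm (pr S v) \<le> (\<Sum>i\<in>S. norm v)"
      unfolding pr_def by (rule sum_norm_le) (simp add: component_le_norm_cart)
    also have "\<dots> \<le> (\<Sum>i\<in>(UNIV::'n set). norm v)"
      by (rule sum_mono2) auto
    finally show ?thesis by simp
  qed
  have key: "\<forall>\<epsilon>>0. \<exists>\<delta>>0. \<forall>v. norm v < \<delta> \<longrightarrow>
      norm (f (x + pr S v) - f x - (\<Sum>i\<in>S. (v $ i) *\<^sub>R dpart i f x)) \<le> \<epsilon> * norm v"
    if "finite S" for S :: "'n set"
    using that
  proof (induction S rule: finite_induct)
    case empty
    then show ?case by (auto simp: pr_def intro!: exI[of _ 1])
  next
    case (insert j S)
    show ?case
    proof (intro allI impI)
      fix \<epsilon> :: real assume "\<epsilon> > 0"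
      then obtain \<delta>1 where d1: "\<delta>1 > 0" and d1': "\<And>v. norm v < \<delta>1 \<Longrightarrow>
        norm (f (x + pr S v) - f x - (\<Sum>i\<in>S. (v $ i) *\<^sub>R dpart i f x)) \<le> \<epsilon>/2 * norm v"
        using insert.IH by (meson half_gt_zero)
      have "isCont (dpart j f) x"
        using smooth_continuous[OF smooth_dpart[OF f]] by (simp add: continuous_on_eq_continuous_at)
      then obtain \<delta>2 where d2: "\<delta>2 > 0" and d2': "\<And>y. dist y x < \<delta>2 \<Longrightarrow> dist (dpart j f y) (dpart j f x) < \<epsilon>/2"
        unfolding continuous_at_eps_delta using \<open>\<epsilon> > 0\<close> by (meson half_gt_zero)
      \<comment> \<open>All points of the coordinate path lie within \<open>(n + 1) * norm v\<close>
        of \<open>x\<close>.\<close>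
      define \<delta> where "\<delta> = min \<delta>1 (\<delta>2 / (real CARD('n) + 1))"
      have "norm (f (x + pr (insert j S) v) - f x - (\<Sum>i\<in>insert j S. (v $ i) *\<^sub>R dpart i f x)) \<le> \<epsilon> * norm v"
        if v: "norm v < \<delta>" for v
      proof -
        \<comment> \<open>Subtracting the linear part leaves a function whose derivative is a
          difference of two values of \<open>dpart j f\<close> near \<open>x\<close>, hence
          small.\<close>
        define g where "g t = f ((x + pr S v) + t *\<^sub>R axis j 1) - t *\<^sub>R dpart j f x" for t
        have "norm (g (v $ j) - g 0) \<le> \<epsilon>/2 * \<bar>v $ j - 0\<bar>"
        proof (rule vector_mvt_bound)
          fix t assume t: "t \<in> closed_segment 0 (v $ j)"
          show "(g has_vector_derivative dpart j f ((x + pr S v) + t *\<^sub>R axis j 1) - dpart j f x) (at t)"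
            unfolding g_def
            by (rule derivative_eq_intros smooth_has_vector_derivative[OF f] refl)+ (auto intro!: derivative_eq_intros)
          have "\<bar>t\<bar> \<le> \<bar>v $ j\<bar>" using t by (auto simp: closed_segment_eq_real_ivl split: if_splits)
          also have "\<dots> \<le> norm v" by (rule component_le_norm_cart)
          finally have "norm (pr S v + t *\<^sub>R axis j 1) \<le> (real CARD('n) + 1) * norm v"
            using prn[of S v] norm_triangle_ineq[of "pr S v" "t *\<^sub>R axis j 1"] by (simp add: algebra_simps)
          also have "\<dots> < \<delta>2" using v unfolding \<delta>_def by (simp add: field_simps add_nonneg_pos)
          finally have "dist (x + pr S v + t *\<^sub>R axis j 1) x < \<delta>2" by (simp add: dist_norm add.assoc)
          from d2'[OF this] show "norm (dpart j f ((x + pr S v) + t *\<^sub>R axis j 1) - dpart j f x) \<le> \<epsilon>/2"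
            by (simp add: dist_norm)
        qed
        also have "\<dots> \<le> \<epsilon>/2 * norm v"
          using \<open>\<epsilon> > 0\<close> component_le_norm_cart[of v j] by simp
        finally have 1: "norm (g (v $ j) - g 0) \<le> \<epsilon>/2 * norm v" .
        have 2: "norm (f (x + pr S v) - f x - (\<Sum>i\<in>S. (v $ i) *\<^sub>R dpart i f x)) \<le> \<epsilon>/2 * norm v"
          using d1' v by (simp add: \<delta>_def)
        have "f (x + pr (insert j S) v) - f x - (\<Sum>i\<in>insert j S. (v $ i) *\<^sub>R dpart i f x) =
          (g (v $ j) - g 0) + (f (x + pr S v) - f x - (\<Sum>i\<in>S. (v $ i) *\<^sub>R dpart i f x))"
          using insert.hyps by (simp add: g_def pr_def algebra_simps)
        then have "norm (f (x + pr (insert j S) v) - f x - (\<Sum>i\<in>insert j S. (v $ i) *\<^sub>R dpart i f x)) \<le>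
          \<epsilon>/2 * norm v + \<epsilon>/2 * norm v"
          by (metis norm_triangle_le[OF add_mono[OF 1 2]])
        then show ?thesis by simp
      qed
      moreover have "\<delta> > 0" using d1 d2 by (simp add: \<delta>_def add_nonneg_pos)
      ultimately show "\<exists>\<delta>>0. \<forall>v. norm v < \<delta> \<longrightarrow>
        norm (f (x + pr (insert j S) v) - f x - (\<Sum>i\<in>insert j S. (v $ i) *\<^sub>R dpart i f x)) \<le> \<epsilon> * norm v"
        by blast
    qed
  qed
  have pru: "pr UNIV v = v" for v
    unfolding pr_def by (simp add: vec_eq_iff axis_def if_distrib cong: if_cong)
  show ?thesis
    unfolding has_derivative_at_alt
  proof (intro conjI allI impI)
    show "bounded_linear (\<lambda>v. \<Sum>i\<in>UNIV. (v $ i) *\<^sub>R dpart i f x)"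
      by (intro bounded_linear_sum bounded_linear_scaleR_left[THEN bounded_linear_compose] bounded_linear_vec_nth)
    fix e :: real assume "e > 0"
    then obtain \<delta> where "\<delta> > 0" and d: "\<And>v. norm v < \<delta> \<Longrightarrow>
      norm (f (x + v) - f x - (\<Sum>i\<in>UNIV. (v $ i) *\<^sub>R dpart i f x)) \<le> e * norm v"
      using key[of UNIV] by (auto simp: pru)
    have "\<forall>y. norm (y - x) < \<delta> \<longrightarrow>
      norm (f y - f x - (\<Sum>i\<in>UNIV. ((y - x) $ i) *\<^sub>R dpart i f x)) \<le> e * norm (y - x)"
      using d[of "y - x" for y] by (simp add: add.commute[of x])
    then show "\<exists>d>0. \<forall>y. norm (y - x) < d \<longrightarrow>
      norm (f y - f x - (\<Sum>i\<in>UNIV. ((y - x) $ i) *\<^sub>R dpart i f x)) \<le> e * norm (y - x)"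
      using \<open>\<delta> > 0\<close> by blast
  qed
qed

text \<open>Schwarz: the second difference \<open>\<Delta>\<close> is symmetric in the two
  directions and is approximated by \<open>s t\<close> times either mixed derivative, by two nested
  mean value estimates.\<close>

lemma dpart_commute:
  fixes f :: "real^'n::finite \<Rightarrow> complex"
  assumes f: "smooth f"
  shows "dpart i (dpart j f) = dpart j (dpart i f)"
proof
  fix x
  define \<Delta> where "\<Delta> i j s t = f (x + s *\<^sub>R axis i 1 + t *\<^sub>R axis j 1) - f (x + s *\<^sub>R axis i 1)
    - f (x + t *\<^sub>R axis j 1) + f x" for i j s t
  have key: "\<exists>\<delta>>0. \<forall>s t. 0 < s \<longrightarrow> s < \<delta> \<longrightarrow> 0 < t \<longrightarrow> t < \<delta> \<longrightarrow>
      norm (\<Delta> i j s t - (s * t) *\<^sub>R dpart i (dpart j f) x) \<le> \<epsilon> * s * t" if e: "\<epsilon> > 0" for \<epsilon> i j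
  proof -
    let ?A = "dpart i (dpart j f) x"
    have "isCont (dpart i (dpart j f)) x"
      using smooth_continuous[OF smooth_dpart[OF smooth_dpart[OF f]]] by (simp add: continuous_on_eq_continuous_at)
    then obtain \<delta> where d: "\<delta> > 0" and d': "\<And>y. dist y x < \<delta> \<Longrightarrow> dist (dpart i (dpart j f) y) ?A < \<epsilon>"
      unfolding continuous_at_eps_delta using e by blast
    have "norm (\<Delta> i j s t - (s * t) *\<^sub>R ?A) \<le> \<epsilon> * s * t"
      if s: "0 < s" "s < \<delta>/2" and t: "0 < t" "t < \<delta>/2" for s t
    proof -
      define \<psi> where "\<psi> r = f (x + s *\<^sub>R axis i 1 + r *\<^sub>R axis j 1) - f (x + r *\<^sub>R axis j 1) - r *\<^sub>R s *\<^sub>R ?A" for r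
      define \<psi>' where "\<psi>' r = dpart j f (x + s *\<^sub>R axis i 1 + r *\<^sub>R axis j 1) - dpart j f (x + r *\<^sub>R axis j 1) - s *\<^sub>R ?A" for r
      have "norm (\<psi> t - \<psi> 0) \<le> (\<epsilon> * s) * \<bar>t - 0\<bar>"
      proof (rule vector_mvt_bound)
        fix r assume "r \<in> closed_segment 0 t"
        then have r: "0 \<le> r" "r \<le> t" using t by (auto simp: closed_segment_eq_real_ivl split: if_splits)
        show "(\<psi> has_vector_derivative \<psi>' r) (at r)"
          unfolding \<psi>_def \<psi>'_def
          by (rule derivative_eq_intros smooth_has_vector_derivative[OF f] refl)+ (auto intro!: derivative_eq_intros)
        define h where "h q = dpart j f ((x + r *\<^sub>R axis j 1) + q *\<^sub>R axis i 1) - q *\<^sub>R ?A" for q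
        have "norm (h s - h 0) \<le> \<epsilon> * \<bar>s - 0\<bar>"
        proof (rule vector_mvt_bound)
          fix q assume "q \<in> closed_segment 0 s"
          then have q: "0 \<le> q" "q \<le> s" using s by (auto simp: closed_segment_eq_real_ivl split: if_splits)
          show "(h has_vector_derivative dpart i (dpart j f) ((x + r *\<^sub>R axis j 1) + q *\<^sub>R axis i 1) - ?A) (at q)"
            unfolding h_def
            by (rule derivative_eq_intros smooth_has_vector_derivative[OF smooth_dpart[OF f]] refl)+ (auto intro!: derivative_eq_intros)
          have "norm (r *\<^sub>R axis j 1 + q *\<^sub>R axis i (1::real)) \<le> r + q"
            using norm_triangle_ineq[of "r *\<^sub>R axis j (1::real)" "q *\<^sub>R axis i 1"] r q by simp
          then have "dist (x + r *\<^sub>R axis j 1 + q *\<^sub>R axis i 1) x < \<delta>"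
            using r q s t by (simp add: dist_norm add.assoc)
          from d'[OF this] show "norm (dpart i (dpart j f) ((x + r *\<^sub>R axis j 1) + q *\<^sub>R axis i 1) - ?A) \<le> \<epsilon>"
            by (simp add: dist_norm)
        qed
        then show "norm (\<psi>' r) \<le> \<epsilon> * s"
          using s by (simp add: h_def \<psi>'_def algebra_simps)
      qed
      then show ?thesis using s t by (simp add: \<psi>_def \<Delta>_def algebra_simps)
    qed
    then show ?thesis using d by (intro exI[of _ "\<delta>/2"]) auto
  qed
  have "norm (dpart i (dpart j f) x - dpart j (dpart i f) x) \<le> 0 + \<epsilon>" if "\<epsilon> > 0" for \<epsilon>
  proof -
    have e: "\<epsilon>/2 > 0" using that by simp
    obtain \<delta>1 where d1: "\<delta>1>0" "\<And>s t. 0 < s \<Longrightarrow> s < \<delta>1 \<Longrightarrow> 0 < t \<Longrightarrow> t < \<delta>1 \<Longrightarrow>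
      norm (\<Delta> i j s t - (s * t) *\<^sub>R dpart i (dpart j f) x) \<le> \<epsilon>/2 * s * t" using key[OF e, of i j] by blast
    obtain \<delta>2 where d2: "\<delta>2>0" "\<And>s t. 0 < s \<Longrightarrow> s < \<delta>2 \<Longrightarrow> 0 < t \<Longrightarrow> t < \<delta>2 \<Longrightarrow>
      norm (\<Delta> j i s t - (s * t) *\<^sub>R dpart j (dpart i f) x) \<le> \<epsilon>/2 * s * t" using key[OF e, of j i] by blast
    define s where "s = min \<delta>1 \<delta>2 / 2"
    have s: "0 < s" "s < \<delta>1" "s < \<delta>2" using d1(1) d2(1) by (auto simp: s_def min_def)
    have D: "\<Delta> i j s s = \<Delta> j i s s" unfolding \<Delta>_def by (simp add: algebra_simps)
    have "norm ((s * s) *\<^sub>R (dpart i (dpart j f) x - dpart j (dpart i f) x)) \<le> \<epsilon>/2 * s * s + \<epsilon>/2 * s * s"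
      using norm_triangle_le_diff[OF add_mono[OF d2(2)[of s s] d1(2)[of s s]]] s D by (simp add: algebra_simps)
    then have "(s * s) * norm (dpart i (dpart j f) x - dpart j (dpart i f) x) \<le> (s * s) * \<epsilon>"
      by (simp only: norm_scaleR) (simp add: algebra_simps)
    moreover have "s * s > 0" using s by simp
    ultimately show ?thesis by (simp only: mult_le_cancel_left_pos add_0)
  qed
  then have "norm (dpart i (dpart j f) x - dpart j (dpart i f) x) \<le> 0" by (rule field_le_epsilon)
  then show "dpart i (dpart j f) x = dpart j (dpart i f) x" by simp
qed

lemma dlist_move:
  assumes "smooth f"
  shows "dlist (xs @ i # ys) f = dlist (i # xs @ ys) f"
proof (induction xs)
  case (Cons a xs)
  then show ?case using dpart_commute[OF smooth_dlist[OF assms]] by simp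
qed simp

lemma dlist_perm:
  assumes "smooth f" "mset xs = mset ys"
  shows "dlist xs f = dlist ys f"
  using assms(2)
proof (induction xs arbitrary: ys)
  case (Cons i xs)
  then have "i \<in> set ys" by (metis list.set_intros(1) mset_eq_setD)
  then obtain as bs where ys: "ys = as @ i # bs" by (meson split_list)
  then have "dlist xs f = dlist (as @ bs) f" using Cons by simp
  then show ?case unfolding ys dlist_move[OF assms(1)] by simp
qed simp

section \<open>Gelfand--Shilov seminorms in radial form\<close>

text \<open>Powers of \<open>norm y\<close> and lists of directions replace monomials and
  multi-indices. This changes the scale \<open>h\<close> by a constant factor only, and translations
  and further derivatives act on it simply.\<close>

definition seminorm_le :: "real \<Rightarrow> real \<Rightarrow> real \<Rightarrow> real \<Rightarrow> (real^'n::finite \<Rightarrow> complex) \<Rightarrow> bool" where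
  "seminorm_le s t h B f \<longleftrightarrow> (\<forall>is k y. norm y ^ k * norm (dlist is f y)
     \<le> B * h ^ (length is + k) * fact (length is) powr s * fact k powr t)"

lemma dlist_dmi:
  fixes f :: "real^'n::finite \<Rightarrow> complex"
  assumes "smooth f"
  shows "dlist is f = dmi (count (mset is)) f"
proof -
  have idx: "distinct (idx_list :: 'n list) \<and> set (idx_list :: 'n list) = UNIV"
    unfolding idx_list_def by (rule someI_ex) (use finite_distinct_list[of "UNIV :: 'n set"] in auto)
  have "count (mset (concat (map (\<lambda>i. replicate (c i) i) xs))) j = (if j \<in> set xs then c j else 0)"
    if "distinct xs" for c :: "'n \<Rightarrow> nat" and xs j
    using that by (induction xs) auto
  then have "mset (concat (map (\<lambda>i. replicate (count (mset is) i) i) idx_list)) = mset is"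
    using idx by (intro multiset_eqI) auto
  then show ?thesis unfolding dmi_def using dlist_perm[OF assms] by metis
qed

lemma mi_abs_count: "mi_abs (count (mset (is :: 'n::finite list))) = length is"
proof -
  have "(\<Sum>i\<in>UNIV. count (mset is) i) = (\<Sum>i\<in>set_mset (mset is). count (mset is) i)"
    by (rule sum.mono_neutral_right) (auto simp: not_in_iff)
  then show ?thesis unfolding mi_abs_def by (simp add: size_multiset_overloaded_eq flip: size_mset)
qed

lemma fact_add_le: "(fact (a + b) :: real) \<le> 2 ^ (a + b) * fact a * fact b"
proof -
  have "real ((a + b) choose a) \<le> real (2 ^ (a + b))" by (rule of_nat_mono) (rule binomial_le_pow2)
  then have "fact (a + b) / (fact a * fact b) \<le> (2::real) ^ (a + b)" by (simp add: binomial_fact)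
  then show ?thesis by (simp add: field_simps)
qed

lemma fact_mult_le: "fact a * fact b \<le> (fact (a + b) :: real)"
proof -
  have "1 \<le> (a + b) choose a" by (simp add: Suc_leI)
  then have "1 \<le> real ((a + b) choose a)" by linarith
  then show ?thesis by (simp add: binomial_fact field_simps)
qed

lemma mi_fact_le: "mi_fact \<alpha> \<le> fact (mi_abs \<alpha>)"
proof -
  have "(\<Prod>i\<in>S. fact (\<alpha> i)) \<le> (fact (\<Sum>i\<in>S. \<alpha> i) :: real)" if "finite S" for S
    using that
  proof (induction S rule: finite_induct)
    case (insert j S)
    then have "(\<Prod>i\<in>insert j S. fact (\<alpha> i)) \<le> fact (\<alpha> j) * (fact (\<Sum>i\<in>S. \<alpha> i) :: real)"
      by simp
    also have "\<dots> \<le> fact (\<alpha> j + (\<Sum>i\<in>S. \<alpha> i))" by (rule fact_mult_le)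
    finally show ?case using insert by simp
  qed simp
  from this[of UNIV] show ?thesis by (simp add: mi_fact_def mi_abs_def)
qed

text \<open>Splitting off one coordinate costs a binomial coefficient, at most a power of 2. Such
  geometric factors are later absorbed into the scale \<open>h\<close>.\<close>

lemma fact_le_mi_fact:
  fixes \<alpha> :: "'n::finite mi"
  shows "fact (mi_abs \<alpha>) \<le> (2 ^ CARD('n)) ^ mi_abs \<alpha> * mi_fact \<alpha>"
proof -
  have "fact (\<Sum>i\<in>S. \<alpha> i) \<le> ((2::real) ^ card S) ^ (\<Sum>i\<in>S. \<alpha> i) * (\<Prod>i\<in>S. fact (\<alpha> i))" if "finite S" for S
    using that
  proof (induction S rule: finite_induct)
    case (insert j S)
    let ?m = "\<Sum>i\<in>S. \<alpha> i"
    have "fact (\<alpha> j + ?m) \<le> 2 ^ (\<alpha> j + ?m) * fact (\<alpha> j) * (fact ?m :: real)" by (rule fact_add_le)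
    also have "\<dots> \<le> 2 ^ (\<alpha> j + ?m) * fact (\<alpha> j) * (((2::real) ^ card S) ^ ?m * (\<Prod>i\<in>S. fact (\<alpha> i)))"
      using insert.IH by (intro mult_left_mono) auto
    also have "\<dots> \<le> 2 ^ (\<alpha> j + ?m) * fact (\<alpha> j) * (((2::real) ^ card S) ^ (\<alpha> j + ?m) * (\<Prod>i\<in>S. fact (\<alpha> i)))"
      by (intro mult_left_mono mult_right_mono power_increasing) (auto intro!: prod_nonneg)
    finally show ?case using insert.hyps by (simp add: power_mult_distrib mult_ac)
  qed simp
  from this[of UNIV] show ?thesis by (simp add: mi_fact_def mi_abs_def)
qed

lemma mi_fact_ge_1: "mi_fact \<alpha> \<ge> 1"
  unfolding mi_fact_def by (rule prod_ge_1) (simp add: fact_ge_1)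

text \<open>Taking the largest coordinate trades \<open>norm y ^ k\<close> for a single monomial, or
  later for derivatives in a single direction, at the cost of \<open>n ^ k\<close>.\<close>

lemma norm_power_le_component:
  fixes y :: "real^'n::finite"
  shows "\<exists>i. norm y ^ k \<le> real CARD('n) ^ k * \<bar>y $ i\<bar> ^ k"
proof -
  obtain i where i: "\<And>j. \<bar>y $ j\<bar> \<le> \<bar>y $ i\<bar>"
  proof -
    have "Max (range (\<lambda>j. \<bar>y $ j\<bar>)) \<in> range (\<lambda>j. \<bar>y $ j\<bar>)" by (rule Max_in) auto
    then obtain i where i: "Max (range (\<lambda>j. \<bar>y $ j\<bar>)) = \<bar>y $ i\<bar>" by blast
    have "\<bar>y $ j\<bar> \<le> \<bar>y $ i\<bar>" for j unfolding i[symmetric] by (rule Max_ge) auto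
    then show thesis by (rule that)
  qed
  have "norm y \<le> (\<Sum>j\<in>UNIV. \<bar>y $ j\<bar>)" by (rule norm_le_l1_cart)
  also have "\<dots> \<le> (\<Sum>j\<in>(UNIV::'n set). \<bar>y $ i\<bar>)" by (rule sum_mono) (rule i)
  finally have "norm y \<le> real CARD('n) * \<bar>y $ i\<bar>" by simp
  then have "norm y ^ k \<le> (real CARD('n) * \<bar>y $ i\<bar>) ^ k" by (rule power_mono) simp
  then show ?thesis by (auto simp: power_mult_distrib)
qed

lemma seminorm_leD:
  "seminorm_le s t h B f \<Longrightarrow> norm y ^ k * norm (dlist is f y)
     \<le> B * h ^ (length is + k) * fact (length is) powr s * fact k powr t"
  by (simp add: seminorm_le_def)

lemma seminorm_le_nonneg: "seminorm_le s t h B f \<Longrightarrow> 0 \<le> B"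
  using order_trans[OF norm_ge_zero, of "f 0" B] seminorm_leD[of s t h B f 0 0 "[]"] by simp

lemma gs_bounded_nonneg: "gs_bounded s t h B f \<Longrightarrow> 0 \<le> B"
proof -
  assume "gs_bounded s t h B f"
  from this[unfolded gs_bounded_def, rule_format, of 0 "\<lambda>_. 0" "\<lambda>_. 0"]
  have "norm (dmi (\<lambda>_. 0) f 0) \<le> B"
    by (simp add: mon_def mi_abs_def mi_fact_def)
  then show ?thesis by (rule order_trans[OF norm_ge_zero])
qed

lemma seminorm_le_mono:
  fixes f :: "real^'n::finite \<Rightarrow> complex"
  assumes f: "seminorm_le s t h B f" and "0 < h" "h \<le> h'" "B \<le> B'"
  shows "seminorm_le s t h' B' f"
  unfolding seminorm_le_def
proof (intro allI)
  fix "is" :: "'n list" and k and y :: "real^'n"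
  have "B * h ^ (length is + k) * fact (length is) powr s * fact k powr t \<le>
      B' * h' ^ (length is + k) * fact (length is) powr s * fact k powr t"
    using assms seminorm_le_nonneg[OF f] by (intro mult_right_mono mult_mono power_mono) auto
  with seminorm_leD[OF f, of y k "is"] show "norm y ^ k * norm (dlist is f y) \<le> B' * h' ^ (length is + k) * fact (length is) powr s * fact k powr t" by (rule order_trans)
qed

lemma gs_bounded_imp_seminorm_le:
  fixes f :: "real^'n::finite \<Rightarrow> complex"
  assumes f: "gs_bounded s t h B f" "smooth f" and h: "0 < h" and s: "0 \<le> s"
  shows "seminorm_le s t (real CARD('n) * h) B f"
  unfolding seminorm_le_def
proof (intro allI)
  fix "is" :: "'n list" and k and y :: "real^'n"
  let ?n = "real CARD('n)"
  have n1: "1 \<le> ?n" by (simp add: Suc_leI)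
  have B: "0 \<le> B" by (rule gs_bounded_nonneg[OF f(1)])
  obtain i where i: "norm y ^ k \<le> ?n ^ k * \<bar>y $ i\<bar> ^ k" using norm_power_le_component by blast
  \<comment> \<open>Concentrated in the largest coordinate, so that its multi-index factorial is
    exactly \<open>fact k\<close>.\<close>
  define \<beta> where "\<beta> = (\<lambda>j. if j = i then k else 0)"
  have \<beta>: "mi_abs \<beta> = k" "mi_fact \<beta> = fact k" "mon y \<beta> = (y $ i) ^ k"
    unfolding \<beta>_def mi_abs_def mi_fact_def mon_def by (simp_all add: if_distrib prod.If_cases sum.If_cases cong: if_cong)
  have "\<bar>mon y \<beta>\<bar> * norm (dmi (count (mset is)) f y)
        \<le> B * h ^ (mi_abs (count (mset is)) + mi_abs \<beta>) * mi_fact (count (mset is)) powr s * mi_fact \<beta> powr t"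
    using f(1) unfolding gs_bounded_def by blast
  then have 1: "\<bar>y $ i\<bar> ^ k * norm (dlist is f y) \<le> B * h ^ (length is + k) * mi_fact (count (mset is)) powr s * fact k powr t"
    unfolding \<beta> mi_abs_count dlist_dmi[OF f(2), symmetric] by (simp add: power_abs)
  have "norm y ^ k * norm (dlist is f y) \<le> (?n ^ k * \<bar>y $ i\<bar> ^ k) * norm (dlist is f y)"
    by (rule mult_right_mono[OF i]) simp
  also have "\<dots> = ?n ^ k * (\<bar>y $ i\<bar> ^ k * norm (dlist is f y))" by (simp only: mult.assoc)
  also have "\<dots> \<le> ?n ^ (length is + k) * (B * h ^ (length is + k) * fact (length is) powr s * fact k powr t)"
  proof (rule mult_mono)
    show "?n ^ k \<le> ?n ^ (length is + k)" using n1 by (intro power_increasing) auto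
    have "B * h ^ (length is + k) * mi_fact (count (mset is)) powr s * fact k powr t
      \<le> B * h ^ (length is + k) * fact (length is) powr s * fact k powr t"
      using mi_fact_le[of "count (mset is)"] mi_fact_ge_1[of "count (mset is)"] B h s
      by (intro mult_right_mono mult_left_mono powr_mono2) (auto simp: mi_abs_count)
    with 1 show "\<bar>y $ i\<bar> ^ k * norm (dlist is f y) \<le> B * h ^ (length is + k) * fact (length is) powr s * fact k powr t"
      by (rule order_trans)
  qed auto
  finally show "norm y ^ k * norm (dlist is f y)
     \<le> B * (?n * h) ^ (length is + k) * fact (length is) powr s * fact k powr t"
    by (simp add: power_mult_distrib mult_ac)
qed

lemma power_powr_swap: "0 < (x::real) \<Longrightarrow> (x ^ n) powr s = (x powr s) ^ n"
  by (simp add: powr_powr powr_realpow[symmetric] mult.commute)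

lemma fact_mi_abs_powr_le:
  fixes \<alpha> :: "'n::finite mi"
  assumes "0 \<le> s"
  shows "fact (mi_abs \<alpha>) powr s \<le> ((2 ^ CARD('n)) powr s) ^ mi_abs \<alpha> * mi_fact \<alpha> powr s"
proof -
  have "fact (mi_abs \<alpha>) powr s \<le> ((2 ^ CARD('n)) ^ mi_abs \<alpha> * mi_fact \<alpha>) powr s"
    using assms by (intro powr_mono2 fact_le_mi_fact) auto
  also have "\<dots> = ((2 ^ CARD('n)) ^ mi_abs \<alpha>) powr s * mi_fact \<alpha> powr s"
    by (rule powr_mult)
  also have "((2 ^ CARD('n) :: real) ^ mi_abs \<alpha>) powr s = ((2 ^ CARD('n)) powr s) ^ mi_abs \<alpha>"
    by (rule power_powr_swap) simp
  finally show ?thesis .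
qed

text \<open>Dominates both \<open>(2^n)^s\<close> and \<open>(2^n)^t\<close>, the costs per order of
  passing from the factorial of the total order to the multi-index factorial in the two
  exponents.\<close>

definition gs_const :: "'n::finite itself \<Rightarrow> real \<Rightarrow> real \<Rightarrow> real" where
  "gs_const _ s t = (2 ^ CARD('n)) powr (s + t)"

lemma gs_const_ge_1: "0 \<le> s \<Longrightarrow> 0 \<le> t \<Longrightarrow> gs_const TYPE('n::finite) s t \<ge> 1"
  unfolding gs_const_def by (rule ge_one_powr_ge_zero) auto

lemma seminorm_le_imp_gs_bounded:
  fixes f :: "real^'n::finite \<Rightarrow> complex"
  assumes f: "seminorm_le s t h B f" "smooth f" and h: "0 < h" and s: "0 \<le> s" and t: "0 \<le> t"
  shows "gs_bounded s t (gs_const TYPE('n) s t * h) B f"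
  unfolding gs_bounded_def
proof (intro allI)
  fix \<alpha> \<beta> :: "'n mi" and x :: "real^'n"
  let ?K = "gs_const TYPE('n) s t"
  have B: "0 \<le> B" by (rule seminorm_le_nonneg[OF f(1)])
  \<comment> \<open>A list of directions with multiplicities \<alpha>, which turns the multi-index
    derivative into a \<open>dlist\<close>.\<close>
  obtain xs :: "'n list" where xs: "mset xs = Abs_multiset \<alpha>" using ex_mset by blast
  have cnt: "count (mset xs) = \<alpha>" unfolding xs by (simp add: Abs_multiset_inverse)
  have len: "length xs = mi_abs \<alpha>" using mi_abs_count[of xs] by (simp add: cnt)
  have m: "\<bar>mon x \<beta>\<bar> \<le> norm x ^ mi_abs \<beta>"
    unfolding mon_def mi_abs_def abs_prod power_sum
    by (intro prod_mono conjI) (auto simp: power_abs intro!: power_mono component_le_norm_cart)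
  have K0: "0 \<le> ?K" by (simp add: gs_const_def)
  have K: "((2 ^ CARD('n)) powr s) \<le> ?K" "((2 ^ CARD('n)) powr t) \<le> ?K"
    unfolding gs_const_def using s t by (intro powr_mono; simp)+
  have p: "fact (mi_abs \<gamma>) powr r \<le> ?K ^ mi_abs \<gamma> * mi_fact \<gamma> powr r"
    if "0 \<le> r" "((2 ^ CARD('n)) powr r) \<le> ?K" for \<gamma> :: "'n mi" and r
  proof -
    note fact_mi_abs_powr_le[OF that(1), of \<gamma>]
    also have "((2 ^ CARD('n)) powr r) ^ mi_abs \<gamma> * mi_fact \<gamma> powr r \<le> ?K ^ mi_abs \<gamma> * mi_fact \<gamma> powr r"
      using that by (intro mult_right_mono power_mono) auto
    finally show ?thesis .
  qed
  have "\<bar>mon x \<beta>\<bar> * norm (dmi \<alpha> f x) \<le> norm x ^ mi_abs \<beta> * norm (dlist xs f x)"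
    unfolding dlist_dmi[OF f(2)] cnt by (rule mult_right_mono[OF m]) simp
  also have "\<dots> \<le> B * h ^ (mi_abs \<alpha> + mi_abs \<beta>) * fact (mi_abs \<alpha>) powr s * fact (mi_abs \<beta>) powr t"
    using seminorm_leD[OF f(1), of x "mi_abs \<beta>" xs] by (simp add: len)
  also have "\<dots> \<le> B * h ^ (mi_abs \<alpha> + mi_abs \<beta>) * (?K ^ mi_abs \<alpha> * mi_fact \<alpha> powr s) * (?K ^ mi_abs \<beta> * mi_fact \<beta> powr t)"
    using p[OF s K(1), of \<alpha>] p[OF t K(2), of \<beta>] B h K0
    by (intro mult_mono mult_left_mono) (auto intro!: mult_nonneg_nonneg zero_le_power)
  also have "\<dots> = B * (?K * h) ^ (mi_abs \<alpha> + mi_abs \<beta>) * mi_fact \<alpha> powr s * mi_fact \<beta> powr t"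
    by (simp add: power_mult_distrib power_add mult_ac)
  finally show "\<bar>mon x \<beta>\<bar> * norm (dmi \<alpha> f x) \<le> B * (?K * h) ^ (mi_abs \<alpha> + mi_abs \<beta>) * mi_fact \<alpha> powr s * mi_fact \<beta> powr t" .
qed

text \<open>The two families of seminorms differ by constant factors in \<open>h\<close>, which
  neither the quantifier "some h" nor "every h" sees.\<close>

lemma GS_test_iff:
  fixes f :: "real^'n::finite \<Rightarrow> complex"
  assumes s: "0 < s" and t: "0 < t"
  shows "f \<in> GS_test b s t \<longleftrightarrow> smooth f \<and>
    (if b then \<exists>h>0. \<exists>B. seminorm_le s t h B f else \<forall>h>0. \<exists>B. seminorm_le s t h B f)"
proof -
  let ?n = "real CARD('n)" and ?K = "gs_const TYPE('n) s t"
  have K: "?K > 0" using gs_const_ge_1[of s t, where 'n = 'n] s t by simp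
  have n: "?n > 0" by simp
  have 1: "\<exists>B. seminorm_le s t h B f" if "smooth f" "h > 0" "gs_bounded s t (h / ?n) B f" for h B
    using gs_bounded_imp_seminorm_le[OF that(3,1)] that(2) s n by auto
  have 2: "\<exists>B. gs_bounded s t h B f" if "smooth f" "h > 0" "seminorm_le s t (h / ?K) B f" for h B
    using seminorm_le_imp_gs_bounded[OF that(3,1)] that(2) s t K by auto
  show ?thesis
  proof (cases b)
    case True
    have "\<exists>h>0. \<exists>B. seminorm_le s t h B f" if "smooth f" "h > 0" "gs_bounded s t h B f" for h B
      using gs_bounded_imp_seminorm_le[OF that(3,1,2)] s that(2) n
      by (intro exI[of _ "?n * h"] conjI exI[of _ B]) auto
    moreover have "\<exists>h>0. \<exists>B. gs_bounded s t h B f" if "smooth f" "h > 0" "seminorm_le s t h B f" for h B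
      using seminorm_le_imp_gs_bounded[OF that(3,1,2)] s t that(2) K
      by (intro exI[of _ "?K * h"] conjI exI[of _ B]) auto
    ultimately have "(\<exists>h>0. \<exists>B. gs_bounded s t h B f) \<longleftrightarrow> (\<exists>h>0. \<exists>B. seminorm_le s t h B f)" if "smooth f"
      using that by blast
    then show ?thesis using True by (auto simp: GS_test_def GS_S_def)
  next
    case False
    have "\<exists>B. seminorm_le s t h B f" if "smooth f" "\<forall>h>0. \<exists>B. gs_bounded s t h B f" "h > 0" for h
    proof -
      have "h / ?n > 0" using that(3) n by simp
      with that(2) obtain B where "gs_bounded s t (h / ?n) B f" by blast
      then show ?thesis by (rule 1[OF that(1,3)])
    qed
    moreover have "\<exists>B. gs_bounded s t h B f" if "smooth f" "\<forall>h>0. \<exists>B. seminorm_le s t h B f" "h > 0" for h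
    proof -
      have "h / ?K > 0" using that(3) K by simp
      with that(2) obtain B where "seminorm_le s t (h / ?K) B f" by blast
      then show ?thesis by (rule 2[OF that(1,3)])
    qed
    ultimately have "(\<forall>h>0. \<exists>B. gs_bounded s t h B f) \<longleftrightarrow> (\<forall>h>0. \<exists>B. seminorm_le s t h B f)" if "smooth f"
      using that by blast
    then show ?thesis using False by (auto simp: GS_test_def GS_Sigma_def)
  qed
qed

text \<open>A bound by \<open>seminorm_le\<close> at \<open>h\<close> is one by
  \<open>gs_bounded\<close> at a multiple of \<open>h\<close>, so continuity moves back by the same
  factor; both quantifiers over \<open>h\<close> allow the rescaling.\<close>

lemma GS_dual_cont:
  fixes u :: "(real^'n::finite \<Rightarrow> complex) \<Rightarrow> complex"
  assumes u: "GS_dual b s t u" and s: "0 < s" and t: "0 < t"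
  defines "cont \<equiv> \<lambda>h. \<exists>C\<ge>0. \<forall>f\<in>GS_test b s t. \<forall>B. seminorm_le s t h B f \<longrightarrow> norm (u f) \<le> C * B"
  shows "if b then \<forall>h>0. cont h else \<exists>h>0. cont h"
proof -
  let ?K = "gs_const TYPE('n) s t"
  have K: "?K > 0" using gs_const_ge_1[of s t, where 'n = 'n] s t by simp
  have *: "cont h" if "h > 0" "\<exists>C\<ge>0. \<forall>f\<in>GS_test b s t. \<forall>B. gs_bounded s t (?K * h) B f \<longrightarrow> norm (u f) \<le> C * B" for h
  proof -
    have "gs_bounded s t (?K * h) B f" if "f \<in> GS_test b s t" "seminorm_le s t h B f" for f :: "real^'n \<Rightarrow> complex" and B
      using seminorm_le_imp_gs_bounded[OF that(2)] that(1) \<open>h > 0\<close> s t by (simp add: GS_test_iff)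
    then show ?thesis using that(2) unfolding cont_def by blast
  qed
  show ?thesis
  proof (cases b)
    case True
    have "cont h" if "h > 0" for h
    proof (rule *[OF that])
      have "?K * h > 0" using K that by simp
      then show "\<exists>C\<ge>0. \<forall>f\<in>GS_test b s t. \<forall>B. gs_bounded s t (?K * h) B f \<longrightarrow> norm (u f) \<le> C * B"
        using u True unfolding GS_dual_def by auto
    qed
    then show ?thesis using True by simp
  next
    case False
    then obtain h where h: "h > 0" "\<exists>C\<ge>0. \<forall>f\<in>GS_test b s t. \<forall>B. gs_bounded s t h B f \<longrightarrow> norm (u f) \<le> C * B"
      using u unfolding GS_dual_def by auto
    then have "cont (h / ?K)" using K by (intro *) auto
    moreover have "h / ?K > 0" using h(1) K by simp
    ultimately show ?thesis using False by auto
  qed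
qed

section \<open>Fourier inversion on the torus\<close>

text \<open>The majorant \<open>M\<close> makes the finite partial sums converge uniformly in
  \<open>t\<close>, and integration against an integrable factor preserves this.\<close>

lemma integral_has_sum:
  fixes \<phi> S :: "'a::euclidean_space \<Rightarrow> complex" and a :: "'k \<Rightarrow> 'a \<Rightarrow> complex"
  assumes \<phi>: "integrable lborel \<phi>" and am: "\<And>k. k \<in> A \<Longrightarrow> a k \<in> borel_measurable borel"
    and M: "\<And>k t. k \<in> A \<Longrightarrow> norm (a k t) \<le> M k" "M summable_on A"
    and S: "\<And>t. ((\<lambda>k. a k t) has_sum S t) A" and Sm: "S \<in> borel_measurable borel"
  shows "((\<lambda>k. LINT t|lborel. \<phi> t * a k t) has_sum (LINT t|lborel. \<phi> t * S t)) A"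
proof -
  have Sb: "norm (S t) \<le> infsum M A" for t
    by (rule norm_infsum_le[OF S has_sum_infsum[OF M(2)] M(1)])
  have i1: "integrable lborel (\<lambda>t. \<phi> t * S t)"
    by (rule integrable_mult_bounded[OF \<phi> Sm Sb])
  have i2: "integrable lborel (\<lambda>t. \<phi> t * a k t)" if "k \<in> A" for k
    by (rule integrable_mult_bounded[OF \<phi> am[OF that] M(1)[OF that]])
  \<comment> \<open>Adding 1 keeps the divisor positive when \<phi> vanishes.\<close>
  define I where "I = (LINT t|lborel. norm (\<phi> t)) + 1"
  have I: "I > 0" unfolding I_def by (rule add_nonneg_pos) (auto intro: integral_nonneg_AE)
  have u: "uniform_limit UNIV (\<lambda>X t. \<Sum>k\<in>X. a k t) S (finite_subsets_at_top A)"
    by (rule Weierstrass_m_test_general') (use M S in auto)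
  show ?thesis
    unfolding has_sum_def tendsto_iff
  proof (intro allI impI)
    fix \<epsilon> :: real assume \<epsilon>: "\<epsilon> > 0"
    have "\<forall>\<^sub>F X in finite_subsets_at_top A. finite X \<and> X \<subseteq> A"
      by (rule eventually_finite_subsets_at_top_weakI) auto
    moreover have "\<forall>\<^sub>F X in finite_subsets_at_top A. \<forall>t\<in>UNIV. dist (\<Sum>k\<in>X. a k t) (S t) < \<epsilon> / I"
      by (rule uniform_limitD[OF u]) (use \<epsilon> I in simp)
    ultimately show "\<forall>\<^sub>F X in finite_subsets_at_top A. dist (\<Sum>k\<in>X. LINT t|lborel. \<phi> t * a k t) (LINT t|lborel. \<phi> t * S t) < \<epsilon>"
    proof eventually_elim
      case (elim X)
      have "(\<Sum>k\<in>X. LINT t|lborel. \<phi> t * a k t) - (LINT t|lborel. \<phi> t * S t) =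
          (LINT t|lborel. (\<Sum>k\<in>X. \<phi> t * a k t) - \<phi> t * S t)"
        using elim i1 i2 by (subst Bochner_Integration.integral_diff) (auto intro!: Bochner_Integration.integrable_sum simp: subset_iff)
      also have "norm \<dots> \<le> (LINT t|lborel. norm (\<phi> t) * (\<epsilon> / I))"
      proof (rule Bochner_Integration.integral_norm_bound_integral)
        show "integrable lborel (\<lambda>t. (\<Sum>k\<in>X. \<phi> t * a k t) - \<phi> t * S t)"
          using elim i1 i2 by (intro Bochner_Integration.integrable_diff Bochner_Integration.integrable_sum) auto
        show "integrable lborel (\<lambda>t. norm (\<phi> t) * (\<epsilon> / I))" using \<phi> by simp
        fix t
        have "norm ((\<Sum>k\<in>X. \<phi> t * a k t) - \<phi> t * S t) = norm (\<phi> t) * dist (\<Sum>k\<in>X. a k t) (S t)"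
          by (simp add: dist_norm norm_mult[symmetric] right_diff_distrib sum_distrib_left)
        also have "\<dots> \<le> norm (\<phi> t) * (\<epsilon> / I)"
          using elim by (intro mult_left_mono) (auto simp: less_imp_le)
        finally show "norm ((\<Sum>k\<in>X. \<phi> t * a k t) - \<phi> t * S t) \<le> norm (\<phi> t) * (\<epsilon> / I)" .
      qed
      also have "\<dots> = (I - 1) * (\<epsilon> / I)" by (simp only: I_def integral_mult_left_zero add_diff_cancel_right')
      also have "\<dots> < \<epsilon>" using \<epsilon> I by (simp add: field_simps)
      finally show ?case by (simp add: dist_norm)
    qed
  qed
qed

lemma exponential_series:
  fixes v :: "'k \<Rightarrow> 'a::euclidean_space"
  assumes c: "(\<lambda>k. norm (c k)) summable_on A"
  defines "S \<equiv> \<lambda>t. \<Sum>\<^sub>\<infinity>k\<in>A. c k * cis (t \<bullet> v k)"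
  shows "((\<lambda>k. c k * cis (t \<bullet> v k)) has_sum S t) A" and "continuous_on UNIV S"
proof -
  have s: "((\<lambda>k. c k * cis (t \<bullet> v k)) has_sum S t) A" for t
    unfolding S_def
    by (rule has_sum_infsum, rule abs_summable_summable) (use c in \<open>simp add: norm_mult\<close>)
  then show "((\<lambda>k. c k * cis (t \<bullet> v k)) has_sum S t) A" .
  have "uniform_limit UNIV (\<lambda>X t. \<Sum>k\<in>X. c k * cis (t \<bullet> v k)) S (finite_subsets_at_top A)"
    by (rule Weierstrass_m_test_general'[OF _ s c]) (simp add: norm_mult)
  then show "continuous_on UNIV S"
    by (rule uniform_limit_theorem[rotated]) (auto intro!: always_eventually continuous_intros)
qed

text \<open>Shifting by half a wavelength in a direction with \<open>k i \<noteq> 0\<close> changes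
  the sign of the character but not its integral over a period.\<close>

lemma cube_integral_cis:
  "cube_integral (\<lambda>t::real^'n::finite. cis (t \<bullet> ((2 * pi) *\<^sub>R zvec k))) = (if k = (\<lambda>_. 0) then 1 else 0)"
proof (cases "k = (\<lambda>_. 0)")
  case True
  then have "zvec k = (0 :: real^'n)" by (simp add: vec_eq_iff)
  then show ?thesis using True emeasure_ucube[of "0::real^'n"]
    by (simp add: cube_integral_def measure_def scaleR_conv_of_real)
next
  case False
  then obtain i where i: "k i \<noteq> 0" by auto
  define y :: "real^'n" where "y = (1 / (2 * of_int (k i))) *\<^sub>R axis i 1"
  let ?P = "\<lambda>t::real^'n. cis (t \<bullet> ((2 * pi) *\<^sub>R zvec k))"
  have "cis (y \<bullet> ((2 * pi) *\<^sub>R zvec k)) = -1"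
    using i by (simp add: y_def inner_axis' )
  then have "?P (t + y) = - ?P t" for t
    by (simp only: inner_add_left cis_mult[symmetric]) simp
  moreover have "(LINT t|lborel. indicator (ucube 0) t *\<^sub>R ?P (t + y)) = cube_integral ?P"
    by (rule cube_integral_shift[OF zperiodic_cis]) (intro continuous_intros)
  ultimately have "- cube_integral ?P = cube_integral ?P"
    by (simp add: cube_integral_def)
  then show ?thesis using False by simp
qed

text \<open>The sum of the series has the same coefficients as \<open>P\<close>, so the two agree by
  injectivity. Summability of the coefficients makes the sum continuous and termwise integration
  legitimate.\<close>

lemma torus_inversion:
  fixes P :: "real^'n::finite \<Rightarrow> complex"
  assumes per: "zperiodic P" and c: "continuous_on UNIV P"
    and p: "\<And>k. p k = cube_integral (\<lambda>t. P t * cis (- (t \<bullet> ((2 * pi) *\<^sub>R zvec k))))"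
    and sm: "(\<lambda>k. norm (p k)) summable_on UNIV"
  shows "((\<lambda>k. p k * cis (t \<bullet> ((2 * pi) *\<^sub>R zvec k))) has_sum P t) UNIV"
proof -
  define S where "S t = (\<Sum>\<^sub>\<infinity>k. p k * cis (t \<bullet> ((2 * pi) *\<^sub>R zvec k)))" for t :: "real^'n"
  have S: "((\<lambda>k. p k * cis (t \<bullet> ((2 * pi) *\<^sub>R zvec k))) has_sum S t) UNIV" for t
    unfolding S_def by (rule exponential_series(1)[OF sm])
  have Sc: "continuous_on UNIV S"
    unfolding S_def[abs_def] by (rule exponential_series(2)[OF sm])
  have Sp: "zperiodic S"
    unfolding zperiodic_def S_def zperiodicD[OF zperiodic_cis] by simp
  have [measurable]: "P \<in> borel_measurable borel" "S \<in> borel_measurable borel"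
    using c Sc by (auto intro: borel_measurable_continuous_onI)
  obtain BP BS where B: "\<And>t. norm (P t) \<le> BP" "\<And>t. norm (S t) \<le> BS"
    using zperiodic_bounded[OF per c] zperiodic_bounded[OF Sp Sc] by blast
  have "P t - S t = 0"
  proof (rule torus_fourier_injective[where P = "\<lambda>t. P t - S t"])
    show "zperiodic (\<lambda>t. P t - S t)" using per Sp by (simp add: zperiodic_def)
    show "continuous_on UNIV (\<lambda>t. P t - S t)" using c Sc by (intro continuous_intros)
    fix m :: "'n \<Rightarrow> int"
    let ?e = "\<lambda>k t. cis (t \<bullet> ((2 * pi) *\<^sub>R zvec k :: real^'n))"
    \<comment> \<open>Injectivity is phrased with positive and the coefficients with negative
      exponents, hence the reflected index.\<close>
    define n where "n = (\<lambda>i. - m i)"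
    have n: "- (t \<bullet> ((2 * pi) *\<^sub>R zvec n)) = t \<bullet> ((2 * pi) *\<^sub>R zvec m)" for t :: "real^'n"
      unfolding n_def zvec_minus[symmetric] by simp
    have em: "?e k \<in> borel_measurable borel" for k
      by (intro borel_measurable_continuous_onI continuous_intros)
    have Pem: "(\<lambda>t. P t * ?e m t) \<in> borel_measurable borel" "(\<lambda>t. S t * ?e m t) \<in> borel_measurable borel"
      by (intro borel_measurable_continuous_onI continuous_intros c Sc)+
    have iP: "integrable lborel (\<lambda>t. indicator (ucube 0) t *\<^sub>R (P t * ?e m t))"
      by (rule integrable_ucube[OF Pem(1), where B = BP]) (simp add: norm_mult B)
    have iS: "integrable lborel (\<lambda>t. indicator (ucube 0) t *\<^sub>R (S t * ?e m t))"
      by (rule integrable_ucube[OF Pem(2), where B = BS]) (simp add: norm_mult B)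
    have ie: "integrable lborel (\<lambda>t. indicator (ucube 0) t *\<^sub>R ?e m t)"
      by (rule integrable_ucube[OF em, where B = 1]) simp
    have pem: "(\<lambda>t. p k * ?e k t) \<in> borel_measurable borel" for k
      by (rule borel_measurable_times[OF borel_measurable_const em])
    have "((\<lambda>k. LINT t|lborel. (indicator (ucube 0) t *\<^sub>R ?e m t) * (p k * ?e k t)) has_sum
        (LINT t|lborel. (indicator (ucube 0) t *\<^sub>R ?e m t) * S t)) UNIV"
      by (rule integral_has_sum[OF ie pem _ sm S]) (simp_all add: norm_mult)
    moreover have "(LINT t|lborel. (indicator (ucube 0) t *\<^sub>R ?e m t) * (p k * ?e k t)) = (if k = n then p n else 0)" for k
    proof -
      have "?e m t * ?e k t = ?e (\<lambda>i. m i + k i) t" for t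
        unfolding zvec_add[symmetric] scaleR_add_right inner_add_right cis_mult[symmetric] by (rule refl)
      then have "(LINT t|lborel. (indicator (ucube 0) t *\<^sub>R ?e m t) * (p k * ?e k t)) =
          p k * cube_integral (?e (\<lambda>i. m i + k i))"
        unfolding cube_integral_def integral_mult_right_zero[symmetric]
        by (intro Bochner_Integration.integral_cong refl) (simp add: mult.left_commute)
      moreover have "(\<lambda>i. m i + k i) = (\<lambda>_. 0) \<longleftrightarrow> k = n"
        by (auto simp: fun_eq_iff n_def add_eq_0_iff)
      ultimately show ?thesis unfolding cube_integral_cis by simp
    qed
    ultimately have "((\<lambda>k. if k = n then p n else 0) has_sum
        (LINT t|lborel. (indicator (ucube 0) t *\<^sub>R ?e m t) * S t)) UNIV" by simp
    moreover have "((\<lambda>k. if k = n then p n else 0) has_sum p n) UNIV"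
      by (rule has_sum_finite_neutralI[of "{n}"]) auto
    ultimately have "(LINT t|lborel. (indicator (ucube 0) t *\<^sub>R ?e m t) * S t) = p n"
      by (rule has_sum_unique)
    then have 1: "(LINT t|lborel. indicator (ucube 0) t *\<^sub>R (S t * ?e m t)) = p n"
      by (simp add: mult.commute)
    have 2: "(LINT t|lborel. indicator (ucube 0) t *\<^sub>R (P t * ?e m t)) = p n"
      unfolding p cube_integral_def n ..
    have "cube_integral (\<lambda>t. (P t - S t) * ?e m t) = (LINT t|lborel. indicator (ucube 0) t *\<^sub>R (P t * ?e m t)
      - indicator (ucube 0) t *\<^sub>R (S t * ?e m t))"
      unfolding cube_integral_def by (simp add: left_diff_distrib scaleR_diff_right)
    also have "\<dots> = 0" using iP iS 1 2 by simp
    finally show "cube_integral (\<lambda>t. (P t - S t) * ?e m t) = 0" .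
  qed
  then show ?thesis using S[of t] by simp
qed

section \<open>The dual lattice\<close>

lemma summable_on_int_inverse_square: "(\<lambda>k::int. 1 / (1 + (real_of_int k)\<^sup>2)) summable_on UNIV"
proof -
  let ?f = "\<lambda>k::int. 1 / (1 + (real_of_int k)\<^sup>2)"
  have "summable (\<lambda>n. 1 / (1 + (real n)\<^sup>2))"
  proof (rule summable_comparison_test_ev)
    show "\<forall>\<^sub>F n in sequentially. norm (1 / (1 + (real n)\<^sup>2)) \<le> inverse (real n ^ 2)"
      using eventually_gt_at_top[of 0] by eventually_elim (simp add: inverse_eq_divide frac_le)
    show "summable (\<lambda>n. inverse (real n ^ 2))" by (rule inverse_power_summable) simp
  qed
  then have "(\<lambda>n. 1 / (1 + (real n)\<^sup>2)) summable_on UNIV"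
    by (rule summable_nonneg_imp_summable_on) simp
  then have "?f summable_on range int" "?f summable_on range (\<lambda>n. - int n)"
    by (subst summable_on_reindex; simp add: inj_on_def o_def)+
  then have "?f summable_on (range int \<union> range (\<lambda>n. - int n))" by (rule summable_on_union)
  moreover have "range int \<union> range (\<lambda>n. - int n) = UNIV"
  proof -
    have "k \<in> range int \<union> range (\<lambda>n. - int n)" for k by (cases k rule: int_cases2) auto
    then show ?thesis by blast
  qed
  ultimately show ?thesis by simp
qed

text \<open>Finitely many tuples lie in a finite box \<open>B^n\<close>, over which the sum of
  products factorizes into a product of sums.\<close>

lemma summable_on_prod_functions:
  fixes f :: "'a \<Rightarrow> real"
  assumes f: "f summable_on UNIV" and nn: "\<And>x. 0 \<le> f x"
  shows "(\<lambda>k::'n::finite \<Rightarrow> 'a. \<Prod>i\<in>UNIV. f (k i)) summable_on UNIV"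
proof (rule nonneg_bdd_above_summable_on)
  show "bdd_above (sum (\<lambda>k::'n \<Rightarrow> 'a. \<Prod>i\<in>UNIV. f (k i)) ` {F. F \<subseteq> UNIV \<and> finite F})"
  proof (rule bdd_aboveI2)
    fix F :: "('n \<Rightarrow> 'a) set" assume "F \<in> {F. F \<subseteq> UNIV \<and> finite F}"
    then have F: "finite F" by simp
    define B where "B = (\<Union>k\<in>F. range k)"
    have B: "finite B" using F by (auto simp: B_def)
    have "(\<Sum>k\<in>F. \<Prod>i\<in>UNIV. f (k i)) \<le> (\<Sum>k\<in>PiE (UNIV::'n set) (\<lambda>_. B). \<Prod>i\<in>UNIV. f (k i))"
    proof (rule sum_mono2)
      show "finite (PiE (UNIV::'n set) (\<lambda>_. B))" using B by (intro finite_PiE) auto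
      show "F \<subseteq> PiE (UNIV::'n set) (\<lambda>_. B)" by (auto simp: B_def PiE_UNIV_domain)
    qed (simp add: prod_nonneg nn)
    also have "\<dots> = (\<Prod>i\<in>(UNIV::'n set). \<Sum>b\<in>B. f b)"
      by (rule prod_sum_PiE[symmetric]) (use B in auto)
    also have "\<dots> \<le> (\<Prod>i\<in>(UNIV::'n set). infsum f UNIV)"
      by (intro prod_mono conjI sum_nonneg nn finite_sum_le_infsum f B) auto
    finally show "(\<Sum>k\<in>F. \<Prod>i\<in>UNIV. f (k i)) \<le> (\<Prod>i\<in>(UNIV::'n set). infsum f UNIV)" .
  qed
qed (simp add: prod_nonneg nn)

definition lmap :: "('n::finite \<Rightarrow> real^'n) \<Rightarrow> real^'n \<Rightarrow> real^'n" where
  "lmap e t = (\<Sum>k\<in>UNIV. (t $ k) *\<^sub>R e k)"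

text \<open>The adjoint of \<open>lmap e\<close>; it carries the dual lattice onto
  \<open>2 pi\<close> times the integer vectors.\<close>

definition pairing :: "('n::finite \<Rightarrow> real^'n) \<Rightarrow> real^'n \<Rightarrow> real^'n" where
  "pairing e \<alpha> = (\<chi> j. e j \<bullet> \<alpha>)"

text \<open>Indexes the dual lattice by integer vectors, so that its characters become, in lattice
  coordinates, those of the standard torus.\<close>

definition dual_vec :: "('n::finite \<Rightarrow> real^'n) \<Rightarrow> ('n \<Rightarrow> int) \<Rightarrow> real^'n" where
  "dual_vec e k = inv (pairing e) ((2 * pi) *\<^sub>R zvec k)"

lemma lmap_linear: "linear (lmap e)"
  unfolding lmap_def by (rule linearI) (simp_all add: scaleR_add_left sum.distrib scaleR_sum_right)

lemma lmap_add: "lmap e (s + t) = lmap e s + lmap e t"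
  by (rule linear_add[OF lmap_linear])

lemma lmap_continuous: "continuous_on S (lmap e)"
  by (rule linear_continuous_on) (simp add: lmap_linear linear_linear)

lemma lmap_zero [simp]: "lmap e 0 = 0"
  by (rule linear_0[OF lmap_linear])

lemma lattice_eq: "lattice e = range (\<lambda>k. lmap e (zvec k))"
  by (auto simp: lattice_def lmap_def)

lemma lmap_inner: "lmap e t \<bullet> \<alpha> = t \<bullet> pairing e \<alpha>"
  by (simp add: lmap_def pairing_def inner_vec_def[of t] inner_sum_left)

context
  fixes e :: "'n::finite \<Rightarrow> real^'n"
  assumes basis: "inj e" "independent (range e)"
begin

lemma span_basis: "span (range e) = UNIV"
proof -
  have "UNIV \<subseteq> span (range e)"
    by (rule card_ge_dim_independent) (use basis in \<open>auto simp: card_image\<close>)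
  then show ?thesis by auto
qed

lemma lmap_surj: "surj (lmap e)"
proof -
  have "x \<in> range (lmap e)" for x
  proof -
    have "x \<in> range (\<lambda>u. \<Sum>v\<in>range e. u v *\<^sub>R v)"
      using span_finite[of "range e"] span_basis by auto
    then obtain u where "x = (\<Sum>v\<in>range e. u v *\<^sub>R v)" by auto
    also have "\<dots> = (\<Sum>k\<in>UNIV. u (e k) *\<^sub>R e k)" using basis(1) by (simp add: sum.reindex)
    also have "\<dots> = lmap e (\<chi> k. u (e k))" by (simp add: lmap_def)
    finally show ?thesis by blast
  qed
  then show ?thesis by blast
qed

lemma pairing_bij: "bij (pairing e)"
proof -
  have l: "linear (pairing e)"
    by (rule linearI) (simp_all add: pairing_def vec_eq_iff inner_add_right)
  have "inj (pairing e)"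
  proof (rule linear_injective_0[OF l, THEN iffD2], intro allI impI)
    fix \<alpha> assume "pairing e \<alpha> = 0"
    then have "e j \<bullet> \<alpha> = 0" for j by (simp add: pairing_def vec_eq_iff)
    then have o: "orthogonal \<alpha> (e j)" for j by (simp add: orthogonal_def inner_commute)
    have "\<alpha> \<in> span (range e)" by (simp only: span_basis UNIV_I)
    then have "orthogonal \<alpha> \<alpha>"
    proof (rule orthogonal_to_span)
      fix y assume "y \<in> range e"
      then show "orthogonal \<alpha> y" using o by (elim rangeE) simp
    qed
    then show "\<alpha> = 0" by (simp add: orthogonal_def)
  qed
  moreover from this have "surj (pairing e)" by (rule linear_inj_imp_surj[OF l])
  ultimately show ?thesis by (simp only: bij_def)
qed

lemma pairing_dual_vec: "pairing e (dual_vec e k) = (2 * pi) *\<^sub>R zvec k"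
  unfolding dual_vec_def by (rule surj_f_inv_f[OF bij_is_surj[OF pairing_bij]])

lemma bij_betw_dual_vec: "bij_betw (dual_vec e) UNIV (dual_lattice e)"
proof (rule bij_betw_imageI)
  show "inj (dual_vec e)"
  proof (rule injI)
    fix k l assume "dual_vec e k = dual_vec e l"
    then have "(2 * pi) *\<^sub>R zvec k = ((2 * pi) *\<^sub>R zvec l :: real^'n)"
      unfolding pairing_dual_vec[symmetric] by (rule arg_cong)
    then have "zvec k = (zvec l :: real^'n)" by simp
    then show "k = l" by (auto simp: vec_eq_iff fun_eq_iff)
  qed
  show "range (dual_vec e) = dual_lattice e"
  proof (intro set_eqI iffI)
    fix \<alpha> assume "\<alpha> \<in> range (dual_vec e)"
    then obtain k where "\<alpha> = dual_vec e k" by auto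
    then have "e j \<bullet> \<alpha> = 2 * pi * of_int (k j)" for j
      using arg_cong[OF pairing_dual_vec[of k], of "\<lambda>v. v $ j"] by (simp add: pairing_def)
    then show "\<alpha> \<in> dual_lattice e" by (auto simp: dual_lattice_def)
  next
    fix \<alpha> assume "\<alpha> \<in> dual_lattice e"
    then have "\<forall>j. \<exists>k. e j \<bullet> \<alpha> = 2 * pi * of_int k" by (simp add: dual_lattice_def)
    then obtain k where "\<forall>j. e j \<bullet> \<alpha> = 2 * pi * of_int (k j)" by (rule choice[THEN exE])
    then have "pairing e \<alpha> = pairing e (dual_vec e k)" unfolding pairing_dual_vec by (simp add: pairing_def vec_eq_iff)
    then have "\<alpha> = dual_vec e k" by (rule injD[OF bij_is_inj[OF pairing_bij]])
    then show "\<alpha> \<in> range (dual_vec e)" by (simp only: rangeI)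
  qed
qed

lemma lmap_inner_dual_vec: "lmap e t \<bullet> dual_vec e k = t \<bullet> ((2 * pi) *\<^sub>R zvec k)"
  unfolding lmap_inner pairing_dual_vec ..

end

context
  fixes e :: "'n::finite \<Rightarrow> real^'n"
  assumes basis: "inj e" "independent (range e)"
begin

text \<open>The integer coordinates of a dual lattice point are bounded by a multiple of its norm.
  Hence, up to a constant, \<open>(1 + norm \<alpha>)^(2 n)\<close> dominates the product of the
  \<open>1 + k_j^2\<close>, whose reciprocals are summable; the exponent \<open>2 n\<close> is the
  price of this factorized comparison.\<close>

lemma dual_lattice_summable:
  "(\<lambda>\<alpha>. 1 / (1 + norm \<alpha>) ^ (2 * CARD('n))) summable_on dual_lattice e"
proof -
  define M where "M = 1 + (\<Sum>j\<in>UNIV. norm (e j))"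
  have M: "norm (e j) \<le> M" "1 \<le> M" for j
    unfolding M_def using member_le_sum[of j UNIV "\<lambda>j. norm (e j)"] by (auto intro: sum_nonneg)
  have "(\<lambda>k::'n \<Rightarrow> int. \<Prod>i\<in>UNIV. 1 / (1 + (real_of_int (k i))\<^sup>2)) summable_on UNIV"
    by (rule summable_on_prod_functions[OF summable_on_int_inverse_square]) simp
  then have "(\<lambda>k::'n \<Rightarrow> int. M ^ (2 * CARD('n)) * (\<Prod>i\<in>UNIV. 1 / (1 + (real_of_int (k i))\<^sup>2))) summable_on UNIV"
    by (rule summable_on_cmult_right)
  then have "(\<lambda>k. 1 / (1 + norm (dual_vec e k)) ^ (2 * CARD('n))) summable_on UNIV"
  proof (rule summable_on_comparison_test)
    fix k :: "'n \<Rightarrow> int"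
    let ?a = "norm (dual_vec e k)"
    have "1 + (real_of_int (k j))\<^sup>2 \<le> (M * (1 + ?a))\<^sup>2" for j
    proof -
      have "2 * pi * of_int (k j) = e j \<bullet> dual_vec e k"
        using arg_cong[OF pairing_dual_vec[OF basis, of k], of "\<lambda>v. v $ j"] by (simp add: pairing_def)
      moreover have "2 * pi * \<bar>of_int (k j)\<bar> = \<bar>2 * pi * of_int (k j)\<bar>" by (simp only: abs_mult) simp
      ultimately have "2 * pi * \<bar>of_int (k j)\<bar> = \<bar>e j \<bullet> dual_vec e k\<bar>" by (simp only:)
      also have "\<dots> \<le> norm (e j) * ?a" by (rule Cauchy_Schwarz_ineq2)
      also have "\<dots> \<le> M * ?a" using M by (intro mult_right_mono) auto
      finally have "2 * pi * \<bar>of_int (k j)\<bar> \<le> M * ?a" .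
      moreover have "1 * \<bar>of_int (k j)\<bar> \<le> 2 * pi * \<bar>real_of_int (k j)\<bar>"
        using pi_ge_two by (intro mult_right_mono) auto
      ultimately have k: "\<bar>of_int (k j)\<bar> \<le> M * ?a" by linarith
      have "1 + (real_of_int (k j))\<^sup>2 = 1 + \<bar>of_int (k j)\<bar>\<^sup>2" by simp
      also have "\<dots> \<le> M\<^sup>2 + (M * ?a)\<^sup>2"
        using k M(2) by (intro add_mono power_mono one_le_power) auto
      also have "\<dots> \<le> (M * (1 + ?a))\<^sup>2" using M(2) by (simp add: power2_eq_square algebra_simps)
      finally show ?thesis .
    qed
    then have "(\<Prod>j\<in>UNIV. 1 + (real_of_int (k j))\<^sup>2) \<le> (\<Prod>j\<in>(UNIV::'n set). (M * (1 + ?a))\<^sup>2)"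
      by (intro prod_mono) auto
    also have "\<dots> = M ^ (2 * CARD('n)) * (1 + ?a) ^ (2 * CARD('n))"
      by (simp add: power_mult_distrib power_mult)
    finally have le: "(\<Prod>j\<in>UNIV. 1 + (real_of_int (k j))\<^sup>2) \<le> M ^ (2 * CARD('n)) * (1 + ?a) ^ (2 * CARD('n))" .
    have pos: "0 < (\<Prod>j\<in>UNIV. 1 + (real_of_int (k j))\<^sup>2)" "0 < (1 + ?a) ^ (2 * CARD('n))"
      by (auto intro!: prod_pos zero_less_power add_pos_nonneg)
    have "1 / (1 + ?a) ^ (2 * CARD('n)) \<le> M ^ (2 * CARD('n)) * (1 / (\<Prod>j\<in>UNIV. 1 + (real_of_int (k j))\<^sup>2))"
      using le pos by (simp add: field_simps)
    then show "1 / (1 + ?a) ^ (2 * CARD('n)) \<le> M ^ (2 * CARD('n)) * (\<Prod>i\<in>UNIV. 1 / (1 + (real_of_int (k i))\<^sup>2))"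
      by (simp add: prod_dividef)
    show "0 \<le> 1 / (1 + ?a) ^ (2 * CARD('n))" by simp
  qed
  then show ?thesis by (subst (asm) summable_on_reindex_bij_betw[OF bij_betw_dual_vec[OF basis]])
qed

end

section \<open>Superpositions of translates of a test function\<close>

text \<open>Summing the seminorm bounds over all powers of \<open>|y|\<close> turns them into decay by the reciprocal
of this weight, uniformly in the derivatives.\<close>

definition weight :: "real \<Rightarrow> real \<Rightarrow> real" where
  "weight t r = (\<Sum>k. (1 / fact k powr t) * r ^ k)"

lemma weight_summable:
  assumes "0 < t"
  shows "summable (\<lambda>k. (1 / fact k powr t) * (r::real) ^ k)"
proof -
  have "filterlim (\<lambda>n. real (Suc n) powr t) at_top sequentially"
    using assms by real_asymp
  then have "eventually (\<lambda>n. 2 * \<bar>r\<bar> \<le> real (Suc n) powr t) sequentially"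
    by (simp add: filterlim_at_top)
  then obtain N where N: "\<And>n. n \<ge> N \<Longrightarrow> 2 * \<bar>r\<bar> \<le> real (Suc n) powr t"
    by (auto simp: eventually_at_top_linorder)
  show ?thesis
  proof (rule summable_ratio_test[where c = "1/2" and N = N])
    fix n assume "n \<ge> N"
    let ?d = "real (Suc n) powr t" and ?f = "fact n powr t :: real"
    have d: "?d > 0" "?f > 0" by simp_all
    have "\<bar>r\<bar> / ?d \<le> 1/2" using N[OF \<open>n \<ge> N\<close>] d by (simp add: field_simps)
    then have "(\<bar>r\<bar> / ?d) * (\<bar>r\<bar> ^ n / ?f) \<le> 1/2 * (\<bar>r\<bar> ^ n / ?f)"
      by (rule mult_right_mono) simp
    moreover have "fact (Suc n) powr t = ?d * ?f"
      by (simp only: fact_Suc of_nat_mult powr_mult)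
    ultimately show "norm ((1 / fact (Suc n) powr t) * r ^ Suc n) \<le> 1/2 * norm ((1 / fact n powr t) * r ^ n)"
      by (simp add: abs_mult power_abs mult_ac)
  qed simp
qed

lemma weight_term_le:
  assumes "0 < t" "0 \<le> r"
  shows "r ^ k \<le> fact k powr t * weight t r"
proof -
  have "(\<Sum>k\<in>{k}. (1 / fact k powr t) * r ^ k) \<le> weight t r"
    unfolding weight_def by (rule sum_le_suminf[OF weight_summable]) (use assms in auto)
  then show ?thesis by (simp add: field_simps)
qed

lemma weight_ge_1: "0 < t \<Longrightarrow> 0 \<le> r \<Longrightarrow> 1 \<le> weight t r"
  using weight_term_le[of t r 0] by simp

lemma weight_continuous: "0 < t \<Longrightarrow> continuous_on UNIV (weight t)"
  unfolding weight_def[abs_def] continuous_on_eq_continuous_at[OF open_UNIV]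
  by (intro ballI isCont_powser_converges_everywhere weight_summable)

lemma weight_measurable: "0 < t \<Longrightarrow> weight t \<in> borel_measurable borel"
  by (rule borel_measurable_continuous_onI[OF weight_continuous])

text \<open>Collects the losses in \<open>seminorm_weight_decay\<close>: \<open>2^m\<close> from
  \<open>(1 + r)^m \<le> 2^m (1 + r^m)\<close>, a further 2 from a geometric series, and one summand
  for each of the powers 0 and \<open>m\<close> of \<open>norm y\<close>.\<close>

definition decay_const :: "real \<Rightarrow> real \<Rightarrow> nat \<Rightarrow> real" where
  "decay_const t h m = 2 ^ (m + 1) * (1 + (2 powr t * h) ^ m * fact m powr t)"

lemma fact_add_powr_le:
  assumes "0 \<le> t"
  shows "fact (j + k) powr t \<le> (2 powr t) ^ (j + k) * fact j powr t * (fact k powr t :: real)"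
proof -
  have "fact (j + k) powr t \<le> (2 ^ (j + k) * fact j * fact k :: real) powr t"
    using assms by (intro powr_mono2 fact_add_le) auto
  also have "\<dots> = (2 ^ (j + k)) powr t * fact j powr t * (fact k powr t :: real)"
    by (simp only: powr_mult)
  also have "(2 ^ (j + k) :: real) powr t = (2 powr t) ^ (j + k)"
    by (rule power_powr_swap) simp
  finally show ?thesis .
qed

lemma one_plus_power_le:
  fixes r :: real
  assumes "0 \<le> r"
  shows "(1 + r) ^ m \<le> 2 ^ m * (1 + r ^ m)"
proof -
  have "(1 + r) ^ m \<le> (2 * max 1 r) ^ m" using assms by (intro power_mono) auto
  also have "\<dots> = 2 ^ m * (max 1 r) ^ m" by (rule power_mult_distrib)
  also have "(max 1 r) ^ m \<le> 1 + r ^ m" using assms by (simp add: max_def)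
  finally show ?thesis by simp
qed

text \<open>Each term of the weight is tested against the seminorm of order \<open>j + k\<close>.
  The factor \<open>fact k powr t\<close> cancels the coefficient of the weight, and
  \<open>h' \<ge> 2 * 2^t * h\<close> leaves \<open>(1/2)^k\<close>, a convergent series.\<close>

lemma seminorm_weight_decay:
  fixes f :: "real^'n::finite \<Rightarrow> complex"
  assumes f: "seminorm_le s t h B f" and h: "0 < h" and t: "0 < t" and h': "2 powr (t + 1) * h \<le> h'"
  shows "(1 + norm y) ^ m * weight t (norm y / h') * norm (dlist is f y)
    \<le> decay_const t h m * B * h ^ length is * fact (length is) powr s"
proof -
  let ?D = "norm (dlist is f y)" and ?A = "B * h ^ length is * fact (length is) powr s"
  have B: "0 \<le> B" by (rule seminorm_le_nonneg[OF f])
  then have A: "0 \<le> ?A" using h by simp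
  have h0: "0 < h'" using h h' by (smt (verit) mult_pos_pos powr_gt_zero)
  have step: "norm y ^ j * weight t (norm y / h') * ?D \<le> 2 * ?A * ((2 powr t * h) ^ j * fact j powr t)" for j
  proof -
    have tm: "(1 / fact k powr t) * (norm y / h') ^ k * (norm y ^ j * ?D) \<le>
        (?A * ((2 powr t * h) ^ j * fact j powr t)) * (1/2) ^ k" for k
    proof -
      have "norm y ^ k * (norm y ^ j * ?D) = norm y ^ (j + k) * ?D" by (simp add: power_add mult_ac)
      also have "\<dots> \<le> B * h ^ (length is + (j + k)) * fact (length is) powr s * fact (j + k) powr t"
        by (rule seminorm_leD[OF f])
      also have "\<dots> \<le> B * h ^ (length is + (j + k)) * fact (length is) powr s *
          ((2 powr t) ^ (j + k) * fact j powr t * fact k powr t)"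
        using fact_add_powr_le[of t j k] B h t by (intro mult_left_mono) auto
      also have "\<dots> = (?A * ((2 powr t * h) ^ j * fact j powr t)) * ((2 powr t * h) ^ k * fact k powr t)"
        by (simp add: power_add power_mult_distrib mult_ac)
      also have "\<dots> \<le> (?A * ((2 powr t * h) ^ j * fact j powr t)) * ((h' / 2) ^ k * fact k powr t)"
      proof -
        have "2 powr t * h \<le> h' / 2" using h' by (simp add: powr_add)
        then show ?thesis using A h by (intro mult_left_mono mult_right_mono power_mono) auto
      qed
      finally have *: "norm y ^ k * (norm y ^ j * ?D) \<le>
        (?A * ((2 powr t * h) ^ j * fact j powr t)) * ((h' / 2) ^ k * fact k powr t)" .
      have "(1 / fact k powr t) * (norm y / h') ^ k * (norm y ^ j * ?D) =
        (norm y ^ k * (norm y ^ j * ?D)) / (h' ^ k * fact k powr t)"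
        by (simp add: power_divide)
      also have "\<dots> \<le> ((?A * ((2 powr t * h) ^ j * fact j powr t)) * ((h' / 2) ^ k * fact k powr t)) / (h' ^ k * fact k powr t)"
        by (rule divide_right_mono[OF *]) (use h0 in simp)
      also have "\<dots> = (?A * ((2 powr t * h) ^ j * fact j powr t)) * (1/2) ^ k"
        using h0 by (simp add: power_divide)
      finally show ?thesis .
    qed
    have s1: "summable (\<lambda>k. (1 / fact k powr t) * (norm y / h') ^ k)" by (rule weight_summable[OF t])
    have "weight t (norm y / h') * (norm y ^ j * ?D) = (\<Sum>k. (1 / fact k powr t) * (norm y / h') ^ k * (norm y ^ j * ?D))"
      unfolding weight_def by (rule suminf_mult2[OF s1])
    also have "\<dots> \<le> (\<Sum>k. (?A * ((2 powr t * h) ^ j * fact j powr t)) * (1/2) ^ k)"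
      by (rule suminf_le[OF tm]) (rule summable_mult2[OF s1], intro summable_mult summable_geometric, simp)
    also have "\<dots> = (?A * ((2 powr t * h) ^ j * fact j powr t)) * 2"
      by (subst suminf_mult) (simp_all add: suminf_geometric summable_geometric)
    finally show ?thesis by (simp add: mult_ac)
  qed
  have w: "0 \<le> weight t (norm y / h')" using weight_ge_1[OF t, of "norm y / h'"] h0 by simp
  have "(1 + norm y) ^ m * weight t (norm y / h') * ?D \<le> (2 ^ m * (1 + norm y ^ m)) * weight t (norm y / h') * ?D"
    using w by (intro mult_right_mono one_plus_power_le) auto
  also have "\<dots> = 2 ^ m * (norm y ^ 0 * weight t (norm y / h') * ?D + norm y ^ m * weight t (norm y / h') * ?D)"
    by (simp add: algebra_simps)
  also have "\<dots> \<le> 2 ^ m * (2 * ?A * ((2 powr t * h) ^ 0 * fact 0 powr t) + 2 * ?A * ((2 powr t * h) ^ m * fact m powr t))"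
    by (intro mult_left_mono add_mono step) auto
  also have "\<dots> = decay_const t h m * ?A" by (simp add: decay_const_def algebra_simps)
  finally show ?thesis by (simp add: mult.assoc)
qed

lemma decay_const_nonneg: "0 \<le> h \<Longrightarrow> 0 \<le> decay_const t h m"
  unfolding decay_const_def by simp

lemma seminorm_decay:
  fixes f :: "real^'n::finite \<Rightarrow> complex"
  assumes f: "seminorm_le s t h B f" and h: "0 < h" and t: "0 < t"
  shows "norm (dlist is f y) \<le> decay_const t h m * B * h ^ length is * fact (length is) powr s / (1 + norm y) ^ m"
proof -
  define h' where "h' = 2 powr (t + 1) * h"
  have "0 < h'" using h by (simp add: h'_def)
  then have w: "1 \<le> weight t (norm y / h')" by (intro weight_ge_1 t) simp
  have "(1 + norm y) ^ m * 1 * norm (dlist is f y) \<le> (1 + norm y) ^ m * weight t (norm y / h') * norm (dlist is f y)"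
    using w by (intro mult_right_mono mult_left_mono) auto
  also have "\<dots> \<le> decay_const t h m * B * h ^ length is * fact (length is) powr s"
    by (rule seminorm_weight_decay[OF f h t]) (simp add: h'_def)
  finally have "(1 + norm y) ^ m * norm (dlist is f y) \<le> decay_const t h m * B * h ^ length is * fact (length is) powr s" by simp
  moreover have "0 < (1 + norm y) ^ m" by (intro zero_less_power add_pos_nonneg) auto
  ultimately show ?thesis by (simp add: pos_le_divide_eq mult.commute)
qed

lemma seminorm_weight_integrable:
  fixes f :: "real^'n::finite \<Rightarrow> complex"
  assumes f: "seminorm_le s t h B f" "smooth f" and h: "0 < h" and t: "0 < t" and h': "2 powr (t + 1) * h \<le> h'"
  shows "integrable lborel (\<lambda>y. (1 + norm y) * weight t (norm y / h') * norm (f y))"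
proof (rule Bochner_Integration.integrable_bound)
  let ?m = "CARD('n) + 1"
  \<comment> \<open>One power beyond \<open>?m\<close> pays for the factor
    \<open>1 + norm y\<close>.\<close>
  let ?C = "decay_const t h (Suc ?m) * B"
  show "integrable lborel (\<lambda>y::real^'n. ?C * (1 / (1 + norm y) ^ ?m))"
    using integrable_decay[where 'a = "real^'n"] by (intro integrable_mult_right) simp
  have [measurable]: "weight t \<in> borel_measurable borel" "f \<in> borel_measurable borel"
    using t f(2) by (auto intro: weight_measurable smooth_measurable)
  show "(\<lambda>y. (1 + norm y) * weight t (norm y / h') * norm (f y)) \<in> borel_measurable lborel" by measurable
  have h0: "0 < h'" using h h' by (smt (verit) mult_pos_pos powr_gt_zero)
  have "norm ((1 + norm y) * weight t (norm y / h') * norm (f y)) \<le> ?C * (1 / (1 + norm y) ^ ?m)" for y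
  proof -
    have p: "0 < (1 + norm y) ^ ?m" by (intro zero_less_power add_pos_nonneg) auto
    have w: "0 \<le> weight t (norm y / h')" using weight_ge_1[OF t, of "norm y / h'"] h0 by simp
    have "(1 + norm y) ^ Suc ?m * weight t (norm y / h') * norm (dlist [] f y) \<le> ?C * h ^ length ([]::'n list) * fact (length ([]::'n list)) powr s"
      by (rule seminorm_weight_decay[OF f(1) h t h'])
    then have "(1 + norm y) ^ ?m * ((1 + norm y) * weight t (norm y / h') * norm (f y)) \<le> ?C"
      by (simp add: mult_ac)
    then have "(1 + norm y) * weight t (norm y / h') * norm (f y) \<le> ?C / (1 + norm y) ^ ?m"
      using p by (simp add: pos_le_divide_eq mult.commute)
    then show ?thesis using w by (simp add: abs_mult)
  qed
  then show "AE y in lborel. norm ((1 + norm y) * weight t (norm y / h') * norm (f y)) \<le> norm (?C * (1 / (1 + norm y) ^ ?m))"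
    unfolding real_norm_def by (intro AE_I2) (rule order_trans[OF _ abs_ge_self])
qed

lemma seminorm_integrable:
  fixes f :: "real^'n::finite \<Rightarrow> complex"
  assumes f: "seminorm_le s t h B f" "smooth f" and h: "0 < h" and t: "0 < t"
  shows "integrable lborel (dlist is f)"
proof (rule Bochner_Integration.integrable_bound)
  let ?m = "CARD('n) + 1"
  let ?C = "decay_const t h ?m * B * h ^ length is * fact (length is) powr s"
  show "integrable lborel (\<lambda>y::real^'n. ?C * (1 / (1 + norm y) ^ ?m))"
    using integrable_decay[where 'a = "real^'n"] by (intro integrable_mult_right) simp
  show "dlist is f \<in> borel_measurable lborel" using smooth_measurable[OF smooth_dlist[OF f(2)]] by simp
  show "AE y in lborel. norm (dlist is f y) \<le> norm (?C * (1 / (1 + norm y) ^ ?m))"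
  proof (intro AE_I2)
    fix y
    have "norm (dlist is f y) \<le> ?C * (1 / (1 + norm y) ^ ?m)"
      using seminorm_decay[OF f(1) h t, of "is" y ?m] by (simp only: times_divide_eq_right mult_1_right)
    also have "\<dots> \<le> norm (?C * (1 / (1 + norm y) ^ ?m))" unfolding real_norm_def by (rule abs_ge_self)
    finally show "norm (dlist is f y) \<le> norm (?C * (1 / (1 + norm y) ^ ?m))" .
  qed
qed

section \<open>Translation of test functions: cost and continuity\<close>

lemma dlist_translate: "dlist is (\<lambda>y. f (y - z)) = (\<lambda>y. dlist is f (y - z))"
proof (induction "is")
  case (Cons i "is")
  show ?case unfolding dlist_Cons Cons.IH by (simp add: dpart_def algebra_simps)
qed simp

lemma smooth_translate:
  assumes "smooth f"
  shows "smooth (\<lambda>y. f (y - z))"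
  unfolding smooth_def dlist_translate
proof (intro allI conjI)
  fix "is" i x
  show "continuous_on UNIV (\<lambda>y. dlist is f (y - z))"
    using smooth_continuous[OF smooth_dlist[OF assms]]
    by (rule continuous_on_compose2) (auto intro!: continuous_intros)
  have "(\<lambda>t. dlist is f ((x - z) + t *\<^sub>R axis i 1)) differentiable (at 0)"
    using assms unfolding smooth_def by blast
  then show "(\<lambda>t. dlist is f (x + t *\<^sub>R axis i 1 - z)) differentiable (at 0)"
    by (simp add: algebra_simps)
qed

lemma power_norm_add_le:
  "norm (y::'a::real_normed_vector) ^ k \<le> 2 ^ k * (norm (y - z) ^ k + norm z ^ k)"
proof -
  have "norm y \<le> norm (y - z) + norm z" using norm_triangle_ineq[of "y - z" z] by simp
  also have "\<dots> \<le> 2 * max (norm (y - z)) (norm z)" by simp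
  finally have "norm y ^ k \<le> (2 * max (norm (y - z)) (norm z)) ^ k" by (rule power_mono) simp
  also have "\<dots> = 2 ^ k * max (norm (y - z)) (norm z) ^ k" by (rule power_mult_distrib)
  also have "max (norm (y - z)) (norm z) ^ k \<le> norm (y - z) ^ k + norm z ^ k" by (simp add: max_def)
  finally show ?thesis by simp
qed

text \<open>A shift by \<open>z\<close> costs only a value of the weight, because
  \<open>norm z ^ k\<close> is at most \<open>h^k * fact k powr t\<close> times it and so has the
  shape of a seminorm bound. At a suitable scale, test functions decay faster than this cost grows;
  superpositions rely on that.\<close>

lemma translate_bound:
  fixes f :: "real^'n::finite \<Rightarrow> complex"
  assumes f: "seminorm_le s t h B f" and h: "0 < h" and t: "0 < t" and z: "norm z \<le> R"
  shows "norm y ^ k * norm (dlist is f (y - z)) \<le>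
    (2 * B * weight t (R / h)) * (2 * h) ^ (length is + k) * fact (length is) powr s * fact k powr t"
proof -
  let ?D = "norm (dlist is f (y - z))" and ?W = "weight t (R / h)"
  have B: "0 \<le> B" by (rule seminorm_le_nonneg[OF f])
  have R: "0 \<le> R" using z norm_ge_zero order_trans by blast
  have w1: "1 \<le> ?W" using R h by (intro weight_ge_1[OF t]) simp
  let ?Q = "B * h ^ (length is + k) * fact (length is) powr s * fact k powr t"
  have Q: "0 \<le> ?Q" using B h by simp
  have 1: "norm (y - z) ^ k * ?D \<le> ?Q * ?W"
  proof -
    have "norm (y - z) ^ k * ?D \<le> ?Q * 1" using seminorm_leD[OF f, of "y - z" k "is"] by simp
    also have "\<dots> \<le> ?Q * ?W" by (rule mult_left_mono[OF w1 Q])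
    finally show ?thesis .
  qed
  have 2: "norm z ^ k * ?D \<le> ?Q * ?W"
  proof -
    have "norm z ^ k \<le> R ^ k" using z by (intro power_mono) auto
    also have "\<dots> = h ^ k * (R / h) ^ k" using h by (simp add: power_divide)
    also have "\<dots> \<le> h ^ k * (fact k powr t * ?W)"
      using R h by (intro mult_left_mono weight_term_le[OF t]) auto
    finally have a: "norm z ^ k \<le> h ^ k * (fact k powr t * ?W)" .
    have b: "?D \<le> B * h ^ length is * fact (length is) powr s"
      using seminorm_leD[OF f, of "y - z" 0 "is"] by simp
    have "norm z ^ k * ?D \<le> (h ^ k * (fact k powr t * ?W)) * (B * h ^ length is * fact (length is) powr s)"
      using a b w1 h by (intro mult_mono) auto
    then show ?thesis by (simp add: power_add mult_ac)
  qed
  have "norm y ^ k * ?D \<le> (2 ^ k * (norm (y - z) ^ k + norm z ^ k)) * ?D"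
    by (rule mult_right_mono[OF power_norm_add_le]) simp
  also have "\<dots> = 2 ^ k * (norm (y - z) ^ k * ?D + norm z ^ k * ?D)" by (simp add: algebra_simps)
  also have "\<dots> \<le> 2 ^ k * (?Q * ?W + ?Q * ?W)" by (intro mult_left_mono add_mono 1 2) simp
  also have "\<dots> \<le> 2 ^ (length is + k) * (?Q * ?W + ?Q * ?W)"
    using Q w1 B h by (intro mult_right_mono power_increasing add_nonneg_nonneg mult_nonneg_nonneg) auto
  also have "\<dots> = (2 * B * ?W) * (2 * h) ^ (length is + k) * fact (length is) powr s * fact k powr t"
    by (simp add: power_mult_distrib mult_ac)
  finally show ?thesis .
qed

lemma seminorm_translate:
  fixes f :: "real^'n::finite \<Rightarrow> complex"
  assumes "seminorm_le s t h B f" "0 < h" "0 < t" "norm z \<le> R"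
  shows "seminorm_le s t (2 * h) (2 * B * weight t (R / h)) (\<lambda>y. f (y - z))"
  unfolding seminorm_le_def dlist_translate using translate_bound[OF assms] by blast

lemma smooth_line_derivative:
  fixes f :: "real^'n::finite \<Rightarrow> complex"
  assumes "smooth f"
  shows "((\<lambda>r. f (p + r *\<^sub>R v)) has_vector_derivative (\<Sum>i\<in>UNIV. (v $ i) *\<^sub>R dpart i f (p + r *\<^sub>R v))) (at r)"
proof -
  have "((\<lambda>r. p + r *\<^sub>R v) has_derivative (\<lambda>x. x *\<^sub>R v)) (at r)"
    by (auto intro!: derivative_eq_intros)
  from has_derivative_compose[OF this smooth_has_derivative[OF assms]]
  show ?thesis unfolding has_vector_derivative_def by (simp add: scaleR_sum_right)
qed

text \<open>Mean value estimate along the segment from \<open>w\<close> to \<open>z\<close>, which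
  stays in the ball of radius \<open>R\<close>. The additional derivative raises the factorial to
  \<open>fact (l + 1) powr s\<close>, and \<open>l + 1 \<le> 2^l\<close> turns this into the factor
  \<open>2 powr s\<close> of the scale.\<close>

lemma translate_diff_bound:
  fixes f :: "real^'n::finite \<Rightarrow> complex"
  assumes f: "seminorm_le s t h B f" "smooth f" and h: "0 < h" and t: "0 < t" and s: "0 \<le> s"
    and z: "norm z \<le> R" "norm w \<le> R"
  shows "norm y ^ k * norm (dlist is f (y - z) - dlist is f (y - w)) \<le>
    (4 * real CARD('n) * h * B * weight t (R / h) * norm (z - w)) * (2 powr (1 + s) * h) ^ (length is + k)
      * fact (length is) powr s * fact k powr t"
proof -
  let ?l = "length is" and ?W = "weight t (R / h)"
  have B: "0 \<le> B" by (rule seminorm_le_nonneg[OF f(1)])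
  have R: "0 \<le> R" using z(1) norm_ge_zero order_trans by blast
  have w1: "1 \<le> ?W" using R h by (intro weight_ge_1[OF t]) simp
  define M where "M = (4 * h * B * ?W) * (2 powr (1 + s) * h) ^ (?l + k) * fact ?l powr s * fact k powr t"
  define g where "g r = (norm y ^ k) *\<^sub>R dlist is f ((y - w) + r *\<^sub>R (w - z))" for r
  define g' where "g' r = (norm y ^ k) *\<^sub>R (\<Sum>i\<in>UNIV. ((w - z) $ i) *\<^sub>R dpart i (dlist is f) ((y - w) + r *\<^sub>R (w - z)))" for r
  have "norm (g 1 - g 0) \<le> (real CARD('n) * norm (z - w) * M) * \<bar>1 - 0\<bar>"
  proof (rule vector_mvt_bound)
    fix r :: real assume "r \<in> closed_segment 0 1"
    then have r: "0 \<le> r" "r \<le> 1" by (auto simp: closed_segment_eq_real_ivl)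
    show "(g has_vector_derivative g' r) (at r)"
      unfolding g_def g'_def
      by (rule bounded_linear.has_vector_derivative[OF bounded_linear_scaleR_right smooth_line_derivative[OF smooth_dlist[OF f(2)]]])
    define \<zeta> where "\<zeta> = (1 - r) *\<^sub>R w + r *\<^sub>R z"
    have eq: "(y - w) + r *\<^sub>R (w - z) = y - \<zeta>" by (simp add: \<zeta>_def algebra_simps)
    have "norm \<zeta> \<le> (1 - r) * norm w + r * norm z"
      unfolding \<zeta>_def using r norm_triangle_ineq[of "(1 - r) *\<^sub>R w" "r *\<^sub>R z"] by simp
    also have "\<dots> \<le> (1 - r) * R + r * R" using r z by (intro add_mono mult_left_mono) auto
    finally have \<zeta>: "norm \<zeta> \<le> R" by (simp add: algebra_simps)
    have bd: "norm y ^ k * norm (dlist (i # is) f (y - \<zeta>)) \<le> M" for i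
    proof -
      have "(fact (Suc ?l) :: real) \<le> 2 ^ ?l * fact ?l"
      proof -
        have "Suc ?l \<le> 2 ^ ?l" by (simp add: Suc_leI)
        then have "real (Suc ?l) \<le> real (2 ^ ?l)" by (rule of_nat_mono)
        then show ?thesis unfolding fact_Suc by (intro mult_right_mono) auto
      qed
      then have "(fact (Suc ?l) :: real) powr s \<le> (2 ^ ?l * fact ?l) powr s" using s by (intro powr_mono2) auto
      also have "\<dots> = (2 powr s) ^ ?l * fact ?l powr s"
        by (simp only: powr_mult power_powr_swap[of 2 ?l s])
      also have "\<dots> \<le> (2 powr s) ^ (?l + k) * fact ?l powr s"
        using s by (intro mult_right_mono power_increasing ge_one_powr_ge_zero) auto
      finally have F: "(fact (Suc ?l) :: real) powr s \<le> (2 powr s) ^ (?l + k) * fact ?l powr s" .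
      have "norm y ^ k * norm (dlist (i # is) f (y - \<zeta>)) \<le>
        (2 * B * ?W) * (2 * h) ^ (Suc ?l + k) * fact (Suc ?l) powr s * fact k powr t"
        using translate_bound[OF f(1) h t \<zeta>, of y k "i # is"] by simp
      also have "\<dots> \<le> (2 * B * ?W) * (2 * h) ^ (Suc ?l + k) * ((2 powr s) ^ (?l + k) * fact ?l powr s) * fact k powr t"
        using F B w1 h by (intro mult_right_mono mult_left_mono) auto
      also have "\<dots> = M" unfolding M_def by (simp add: powr_add power_mult_distrib mult_ac)
      finally show ?thesis .
    qed
    have "norm (g' r) \<le> norm y ^ k * (\<Sum>i\<in>UNIV. norm (((w - z) $ i) *\<^sub>R dlist (i # is) f (y - \<zeta>)))"
      unfolding g'_def eq using norm_sum[of "\<lambda>i. ((w - z) $ i) *\<^sub>R dlist (i # is) f (y - \<zeta>)" UNIV]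
      by (simp add: mult_left_mono)
    also have "\<dots> = (\<Sum>i\<in>UNIV. \<bar>(w - z) $ i\<bar> * (norm y ^ k * norm (dlist (i # is) f (y - \<zeta>))))"
      by (simp add: sum_distrib_left mult_ac)
    also have "\<dots> \<le> (\<Sum>i\<in>(UNIV::'n set). norm (w - z) * M)"
    proof (rule sum_mono)
      fix i
      show "\<bar>(w - z) $ i\<bar> * (norm y ^ k * norm (dlist (i # is) f (y - \<zeta>))) \<le> norm (w - z) * M"
        by (rule mult_mono[OF component_le_norm_cart bd]) simp_all
    qed
    finally show "norm (g' r) \<le> real CARD('n) * norm (z - w) * M" by (simp add: norm_minus_commute)
  qed
  moreover have "g 1 - g 0 = (norm y ^ k) *\<^sub>R (dlist is f (y - z) - dlist is f (y - w))"
    by (simp add: g_def scaleR_diff_right)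
  ultimately show ?thesis by (simp add: M_def mult_ac)
qed

lemma dlist_linear:
  fixes f g :: "real^'n::finite \<Rightarrow> complex"
  assumes f: "smooth f" and g: "smooth g"
  shows "dlist is (\<lambda>x. a * f x + c * g x) = (\<lambda>x. a * dlist is f x + c * dlist is g x)"
proof (induction "is")
  case (Cons i "is")
  have "((\<lambda>t. a * dlist is f (x + t *\<^sub>R axis i 1) + c * dlist is g (x + t *\<^sub>R axis i 1)) has_vector_derivative
      a * dpart i (dlist is f) x + c * dpart i (dlist is g) x) (at 0)" for x
    using smooth_has_vector_derivative[OF smooth_dlist[OF f, of "is"], of x i 0]
      smooth_has_vector_derivative[OF smooth_dlist[OF g, of "is"], of x i 0]
    by (intro has_vector_derivative_add has_vector_derivative_mult_right) simp_all
  then show ?case unfolding dlist_Cons Cons.IH by (intro ext dpart_eqI)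
qed simp

lemma smooth_linear:
  fixes f g :: "real^'n::finite \<Rightarrow> complex"
  assumes f: "smooth f" and g: "smooth g"
  shows "smooth (\<lambda>x. a * f x + c * g x)"
  unfolding smooth_def dlist_linear[OF assms]
proof (intro allI conjI)
  fix "is" i x
  show "continuous_on UNIV (\<lambda>x. a * dlist is f x + c * dlist is g x)"
    using smooth_continuous[OF smooth_dlist[OF f]] smooth_continuous[OF smooth_dlist[OF g]]
    by (intro continuous_intros)
  have "((\<lambda>t. a * dlist is f (x + t *\<^sub>R axis i 1) + c * dlist is g (x + t *\<^sub>R axis i 1)) has_vector_derivative
      a * dpart i (dlist is f) x + c * dpart i (dlist is g) x) (at 0)"
    using smooth_has_vector_derivative[OF smooth_dlist[OF f, of "is"], of x i 0]
      smooth_has_vector_derivative[OF smooth_dlist[OF g, of "is"], of x i 0]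
    by (intro has_vector_derivative_add has_vector_derivative_mult_right) simp_all
  then show "(\<lambda>t. a * dlist is f (x + t *\<^sub>R axis i 1) + c * dlist is g (x + t *\<^sub>R axis i 1)) differentiable at 0"
    by (rule differentiableI_vector)
qed

lemma seminorm_linear:
  fixes f g :: "real^'n::finite \<Rightarrow> complex"
  assumes f: "smooth f" "seminorm_le s t h B f" and g: "smooth g" "seminorm_le s t h B' g"
  shows "seminorm_le s t h (norm a * B + norm c * B') (\<lambda>x. a * f x + c * g x)"
  unfolding seminorm_le_def dlist_linear[OF f(1) g(1)]
proof (intro allI)
  fix "is" :: "'n list" and k and y :: "real^'n"
  let ?Q = "h ^ (length is + k) * fact (length is) powr s * fact k powr t"
  have "norm y ^ k * norm (a * dlist is f y + c * dlist is g y) \<le>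
      norm y ^ k * (norm a * norm (dlist is f y) + norm c * norm (dlist is g y))"
    by (rule mult_left_mono) (simp_all add: norm_triangle_le norm_mult)
  also have "\<dots> = norm a * (norm y ^ k * norm (dlist is f y)) + norm c * (norm y ^ k * norm (dlist is g y))"
    by (simp add: algebra_simps)
  also have "\<dots> \<le> norm a * (B * ?Q) + norm c * (B' * ?Q)"
    using seminorm_leD[OF f(2), of y k "is"] seminorm_leD[OF g(2), of y k "is"]
    by (intro add_mono mult_left_mono) (simp_all add: mult_ac)
  finally show "norm y ^ k * norm (a * dlist is f y + c * dlist is g y) \<le>
    (norm a * B + norm c * B') * h ^ (length is + k) * fact (length is) powr s * fact k powr t"
    by (simp add: algebra_simps)
qed

lemma dlist_bounded_of_seminorm:
  "seminorm_le s t h B f \<Longrightarrow> \<exists>M. \<forall>y. norm (dlist is f y) \<le> M"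
  using seminorm_leD[of s t h B f _ 0 "is"] by auto

section \<open>Integrals of translates: smoothness and seminorms\<close>

text \<open>The measurable shift \<open>q\<close> covers both the convolution
  (\<open>q z = z\<close>) and its approximations by finite sums (\<open>q\<close> simple).\<close>

lemma superposition_dlist:
  fixes \<kappa> \<psi> :: "real^'n::finite \<Rightarrow> complex" and q :: "real^'n \<Rightarrow> real^'n"
  assumes \<psi>: "integrable lborel \<psi>" and \<kappa>: "smooth \<kappa>" and q: "q \<in> borel_measurable borel"
    and bd: "\<And>is. \<exists>M. \<forall>y. norm (dlist is \<kappa> y) \<le> M"
  shows "dlist is (\<lambda>y. LINT z|lborel. \<psi> z * \<kappa> (y - q z)) = (\<lambda>y. LINT z|lborel. \<psi> z * dlist is \<kappa> (y - q z))"
    and "smooth (\<lambda>y. LINT z|lborel. \<psi> z * \<kappa> (y - q z))"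
proof -
  define F where "F is y = (LINT z|lborel. \<psi> z * dlist is \<kappa> (y - q z))" for "is" y
  have int: "integrable lborel (\<lambda>z. \<psi> z * dlist is \<kappa> (y - q z))" for "is" y
  proof -
    obtain M where M: "\<And>y. norm (dlist is \<kappa> y) \<le> M" using bd[of "is"] by blast
    have [measurable]: "dlist is \<kappa> \<in> borel_measurable borel" by (rule smooth_measurable[OF smooth_dlist[OF \<kappa>]])
    have "(\<lambda>z. dlist is \<kappa> (y - q z)) \<in> borel_measurable borel" using q by measurable
    then show ?thesis by (rule integrable_mult_bounded[OF \<psi> _ M])
  qed
  have der: "((\<lambda>r. F is (y + r *\<^sub>R axis i 1)) has_vector_derivative F (i # is) y) (at 0)" for "is" i y
  proof -
    obtain M where M: "\<And>y. norm (dlist (i # is) \<kappa> y) \<le> M" using bd[of "i # is"] by blast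
    have "((\<lambda>r. LINT z|lborel. \<psi> z * dlist is \<kappa> (y + r *\<^sub>R axis i 1 - q z)) has_vector_derivative
        (LINT z|lborel. \<psi> z * dlist (i # is) \<kappa> (y + 0 *\<^sub>R axis i 1 - q z))) (at 0)"
    proof (rule has_vector_derivative_integral(1)[where G = "\<lambda>z. norm (\<psi> z) * M"])
      fix r :: real and z
      show "integrable lborel (\<lambda>z. \<psi> z * dlist is \<kappa> (y + r *\<^sub>R axis i 1 - q z))" by (rule int)
      have "((\<lambda>r. dlist is \<kappa> ((y - q z) + r *\<^sub>R axis i 1)) has_vector_derivative dlist (i # is) \<kappa> ((y - q z) + r *\<^sub>R axis i 1)) (at r)"
        using smooth_has_vector_derivative[OF smooth_dlist[OF \<kappa>]] by simp
      then have "((\<lambda>r. \<psi> z * dlist is \<kappa> ((y - q z) + r *\<^sub>R axis i 1)) has_vector_derivative \<psi> z * dlist (i # is) \<kappa> ((y - q z) + r *\<^sub>R axis i 1)) (at r)"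
        by (rule has_vector_derivative_mult_right)
      moreover have "y - q z + r' *\<^sub>R axis i 1 = y + r' *\<^sub>R axis i 1 - q z" for r' :: real by simp
      ultimately show "((\<lambda>r. \<psi> z * dlist is \<kappa> (y + r *\<^sub>R axis i 1 - q z)) has_vector_derivative \<psi> z * dlist (i # is) \<kappa> (y + r *\<^sub>R axis i 1 - q z)) (at r)"
        by (simp only:)
      show "norm (\<psi> z * dlist (i # is) \<kappa> (y + r *\<^sub>R axis i 1 - q z)) \<le> norm (\<psi> z) * M"
        unfolding norm_mult by (rule mult_left_mono[OF M]) simp
    next
      show "integrable lborel (\<lambda>z. norm (\<psi> z) * M)" using \<psi> by simp
    qed
    then show ?thesis by (simp only: F_def scaleR_zero_left add_0_right)
  qed
  have eq: "dlist is (F []) = F is" for "is"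
  proof (induction "is")
    case (Cons i "is")
    show ?case unfolding dlist_Cons Cons.IH by (intro ext dpart_eqI der)
  qed simp
  have F0: "(\<lambda>y. LINT z|lborel. \<psi> z * \<kappa> (y - q z)) = F []" by (rule ext) (simp add: F_def)
  show "dlist is (\<lambda>y. LINT z|lborel. \<psi> z * \<kappa> (y - q z)) = (\<lambda>y. LINT z|lborel. \<psi> z * dlist is \<kappa> (y - q z))"
    unfolding F0 eq F_def ..
  have "continuous_on UNIV (F is)" for "is"
    unfolding continuous_on_eq_continuous_at[OF open_UNIV]
  proof (intro ballI)
    fix y :: "real^'n"
    obtain M where M: "\<And>y. norm (dlist is \<kappa> y) \<le> M" using bd[of "is"] by blast
    show "isCont (F is) y"
      unfolding continuous_at_sequentially
    proof (intro allI impI)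
      fix X assume X: "X \<longlonglongrightarrow> y"
      have "(\<lambda>n. LINT z|lborel. \<psi> z * dlist is \<kappa> (X n - q z)) \<longlonglongrightarrow> (LINT z|lborel. \<psi> z * dlist is \<kappa> (y - q z))"
      proof (rule integral_dominated_convergence[where w = "\<lambda>z. norm (\<psi> z) * M"])
        show "(\<lambda>z. \<psi> z * dlist is \<kappa> (y - q z)) \<in> borel_measurable lborel" using int by (rule borel_measurable_integrable)
        show "(\<lambda>z. \<psi> z * dlist is \<kappa> (X n - q z)) \<in> borel_measurable lborel" for n using int by (rule borel_measurable_integrable)
        show "integrable lborel (\<lambda>z. norm (\<psi> z) * M)" using \<psi> by simp
        have "(\<lambda>n. dlist is \<kappa> (X n - q z)) \<longlonglongrightarrow> dlist is \<kappa> (y - q z)" for z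
          by (rule continuous_on_tendsto_compose[OF smooth_continuous[OF smooth_dlist[OF \<kappa>]]])
            (auto intro: tendsto_diff X)
        then show "AE z in lborel. (\<lambda>n. \<psi> z * dlist is \<kappa> (X n - q z)) \<longlonglongrightarrow> \<psi> z * dlist is \<kappa> (y - q z)"
          by (intro AE_I2 tendsto_mult_left)
        show "AE z in lborel. norm (\<psi> z * dlist is \<kappa> (X n - q z)) \<le> norm (\<psi> z) * M" for n
          unfolding norm_mult by (intro AE_I2 mult_left_mono M) simp
      qed
      then show "(F is \<circ> X) \<longlonglongrightarrow> F is y" by (simp add: F_def o_def)
    qed
  qed
  moreover have "(\<lambda>r. F is (y + r *\<^sub>R axis i 1)) differentiable at 0" for "is" i y
    using der by (rule differentiableI_vector)
  ultimately show "smooth (\<lambda>y. LINT z|lborel. \<psi> z * \<kappa> (y - q z))"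
    unfolding F0 smooth_def eq by blast
qed

lemma superposition_seminorm:
  fixes \<kappa> \<psi> :: "real^'n::finite \<Rightarrow> complex" and q :: "real^'n \<Rightarrow> real^'n"
  assumes \<psi>: "integrable lborel \<psi>" and \<kappa>: "smooth \<kappa>" "seminorm_le s t h B \<kappa>" and q: "q \<in> borel_measurable borel"
    and h: "0 < h" and t: "0 < t" and q2: "\<And>z. norm (q z) \<le> 2 * norm z"
    and w: "integrable lborel (\<lambda>z. weight t (2 * norm z / h) * norm (\<psi> z))"
  shows "seminorm_le s t (2 * h) (2 * B * (LINT z|lborel. weight t (2 * norm z / h) * norm (\<psi> z)))
    (\<lambda>y. LINT z|lborel. \<psi> z * \<kappa> (y - q z))"
  unfolding seminorm_le_def superposition_dlist(1)[OF \<psi> \<kappa>(1) q dlist_bounded_of_seminorm[OF \<kappa>(2)]]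
proof (intro allI)
  fix "is" :: "'n list" and k and y :: "real^'n"
  let ?Q = "(2 * h) ^ (length is + k) * fact (length is) powr s * fact k powr t"
  have "norm y ^ k * norm (LINT z|lborel. \<psi> z * dlist is \<kappa> (y - q z)) =
    norm (LINT z|lborel. of_real (norm y ^ k) * (\<psi> z * dlist is \<kappa> (y - q z)))"
    by (simp add: norm_mult norm_power)
  also have "\<dots> \<le> (LINT z|lborel. (2 * B * ?Q) * (weight t (2 * norm z / h) * norm (\<psi> z)))"
  proof (rule Bochner_Integration.integral_norm_bound_integral)
    obtain M where M: "\<And>y. norm (dlist is \<kappa> y) \<le> M" using dlist_bounded_of_seminorm[OF \<kappa>(2)] by blast
    have [measurable]: "dlist is \<kappa> \<in> borel_measurable borel" by (rule smooth_measurable[OF smooth_dlist[OF \<kappa>(1)]])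
    have "(\<lambda>z. dlist is \<kappa> (y - q z)) \<in> borel_measurable borel" using q by measurable
    then show "integrable lborel (\<lambda>z. of_real (norm y ^ k) * (\<psi> z * dlist is \<kappa> (y - q z)))"
      by (intro integrable_mult_right integrable_mult_bounded[OF \<psi> _ M])
    show "integrable lborel (\<lambda>z. (2 * B * ?Q) * (weight t (2 * norm z / h) * norm (\<psi> z)))"
      using w by (rule integrable_mult_right)
    fix z
    have "norm (of_real (norm y ^ k) * (\<psi> z * dlist is \<kappa> (y - q z))) = norm (\<psi> z) * (norm y ^ k * norm (dlist is \<kappa> (y - q z)))"
      by (simp add: norm_mult norm_power)
    also have "\<dots> \<le> norm (\<psi> z) * ((2 * B * weight t (2 * norm z / h)) * (2 * h) ^ (length is + k) * fact (length is) powr s * fact k powr t)"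
      by (rule mult_left_mono[OF translate_bound[OF \<kappa>(2) h t q2]]) simp
    finally show "norm (of_real (norm y ^ k) * (\<psi> z * dlist is \<kappa> (y - q z))) \<le> (2 * B * ?Q) * (weight t (2 * norm z / h) * norm (\<psi> z))"
      by (simp add: mult_ac)
  qed
  also have "\<dots> = (2 * B * ?Q) * (LINT z|lborel. weight t (2 * norm z / h) * norm (\<psi> z))"
    by (rule integral_mult_right_zero)
  finally show "norm y ^ k * norm (LINT z|lborel. \<psi> z * dlist is \<kappa> (y - q z)) \<le>
    2 * B * (LINT z|lborel. weight t (2 * norm z / h) * norm (\<psi> z)) * (2 * h) ^ (length is + k) * fact (length is) powr s * fact k powr t"
    by (simp add: mult_ac)
qed

text \<open>The error of replacing the shift \<open>z\<close> by \<open>q z\<close>, small when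
  \<open>q\<close> is close to the identity in a weighted mean. The coefficients 1 and -1 give the
  difference the form in which linearity of functionals is stated.\<close>

lemma superposition_diff_seminorm:
  fixes \<kappa> \<psi> :: "real^'n::finite \<Rightarrow> complex" and q :: "real^'n \<Rightarrow> real^'n"
  assumes \<psi>: "integrable lborel \<psi>" and \<kappa>: "smooth \<kappa>" "seminorm_le s t h B \<kappa>" and q: "q \<in> borel_measurable borel"
    and h: "0 < h" and t: "0 < t" and s: "0 \<le> s" and q2: "\<And>z. norm (q z) \<le> 2 * norm z"
    and w: "integrable lborel (\<lambda>z. weight t (2 * norm z / h) * norm (z - q z) * norm (\<psi> z))"
  shows "seminorm_le s t (2 powr (1 + s) * h)
      ((4 * real CARD('n) * h * B) * (LINT z|lborel. weight t (2 * norm z / h) * norm (z - q z) * norm (\<psi> z)))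
    (\<lambda>y. 1 * (LINT z|lborel. \<psi> z * \<kappa> (y - z)) + (-1) * (LINT z|lborel. \<psi> z * \<kappa> (y - q z)))"
proof -
  note bd = dlist_bounded_of_seminorm[OF \<kappa>(2)]
  have idm: "(\<lambda>z::real^'n. z) \<in> borel_measurable borel" by measurable
  note S1 = superposition_dlist[OF \<psi> \<kappa>(1) idm bd] and S2 = superposition_dlist[OF \<psi> \<kappa>(1) q bd]
  show ?thesis
    unfolding seminorm_le_def dlist_linear[OF S1(2) S2(2)] S1(1) S2(1)
  proof (intro allI)
    fix "is" :: "'n list" and k and y :: "real^'n"
    let ?Q = "(2 powr (1 + s) * h) ^ (length is + k) * fact (length is) powr s * fact k powr t"
    let ?c = "4 * real CARD('n) * h * B"
    obtain M where M: "\<And>y. norm (dlist is \<kappa> y) \<le> M" using bd by blast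
    have [measurable]: "dlist is \<kappa> \<in> borel_measurable borel" by (rule smooth_measurable[OF smooth_dlist[OF \<kappa>(1)]])
    have m1: "(\<lambda>z. dlist is \<kappa> (y - z)) \<in> borel_measurable borel" by measurable
    have m2: "(\<lambda>z. dlist is \<kappa> (y - q z)) \<in> borel_measurable borel" using q by measurable
    note i1 = integrable_mult_bounded[OF \<psi> m1 M] and i2 = integrable_mult_bounded[OF \<psi> m2 M]
    have "1 * (LINT z|lborel. \<psi> z * dlist is \<kappa> (y - z)) + (-1) * (LINT z|lborel. \<psi> z * dlist is \<kappa> (y - q z)) =
      (LINT z|lborel. \<psi> z * dlist is \<kappa> (y - z) - \<psi> z * dlist is \<kappa> (y - q z))"
      using i1 i2 by simp
    then have "norm y ^ k * norm (1 * (LINT z|lborel. \<psi> z * dlist is \<kappa> (y - z)) + (-1) * (LINT z|lborel. \<psi> z * dlist is \<kappa> (y - q z))) =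
      norm (LINT z|lborel. of_real (norm y ^ k) * (\<psi> z * dlist is \<kappa> (y - z) - \<psi> z * dlist is \<kappa> (y - q z)))"
      by (simp add: norm_mult norm_power)
    also have "\<dots> \<le> (LINT z|lborel. (?c * ?Q) * (weight t (2 * norm z / h) * norm (z - q z) * norm (\<psi> z)))"
    proof (rule Bochner_Integration.integral_norm_bound_integral)
      show "integrable lborel (\<lambda>z. of_real (norm y ^ k) * (\<psi> z * dlist is \<kappa> (y - z) - \<psi> z * dlist is \<kappa> (y - q z)))"
        by (intro integrable_mult_right Bochner_Integration.integrable_diff i1 i2)
      show "integrable lborel (\<lambda>z. (?c * ?Q) * (weight t (2 * norm z / h) * norm (z - q z) * norm (\<psi> z)))"
        using w by (rule integrable_mult_right)
      fix z
      have "norm (of_real (norm y ^ k) * (\<psi> z * dlist is \<kappa> (y - z) - \<psi> z * dlist is \<kappa> (y - q z))) =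
        norm (\<psi> z) * (norm y ^ k * norm (dlist is \<kappa> (y - z) - dlist is \<kappa> (y - q z)))"
        by (simp add: norm_mult norm_power flip: right_diff_distrib)
      also have "\<dots> \<le> norm (\<psi> z) * ((4 * real CARD('n) * h * B * weight t (2 * norm z / h) * norm (z - q z)) * (2 powr (1 + s) * h) ^ (length is + k)
          * fact (length is) powr s * fact k powr t)"
        by (rule mult_left_mono[OF translate_diff_bound[OF \<kappa>(2,1) h t s _ q2]]) simp_all
      finally show "norm (of_real (norm y ^ k) * (\<psi> z * dlist is \<kappa> (y - z) - \<psi> z * dlist is \<kappa> (y - q z))) \<le>
        (?c * ?Q) * (weight t (2 * norm z / h) * norm (z - q z) * norm (\<psi> z))"
        by (simp add: mult_ac)
    qed
    also have "\<dots> = (?c * ?Q) * (LINT z|lborel. weight t (2 * norm z / h) * norm (z - q z) * norm (\<psi> z))"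
      by (rule integral_mult_right_zero)
    finally show "norm y ^ k * norm (1 * (LINT z|lborel. \<psi> z * dlist is \<kappa> (y - z)) + (-1) * (LINT z|lborel. \<psi> z * dlist is \<kappa> (y - q z))) \<le>
      ?c * (LINT z|lborel. weight t (2 * norm z / h) * norm (z - q z) * norm (\<psi> z)) * (2 powr (1 + s) * h) ^ (length is + k) * fact (length is) powr s * fact k powr t"
      by (simp add: mult_ac)
  qed
qed

section \<open>Continuous functionals and closure properties of the test spaces\<close>

definition cont_at :: "bool \<Rightarrow> real \<Rightarrow> real \<Rightarrow> ((real^'n::finite \<Rightarrow> complex) \<Rightarrow> complex) \<Rightarrow> real \<Rightarrow> bool" where
  "cont_at b s t L h \<longleftrightarrow> (\<exists>C\<ge>0. \<forall>f\<in>GS_test b s t. \<forall>B. seminorm_le s t h B f \<longrightarrow> norm (L f) \<le> C * B)"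

text \<open>The content of \<open>GS_dual\<close> in terms of \<open>seminorm_le\<close>; this is
  the property that passes from \<open>u\<close> to its twisted means.\<close>

definition dual_functional :: "bool \<Rightarrow> real \<Rightarrow> real \<Rightarrow> ((real^'n::finite \<Rightarrow> complex) \<Rightarrow> complex) \<Rightarrow> bool" where
  "dual_functional b s t L \<longleftrightarrow>
     (\<forall>f\<in>GS_test b s t. \<forall>g\<in>GS_test b s t. \<forall>a c. L (\<lambda>x. a * f x + c * g x) = a * L f + c * L g) \<and>
     (if b then \<forall>h>0. cont_at b s t L h else \<exists>h>0. cont_at b s t L h)"

lemma GS_dual_imp_dual_functional:
  assumes u: "GS_dual b s t u" and "0 < s" "0 < t"
  shows "dual_functional b s t u"
proof -
  have "\<forall>f\<in>GS_test b s t. \<forall>g\<in>GS_test b s t. \<forall>a c. u (\<lambda>x. a * f x + c * g x) = a * u f + c * u g"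
    using u unfolding GS_dual_def by (rule conjunct1)
  then show ?thesis
    unfolding dual_functional_def cont_at_def using GS_dual_cont[OF assms] by (rule conjI)
qed

lemma GS_test_smooth: "f \<in> GS_test b s t \<Longrightarrow> smooth f"
  by (auto simp: GS_test_def GS_S_def GS_Sigma_def split: if_splits)

lemma GS_test_seminorm:
  fixes f :: "real^'n::finite \<Rightarrow> complex"
  assumes "f \<in> GS_test b s t" "0 < s" "0 < t"
  shows "\<exists>h>0. \<exists>B. seminorm_le s t h B f"
proof (cases b)
  case True
  then show ?thesis using assms by (simp add: GS_test_iff)
next
  case False
  then have "\<forall>h>0. \<exists>B. seminorm_le s t h B f" using assms by (simp add: GS_test_iff)
  then show ?thesis using zero_less_one by blast
qed

text \<open>An operation enlarging the scale by a fixed factor \<open>K\<close> preserves both kinds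
  of spaces: for "some h" the larger of two scales is taken, for "every h" the scale is divided by
  \<open>K\<close> beforehand.\<close>

lemma GS_test_closure:
  fixes f \<psi> \<kappa> :: "real^'n::finite \<Rightarrow> complex"
  assumes s: "0 < s" and t: "0 < t" and T: "\<psi> \<in> GS_test b s t" "\<kappa> \<in> GS_test b s t" and f: "smooth f" and K: "0 < K"
    and bd: "\<And>h B B'. 0 < h \<Longrightarrow> seminorm_le s t h B \<psi> \<Longrightarrow> seminorm_le s t h B' \<kappa> \<Longrightarrow> \<exists>B. seminorm_le s t (K * h) B f"
  shows "f \<in> GS_test b s t"
proof (cases b)
  case True
  obtain h1 B1 h2 B2 where h: "0 < h1" "seminorm_le s t h1 B1 \<psi>" "0 < h2" "seminorm_le s t h2 B2 \<kappa>"
    using T s t True by (auto simp: GS_test_iff)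
  define h where "h = max h1 h2"
  have h0: "0 < h" using h by (simp add: h_def)
  have "seminorm_le s t h B1 \<psi>" "seminorm_le s t h B2 \<kappa>"
    by (rule seminorm_le_mono[OF h(2) h(1)], simp_all add: h_def) (rule seminorm_le_mono[OF h(4) h(3)], simp_all)
  from bd[OF h0 this] obtain B where "seminorm_le s t (K * h) B f" by blast
  moreover have "0 < K * h" using K h0 by simp
  ultimately show ?thesis unfolding GS_test_iff[OF s t] using f True by auto
next
  case False
  have "\<exists>B. seminorm_le s t h B f" if "0 < h" for h
  proof -
    have hK: "0 < h / K" using that K by simp
    have "\<forall>h>0. \<exists>B. seminorm_le s t h B \<psi>" "\<forall>h>0. \<exists>B. seminorm_le s t h B \<kappa>"
      using T s t False by (simp_all add: GS_test_iff)
    with hK obtain B B' where "seminorm_le s t (h / K) B \<psi>" "seminorm_le s t (h / K) B' \<kappa>"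
      by blast
    from bd[OF hK this] K show ?thesis by simp
  qed
  then show ?thesis using f s t False by (simp add: GS_test_iff)
qed

text \<open>Functional and test functions meet at one scale for opposite reasons: either the
  functional is bounded at every scale and \<open>h\<close> is chosen for the functions, or the
  functions are bounded at every scale and \<open>h\<close> is chosen for the functional.\<close>

lemma common_scale:
  fixes L :: "(real^'n::finite \<Rightarrow> complex) \<Rightarrow> complex"
  assumes L: "dual_functional b s t L" and s: "0 < s" and t: "0 < t" and T: "\<psi> \<in> GS_test b s t" "\<kappa> \<in> GS_test b s t" and K: "0 < K"
  shows "\<exists>h>0. cont_at b s t L (K * h) \<and> (\<exists>B. seminorm_le s t h B \<psi>) \<and> (\<exists>B. seminorm_le s t h B \<kappa>)"
proof (cases b)
  case True
  obtain h1 B1 h2 B2 where h: "0 < h1" "seminorm_le s t h1 B1 \<psi>" "0 < h2" "seminorm_le s t h2 B2 \<kappa>"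
    using T s t True by (auto simp: GS_test_iff)
  define h where "h = max h1 h2"
  have h0: "0 < h" using h by (simp add: h_def)
  have "seminorm_le s t h B1 \<psi>" "seminorm_le s t h B2 \<kappa>"
    by (rule seminorm_le_mono[OF h(2) h(1)], simp_all add: h_def) (rule seminorm_le_mono[OF h(4) h(3)], simp_all)
  moreover have "cont_at b s t L (K * h)" using L True h0 K by (simp add: dual_functional_def)
  ultimately show ?thesis using h0 by blast
next
  case False
  obtain h where h: "0 < h" "cont_at b s t L h" using L False by (auto simp: dual_functional_def)
  have hK: "0 < h / K" using h K by simp
  then have "\<exists>B. seminorm_le s t (h / K) B \<psi>" "\<exists>B. seminorm_le s t (h / K) B \<kappa>"
    using T s t False by (auto simp: GS_test_iff)
  then show ?thesis using hK h K by (intro exI[of _ "h / K"]) simp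
qed

lemma GS_test_linear:
  fixes f g :: "real^'n::finite \<Rightarrow> complex"
  assumes s: "0 < s" and t: "0 < t" and T: "f \<in> GS_test b s t" "g \<in> GS_test b s t"
  shows "(\<lambda>x. a * f x + c * g x) \<in> GS_test b s t"
proof (rule GS_test_closure[OF s t T])
  show "smooth (\<lambda>x. a * f x + c * g x)" using T by (intro smooth_linear GS_test_smooth)
  show "(0::real) < 1" by simp
  show "\<exists>B. seminorm_le s t (1 * h) B (\<lambda>x. a * f x + c * g x)"
    if "0 < h" "seminorm_le s t h B f" "seminorm_le s t h B' g" for h B B'
    using seminorm_linear[OF GS_test_smooth[OF T(1)] that(2) GS_test_smooth[OF T(2)] that(3)] by auto
qed

lemma GS_test_translate:
  fixes f :: "real^'n::finite \<Rightarrow> complex"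
  assumes s: "0 < s" and t: "0 < t" and T: "f \<in> GS_test b s t"
  shows "(\<lambda>y. f (y - z)) \<in> GS_test b s t"
proof (rule GS_test_closure[OF s t T T])
  show "smooth (\<lambda>y. f (y - z))" using T by (intro smooth_translate GS_test_smooth)
  show "(0::real) < 2" by simp
  show "\<exists>B. seminorm_le s t (2 * h) B (\<lambda>y. f (y - z))" if "0 < h" "seminorm_le s t h B f" for h B
    using seminorm_translate[OF that(2,1) t order_refl] by blast
qed

lemma seminorm_le_dpart:
  fixes f :: "real^'n::finite \<Rightarrow> complex"
  assumes f: "seminorm_le s t h B f" and h: "0 < h" and s: "0 \<le> s"
  shows "seminorm_le s t (2 powr s * h) (B * h) (dpart i f)"
  unfolding seminorm_le_def
proof (intro allI)
  fix "is" :: "'n list" and k and y :: "real^'n"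
  let ?l = "length is"
  have B: "0 \<le> B" by (rule seminorm_le_nonneg[OF f])
  have "Suc ?l \<le> 2 ^ ?l" by (simp add: Suc_leI)
  then have "real (Suc ?l) \<le> real (2 ^ ?l)" by (rule of_nat_mono)
  then have "(fact (Suc ?l) :: real) \<le> 2 ^ ?l * fact ?l" unfolding fact_Suc by (intro mult_right_mono) auto
  then have "(fact (Suc ?l) :: real) powr s \<le> (2 ^ ?l * fact ?l) powr s" using s by (intro powr_mono2) auto
  also have "\<dots> = (2 powr s) ^ ?l * fact ?l powr s" by (simp only: powr_mult power_powr_swap[of 2 ?l s])
  also have "\<dots> \<le> (2 powr s) ^ (?l + k) * fact ?l powr s"
    using s by (intro mult_right_mono power_increasing ge_one_powr_ge_zero) auto
  finally have F: "(fact (Suc ?l) :: real) powr s \<le> (2 powr s) ^ (?l + k) * fact ?l powr s" .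
  have "norm y ^ k * norm (dlist is (dpart i f) y) = norm y ^ k * norm (dlist (is @ [i]) f y)"
    by (simp add: dlist_append)
  also have "\<dots> \<le> B * h ^ (Suc ?l + k) * fact (Suc ?l) powr s * fact k powr t"
    using seminorm_leD[OF f, of y k "is @ [i]"] by simp
  also have "\<dots> \<le> B * h ^ (Suc ?l + k) * ((2 powr s) ^ (?l + k) * fact ?l powr s) * fact k powr t"
    using F B h by (intro mult_right_mono mult_left_mono) auto
  also have "\<dots> = B * h * (2 powr s * h) ^ (?l + k) * fact ?l powr s * fact k powr t"
    by (simp add: power_mult_distrib mult_ac)
  finally show "norm y ^ k * norm (dlist is (dpart i f) y) \<le> B * h * (2 powr s * h) ^ (?l + k) * fact ?l powr s * fact k powr t" .
qed

lemma GS_test_dpart: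
  fixes f :: "real^'n::finite \<Rightarrow> complex"
  assumes s: "0 < s" and t: "0 < t" and T: "f \<in> GS_test b s t"
  shows "dpart i f \<in> GS_test b s t"
proof (rule GS_test_closure[OF s t T T])
  show "smooth (dpart i f)" using T by (intro smooth_dpart GS_test_smooth)
  show "0 < 2 powr s" by simp
  show "\<exists>B. seminorm_le s t (2 powr s * h) B (dpart i f)" if "0 < h" "seminorm_le s t h B f" for h B
    using seminorm_le_dpart[OF that(2,1)] s by auto
qed

lemma GS_test_integrable:
  fixes f :: "real^'n::finite \<Rightarrow> complex"
  assumes "f \<in> GS_test b s t" "0 < s" "0 < t"
  shows "integrable lborel f"
  using GS_test_seminorm[OF assms] seminorm_integrable[of s t _ _ f "[]"] GS_test_smooth[OF assms(1)] assms(3) by auto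

lemma GS_test_superposition:
  fixes \<kappa> \<psi> :: "real^'n::finite \<Rightarrow> complex" and q :: "real^'n \<Rightarrow> real^'n"
  assumes s: "0 < s" and t: "0 < t" and T: "\<psi> \<in> GS_test b s t" "\<kappa> \<in> GS_test b s t"
    and q: "q \<in> borel_measurable borel" "\<And>z. norm (q z) \<le> 2 * norm z"
  shows "(\<lambda>y. LINT z|lborel. \<psi> z * \<kappa> (y - q z)) \<in> GS_test b s t"
proof (rule GS_test_closure[OF s t T])
  have i: "integrable lborel \<psi>" by (rule GS_test_integrable[OF T(1) s t])
  obtain h0 B0 where "seminorm_le s t h0 B0 \<kappa>" using GS_test_seminorm[OF T(2) s t] by blast
  then show "smooth (\<lambda>y. LINT z|lborel. \<psi> z * \<kappa> (y - q z))"
    by (intro superposition_dlist(2)[OF i GS_test_smooth[OF T(2)] q(1)] dlist_bounded_of_seminorm)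
  \<comment> \<open>Chosen so that the weight at \<open>2 norm z / (c h)\<close> is the one against
    which \<psi> is known to be integrable.\<close>
  define c where "c = 2 * 2 powr (t + 1)"
  have c: "c \<ge> 1" using ge_one_powr_ge_zero[of 2 "t + 1"] t by (simp add: c_def)
  show "0 < 2 * c" using c by simp
  fix h B B' assume h: "0 < h" and sm: "seminorm_le s t h B \<psi>" "seminorm_le s t h B' \<kappa>"
  have ch: "0 < c * h" using c h by simp
  have "seminorm_le s t (c * h) B' \<kappa>" using sm(2) h c by (rule_tac seminorm_le_mono) auto
  moreover have "integrable lborel (\<lambda>z. weight t (2 * norm z / (c * h)) * norm (\<psi> z))"
  proof (rule Bochner_Integration.integrable_bound)
    show "integrable lborel (\<lambda>z. (1 + norm z) * weight t (norm z / (2 powr (t + 1) * h)) * norm (\<psi> z))"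
      by (rule seminorm_weight_integrable[OF sm(1) GS_test_smooth[OF T(1)] h t order_refl])
    have [measurable]: "weight t \<in> borel_measurable borel" "\<psi> \<in> borel_measurable borel"
      using t i by (auto intro: weight_measurable)
    show "(\<lambda>z. weight t (2 * norm z / (c * h)) * norm (\<psi> z)) \<in> borel_measurable lborel" by measurable
    have "norm (weight t (2 * norm z / (c * h)) * norm (\<psi> z)) \<le> norm ((1 + norm z) * weight t (norm z / (2 powr (t + 1) * h)) * norm (\<psi> z))" for z
    proof -
      have e: "2 * norm z / (c * h) = norm z / (2 powr (t + 1) * h)" by (simp add: c_def)
      have w: "1 \<le> weight t (norm z / (2 powr (t + 1) * h))" using h by (intro weight_ge_1[OF t]) simp
      have "1 * (weight t (norm z / (2 powr (t + 1) * h)) * norm (\<psi> z)) \<le> (1 + norm z) * (weight t (norm z / (2 powr (t + 1) * h)) * norm (\<psi> z))"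
        using w by (intro mult_right_mono) auto
      then show ?thesis unfolding e using w by (simp add: abs_mult mult.assoc)
    qed
    then show "AE z in lborel. norm (weight t (2 * norm z / (c * h)) * norm (\<psi> z)) \<le> norm ((1 + norm z) * weight t (norm z / (2 powr (t + 1) * h)) * norm (\<psi> z))"
      by (intro AE_I2)
  qed
  ultimately have "seminorm_le s t (2 * (c * h)) (2 * B' * (LINT z|lborel. weight t (2 * norm z / (c * h)) * norm (\<psi> z)))
    (\<lambda>y. LINT z|lborel. \<psi> z * \<kappa> (y - q z))"
    by (intro superposition_seminorm[OF i GS_test_smooth[OF T(2)] _ q(1) ch t q(2)])
  then show "\<exists>B. seminorm_le s t (2 * c * h) B (\<lambda>y. LINT z|lborel. \<psi> z * \<kappa> (y - q z))"
    by (auto simp: mult.assoc)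
qed

section \<open>Twisted means of periodic functionals\<close>

lemma dual_functional_add:
  "dual_functional b s t L \<Longrightarrow> f \<in> GS_test b s t \<Longrightarrow> g \<in> GS_test b s t \<Longrightarrow>
    L (\<lambda>x. a * f x + c * g x) = a * L f + c * L g"
  by (simp add: dual_functional_def)

lemma GS_test_zero:
  fixes f :: "real^'n::finite \<Rightarrow> complex"
  assumes "f \<in> GS_test b s t" "0 < s" "0 < t"
  shows "(\<lambda>_::real^'n. 0) \<in> GS_test b s t"
  using GS_test_linear[OF assms(2,3,1,1), of 0 0] by simp

lemma dual_functional_translate_sum:
  fixes \<kappa> :: "real^'n::finite \<Rightarrow> complex"
  assumes L: "dual_functional b s t L" and s: "0 < s" and t: "0 < t" and \<kappa>: "\<kappa> \<in> GS_test b s t" and W: "finite W"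
  shows "(\<lambda>y. \<Sum>w\<in>W. c w * \<kappa> (y - w)) \<in> GS_test b s t \<and>
    L (\<lambda>y. \<Sum>w\<in>W. c w * \<kappa> (y - w)) = (\<Sum>w\<in>W. c w * L (\<lambda>y. \<kappa> (y - w)))"
  using W
proof (induction W rule: finite_induct)
  case empty
  have "L (\<lambda>x. 0 * \<kappa> x + 0 * \<kappa> x) = 0 * L \<kappa> + 0 * L \<kappa>" by (rule dual_functional_add[OF L \<kappa> \<kappa>])
  then show ?case using GS_test_zero[OF \<kappa> s t] by simp
next
  case (insert w W)
  let ?g = "\<lambda>y. \<Sum>w\<in>W. c w * \<kappa> (y - w)"
  have g: "?g \<in> GS_test b s t" and Lg: "L ?g = (\<Sum>w\<in>W. c w * L (\<lambda>y. \<kappa> (y - w)))" using insert.IH by auto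
  have k: "(\<lambda>y. \<kappa> (y - w)) \<in> GS_test b s t" by (rule GS_test_translate[OF s t \<kappa>])
  have e: "(\<lambda>y. \<Sum>w\<in>insert w W. c w * \<kappa> (y - w)) = (\<lambda>y. c w * \<kappa> (y - w) + 1 * ?g y)"
    using insert.hyps by simp
  show ?case unfolding e dual_functional_add[OF L k g] Lg
    using GS_test_linear[OF s t k g, of "c w" 1] insert.hyps by simp
qed

text \<open>Applied with \<open>F\<close> given by translates of a test function and with
  \<open>F\<close> a character; the coefficients are the same in both cases.\<close>

lemma simple_superposition:
  fixes \<kappa> \<psi> :: "real^'n::finite \<Rightarrow> complex" and p :: "real^'n \<Rightarrow> real^'n"
  assumes p: "simple_function borel p" and \<psi>: "integrable lborel \<psi>"
  shows "(LINT z|lborel. \<psi> z * F (p z)) = (\<Sum>w\<in>range p. (LINT z|lborel. \<psi> z * indicator (p -` {w}) z) * F w)"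
proof -
  have fin: "finite (range p)" using p by (auto simp: simple_function_def)
  have pm: "p -` {w} \<in> sets borel" for w
    using simple_functionD(2)[OF p, of "{w}"] by simp
  have i: "integrable lborel (\<lambda>z. \<psi> z * indicator (p -` {w}) z)" for w
    by (rule integrable_mult_bounded[OF \<psi> borel_measurable_indicator[OF pm], where K = 1]) (simp add: indicator_def)
  have "\<psi> z * F (p z) = (\<Sum>w\<in>range p. (\<psi> z * indicator (p -` {w}) z) * F w)" for z
  proof -
    have "(\<Sum>w\<in>range p. (\<psi> z * indicator (p -` {w}) z) * F w) = (\<Sum>w\<in>range p. if w = p z then \<psi> z * F w else 0)"
      by (rule sum.cong) (auto simp: indicator_def)
    also have "\<dots> = \<psi> z * F (p z)" using fin by (simp add: sum.delta)
    finally show ?thesis by simp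
  qed
  then have "(LINT z|lborel. \<psi> z * F (p z)) = (LINT z|lborel. (\<Sum>w\<in>range p. (\<psi> z * indicator (p -` {w}) z) * F w))" by (simp only:)
  also have "\<dots> = (\<Sum>w\<in>range p. LINT z|lborel. (\<psi> z * indicator (p -` {w}) z) * F w)"
    by (rule Bochner_Integration.integral_sum) (intro integrable_mult_left i)
  finally show ?thesis by (simp only: integral_mult_left_zero)
qed

text \<open>The interchange of functional and integral is justified by replacing the translation
parameter by simple functions.\<close>

lemma covariant_functional_convolution:
  fixes \<kappa> \<psi> :: "real^'n::finite \<Rightarrow> complex"
  assumes L: "dual_functional b s t L" and s: "0 < s" and t: "0 < t"
    and cov: "\<And>\<psi> z. \<psi> \<in> GS_test b s t \<Longrightarrow> L (\<lambda>y. \<psi> (y - z)) = cis (z \<bullet> \<alpha>) * L \<psi>"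
    and T: "\<psi> \<in> GS_test b s t" "\<kappa> \<in> GS_test b s t"
  shows "L (\<lambda>y. LINT z|lborel. \<psi> z * \<kappa> (y - z)) = L \<kappa> * (LINT z|lborel. \<psi> z * cis (z \<bullet> \<alpha>))"
proof -
  define c where "c = 2 * 2 powr (t + 1)"
  have c1: "c \<ge> 1" using ge_one_powr_ge_zero[of 2 "t + 1"] t by (simp add: c_def)
  \<comment> \<open>Product of two losses: \<open>c\<close> for the integrability of the weight,
    \<open>2 powr (1 + s)\<close> for the difference of superpositions.\<close>
  define K where "K = 2 powr (1 + s) * c"
  have K: "0 < K" using c1 by (simp add: K_def)
  obtain h where h: "0 < h" and "cont_at b s t L (K * h)" and "\<exists>B. seminorm_le s t h B \<psi>" "\<exists>B. seminorm_le s t h B \<kappa>"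
    using common_scale[OF L s t T K] by blast
  then obtain C B0 B where C: "C \<ge> 0" "\<And>f B. f \<in> GS_test b s t \<Longrightarrow> seminorm_le s t (K * h) B f \<Longrightarrow> norm (L f) \<le> C * B"
    and B: "seminorm_le s t h B0 \<psi>" "seminorm_le s t h B \<kappa>" unfolding cont_at_def by blast
  define h1 where "h1 = c * h"
  have h1: "0 < h1" "K * h = 2 powr (1 + s) * h1" using h c1 by (simp_all add: h1_def K_def mult_ac)
  have \<kappa>1: "seminorm_le s t h1 B \<kappa>" by (rule seminorm_le_mono[OF B(2) h]) (use h c1 in \<open>simp_all add: h1_def\<close>)
  have S: "smooth \<psi>" "smooth \<kappa>" using T by (simp_all add: GS_test_smooth)
  have i\<psi>: "integrable lborel \<psi>" by (rule GS_test_integrable[OF T(1) s t])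
  have [measurable]: "weight t \<in> borel_measurable borel" "\<psi> \<in> borel_measurable borel"
    using t i\<psi> by (auto intro: weight_measurable)
  have iw: "integrable lborel (\<lambda>z. (1 + norm z) * weight t (2 * norm z / h1) * norm (\<psi> z))"
  proof -
    have "2 * norm z / h1 = norm z / (2 powr (t + 1) * h)" for z :: "real^'n" by (simp add: h1_def c_def)
    then show ?thesis using seminorm_weight_integrable[OF B(1) S(1) h t order_refl] by simp
  qed
  have w0: "0 \<le> weight t (2 * norm z / h1)" for z :: "real^'n"
    using weight_ge_1[OF t, of "2 * norm z / h1"] h1 by simp
  \<comment> \<open>Simple functions tending to the identity; the bound \<open>2 norm z\<close>
    keeps every shift within the range of the weight.\<close>
  obtain p :: "nat \<Rightarrow> real^'n \<Rightarrow> real^'n" where p: "\<And>i. simple_function borel (p i)" "\<And>z. (\<lambda>i. p i z) \<longlonglongrightarrow> z"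
    "\<And>i z. norm (p i z) \<le> 2 * norm z"
    using borel_measurable_implies_sequence_metric[of "\<lambda>z::real^'n. z" borel 0] by (auto simp: dist_norm)
  have pm [measurable]: "p i \<in> borel_measurable borel" for i using p(1) by (rule borel_measurable_simple_function)
  let ?F = "\<lambda>q y. LINT z|lborel. \<psi> z * \<kappa> (y - q z)"
  have FT: "?F q \<in> GS_test b s t" if "q \<in> borel_measurable borel" "\<And>z. norm (q z) \<le> 2 * norm z" for q
    using GS_test_superposition[OF s t T that] .
  have F0: "?F (\<lambda>z. z) \<in> GS_test b s t" by (rule FT) auto
  have Fi: "?F (p i) \<in> GS_test b s t" for i by (rule FT[OF pm p(3)])
  \<comment> \<open>For a simple shift the claim is linearity combined with covariance.\<close>
  have Lp: "L (?F (p i)) = L \<kappa> * (LINT z|lborel. \<psi> z * cis (p i z \<bullet> \<alpha>))" for i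
  proof -
    let ?c = "\<lambda>w. LINT z|lborel. \<psi> z * indicator (p i -` {w}) z"
    have fin: "finite (range (p i))" using p(1)[of i] by (auto simp: simple_function_def)
    have "?F (p i) = (\<lambda>y. \<Sum>w\<in>range (p i). ?c w * \<kappa> (y - w))"
      by (rule ext) (rule simple_superposition[OF p(1) i\<psi>])
    then have "L (?F (p i)) = (\<Sum>w\<in>range (p i). ?c w * L (\<lambda>y. \<kappa> (y - w)))"
      using dual_functional_translate_sum[OF L s t T(2) fin, of ?c] by simp
    also have "\<dots> = L \<kappa> * (\<Sum>w\<in>range (p i). ?c w * cis (w \<bullet> \<alpha>))"
      by (simp add: cov[OF T(2)] sum_distrib_left mult_ac)
    also have "(\<Sum>w\<in>range (p i). ?c w * cis (w \<bullet> \<alpha>)) = (LINT z|lborel. \<psi> z * cis (p i z \<bullet> \<alpha>))"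
      by (rule simple_superposition[OF p(1) i\<psi>, symmetric])
    finally show ?thesis .
  qed
  have d3: "norm (z - p i z) \<le> 3 * norm z" for i z
    using norm_triangle_ineq4[of z "p i z"] p(3)[of i z] by linarith
  let ?e = "\<lambda>i. LINT z|lborel. weight t (2 * norm z / h1) * norm (z - p i z) * norm (\<psi> z)"
  have bd3: "norm (weight t (2 * norm z / h1) * norm (z - p i z) * norm (\<psi> z)) \<le>
      3 * ((1 + norm z) * weight t (2 * norm z / h1) * norm (\<psi> z))" for i z
  proof -
    have "weight t (2 * norm z / h1) * norm (z - p i z) * norm (\<psi> z) \<le> weight t (2 * norm z / h1) * (3 * (1 + norm z)) * norm (\<psi> z)"
      using w0 d3[of z i] norm_ge_zero[of z] by (intro mult_right_mono mult_left_mono) simp_all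
    also have "\<dots> = 3 * ((1 + norm z) * weight t (2 * norm z / h1) * norm (\<psi> z))" by (simp only: mult_ac)
    finally show ?thesis using w0[of z] by (simp add: abs_mult)
  qed
  have ie: "integrable lborel (\<lambda>z. weight t (2 * norm z / h1) * norm (z - p i z) * norm (\<psi> z))" for i
  proof (rule Bochner_Integration.integrable_bound[OF integrable_mult_right[OF iw, of 3]])
    show "(\<lambda>z. weight t (2 * norm z / h1) * norm (z - p i z) * norm (\<psi> z)) \<in> borel_measurable lborel" by measurable
    show "AE z in lborel. norm (weight t (2 * norm z / h1) * norm (z - p i z) * norm (\<psi> z)) \<le>
      norm (3 * ((1 + norm z) * weight t (2 * norm z / h1) * norm (\<psi> z)))"
      using order_trans[OF bd3 abs_ge_self] unfolding real_norm_def by (intro AE_I2)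
  qed
  \<comment> \<open>The weighted mean distance of \<open>p i\<close> to the identity tends to 0, so
    the superpositions converge in a seminorm that controls \<open>L\<close>.\<close>
  have e0: "?e \<longlonglongrightarrow> (LINT z::real^'n|lborel. (0::real))"
  proof (rule integral_dominated_convergence[where w = "\<lambda>z. 3 * ((1 + norm z) * weight t (2 * norm z / h1) * norm (\<psi> z))"])
    show "integrable lborel (\<lambda>z. 3 * ((1 + norm z) * weight t (2 * norm z / h1) * norm (\<psi> z)))"
      using iw by (rule integrable_mult_right)
    show "(\<lambda>z. weight t (2 * norm z / h1) * norm (z - p i z) * norm (\<psi> z)) \<in> borel_measurable lborel" for i by measurable
    have "(\<lambda>i. weight t (2 * norm z / h1) * norm (z - p i z) * norm (\<psi> z)) \<longlonglongrightarrow> weight t (2 * norm z / h1) * norm (z - z) * norm (\<psi> z)" for z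
      by (intro tendsto_mult tendsto_const tendsto_norm tendsto_diff p(2))
    then show "AE z in lborel. (\<lambda>i. weight t (2 * norm z / h1) * norm (z - p i z) * norm (\<psi> z)) \<longlonglongrightarrow> 0" by simp
    show "AE z in lborel. norm (weight t (2 * norm z / h1) * norm (z - p i z) * norm (\<psi> z)) \<le>
      3 * ((1 + norm z) * weight t (2 * norm z / h1) * norm (\<psi> z))" for i
      by (intro AE_I2 bd3)
  qed simp
  have diff: "norm (L (?F (\<lambda>z. z)) - L (?F (p i))) \<le> C * ((4 * real CARD('n) * h1 * B) * ?e i)" for i
  proof -
    have "L (?F (\<lambda>z. z)) - L (?F (p i)) = L (\<lambda>y. 1 * ?F (\<lambda>z. z) y + (-1) * ?F (p i) y)"
      using dual_functional_add[OF L F0 Fi, of 1 "-1"] by simp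
    also have "norm \<dots> \<le> C * ((4 * real CARD('n) * h1 * B) * ?e i)"
    proof (rule C(2))
      show "(\<lambda>y. 1 * ?F (\<lambda>z. z) y + (-1) * ?F (p i) y) \<in> GS_test b s t" by (rule GS_test_linear[OF s t F0 Fi])
      show "seminorm_le s t (K * h) ((4 * real CARD('n) * h1 * B) * ?e i) (\<lambda>y. 1 * ?F (\<lambda>z. z) y + (-1) * ?F (p i) y)"
        unfolding h1(2)
        by (rule superposition_diff_seminorm[OF i\<psi> S(2) \<kappa>1 pm h1(1) t less_imp_le[OF s] p(3) ie])
    qed
    finally show ?thesis .
  qed
  have "(\<lambda>i. C * ((4 * real CARD('n) * h1 * B) * ?e i)) \<longlonglongrightarrow> C * ((4 * real CARD('n) * h1 * B) * (LINT z::real^'n|lborel. 0))"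
    by (intro tendsto_mult tendsto_const e0)
  then have "(\<lambda>i. C * ((4 * real CARD('n) * h1 * B) * ?e i)) \<longlonglongrightarrow> 0" by simp
  then have "(\<lambda>i. L (?F (\<lambda>z. z)) - L (?F (p i))) \<longlonglongrightarrow> 0"
    by (rule Lim_null_comparison[rotated]) (intro always_eventually allI diff)
  from tendsto_diff[OF tendsto_const[of "L (?F (\<lambda>z. z))"] this]
  have l1: "(\<lambda>i. L (?F (p i))) \<longlonglongrightarrow> L (?F (\<lambda>z. z))" by simp
  have "(\<lambda>i. LINT z|lborel. \<psi> z * cis (p i z \<bullet> \<alpha>)) \<longlonglongrightarrow> (LINT z|lborel. \<psi> z * cis (z \<bullet> \<alpha>))"
  proof (rule integral_dominated_convergence[where w = "\<lambda>z. norm (\<psi> z)"])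
    show "integrable lborel (\<lambda>z. norm (\<psi> z))" using i\<psi> by simp
    show "(\<lambda>z. \<psi> z * cis (z \<bullet> \<alpha>)) \<in> borel_measurable lborel" by measurable
    show "(\<lambda>z. \<psi> z * cis (p i z \<bullet> \<alpha>)) \<in> borel_measurable lborel" for i by measurable
    have "(\<lambda>i. cis (p i z \<bullet> \<alpha>)) \<longlonglongrightarrow> cis (z \<bullet> \<alpha>)" for z
    proof -
      have "continuous_on UNIV (\<lambda>x. cis (x \<bullet> \<alpha>))" by (intro continuous_intros)
      from continuous_on_tendsto_compose[OF this p(2)] show ?thesis by simp
    qed
    then show "AE z in lborel. (\<lambda>i. \<psi> z * cis (p i z \<bullet> \<alpha>)) \<longlonglongrightarrow> \<psi> z * cis (z \<bullet> \<alpha>)"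
      by (intro AE_I2 tendsto_mult_left)
    show "AE z in lborel. norm (\<psi> z * cis (p i z \<bullet> \<alpha>)) \<le> norm (\<psi> z)" for i by (simp add: norm_mult)
  qed
  then have "(\<lambda>i. L (?F (p i))) \<longlonglongrightarrow> L \<kappa> * (LINT z|lborel. \<psi> z * cis (z \<bullet> \<alpha>))"
    unfolding Lp by (rule tendsto_mult_left)
  with l1 show ?thesis by (rule LIMSEQ_unique)
qed

lemma convolution_commute:
  fixes f g :: "real^'n::finite \<Rightarrow> complex"
  assumes "f \<in> borel_measurable borel" "g \<in> borel_measurable borel"
  shows "(LINT z|lborel. f z * g (y - z)) = (LINT z|lborel. g z * f (y - z))"
proof -
  note [measurable] = assms
  have "(\<lambda>z. f z * g (y - z)) \<in> borel_measurable borel" by measurable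
  from lborel_integral_affine(1)[OF this, of "-1" y] show ?thesis by (simp add: mult.commute)
qed

text \<open>Both sides are \<open>L\<close> of the convolution of \<psi> and \<kappa>, evaluated by
  translating either factor. This makes \<open>L\<close> proportional to the Fourier integral at
  \<alpha>.\<close>

lemma covariant_functional:
  fixes \<kappa> \<psi> :: "real^'n::finite \<Rightarrow> complex"
  assumes L: "dual_functional b s t L" and s: "0 < s" and t: "0 < t"
    and cov: "\<And>\<psi> z. \<psi> \<in> GS_test b s t \<Longrightarrow> L (\<lambda>y. \<psi> (y - z)) = cis (z \<bullet> \<alpha>) * L \<psi>"
    and T: "\<psi> \<in> GS_test b s t" "\<kappa> \<in> GS_test b s t"
  shows "L \<kappa> * (LINT z|lborel. \<psi> z * cis (z \<bullet> \<alpha>)) = L \<psi> * (LINT z|lborel. \<kappa> z * cis (z \<bullet> \<alpha>))"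
proof -
  have "(\<lambda>y. LINT z|lborel. \<psi> z * \<kappa> (y - z)) = (\<lambda>y. LINT z|lborel. \<kappa> z * \<psi> (y - z))"
    using T by (intro ext convolution_commute smooth_measurable GS_test_smooth)
  then show ?thesis
    using covariant_functional_convolution[OF L s t cov T] covariant_functional_convolution[OF L s t cov T(2,1)] by simp
qed

text \<open>The Fourier coefficient at \<alpha> of the profile of \<open>u\<close> along the
  translates of \<open>f\<close>, in lattice coordinates and hence with a cell of volume 1.\<close>

definition twisted_mean :: "('n::finite \<Rightarrow> real^'n) \<Rightarrow> ((real^'n \<Rightarrow> complex) \<Rightarrow> complex) \<Rightarrow> real^'n \<Rightarrow> (real^'n \<Rightarrow> complex) \<Rightarrow> complex" where
  "twisted_mean e u \<alpha> f = cube_integral (\<lambda>t. u (\<lambda>y. f (y - lmap e t)) * cis (- (lmap e t \<bullet> \<alpha>)))"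

text \<open>Translation is locally Lipschitz in the seminorms at a fixed loss of scale, which
  \<open>common_scale\<close> absorbs.\<close>

lemma dual_functional_translate_continuous:
  fixes f :: "real^'n::finite \<Rightarrow> complex"
  assumes L: "dual_functional b s t L" and s: "0 < s" and t: "0 < t" and f: "f \<in> GS_test b s t"
  shows "continuous_on UNIV (\<lambda>z. L (\<lambda>y. f (y - z)))"
proof -
  define K where "K = 2 powr (1 + s)"
  have K: "0 < K" by (simp add: K_def)
  obtain h where h: "0 < h" and "cont_at b s t L (K * h)" and "\<exists>B. seminorm_le s t h B f"
    using common_scale[OF L s t f f K] by blast
  then obtain C B where C: "C \<ge> 0" "\<And>f B. f \<in> GS_test b s t \<Longrightarrow> seminorm_le s t (K * h) B f \<Longrightarrow> norm (L f) \<le> C * B"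
    and B: "seminorm_le s t h B f" unfolding cont_at_def by blast
  have T: "(\<lambda>y. f (y - z)) \<in> GS_test b s t" for z by (rule GS_test_translate[OF s t f])
  have S: "smooth f" using f by (rule GS_test_smooth)
  have lip: "norm (L (\<lambda>y. f (y - z)) - L (\<lambda>y. f (y - w))) \<le> (C * (4 * real CARD('n) * h * B * weight t (R / h))) * norm (z - w)"
    if "norm z \<le> R" "norm w \<le> R" for z w R
  proof -
    have "L (\<lambda>y. f (y - z)) - L (\<lambda>y. f (y - w)) = L (\<lambda>y. 1 * f (y - z) + (-1) * f (y - w))"
      using dual_functional_add[OF L T[of z] T[of w], of 1 "-1"] by simp
    also have "norm \<dots> \<le> C * (4 * real CARD('n) * h * B * weight t (R / h) * norm (z - w))"
    proof (rule C(2))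
      show "(\<lambda>y. 1 * f (y - z) + (-1) * f (y - w)) \<in> GS_test b s t" by (rule GS_test_linear[OF s t T T])
      show "seminorm_le s t (K * h) (4 * real CARD('n) * h * B * weight t (R / h) * norm (z - w)) (\<lambda>y. 1 * f (y - z) + (-1) * f (y - w))"
        unfolding seminorm_le_def dlist_linear[OF smooth_translate[OF S] smooth_translate[OF S]] dlist_translate K_def
        using translate_diff_bound[OF B S h t less_imp_le[OF s] that] by simp
    qed
    finally show ?thesis by (simp add: mult_ac)
  qed
  have "continuous_on (ball 0 R) (\<lambda>z. L (\<lambda>y. f (y - z)))" for R
  proof -
    let ?M = "C * (4 * real CARD('n) * h * B * weight t (R / h))"
    have "\<bar>?M\<bar>-lipschitz_on (ball 0 R) (\<lambda>z. L (\<lambda>y. f (y - z)))"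
    proof (rule lipschitz_onI)
      fix z w :: "real^'n" assume "z \<in> ball 0 R" "w \<in> ball 0 R"
      then have "norm z \<le> R" "norm w \<le> R" by auto
      from lip[OF this] have "dist (L (\<lambda>y. f (y - z))) (L (\<lambda>y. f (y - w))) \<le> ?M * dist z w"
        by (simp only: dist_norm)
      also have "\<dots> \<le> \<bar>?M\<bar> * dist z w" by (intro mult_right_mono abs_ge_self) simp
      finally show "dist (L (\<lambda>y. f (y - z))) (L (\<lambda>y. f (y - w))) \<le> \<bar>?M\<bar> * dist z w" .
    qed simp
    then show ?thesis by (rule lipschitz_on_continuous_on)
  qed
  then have "continuous_on (\<Union>R. ball 0 R) (\<lambda>z. L (\<lambda>y. f (y - z)))"
    by (intro continuous_on_open_UN) auto
  moreover have "(\<Union>R. ball (0::real^'n) R) = UNIV"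
    using gt_ex by (auto simp: mem_ball)
  ultimately show ?thesis by simp
qed

lemma zperiodic_dual_cis:
  assumes "\<alpha> \<in> dual_lattice e"
  shows "zperiodic (\<lambda>t. cis (- (lmap e t \<bullet> \<alpha>)))"
  unfolding zperiodic_def
proof (intro allI)
  fix k t
  have "\<forall>j. \<exists>k::int. e j \<bullet> \<alpha> = 2 * pi * of_int k" using assms by (simp add: dual_lattice_def)
  then obtain l where l: "\<forall>j. e j \<bullet> \<alpha> = 2 * pi * of_int (l j)" by (rule choice[THEN exE])
  have "lmap e (zvec k) \<bullet> \<alpha> = 2 * pi * of_int (\<Sum>j\<in>UNIV. k j * l j)"
    using l by (simp add: lmap_def inner_sum_left sum_distrib_left mult_ac)
  then have "cis (- (lmap e (zvec k) \<bullet> \<alpha>)) = cis (2 * pi * of_int (- (\<Sum>j\<in>UNIV. k j * l j)))" by simp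
  also have "\<dots> = 1" by (rule cis_multiple_2pi) (rule Ints_of_int)
  finally have "cis (- (lmap e (zvec k) \<bullet> \<alpha>)) = 1" .
  moreover have "- (lmap e (t + zvec k) \<bullet> \<alpha>) = - (lmap e t \<bullet> \<alpha>) + - (lmap e (zvec k) \<bullet> \<alpha>)"
    by (simp add: lmap_add inner_add_left)
  ultimately show "cis (- (lmap e (t + zvec k) \<bullet> \<alpha>)) = cis (- (lmap e t \<bullet> \<alpha>))"
    by (simp only: cis_mult[symmetric]) simp
qed

context
  fixes e :: "'n::finite \<Rightarrow> real^'n" and b :: bool and s t :: real and u :: "(real^'n \<Rightarrow> complex) \<Rightarrow> complex"
  assumes basis: "inj e" "independent (range e)" and s: "0 < s" and t: "0 < t"
    and u: "dual_functional b s t u" and per: "periodic_dist e b s t u"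
begin

lemma periodic_profile:
  assumes f: "f \<in> GS_test b s t"
  shows "zperiodic (\<lambda>r. u (\<lambda>y. f (y - lmap e r)))" and "continuous_on UNIV (\<lambda>r. u (\<lambda>y. f (y - lmap e r)))"
proof -
  show "zperiodic (\<lambda>r. u (\<lambda>y. f (y - lmap e r)))"
    unfolding zperiodic_def
  proof (intro allI)
    fix k r
    have "lmap e (zvec k) \<in> lattice e" by (simp add: lattice_eq)
    from per[unfolded periodic_dist_def, rule_format, OF this GS_test_translate[OF s t f, of "lmap e r"]]
    have "u (\<lambda>y. f (y - lmap e (zvec k) - lmap e r)) = u (\<lambda>y. f (y - lmap e r))" .
    moreover have "(\<lambda>y. f (y - lmap e (zvec k) - lmap e r)) = (\<lambda>y. f (y - lmap e (r + zvec k)))"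
      by (rule ext, rule arg_cong[where f = f]) (simp add: lmap_add)
    ultimately show "u (\<lambda>y. f (y - lmap e (r + zvec k))) = u (\<lambda>y. f (y - lmap e r))" by simp
  qed
  show "continuous_on UNIV (\<lambda>r. u (\<lambda>y. f (y - lmap e r)))"
    by (rule continuous_on_compose2[OF dual_functional_translate_continuous[OF u s t f] lmap_continuous]) simp
qed

lemma twisted_profile:
  assumes f: "f \<in> GS_test b s t" and \<alpha>: "\<alpha> \<in> dual_lattice e"
  shows "zperiodic (\<lambda>r. u (\<lambda>y. f (y - lmap e r)) * cis (- (lmap e r \<bullet> \<alpha>)))"
    and "continuous_on UNIV (\<lambda>r. u (\<lambda>y. f (y - lmap e r)) * cis (- (lmap e r \<bullet> \<alpha>)))"
proof -
  show "zperiodic (\<lambda>r. u (\<lambda>y. f (y - lmap e r)) * cis (- (lmap e r \<bullet> \<alpha>)))"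
    by (rule zperiodic_mult[OF periodic_profile(1)[OF f] zperiodic_dual_cis[OF \<alpha>]])
  show "continuous_on UNIV (\<lambda>r. u (\<lambda>y. f (y - lmap e r)) * cis (- (lmap e r \<bullet> \<alpha>)))"
    by (intro continuous_intros periodic_profile(2)[OF f] lmap_continuous)
qed

lemma lmap_bounded_on_ucube: "\<exists>R. \<forall>r\<in>ucube 0. norm (lmap e r) \<le> R"
proof -
  have "bounded (lmap e ` cbox 0 1)"
    by (rule compact_imp_bounded) (rule compact_continuous_image[OF lmap_continuous compact_cbox])
  then obtain R where "\<forall>x\<in>lmap e ` cbox 0 1. norm x \<le> R" unfolding bounded_iff by blast
  then show ?thesis using ucube_subset[of 0] by auto
qed

text \<open>The average runs over a bounded cell, so a single enlargement of the scale from
  \<open>h\<close> to \<open>2 h\<close> serves all translates involved.\<close>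

lemma twisted_mean_dual_functional:
  assumes \<alpha>: "\<alpha> \<in> dual_lattice e"
  shows "dual_functional b s t (twisted_mean e u \<alpha>)"
proof -
  let ?c = "\<lambda>r. cis (- (lmap e r \<bullet> \<alpha>))"
  have int: "integrable lborel (\<lambda>r. indicator (ucube 0) r *\<^sub>R (u (\<lambda>y. f (y - lmap e r)) * ?c r))" if f: "f \<in> GS_test b s t" for f
  proof -
    obtain B where "\<forall>r. norm (u (\<lambda>y. f (y - lmap e r)) * ?c r) \<le> B"
      using zperiodic_bounded[OF twisted_profile[OF f \<alpha>]] by blast
    then show ?thesis
      by (intro integrable_ucube[OF borel_measurable_continuous_onI[OF twisted_profile(2)[OF f \<alpha>]]]) blast
  qed
  have lin: "twisted_mean e u \<alpha> (\<lambda>x. a * f x + c * g x) = a * twisted_mean e u \<alpha> f + c * twisted_mean e u \<alpha> g"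
    if T: "f \<in> GS_test b s t" "g \<in> GS_test b s t" for f g a c
  proof -
    have "u (\<lambda>y. a * f (y - z) + c * g (y - z)) = a * u (\<lambda>y. f (y - z)) + c * u (\<lambda>y. g (y - z))" for z
      by (rule dual_functional_add[OF u GS_test_translate[OF s t T(1)] GS_test_translate[OF s t T(2)]])
    then have "twisted_mean e u \<alpha> (\<lambda>x. a * f x + c * g x) =
      (LINT r|lborel. a * (indicator (ucube 0) r *\<^sub>R (u (\<lambda>y. f (y - lmap e r)) * ?c r)) + c * (indicator (ucube 0) r *\<^sub>R (u (\<lambda>y. g (y - lmap e r)) * ?c r)))"
      unfolding twisted_mean_def cube_integral_def
      by (intro Bochner_Integration.integral_cong refl) (simp add: algebra_simps)
    also have "\<dots> = a * twisted_mean e u \<alpha> f + c * twisted_mean e u \<alpha> g"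
      unfolding twisted_mean_def cube_integral_def
      by (simp only: Bochner_Integration.integral_add integrable_mult_right int[OF T(1)] int[OF T(2)] integral_mult_right_zero)
    finally show ?thesis .
  qed
  obtain R where R: "\<And>r. r \<in> ucube 0 \<Longrightarrow> norm (lmap e r) \<le> R" using lmap_bounded_on_ucube by blast
  have cont: "cont_at b s t (twisted_mean e u \<alpha>) h" if h: "0 < h" and c: "cont_at b s t u (2 * h)" for h
  proof -
    obtain C where C: "C \<ge> 0" "\<And>f B. f \<in> GS_test b s t \<Longrightarrow> seminorm_le s t (2 * h) B f \<Longrightarrow> norm (u f) \<le> C * B"
      using c unfolding cont_at_def by blast
    have "norm (twisted_mean e u \<alpha> f) \<le> (C * (2 * \<bar>weight t (R / h)\<bar>)) * B" if f: "f \<in> GS_test b s t" "seminorm_le s t h B f" for f B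
    proof -
      have B: "0 \<le> B" by (rule seminorm_le_nonneg[OF f(2)])
      have "norm (u (\<lambda>y. f (y - lmap e r)) * ?c r) \<le> C * (2 * B * weight t (R / h))" if "r \<in> ucube 0" for r
        using C(2)[OF GS_test_translate[OF s t f(1)] seminorm_translate[OF f(2) h t R[OF that]]] by (simp add: norm_mult)
      then have "norm (twisted_mean e u \<alpha> f) \<le> C * (2 * B * weight t (R / h))"
        unfolding twisted_mean_def
        by (intro cube_integral_norm_le borel_measurable_continuous_onI[OF twisted_profile(2)[OF f(1) \<alpha>]])
      also have "\<dots> \<le> C * (2 * B * \<bar>weight t (R / h)\<bar>)" using C(1) B by (intro mult_left_mono) auto
      finally show ?thesis by (simp add: mult_ac)
    qed
    moreover have "0 \<le> C * (2 * \<bar>weight t (R / h)\<bar>)" using C(1) by simp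
    ultimately show ?thesis unfolding cont_at_def by blast
  qed
  show ?thesis
    unfolding dual_functional_def
  proof (intro conjI ballI allI lin)
    show "if b then \<forall>h>0. cont_at b s t (twisted_mean e u \<alpha>) h else \<exists>h>0. cont_at b s t (twisted_mean e u \<alpha>) h"
    proof (cases b)
      case True
      then have "cont_at b s t u h" if "0 < h" for h using u that by (simp add: dual_functional_def)
      then have "cont_at b s t (twisted_mean e u \<alpha>) h" if "0 < h" for h using that by (intro cont) simp_all
      then show ?thesis using True by simp
    next
      case False
      then obtain h where h: "0 < h" "cont_at b s t u h" using u by (auto simp: dual_functional_def)
      then have "cont_at b s t (twisted_mean e u \<alpha>) (h / 2)" by (intro cont) simp_all
      moreover have "0 < h / 2" using h by simp
      ultimately have "\<exists>h>0. cont_at b s t (twisted_mean e u \<alpha>) h" by blast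
      then show ?thesis using False by simp
    qed
  qed
qed

text \<open>Translating \<open>f\<close> by \<open>z = lmap e r0\<close> shifts the variable of
  integration by \<open>r0\<close>. Integrals of periodic functions over a unit cube are invariant
  under shifts, so only the character is left over.\<close>

lemma twisted_mean_covariant:
  assumes \<alpha>: "\<alpha> \<in> dual_lattice e" and f: "f \<in> GS_test b s t"
  shows "twisted_mean e u \<alpha> (\<lambda>y. f (y - z)) = cis (z \<bullet> \<alpha>) * twisted_mean e u \<alpha> f"
proof -
  obtain r0 where z: "z = lmap e r0" using lmap_surj[OF basis] by blast
  let ?Q = "\<lambda>r. u (\<lambda>y. f (y - lmap e r)) * cis (- (lmap e r \<bullet> \<alpha>))"
  have "u (\<lambda>y. f (y - lmap e r - z)) * cis (- (lmap e r \<bullet> \<alpha>)) = cis (z \<bullet> \<alpha>) * ?Q (r + r0)" for r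
  proof -
    have 1: "(\<lambda>y. f (y - lmap e r - z)) = (\<lambda>y. f (y - lmap e (r + r0)))"
      by (rule ext, rule arg_cong[where f = f]) (simp add: lmap_add z)
    have 2: "cis (- (lmap e r \<bullet> \<alpha>)) = cis (z \<bullet> \<alpha>) * cis (- (lmap e (r + r0) \<bullet> \<alpha>))"
      by (simp add: lmap_add z inner_add_left cis_mult)
    show ?thesis unfolding 1 2 by (simp only: mult.left_commute)
  qed
  then have "twisted_mean e u \<alpha> (\<lambda>y. f (y - z)) = (LINT r|lborel. cis (z \<bullet> \<alpha>) * (indicator (ucube 0) r *\<^sub>R ?Q (r + r0)))"
    unfolding twisted_mean_def cube_integral_def
    by (intro Bochner_Integration.integral_cong refl) (simp only: mult_scaleR_right)
  also have "\<dots> = cis (z \<bullet> \<alpha>) * (LINT r|lborel. indicator (ucube 0) r *\<^sub>R ?Q (r + r0))"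
    by (rule integral_mult_right_zero)
  also have "(LINT r|lborel. indicator (ucube 0) r *\<^sub>R ?Q (r + r0)) = cube_integral ?Q"
    by (rule cube_integral_shift[OF twisted_profile[OF f \<alpha>]])
  finally show ?thesis unfolding twisted_mean_def .
qed

end

section \<open>Exponential decay of Fourier transforms\<close>

text \<open>Unnormalized and with positive sign: the value is the pairing with the character of
  frequency \<alpha>, and the factor \<open>(2 pi)^(n/2)\<close> of the formal series
  cancels.\<close>

definition ftrans :: "(real^'n::finite \<Rightarrow> complex) \<Rightarrow> real^'n \<Rightarrow> complex" where
  "ftrans f \<alpha> = (LINT y|lborel. f y * cis (y \<bullet> \<alpha>))"

lemma fourier_ftrans:
  fixes f :: "real^'n::finite \<Rightarrow> complex"
  shows "complex_of_real ((2 * pi) powr (real CARD('n) / 2)) * c * fourier f (- \<alpha>) = c * ftrans f \<alpha>"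
proof -
  have "complex_of_real ((2 * pi) powr (real CARD('n) / 2)) * complex_of_real ((2 * pi) powr (- real CARD('n) / 2)) = 1"
    by (simp flip: of_real_mult powr_add)
  then have "complex_of_real ((2 * pi) powr (real CARD('n) / 2)) * (complex_of_real ((2 * pi) powr (- real CARD('n) / 2)) * x) = x" for x
    by (simp only: mult.assoc[symmetric]) simp
  then show ?thesis by (simp add: fourier_def ftrans_def mult_ac)
qed

lemma norm_ftrans_le:
  "norm (ftrans f \<alpha>) \<le> (LINT y|lborel. norm (f y))"
  unfolding ftrans_def by (rule order_trans[OF integral_norm_bound]) (simp add: norm_mult)

text \<open>The modulus is independent of \<open>x\<close> and depends on \<xi> and \<alpha> only
  through their difference. This is used both to normalize the coefficients and to bound
  \<open>stft\<close>.\<close>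

lemma ftrans_window:
  fixes \<phi> :: "real^'n::finite \<Rightarrow> complex"
  assumes [measurable]: "\<phi> \<in> borel_measurable borel"
  shows "ftrans (stft_window \<phi> x \<xi>) \<alpha> = cis (x \<bullet> (\<alpha> - \<xi>)) * cnj (ftrans \<phi> (\<xi> - \<alpha>))"
proof -
  let ?G = "\<lambda>y. cnj (\<phi> (y - x)) * cis (- (y \<bullet> \<xi>)) * cis (y \<bullet> \<alpha>)"
  have m: "?G \<in> borel_measurable borel"
  proof -
    have [measurable]: "(\<lambda>y. cnj (\<phi> (y - x))) \<in> borel_measurable borel"
      by (rule measurable_compose[where g = cnj]) (measurable, intro borel_measurable_continuous_onI continuous_intros)
    have [measurable]: "(\<lambda>y::real^'n. cis (- (y \<bullet> \<xi>))) \<in> borel_measurable borel"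
      by (intro borel_measurable_continuous_onI continuous_intros)
    show ?thesis by measurable
  qed
  have "ftrans (stft_window \<phi> x \<xi>) \<alpha> = (LINT y|lborel. ?G y)"
    by (simp add: ftrans_def stft_window_def)
  also have "\<dots> = (LINT y|lborel. ?G (y + x))"
    by (rule lborel_integral_translate(1)[OF m, symmetric])
  also have "\<dots> = (LINT y|lborel. cis (x \<bullet> (\<alpha> - \<xi>)) * cnj (\<phi> y * cis (y \<bullet> (\<xi> - \<alpha>))))"
  proof (rule Bochner_Integration.integral_cong[OF refl])
    fix y
    have "- ((y + x) \<bullet> \<xi>) + (y + x) \<bullet> \<alpha> = x \<bullet> (\<alpha> - \<xi>) + - (y \<bullet> (\<xi> - \<alpha>))"
      by (simp add: inner_add_left inner_diff_right)
    then have "cis (- ((y + x) \<bullet> \<xi>)) * cis ((y + x) \<bullet> \<alpha>) = cis (x \<bullet> (\<alpha> - \<xi>)) * cis (- (y \<bullet> (\<xi> - \<alpha>)))"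
      unfolding cis_mult by (rule arg_cong)
    then show "?G (y + x) = cis (x \<bullet> (\<alpha> - \<xi>)) * cnj (\<phi> y * cis (y \<bullet> (\<xi> - \<alpha>)))"
      by (simp only: mult.assoc complex_cnj_mult cis_cnj add_diff_cancel_right') (simp only: mult.left_commute)
  qed
  also have "\<dots> = cis (x \<bullet> (\<alpha> - \<xi>)) * cnj (ftrans \<phi> (\<xi> - \<alpha>))"
    unfolding ftrans_def integral_mult_right_zero Bochner_Integration.integral_cnj ..
  finally show ?thesis .
qed

text \<open>The partial derivative of \<open>g\<close> times a character has integral 0 by
  \<open>integral_partial_zero\<close>.\<close>

lemma ftrans_dpart:
  fixes g :: "real^'n::finite \<Rightarrow> complex"
  assumes g: "smooth g"
    and b1: "\<And>y. norm (g y) \<le> K / (1 + norm y) ^ (CARD('n) + 1)"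
    and b2: "\<And>y. norm (dpart i g y) \<le> K / (1 + norm y) ^ (CARD('n) + 1)"
  shows "ftrans (dpart i g) \<alpha> = - (\<i> * of_real (\<alpha> $ i)) * ftrans g \<alpha>"
proof -
  have [measurable]: "g \<in> borel_measurable borel" "dpart i g \<in> borel_measurable borel"
    using smooth_measurable smooth_dpart g by blast+
  have int: "integrable lborel f" if "f \<in> borel_measurable borel" "\<And>y. norm (f y) \<le> K / (1 + norm y) ^ (CARD('n) + 1)"
    for f :: "real^'n \<Rightarrow> complex"
  proof (rule Bochner_Integration.integrable_bound)
    show "integrable lborel (\<lambda>y::real^'n. K * (1 / (1 + norm y) ^ (CARD('n) + 1)))"
      using integrable_decay[where 'a = "real^'n"] by (intro integrable_mult_right) simp
    show "f \<in> borel_measurable lborel" using that(1) by simp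
    show "AE y in lborel. norm (f y) \<le> norm (K * (1 / (1 + norm y) ^ (CARD('n) + 1)))"
    proof (intro AE_I2)
      fix y
      have "norm (f y) \<le> K * (1 / (1 + norm y) ^ (CARD('n) + 1))" using that(2)[of y] by simp
      also have "\<dots> \<le> norm (K * (1 / (1 + norm y) ^ (CARD('n) + 1)))" unfolding real_norm_def by (rule abs_ge_self)
      finally show "norm (f y) \<le> norm (K * (1 / (1 + norm y) ^ (CARD('n) + 1)))" .
    qed
  qed
  have ig: "integrable lborel g" "integrable lborel (dpart i g)" by (rule int; use b1 b2 in simp)+
  let ?a = "\<i> * of_real (\<alpha> $ i)"
  define F' where "F' y = dpart i g y * cis (y \<bullet> \<alpha>) + ?a * (g y * cis (y \<bullet> \<alpha>))" for y
  have "(LINT y|lborel. F' y) = 0"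
  proof (rule integral_partial_zero[where F = "\<lambda>y. g y * cis (y \<bullet> \<alpha>)" and e = "axis i 1" and K = "K + \<bar>\<alpha> $ i\<bar> * K"])
    show "(\<lambda>y. g y * cis (y \<bullet> \<alpha>)) \<in> borel_measurable borel" by measurable
    show "integrable lborel (\<lambda>y. g y * cis (y \<bullet> \<alpha>))" by (rule integrable_mult_cis[OF ig(1)])
    show "norm (axis i 1 :: real^'n) \<le> 1" by simp
    fix y
    have d1: "((\<lambda>t. g (y + t *\<^sub>R axis i 1)) has_vector_derivative dpart i g y) (at 0)"
      using smooth_has_vector_derivative[OF g, of y i 0] by simp
    have d2: "((\<lambda>t. cis ((y + t *\<^sub>R axis i 1) \<bullet> \<alpha>)) has_vector_derivative cis (y \<bullet> \<alpha>) * ?a) (at 0)"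
    proof -
      have "((\<lambda>t. (y + t *\<^sub>R axis i 1) \<bullet> \<alpha>) has_derivative (\<lambda>t. t * \<alpha> $ i)) (at 0)"
        by (auto intro!: derivative_eq_intros simp: inner_axis')
      from has_derivative_cis[OF this] show ?thesis
        unfolding has_vector_derivative_def by (simp add: scaleR_conv_of_real mult_ac)
    qed
    show "((\<lambda>t. g (y + t *\<^sub>R axis i 1) * cis ((y + t *\<^sub>R axis i 1) \<bullet> \<alpha>)) has_vector_derivative F' y) (at 0)"
      using has_vector_derivative_mult[OF d1 d2] by (simp add: F'_def algebra_simps)
    have "norm (F' y) \<le> norm (dpart i g y) + \<bar>\<alpha> $ i\<bar> * norm (g y)"
      unfolding F'_def by (rule order_trans[OF norm_triangle_ineq]) (simp add: norm_mult)
    also have "\<dots> \<le> K / (1 + norm y) ^ (CARD('n) + 1) + \<bar>\<alpha> $ i\<bar> * (K / (1 + norm y) ^ (CARD('n) + 1))"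
      by (intro add_mono b2 mult_left_mono b1) simp
    finally show "norm (F' y) \<le> (K + \<bar>\<alpha> $ i\<bar> * K) / (1 + norm y) ^ (DIM(real^'n) + 1)"
      by (simp add: add_divide_distrib)
  qed
  moreover have "(LINT y|lborel. F' y) = ftrans (dpart i g) \<alpha> + ?a * ftrans g \<alpha>"
    unfolding F'_def ftrans_def
    by (simp only: Bochner_Integration.integral_add integrable_mult_cis ig integrable_mult_right integral_mult_right_zero)
  ultimately show ?thesis by (simp add: eq_neg_iff_add_eq_0)
qed

lemma ftrans_dlist_replicate:
  fixes f :: "real^'n::finite \<Rightarrow> complex"
  assumes f: "smooth f" "seminorm_le s t h B f" and h: "0 < h" and t: "0 < t"
  shows "ftrans (dlist (replicate k i) f) \<alpha> = (- (\<i> * of_real (\<alpha> $ i))) ^ k * ftrans f \<alpha>"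
proof (induction k)
  case (Suc k)
  let ?m = "CARD('n) + 1"
  define K1 where "K1 = decay_const t h ?m * B * h ^ k * fact k powr s"
  define K2 where "K2 = decay_const t h ?m * B * h ^ Suc k * fact (Suc k) powr s"
  have p: "0 < (1 + norm y) ^ ?m" for y :: "real^'n" by (intro zero_less_power add_pos_nonneg) auto
  have "ftrans (dpart i (dlist (replicate k i) f)) \<alpha> = - (\<i> * of_real (\<alpha> $ i)) * ftrans (dlist (replicate k i) f) \<alpha>"
  proof (rule ftrans_dpart[OF smooth_dlist[OF f(1)], where K = "max K1 K2"])
    fix y
    have "norm (dlist (replicate k i) f y) \<le> K1 / (1 + norm y) ^ ?m"
      using seminorm_decay[OF f(2) h t, of "replicate k i" y ?m] unfolding K1_def by simp
    also have "\<dots> \<le> max K1 K2 / (1 + norm y) ^ ?m"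
      by (rule divide_right_mono[OF _ less_imp_le[OF p]]) simp
    finally show "norm (dlist (replicate k i) f y) \<le> max K1 K2 / (1 + norm y) ^ ?m" .
    have "norm (dlist (i # replicate k i) f y) \<le> K2 / (1 + norm y) ^ ?m"
      using seminorm_decay[OF f(2) h t, of "i # replicate k i" y ?m] unfolding K2_def by (simp only: length_Cons length_replicate)
    also have "\<dots> \<le> max K1 K2 / (1 + norm y) ^ ?m"
      by (rule divide_right_mono[OF _ less_imp_le[OF p]]) simp
    finally show "norm (dpart i (dlist (replicate k i) f) y) \<le> max K1 K2 / (1 + norm y) ^ ?m" by simp
  qed
  then show ?case using Suc.IH by simp
qed simp

text \<open>For given \<alpha> all \<open>k\<close> derivatives are taken in the direction of its
  largest coordinate, whence the factor \<open>n^k\<close>. Decay of order \<open>n + 1\<close>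
  bounds their integrals.\<close>

lemma ftrans_gevrey_decay:
  fixes f :: "real^'n::finite \<Rightarrow> complex"
  assumes f: "smooth f" "seminorm_le s t h B f" and h: "0 < h" and t: "0 < t"
  shows "\<exists>C\<ge>0. \<forall>\<alpha> k. norm (ftrans f \<alpha>) * norm \<alpha> ^ k \<le> C * (real CARD('n) * h) ^ k * fact k powr s"
proof -
  let ?m = "CARD('n) + 1" and ?n = "real CARD('n)"
  define I where "I = (LINT y::real^'n|lborel. 1 / (1 + norm y) ^ ?m)"
  define D where "D = decay_const t h ?m * B"
  have iI: "integrable lborel (\<lambda>y::real^'n. 1 / (1 + norm y) ^ ?m)"
    using integrable_decay[where 'a = "real^'n"] by simp
  have I0: "0 \<le> I" unfolding I_def by (rule integral_nonneg_AE) simp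
  have D0: "0 \<le> D" unfolding D_def using seminorm_le_nonneg[OF f(2)] decay_const_nonneg[of h] h by simp
  have "norm (ftrans f \<alpha>) * norm \<alpha> ^ k \<le> (D * I) * (?n * h) ^ k * fact k powr s" for \<alpha> k
  proof -
    obtain i where i: "norm \<alpha> ^ k \<le> ?n ^ k * \<bar>\<alpha> $ i\<bar> ^ k" using norm_power_le_component by blast
    have "norm (ftrans f \<alpha>) * \<bar>\<alpha> $ i\<bar> ^ k = norm (ftrans (dlist (replicate k i) f) \<alpha>)"
      unfolding ftrans_dlist_replicate[OF f h t] by (simp add: norm_mult norm_power)
    also have "\<dots> \<le> (LINT y|lborel. norm (dlist (replicate k i) f y))" by (rule norm_ftrans_le)
    also have "\<dots> \<le> (LINT y::real^'n|lborel. (D * h ^ k * fact k powr s) * (1 / (1 + norm y) ^ ?m))"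
    proof (rule Bochner_Integration.integral_mono)
      show "integrable lborel (\<lambda>y. norm (dlist (replicate k i) f y))"
        by (rule integrable_norm[OF seminorm_integrable[OF f(2,1) h t]])
      show "integrable lborel (\<lambda>y::real^'n. (D * h ^ k * fact k powr s) * (1 / (1 + norm y) ^ ?m))"
        by (rule integrable_mult_right[OF iI])
      fix y
      show "norm (dlist (replicate k i) f y) \<le> (D * h ^ k * fact k powr s) * (1 / (1 + norm y) ^ ?m)"
        using seminorm_decay[OF f(2) h t, of "replicate k i" y ?m] by (simp add: D_def)
    qed
    also have "\<dots> = (D * h ^ k * fact k powr s) * I" unfolding I_def by (rule integral_mult_right_zero)
    finally have 1: "norm (ftrans f \<alpha>) * \<bar>\<alpha> $ i\<bar> ^ k \<le> (D * h ^ k * fact k powr s) * I" .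
    have "norm (ftrans f \<alpha>) * norm \<alpha> ^ k \<le> norm (ftrans f \<alpha>) * (?n ^ k * \<bar>\<alpha> $ i\<bar> ^ k)"
      by (rule mult_left_mono[OF i]) simp
    also have "\<dots> = ?n ^ k * (norm (ftrans f \<alpha>) * \<bar>\<alpha> $ i\<bar> ^ k)" by simp
    also have "\<dots> \<le> ?n ^ k * ((D * h ^ k * fact k powr s) * I)" by (rule mult_left_mono[OF 1]) simp
    also have "\<dots> = (D * I) * (?n * h) ^ k * fact k powr s" by (simp add: power_mult_distrib mult_ac)
    finally show ?thesis .
  qed
  moreover have "0 \<le> D * I" using D0 I0 by simp
  ultimately show ?thesis by blast
qed

section \<open>Gevrey bounds versus exponential decay\<close>

text \<open>The power \<open>1/s\<close> turns \<open>fact k powr s\<close> into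
  \<open>fact k\<close>, so the bounds sum up to an exponential series. Evaluating it at half the
  argument makes the right side geometric; hence 1/2 in the rate and \<open>2 powr s\<close> in the
  constant.\<close>

lemma gevrey_to_exp:
  fixes A C x h s :: real
  assumes A: "0 \<le> A" and C: "0 \<le> C" and x: "0 \<le> x" and h: "0 < h" and s: "0 < s"
    and bd: "\<And>k. A * x ^ k \<le> C * h ^ k * fact k powr s"
  shows "A \<le> (2 powr s * C) * exp (- (s / 2 * (1 / h) powr (1 / s)) * x powr (1 / s))"
proof (cases "x = 0")
  case True
  have "A \<le> C" using bd[of 0] by simp
  also have "\<dots> \<le> 2 powr s * C" using C s ge_one_powr_ge_zero[of 2 s] by (simp add: mult_le_cancel_right1)
  finally show ?thesis using True s by simp
next
  case False
  then have x0: "0 < x" using x by simp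
  define y where "y = (x / h) powr (1 / s)"
  define a where "a = A powr (1 / s)"
  define c where "c = C powr (1 / s)"
  have y: "0 < y" using x0 h by (simp add: y_def)
  have ac: "0 \<le> a" "0 \<le> c" by (simp_all add: a_def c_def)
  have 1: "a * y ^ k \<le> c * fact k" for k
  proof -
    have "A * (x / h) ^ k \<le> C * fact k powr s"
      using bd[of k] h by (simp add: power_divide field_simps)
    then have "(A * (x / h) ^ k) powr (1 / s) \<le> (C * fact k powr s) powr (1 / s)"
      using s A x h by (intro powr_mono2) auto
    moreover have "(A * (x / h) ^ k) powr (1 / s) = a * y ^ k"
      unfolding a_def y_def powr_mult using x0 h by (simp add: power_powr_swap)
    moreover have "(C * fact k powr s) powr (1 / s) = c * fact k"
      unfolding c_def powr_mult using s by (simp add: powr_powr)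
    ultimately show ?thesis by simp
  qed
  have "a * exp (y / 2) = (\<Sum>k. a * ((y / 2) ^ k /\<^sub>R fact k))"
    unfolding exp_def by (rule suminf_mult[symmetric]) (rule summable_exp_generic)
  also have "\<dots> \<le> (\<Sum>k. c * (1/2) ^ k)"
  proof (rule suminf_le)
    show "a * ((y / 2) ^ k /\<^sub>R fact k) \<le> c * (1/2) ^ k" for k
      using 1[of k] by (simp add: field_simps power_divide)
    show "summable (\<lambda>k. a * ((y / 2) ^ k /\<^sub>R fact k))" by (intro summable_mult summable_exp_generic)
    show "summable (\<lambda>k. c * (1/2 :: real) ^ k)" by (intro summable_mult summable_geometric) simp
  qed
  also have "\<dots> = 2 * c" by (subst suminf_mult) (simp_all add: suminf_geometric summable_geometric)
  finally have "a * exp (y / 2) \<le> 2 * c" .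
  then have "(a * exp (y / 2)) powr s \<le> (2 * c) powr s" using ac s by (intro powr_mono2) auto
  moreover have "(a * exp (y / 2)) powr s = A * exp (s * y / 2)"
    unfolding powr_mult a_def using A s by (simp add: powr_powr powr_def[of "exp _"] mult.commute)
  moreover have "(2 * c) powr s = 2 powr s * C"
    unfolding powr_mult c_def using C s by (simp add: powr_powr)
  ultimately have "A * exp (s * y / 2) \<le> 2 powr s * C" by simp
  then have "A * exp (s * y / 2) * exp (- (s * y / 2)) \<le> (2 powr s * C) * exp (- (s * y / 2))"
    by (intro mult_right_mono) auto
  then have "A \<le> (2 powr s * C) * exp (- (s * y / 2))" by (simp add: mult.assoc flip: exp_add)
  moreover have "s * y / 2 = (s / 2 * (1 / h) powr (1 / s)) * x powr (1 / s)"
    using x0 h by (simp add: y_def powr_divide)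
  ultimately show ?thesis by simp
qed

text \<open>The power \<open>s\<close> of \<open>y^k \<le> fact k * exp y\<close> at
  \<open>y = (r / s) x^(1/s)\<close>, chosen so that the exponential becomes exactly
  \<open>exp (r x^(1/s))\<close>.\<close>

lemma exp_to_gevrey:
  fixes x r s :: real
  assumes x: "0 \<le> x" and r: "0 < r" and s: "0 < s"
  shows "x ^ k * exp (- r * x powr (1 / s)) \<le> ((s / r) powr s) ^ k * fact k powr s"
proof (cases "x = 0")
  case True
  then show ?thesis using r s by (cases k) auto
next
  case False
  then have x0: "0 < x" using x by simp
  define y where "y = r * x powr (1 / s) / s"
  have y: "0 < y" using x0 r s by (simp add: y_def)
  have "(y ^ k) powr s \<le> (fact k * exp y) powr s"
    using power_le_fact_exp[of y k] y s by (intro powr_mono2) auto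
  moreover have "(y ^ k) powr s = (y powr s) ^ k" by (rule power_powr_swap[OF y])
  moreover have "y powr s = (r / s) powr s * x"
  proof -
    have "y = (r / s) * x powr (1 / s)" by (simp add: y_def)
    then have "y powr s = (r / s) powr s * (x powr (1 / s)) powr s" by (simp only: powr_mult)
    then show ?thesis using x0 s by (simp add: powr_powr)
  qed
  moreover have "(fact k * exp y) powr s = fact k powr s * exp (r * x powr (1 / s))"
    unfolding powr_mult using s by (simp add: powr_def[of "exp _"] y_def)
  ultimately have 1: "((r / s) powr s) ^ k * x ^ k \<le> fact k powr s * exp (r * x powr (1 / s))"
    by (simp add: power_mult_distrib)
  have inv: "((s / r) powr s) ^ k * ((r / s) powr s) ^ k = 1"
    using r s by (simp flip: power_mult_distrib powr_mult)
  have "x ^ k * exp (- r * x powr (1 / s)) = ((s / r) powr s) ^ k * (((r / s) powr s) ^ k * x ^ k) * exp (- r * x powr (1 / s))"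
    using inv by (simp add: mult.assoc[symmetric])
  also have "\<dots> \<le> ((s / r) powr s) ^ k * (fact k powr s * exp (r * x powr (1 / s))) * exp (- r * x powr (1 / s))"
    by (intro mult_right_mono mult_left_mono 1) auto
  also have "\<dots> = ((s / r) powr s) ^ k * fact k powr s" by (simp add: mult.assoc flip: exp_add)
  finally show ?thesis .
qed

lemma exp_le_inverse_power:
  fixes r s :: real
  assumes r: "0 < r" and s: "0 < s"
  shows "\<exists>C>0. \<forall>x\<ge>0. exp (- r * x powr (1 / s)) \<le> C * (1 / (1 + x) ^ m)"
proof -
  define C where "C = 2 ^ m * (1 + ((s / r) powr s) ^ m * fact m powr s)"
  have C: "C > 0" unfolding C_def by (intro mult_pos_pos add_pos_nonneg) auto
  have "exp (- r * x powr (1 / s)) \<le> C * (1 / (1 + x) ^ m)" if x: "0 \<le> x" for x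
  proof -
    let ?E = "exp (- r * x powr (1 / s))"
    have "(1 + x) ^ m * ?E \<le> (2 ^ m * (1 + x ^ m)) * ?E"
      by (intro mult_right_mono one_plus_power_le x) simp
    also have "\<dots> = 2 ^ m * (x ^ 0 * ?E + x ^ m * ?E)" by (simp add: algebra_simps)
    also have "\<dots> \<le> 2 ^ m * (((s / r) powr s) ^ 0 * fact 0 powr s + ((s / r) powr s) ^ m * fact m powr s)"
      by (intro mult_left_mono add_mono exp_to_gevrey x r s) simp
    finally have "(1 + x) ^ m * ?E \<le> C" by (simp add: C_def)
    moreover have "0 < (1 + x) ^ m" using x by (intro zero_less_power) simp
    ultimately show ?thesis by (simp add: pos_le_divide_eq mult.commute)
  qed
  then show ?thesis using C by blast
qed

text \<open>For exponents above 1 subadditivity fails; the factor \<open>2 powr p\<close> gives a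
  substitute valid for all \<open>p \<ge> 0\<close>.\<close>

lemma norm_add_powr_le:
  fixes a b :: "'a::real_normed_vector"
  assumes p: "0 \<le> p"
  shows "norm (a + b) powr p \<le> 2 powr p * (norm a powr p + norm b powr p)"
proof -
  have "norm (a + b) \<le> 2 * max (norm a) (norm b)" using norm_triangle_ineq[of a b] by linarith
  then have "norm (a + b) powr p \<le> (2 * max (norm a) (norm b)) powr p" using p by (intro powr_mono2) auto
  also have "\<dots> = 2 powr p * max (norm a) (norm b) powr p" by (rule powr_mult)
  also have "\<dots> \<le> 2 powr p * (norm a powr p + norm b powr p)" by (intro mult_left_mono) (auto simp: max_def)
  finally show ?thesis .
qed

lemma exp_decay_summable:
  fixes e :: "'n::finite \<Rightarrow> real^'n"
  assumes basis: "inj e" "independent (range e)" and r: "0 < r" and s: "0 < s"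
  shows "(\<lambda>\<alpha>. exp (- r * norm \<alpha> powr (1 / s))) summable_on dual_lattice e"
proof -
  obtain C where C: "C > 0" "\<And>x. 0 \<le> x \<Longrightarrow> exp (- r * x powr (1 / s)) \<le> C * (1 / (1 + x) ^ (2 * CARD('n)))"
    using exp_le_inverse_power[OF r s, of "2 * CARD('n)"] by blast
  have "(\<lambda>\<alpha>. C * (1 / (1 + norm \<alpha>) ^ (2 * CARD('n)))) summable_on dual_lattice e"
    by (rule summable_on_cmult_right[OF dual_lattice_summable[OF basis]])
  then show ?thesis by (rule summable_on_comparison_test) (use C in simp_all)
qed

lemma ftrans_exp_decay:
  fixes f :: "real^'n::finite \<Rightarrow> complex"
  assumes s: "0 < s" and t: "0 < t" and f: "f \<in> GS_test b s t"
  shows "if b then \<exists>r>0. \<exists>C>0. \<forall>\<alpha>. norm (ftrans f \<alpha>) \<le> C * exp (- r * norm \<alpha> powr (1 / s))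
    else \<forall>r>0. \<exists>C>0. \<forall>\<alpha>. norm (ftrans f \<alpha>) \<le> C * exp (- r * norm \<alpha> powr (1 / s))"
proof -
  let ?n = "real CARD('n)"
  have n0: "?n > 0" by simp
  have *: "\<exists>C>0. \<forall>\<alpha>. norm (ftrans f \<alpha>) \<le> C * exp (- (s / 2 * (1 / (?n * h)) powr (1 / s)) * norm \<alpha> powr (1 / s))"
    if h: "0 < h" and B: "seminorm_le s t h B f" for h B
  proof -
    obtain C where C: "C \<ge> 0" "\<And>\<alpha> k. norm (ftrans f \<alpha>) * norm \<alpha> ^ k \<le> C * (?n * h) ^ k * fact k powr s"
      using ftrans_gevrey_decay[OF GS_test_smooth[OF f] B h t] by blast
    \<comment> \<open>The added 1 makes the constant strictly positive.\<close>
    have "norm (ftrans f \<alpha>) \<le> (2 powr s * C + 1) * exp (- (s / 2 * (1 / (?n * h)) powr (1 / s)) * norm \<alpha> powr (1 / s))" for \<alpha>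
    proof -
      have "norm (ftrans f \<alpha>) \<le> (2 powr s * C) * exp (- (s / 2 * (1 / (?n * h)) powr (1 / s)) * norm \<alpha> powr (1 / s))"
        by (rule gevrey_to_exp) (use C h n0 s in simp_all)
      also have "\<dots> \<le> (2 powr s * C + 1) * exp (- (s / 2 * (1 / (?n * h)) powr (1 / s)) * norm \<alpha> powr (1 / s))"
        by (rule mult_right_mono) simp_all
      finally show ?thesis .
    qed
    moreover have "0 < 2 powr s * C + 1" using C(1) by (simp add: add_nonneg_pos)
    ultimately show ?thesis by blast
  qed
  show ?thesis
  proof (cases b)
    case True
    then obtain h B where h: "0 < h" "seminorm_le s t h B f" using f s t by (auto simp: GS_test_iff)
    have "0 < s / 2 * (1 / (?n * h)) powr (1 / s)" using s h n0 by simp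
    with *[OF h] have "\<exists>r>0. \<exists>C>0. \<forall>\<alpha>. norm (ftrans f \<alpha>) \<le> C * exp (- r * norm \<alpha> powr (1 / s))" by blast
    then show ?thesis using True by simp
  next
    case False
    have "\<exists>C>0. \<forall>\<alpha>. norm (ftrans f \<alpha>) \<le> C * exp (- r * norm \<alpha> powr (1 / s))" if r: "0 < r" for r
    proof -
      \<comment> \<open>Solves \<open>s/2 * (1 / (n h))^(1/s) = r\<close> for \<open>h\<close>:
        every rate is reached at a suitable scale.\<close>
      define h where "h = (s / (2 * r)) powr s / ?n"
      have h: "0 < h" using s r n0 by (simp add: h_def)
      have "?n * h = (s / (2 * r)) powr s" using n0 by (simp add: h_def)
      then have "1 / (?n * h) = (2 * r / s) powr s" using s r by (simp add: powr_divide)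
      then have "s / 2 * (1 / (?n * h)) powr (1 / s) = r" using s r by (simp add: powr_powr)
      moreover have "\<forall>h>0. \<exists>B. seminorm_le s t h B f" using f s t False by (simp add: GS_test_iff)
      with h obtain B where "seminorm_le s t h B f" by blast
      ultimately show ?thesis using *[OF h] by metis
    qed
    then show ?thesis using False by simp
  qed
qed

section \<open>Fourier expansion of periodic functionals\<close>

lemma ftrans_zero_iff:
  fixes \<phi> :: "real^'n::finite \<Rightarrow> complex"
  assumes \<phi>: "\<phi> \<in> GS_test b s t" and s: "0 < s" and t: "0 < t" and z: "\<And>\<eta>. ftrans \<phi> \<eta> = 0"
  shows "\<phi> = (\<lambda>_. 0)"
proof
  fix x
  obtain h B where "seminorm_le s t h B \<phi>" using GS_test_seminorm[OF \<phi> s t] by blast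
  then obtain M where M: "\<And>y. norm (dlist [] \<phi> y) \<le> M" using dlist_bounded_of_seminorm by blast
  show "\<phi> x = 0"
    by (rule fourier_injective[OF smooth_continuous[OF GS_test_smooth[OF \<phi>]] GS_test_integrable[OF \<phi> s t], of M])
      (use M z in \<open>simp_all add: ftrans_def\<close>)
qed

lemma smooth_cnj:
  fixes f :: "real^'n::finite \<Rightarrow> complex"
  assumes f: "smooth f"
  shows "dlist is (\<lambda>y. cnj (f y)) = (\<lambda>y. cnj (dlist is f y))"
proof (induction "is")
  case (Cons i "is")
  have "((\<lambda>t. cnj (dlist is f (x + t *\<^sub>R axis i 1))) has_vector_derivative cnj (dpart i (dlist is f) x)) (at 0)" for x
    using bounded_linear.has_vector_derivative[OF bounded_linear_cnj smooth_has_vector_derivative[OF smooth_dlist[OF f, of "is"], of x i 0]]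
    by simp
  then show ?case unfolding dlist_Cons Cons.IH by (intro ext dpart_eqI)
qed simp

text \<open>The window at the origin is the conjugate of \<phi>, so the assumption on windows places
  \<phi> itself in the space on which \<open>u\<close> acts. This gives the continuity and
  integrability that \<open>fourier_injective\<close> asks for.\<close>

lemma window_GS_test:
  fixes \<phi> :: "real^'n::finite \<Rightarrow> complex"
  assumes w: "stft_window \<phi> 0 0 \<in> GS_test b s t" and s: "0 < s" and t: "0 < t"
  shows "\<phi> \<in> GS_test b s t"
proof -
  let ?g = "stft_window \<phi> 0 0"
  have \<phi>: "\<phi> = (\<lambda>y. cnj (?g y))" by (simp add: stft_window_def)
  have g: "smooth ?g" by (rule GS_test_smooth[OF w])
  have c: "((\<lambda>t. cnj (dlist is ?g (x + t *\<^sub>R axis i 1))) has_vector_derivative cnj (dpart i (dlist is ?g) x)) (at 0)" for "is" i x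
    using bounded_linear.has_vector_derivative[OF bounded_linear_cnj smooth_has_vector_derivative[OF smooth_dlist[OF g, of "is"], of x i 0]]
    by simp
  have "(\<lambda>y. cnj (?g y)) \<in> GS_test b s t"
  proof (rule GS_test_closure[OF s t w w])
    show "smooth (\<lambda>y. cnj (?g y))"
      unfolding smooth_def smooth_cnj[OF g]
    proof (intro allI conjI)
      fix "is" i x
      show "continuous_on UNIV (\<lambda>y. cnj (dlist is ?g y))"
        by (intro continuous_on_cnj smooth_continuous smooth_dlist g)
      show "(\<lambda>t. cnj (dlist is ?g (x + t *\<^sub>R axis i 1))) differentiable at 0"
        using c by (rule differentiableI_vector)
    qed
    show "(0::real) < 1" by simp
    show "\<exists>B. seminorm_le s t (1 * h) B (\<lambda>y. cnj (?g y))" if "seminorm_le s t h B ?g" for h B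
      using that unfolding seminorm_le_def smooth_cnj[OF g] by auto
  qed
  then show ?thesis by (subst \<phi>)
qed

lemma GS_test_dlist:
  fixes f :: "real^'n::finite \<Rightarrow> complex"
  assumes "0 < s" "0 < t" "f \<in> GS_test b s t"
  shows "dlist is f \<in> GS_test b s t"
  by (induction "is") (simp_all add: assms GS_test_dpart)

context
  fixes e :: "'n::finite \<Rightarrow> real^'n" and b :: bool and s t :: real and u :: "(real^'n \<Rightarrow> complex) \<Rightarrow> complex"
    and \<phi> :: "real^'n \<Rightarrow> complex"
  assumes basis: "inj e" "independent (range e)" and s: "0 < s" and t: "0 < t"
    and u: "dual_functional b s t u" and per: "periodic_dist e b s t u"
    and win: "\<forall>x \<xi>. stft_window \<phi> x \<xi> \<in> GS_test b s t" and nz: "\<phi> \<noteq> (\<lambda>_. 0)"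
begin

text \<open>Translates of the window at \<open>x = 0\<close> are, up to a phase, the windows at
  other points with the same frequency. The twisted mean is thus an average of values of
  \<open>stft\<close> at fixed \<xi>, up to unimodular factors and normalization.\<close>

lemma norm_twisted_mean_window_le:
  assumes \<alpha>: "\<alpha> \<in> dual_lattice e" and B: "\<And>x. norm (stft \<phi> u x \<xi>) \<le> B"
  shows "norm (twisted_mean e u \<alpha> (stft_window \<phi> 0 \<xi>)) \<le> (2 * pi) powr (real CARD('n) / 2) * B"
proof -
  let ?k = "stft_window \<phi> 0 \<xi>"
  have T: "stft_window \<phi> x \<xi> \<in> GS_test b s t" for x using win by blast
  have "norm (u (\<lambda>y. ?k (y - z))) \<le> (2 * pi) powr (real CARD('n) / 2) * B" for z
  proof -
    \<comment> \<open>The vanishing second summand brings a scalar multiple into the two-term form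
      of linearity.\<close>
    have "(\<lambda>y. ?k (y - z)) = (\<lambda>y. cis (z \<bullet> \<xi>) * stft_window \<phi> z \<xi> y + 0 * stft_window \<phi> z \<xi> y)"
    proof
      fix y
      have "- ((y - z) \<bullet> \<xi>) = z \<bullet> \<xi> + - (y \<bullet> \<xi>)" by (simp add: inner_diff_left)
      then have "cis (- ((y - z) \<bullet> \<xi>)) = cis (z \<bullet> \<xi>) * cis (- (y \<bullet> \<xi>))" by (simp only: cis_mult)
      then show "?k (y - z) = cis (z \<bullet> \<xi>) * stft_window \<phi> z \<xi> y + 0 * stft_window \<phi> z \<xi> y"
        by (simp add: stft_window_def)
    qed
    then have "u (\<lambda>y. ?k (y - z)) = cis (z \<bullet> \<xi>) * u (stft_window \<phi> z \<xi>) + 0 * u (stft_window \<phi> z \<xi>)"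
      using dual_functional_add[OF u T[of z] T[of z], of "cis (z \<bullet> \<xi>)" 0] by simp
    then have "norm (u (\<lambda>y. ?k (y - z))) = norm (u (stft_window \<phi> z \<xi>))" by (simp add: norm_mult)
    also have "\<dots> = (2 * pi) powr (real CARD('n) / 2) * norm (stft \<phi> u z \<xi>)"
    proof -
      have "(2 * pi) powr (real CARD('n) / 2) * (2 * pi) powr (- real CARD('n) / 2) = 1" by (simp flip: powr_add)
      then show ?thesis by (simp add: stft_def norm_mult flip: mult.assoc)
    qed
    also have "\<dots> \<le> (2 * pi) powr (real CARD('n) / 2) * B" by (rule mult_left_mono[OF B]) simp
    finally show ?thesis .
  qed
  then show ?thesis
    unfolding twisted_mean_def
    by (intro cube_integral_norm_le borel_measurable_continuous_onI[OF twisted_profile(2)[OF basis s t u per T \<alpha>]])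
      (simp add: norm_mult)
qed

text \<open>Twisted means of a fixed test function are bounded uniformly in \<alpha>, as the
  characters are unimodular. Applied to the \<open>m\<close>-th derivative of \<open>f\<close> in
  the largest direction of \<alpha>, this bounds the twisted mean of \<open>f\<close> times
  \<open>norm \<alpha> ^ m\<close>.\<close>

lemma twisted_mean_decay:
  assumes f: "f \<in> GS_test b s t"
    and c: "\<And>\<alpha> \<psi>. \<alpha> \<in> dual_lattice e \<Longrightarrow> \<psi> \<in> GS_test b s t \<Longrightarrow> twisted_mean e u \<alpha> \<psi> = c \<alpha> * ftrans \<psi> \<alpha>"
  shows "\<exists>C. \<forall>\<alpha>\<in>dual_lattice e. norm (twisted_mean e u \<alpha> f) \<le> C * (1 / (1 + norm \<alpha>) ^ m)"
proof -
  let ?n = "real CARD('n)"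
  obtain h B where h: "0 < h" "seminorm_le s t h B f" using GS_test_seminorm[OF f s t] by blast
  have "\<exists>M. \<forall>\<alpha>\<in>dual_lattice e. norm (twisted_mean e u \<alpha> g) \<le> M" if g: "g \<in> GS_test b s t" for g
  proof -
    obtain M where M: "\<And>r. norm (u (\<lambda>y. g (y - lmap e r))) \<le> M"
      using zperiodic_bounded[OF periodic_profile[OF basis s t u per g]] by blast
    have "norm (twisted_mean e u \<alpha> g) \<le> M" if "\<alpha> \<in> dual_lattice e" for \<alpha>
      unfolding twisted_mean_def
      by (intro cube_integral_norm_le borel_measurable_continuous_onI[OF twisted_profile(2)[OF basis s t u per g that]])
        (simp add: norm_mult M)
    then show ?thesis by blast
  qed
  then have a1: "\<forall>i. \<exists>M. \<forall>\<alpha>\<in>dual_lattice e. norm (twisted_mean e u \<alpha> (dlist (replicate m i) f)) \<le> M"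
    and a2: "\<exists>M. \<forall>\<alpha>\<in>dual_lattice e. norm (twisted_mean e u \<alpha> f) \<le> M"
    using GS_test_dlist[OF s t f] f by blast+
  from a1 obtain M where M: "\<forall>i. \<forall>\<alpha>\<in>dual_lattice e. norm (twisted_mean e u \<alpha> (dlist (replicate m i) f)) \<le> M i"
    by (rule choice[THEN exE])
  from a2 obtain M0 where M0: "\<forall>\<alpha>\<in>dual_lattice e. norm (twisted_mean e u \<alpha> f) \<le> M0" by (rule exE)
  define C where "C = 2 ^ m * (M0 + ?n ^ m * (\<Sum>i\<in>UNIV. \<bar>M i\<bar>))"
  have "norm (twisted_mean e u \<alpha> f) \<le> C * (1 / (1 + norm \<alpha>) ^ m)" if \<alpha>: "\<alpha> \<in> dual_lattice e" for \<alpha>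
  proof -
    let ?T = "norm (twisted_mean e u \<alpha> f)"
    obtain i where i: "norm \<alpha> ^ m \<le> ?n ^ m * \<bar>\<alpha> $ i\<bar> ^ m" using norm_power_le_component by blast
    have "?T * \<bar>\<alpha> $ i\<bar> ^ m = norm (twisted_mean e u \<alpha> (dlist (replicate m i) f))"
      unfolding c[OF \<alpha> f] c[OF \<alpha> GS_test_dlist[OF s t f]] ftrans_dlist_replicate[OF GS_test_smooth[OF f] h(2,1) t]
      by (simp add: norm_mult norm_power)
    also have "\<dots> \<le> M i" using M \<alpha> by blast
    also have "\<dots> \<le> \<bar>M i\<bar>" by (rule abs_ge_self)
    also have "\<dots> \<le> (\<Sum>i\<in>UNIV. \<bar>M i\<bar>)" by (rule member_le_sum) simp_all
    finally have 1: "?T * \<bar>\<alpha> $ i\<bar> ^ m \<le> (\<Sum>i\<in>UNIV. \<bar>M i\<bar>)" .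
    have "(1 + norm \<alpha>) ^ m * ?T \<le> (2 ^ m * (1 + norm \<alpha> ^ m)) * ?T"
      by (intro mult_right_mono one_plus_power_le) simp_all
    also have "\<dots> \<le> (2 ^ m * (1 + ?n ^ m * \<bar>\<alpha> $ i\<bar> ^ m)) * ?T"
      using i by (intro mult_right_mono mult_left_mono) simp_all
    also have "\<dots> = 2 ^ m * (?T + ?n ^ m * (?T * \<bar>\<alpha> $ i\<bar> ^ m))" by (simp add: algebra_simps)
    also have "\<dots> \<le> C" unfolding C_def by (intro mult_left_mono add_mono M0[rule_format, OF \<alpha>] 1) simp_all
    finally have "(1 + norm \<alpha>) ^ m * ?T \<le> C" .
    moreover have "0 < (1 + norm \<alpha>) ^ m" by (intro zero_less_power add_pos_nonneg) auto
    ultimately show ?thesis by (simp add: pos_le_divide_eq mult.commute)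
  qed
  then show ?thesis by blast
qed

lemma fourier_expansion:
  "\<exists>c \<eta> K. (\<forall>\<psi>\<in>GS_test b s t. ((\<lambda>\<alpha>. c \<alpha> * ftrans \<psi> \<alpha>) has_sum u \<psi>) (dual_lattice e)) \<and>
    (\<forall>\<alpha>\<in>dual_lattice e. \<forall>B. (\<forall>x. norm (stft \<phi> u x (\<alpha> + \<eta>)) \<le> B) \<longrightarrow> norm (c \<alpha>) \<le> K * B)"
proof -
  have w00: "stft_window \<phi> 0 0 \<in> GS_test b s t" using win by blast
  have \<phi>T: "\<phi> \<in> GS_test b s t" by (rule window_GS_test[OF w00 s t])
  have \<phi>m: "\<phi> \<in> borel_measurable borel" by (rule smooth_measurable[OF GS_test_smooth[OF \<phi>T]])
  obtain \<eta> where \<eta>: "ftrans \<phi> \<eta> \<noteq> 0" using ftrans_zero_iff[OF \<phi>T s t] nz by blast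
  \<comment> \<open>The frequency \<alpha> + \<eta> makes the Fourier integral of the window at
    \<alpha> nonzero and independent of \<alpha>, so one divisor serves all coefficients.\<close>
  define \<kappa> where "\<kappa> \<alpha> = stft_window \<phi> 0 (\<alpha> + \<eta>)" for \<alpha>
  have \<kappa>T: "\<kappa> \<alpha> \<in> GS_test b s t" for \<alpha> unfolding \<kappa>_def using win by blast
  have \<kappa>F: "ftrans (\<kappa> \<alpha>) \<alpha> = cnj (ftrans \<phi> \<eta>)" for \<alpha>
    unfolding \<kappa>_def ftrans_window[OF \<phi>m] by simp
  define c where "c \<alpha> = twisted_mean e u \<alpha> (\<kappa> \<alpha>) / cnj (ftrans \<phi> \<eta>)" for \<alpha>
  have c: "twisted_mean e u \<alpha> \<psi> = c \<alpha> * ftrans \<psi> \<alpha>" if \<alpha>: "\<alpha> \<in> dual_lattice e" and \<psi>: "\<psi> \<in> GS_test b s t" for \<alpha> \<psi>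
  proof -
    have "twisted_mean e u \<alpha> (\<kappa> \<alpha>) * ftrans \<psi> \<alpha> = twisted_mean e u \<alpha> \<psi> * ftrans (\<kappa> \<alpha>) \<alpha>"
      unfolding ftrans_def
      by (rule covariant_functional[OF twisted_mean_dual_functional[OF basis s t u per \<alpha>] s t _ \<psi> \<kappa>T])
        (rule twisted_mean_covariant[OF basis s t u per \<alpha>])
    then show ?thesis unfolding \<kappa>F c_def using \<eta> by (simp add: field_simps)
  qed
  have bound: "norm (c \<alpha>) \<le> ((2 * pi) powr (real CARD('n) / 2) / norm (ftrans \<phi> \<eta>)) * B"
    if \<alpha>: "\<alpha> \<in> dual_lattice e" and B: "\<forall>x. norm (stft \<phi> u x (\<alpha> + \<eta>)) \<le> B" for \<alpha> B
  proof -
    have "norm (c \<alpha>) = norm (twisted_mean e u \<alpha> (\<kappa> \<alpha>)) / norm (ftrans \<phi> \<eta>)"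
      by (simp add: c_def norm_divide)
    also have "\<dots> \<le> ((2 * pi) powr (real CARD('n) / 2) * B) / norm (ftrans \<phi> \<eta>)"
      unfolding \<kappa>_def by (rule divide_right_mono[OF norm_twisted_mean_window_le[OF \<alpha>]]) (use B in simp_all)
    finally show ?thesis by simp
  qed
  have sum: "((\<lambda>\<alpha>. c \<alpha> * ftrans \<psi> \<alpha>) has_sum u \<psi>) (dual_lattice e)" if \<psi>: "\<psi> \<in> GS_test b s t" for \<psi>
  proof -
    let ?P = "\<lambda>r. u (\<lambda>y. \<psi> (y - lmap e r))"
    have dv: "dual_vec e k \<in> dual_lattice e" for k
      using bij_betw_dual_vec[OF basis] by (auto simp: bij_betw_def)
    \<comment> \<open>The exponent is that of \<open>dual_lattice_summable\<close>; it makes the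
      coefficients of the profile absolutely summable, as inversion requires.\<close>
    obtain C where C: "\<And>\<alpha>. \<alpha> \<in> dual_lattice e \<Longrightarrow> norm (twisted_mean e u \<alpha> \<psi>) \<le> C * (1 / (1 + norm \<alpha>) ^ (2 * CARD('n)))"
      using twisted_mean_decay[OF \<psi> c, of "2 * CARD('n)"] by blast
    have "(\<lambda>\<alpha>. norm (twisted_mean e u \<alpha> \<psi>)) summable_on dual_lattice e"
      by (rule summable_on_comparison_test[OF summable_on_cmult_right[OF dual_lattice_summable[OF basis], of C]]) (use C in simp_all)
    then have sm: "(\<lambda>k. norm (twisted_mean e u (dual_vec e k) \<psi>)) summable_on UNIV"
      by (subst summable_on_reindex_bij_betw[OF bij_betw_dual_vec[OF basis]])
    have "((\<lambda>k. twisted_mean e u (dual_vec e k) \<psi> * cis (0 \<bullet> ((2 * pi) *\<^sub>R zvec k))) has_sum ?P 0) UNIV"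
      by (rule torus_inversion[OF periodic_profile[OF basis s t u per \<psi>] _ sm])
        (simp only: twisted_mean_def lmap_inner_dual_vec[OF basis])
    then have "((\<lambda>k. twisted_mean e u (dual_vec e k) \<psi>) has_sum u \<psi>) UNIV" by simp
    then have "((\<lambda>\<alpha>. twisted_mean e u \<alpha> \<psi>) has_sum u \<psi>) (dual_lattice e)"
      by (subst (asm) has_sum_reindex_bij_betw[OF bij_betw_dual_vec[OF basis]])
    then show ?thesis
      by (rule has_sum_cong[THEN iffD1, rotated]) (rule c[OF _ \<psi>])
  qed
  show ?thesis
    by (rule exI[of _ c], rule exI[of _ \<eta>], rule exI[of _ "(2 * pi) powr (real CARD('n) / 2) / norm (ftrans \<phi> \<eta>)"])
      (use sum bound in blast)
qed

end

section \<open>Periodic Gevrey functions and their coefficients\<close>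

text \<open>A second order remainder for all angles; it controls the termwise difference quotients
  of a series of characters.\<close>

lemma norm_cis_minus_linear_le: "norm (cis \<theta> - 1 - \<i> * of_real \<theta>) \<le> \<theta>\<^sup>2"
proof -
  have d: "((\<lambda>\<theta>. cis \<theta>) has_vector_derivative \<i> * cis \<tau>) (at \<tau>)" for \<tau>
    using has_derivative_cis[of "\<lambda>x. x" "\<lambda>x. x" \<tau> UNIV] by (simp add: has_vector_derivative_def)
  have d2: "((\<lambda>\<theta>. \<i> * of_real \<theta>) has_vector_derivative \<i>) (at \<tau>)" for \<tau> :: real
    using has_vector_derivative_mult_right[OF has_vector_derivative_of_real[OF DERIV_ident], of \<i>]
    by simp
  have 1: "norm (cis \<tau> - cis 0) \<le> 1 * \<bar>\<tau> - 0\<bar>" for \<tau>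
    by (rule vector_mvt_bound[OF d]) (simp add: norm_mult)
  let ?g = "\<lambda>\<tau>. cis \<tau> - \<i> * of_real \<tau>"
  have "norm (?g \<theta> - ?g 0) \<le> \<bar>\<theta>\<bar> * \<bar>\<theta> - 0\<bar>"
  proof (rule vector_mvt_bound)
    fix \<tau> assume "\<tau> \<in> closed_segment 0 \<theta>"
    then have \<tau>: "\<bar>\<tau>\<bar> \<le> \<bar>\<theta>\<bar>" by (auto simp: closed_segment_eq_real_ivl split: if_splits)
    show "(?g has_vector_derivative \<i> * cis \<tau> - \<i>) (at \<tau>)"
      by (rule has_vector_derivative_diff[OF d d2])
    have "\<i> * cis \<tau> - \<i> = \<i> * (cis \<tau> - cis 0)" by (simp add: algebra_simps)
    then have "norm (\<i> * cis \<tau> - \<i>) = norm (cis \<tau> - cis 0)" by (simp only: norm_mult norm_ii mult_1)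
    then show "norm (\<i> * cis \<tau> - \<i>) \<le> \<bar>\<theta>\<bar>" using 1[of \<tau>] \<tau> by simp
  qed
  then show ?thesis by (simp add: power2_eq_square algebra_simps flip: abs_mult)
qed

definition exp_series :: "(real^'n::finite) set \<Rightarrow> (real^'n \<Rightarrow> complex) \<Rightarrow> real^'n \<Rightarrow> complex" where
  "exp_series A c x = (\<Sum>\<^sub>\<infinity>\<alpha>\<in>A. c \<alpha> * cis (x \<bullet> \<alpha>))"

text \<open>The termwise remainders add up to at most \<open>t^2\<close> times the second moment of
  the coefficients. Having all moments in the assumption makes the step repeatable.\<close>

lemma exp_series_derivative:
  fixes c :: "real^'n::finite \<Rightarrow> complex"
  assumes c: "\<And>k. (\<lambda>\<alpha>. norm (c \<alpha>) * norm \<alpha> ^ k) summable_on A"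
  shows "((\<lambda>t. exp_series A c (x + t *\<^sub>R axis i 1)) has_vector_derivative
    exp_series A (\<lambda>\<alpha>. c \<alpha> * (\<i> * of_real (\<alpha> $ i))) x) (at 0)"
proof -
  let ?c' = "\<lambda>\<alpha>. c \<alpha> * (\<i> * of_real (\<alpha> $ i))"
  have s0: "(\<lambda>\<alpha>. norm (c \<alpha>)) summable_on A" using c[of 0] by simp
  have s1: "(\<lambda>\<alpha>. norm (?c' \<alpha>)) summable_on A"
    by (rule summable_on_comparison_test[OF c[of 1]])
      (simp_all add: norm_mult mult_left_mono component_le_norm_cart)
  define M where "M = (\<Sum>\<^sub>\<infinity>\<alpha>\<in>A. norm (c \<alpha>) * norm \<alpha> ^ 2)"
  have H: "((\<lambda>\<alpha>. c \<alpha> * cis (y \<bullet> \<alpha>)) has_sum exp_series A c y) A" for y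
    unfolding exp_series_def by (rule exponential_series(1)[OF s0])
  have H1: "((\<lambda>\<alpha>. ?c' \<alpha> * cis (y \<bullet> \<alpha>)) has_sum exp_series A ?c' y) A" for y
    unfolding exp_series_def by (rule exponential_series(1)[OF s1])
  have key: "norm (exp_series A c (x + t *\<^sub>R axis i 1) - exp_series A c x - of_real t * exp_series A ?c' x) \<le> t\<^sup>2 * M" for t :: real
  proof (rule norm_infsum_le)
    show "((\<lambda>\<alpha>. c \<alpha> * cis ((x + t *\<^sub>R axis i 1) \<bullet> \<alpha>) - c \<alpha> * cis (x \<bullet> \<alpha>) - of_real t * (?c' \<alpha> * cis (x \<bullet> \<alpha>))) has_sum
      (exp_series A c (x + t *\<^sub>R axis i 1) - exp_series A c x - of_real t * exp_series A ?c' x)) A"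
      using has_sum_add[OF has_sum_add[OF H[of "x + t *\<^sub>R axis i 1"] has_sum_uminusI[OF H[of x]]]
        has_sum_uminusI[OF has_sum_cmult_right[OF H1[of x], of "of_real t"]]]
      by simp
    show "((\<lambda>\<alpha>. t\<^sup>2 * (norm (c \<alpha>) * norm \<alpha> ^ 2)) has_sum t\<^sup>2 * M) A"
      unfolding M_def by (intro has_sum_cmult_right has_sum_infsum c)
    fix \<alpha> :: "real^'n"
    let ?\<theta> = "t * \<alpha> $ i"
    have "(x + t *\<^sub>R axis i 1) \<bullet> \<alpha> = x \<bullet> \<alpha> + ?\<theta>" by (simp add: inner_add_left inner_axis')
    then have "cis ((x + t *\<^sub>R axis i 1) \<bullet> \<alpha>) = cis (x \<bullet> \<alpha>) * cis ?\<theta>" by (simp only: cis_mult)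
    then have "c \<alpha> * cis ((x + t *\<^sub>R axis i 1) \<bullet> \<alpha>) - c \<alpha> * cis (x \<bullet> \<alpha>) - of_real t * (?c' \<alpha> * cis (x \<bullet> \<alpha>)) =
      c \<alpha> * cis (x \<bullet> \<alpha>) * (cis ?\<theta> - 1 - \<i> * of_real ?\<theta>)"
      by (simp add: algebra_simps)
    then have "norm (c \<alpha> * cis ((x + t *\<^sub>R axis i 1) \<bullet> \<alpha>) - c \<alpha> * cis (x \<bullet> \<alpha>) - of_real t * (?c' \<alpha> * cis (x \<bullet> \<alpha>))) =
      norm (c \<alpha>) * norm (cis ?\<theta> - 1 - \<i> * of_real ?\<theta>)" by (simp only: norm_mult norm_cis mult_1_right)
    also have "\<dots> \<le> norm (c \<alpha>) * ?\<theta>\<^sup>2" by (rule mult_left_mono[OF norm_cis_minus_linear_le]) simp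
    also have "\<dots> \<le> norm (c \<alpha>) * (t\<^sup>2 * norm \<alpha> ^ 2)"
    proof (rule mult_left_mono)
      have "\<bar>\<alpha> $ i\<bar>\<^sup>2 \<le> norm \<alpha> ^ 2" by (rule power_mono[OF component_le_norm_cart]) simp
      then show "?\<theta>\<^sup>2 \<le> t\<^sup>2 * norm \<alpha> ^ 2" by (simp add: power_mult_distrib mult_left_mono)
    qed simp
    finally show "norm (c \<alpha> * cis ((x + t *\<^sub>R axis i 1) \<bullet> \<alpha>) - c \<alpha> * cis (x \<bullet> \<alpha>) - of_real t * (?c' \<alpha> * cis (x \<bullet> \<alpha>))) \<le>
      t\<^sup>2 * (norm (c \<alpha>) * norm \<alpha> ^ 2)"
      by (simp only: mult.left_commute)
  qed
  show ?thesis
    unfolding has_vector_derivative_quotient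
  proof (rule LIM_zero_cancel, rule Lim_null_comparison)
    show "\<forall>\<^sub>F t in at 0. norm ((exp_series A c (x + t *\<^sub>R axis i 1) - exp_series A c (x + 0 *\<^sub>R axis i 1)) /\<^sub>R t
      - exp_series A ?c' x) \<le> \<bar>t\<bar> * M"
      unfolding eventually_at_filter
    proof (intro always_eventually allI impI)
      fix t :: real assume t: "t \<noteq> 0"
      let ?d = "exp_series A c (x + t *\<^sub>R axis i 1) - exp_series A c x"
      have "?d /\<^sub>R t - exp_series A ?c' x = (?d - of_real t * exp_series A ?c' x) /\<^sub>R t"
        using t by (simp add: scaleR_conv_of_real right_diff_distrib)
      then have "norm (?d /\<^sub>R t - exp_series A ?c' x) = norm (?d - of_real t * exp_series A ?c' x) / \<bar>t\<bar>"
        by (simp add: divide_inverse mult.commute)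
      also have "\<dots> \<le> (t\<^sup>2 * M) / \<bar>t\<bar>" by (rule divide_right_mono[OF key]) simp
      also have "\<dots> = \<bar>t\<bar> * M"
      proof -
        define a where "a = \<bar>t\<bar>"
        have "t\<^sup>2 = a * a" "a \<noteq> 0" using t by (simp_all add: a_def power2_eq_square)
        then show ?thesis unfolding a_def[symmetric] by simp
      qed
      finally show "norm ((exp_series A c (x + t *\<^sub>R axis i 1) - exp_series A c (x + 0 *\<^sub>R axis i 1)) /\<^sub>R t
        - exp_series A ?c' x) \<le> \<bar>t\<bar> * M" by simp
    qed
    have "((\<lambda>t::real. \<bar>t\<bar> * M) \<longlongrightarrow> \<bar>0\<bar> * M) (at 0)" by (intro tendsto_intros)
    then show "((\<lambda>t::real. \<bar>t\<bar> * M) \<longlongrightarrow> 0) (at 0)" by simp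
  qed
qed

fun derived_coeff :: "'n::finite list \<Rightarrow> (real^'n \<Rightarrow> complex) \<Rightarrow> real^'n \<Rightarrow> complex" where
  "derived_coeff [] c = c"
| "derived_coeff (i # is) c = (\<lambda>\<alpha>. derived_coeff is c \<alpha> * (\<i> * of_real (\<alpha> $ i)))"

lemma norm_derived_coeff_le: "norm (derived_coeff is c \<alpha>) \<le> norm (c \<alpha>) * norm \<alpha> ^ length is"
proof (induction "is")
  case (Cons i "is")
  have "norm (derived_coeff (i # is) c \<alpha>) = norm (derived_coeff is c \<alpha>) * \<bar>\<alpha> $ i\<bar>" by (simp add: norm_mult)
  also have "\<dots> \<le> (norm (c \<alpha>) * norm \<alpha> ^ length is) * norm \<alpha>"
    by (rule mult_mono[OF Cons.IH component_le_norm_cart]) simp_all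
  finally show ?case by (simp add: mult_ac)
qed simp

lemma exp_series_smooth:
  fixes c :: "real^'n::finite \<Rightarrow> complex"
  assumes c: "\<And>k. (\<lambda>\<alpha>. norm (c \<alpha>) * norm \<alpha> ^ k) summable_on A"
  shows "dlist is (exp_series A c) = exp_series A (derived_coeff is c)" and "smooth (exp_series A c)"
proof -
  have d: "(\<lambda>\<alpha>. norm (derived_coeff is c \<alpha>) * norm \<alpha> ^ k) summable_on A" for "is" k
  proof (rule summable_on_comparison_test[OF c[of "length is + k"]])
    fix \<alpha> :: "real^'n"
    show "norm (derived_coeff is c \<alpha>) * norm \<alpha> ^ k \<le> norm (c \<alpha>) * norm \<alpha> ^ (length is + k)"
      using mult_right_mono[OF norm_derived_coeff_le[of "is" c \<alpha>], of "norm \<alpha> ^ k"] by (simp add: power_add mult.assoc)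
  qed simp
  have D: "((\<lambda>t. exp_series A (derived_coeff is c) (x + t *\<^sub>R axis i 1)) has_vector_derivative
    exp_series A (derived_coeff (i # is) c) x) (at 0)" for "is" i x
    using exp_series_derivative[OF d, of "is" x i] by simp
  have eq: "dlist is (exp_series A c) = exp_series A (derived_coeff is c)" for "is"
  proof (induction "is")
    case (Cons i "is")
    show ?case unfolding dlist_Cons Cons.IH by (intro ext dpart_eqI D)
  qed simp
  then show "dlist is (exp_series A c) = exp_series A (derived_coeff is c)" .
  have "(\<lambda>\<alpha>. norm (derived_coeff is c \<alpha>)) summable_on A" for "is" using d[of "is" 0] by simp
  then have "continuous_on UNIV (exp_series A (derived_coeff is c))" for "is"
    unfolding exp_series_def[abs_def] by (rule exponential_series(2))
  moreover have "(\<lambda>t. exp_series A (derived_coeff is c) (x + t *\<^sub>R axis i 1)) differentiable at 0" for "is" i x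
    using D by (rule differentiableI_vector)
  ultimately show "smooth (exp_series A c)" unfolding smooth_def eq by blast
qed

lemma cis_dual_lattice:
  assumes "\<alpha> \<in> dual_lattice e" "j \<in> lattice e"
  shows "cis ((x + j) \<bullet> \<alpha>) = cis (x \<bullet> \<alpha>)"
proof -
  have "\<forall>j. \<exists>k::int. e j \<bullet> \<alpha> = 2 * pi * of_int k" using assms(1) by (simp add: dual_lattice_def)
  then obtain l where l: "\<forall>j. e j \<bullet> \<alpha> = 2 * pi * of_int (l j)" by (rule choice[THEN exE])
  from assms(2) obtain k where k: "j = lmap e (zvec k)" unfolding lattice_eq by blast
  have "j \<bullet> \<alpha> = 2 * pi * of_int (\<Sum>j\<in>UNIV. k j * l j)"
    unfolding k using l by (simp add: lmap_def inner_sum_left sum_distrib_left mult_ac)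
  then have "cis (j \<bullet> \<alpha>) = 1" by (simp only:) (rule cis_multiple_2pi, rule Ints_of_int)
  moreover have "cis ((x + j) \<bullet> \<alpha>) = cis (x \<bullet> \<alpha>) * cis (j \<bullet> \<alpha>)" by (simp add: inner_add_left cis_mult)
  ultimately show ?thesis by simp
qed

lemma exp_series_periodic: "periodic_fun e (exp_series (dual_lattice e) c)"
  unfolding periodic_fun_def exp_series_def
  by (intro ballI allI infsum_cong) (simp add: cis_dual_lattice)

lemma exp_series_pairing:
  fixes c :: "real^'n::finite \<Rightarrow> complex"
  assumes c: "(\<lambda>\<alpha>. norm (c \<alpha>)) summable_on A" and f: "integrable lborel f"
  shows "((\<lambda>\<alpha>. c \<alpha> * ftrans f \<alpha>) has_sum (LINT x|lborel. exp_series A c x * f x)) A"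
proof -
  have S: "((\<lambda>\<alpha>. c \<alpha> * cis (x \<bullet> \<alpha>)) has_sum exp_series A c x) A" for x
    unfolding exp_series_def by (rule exponential_series(1)[OF c])
  have Sm: "exp_series A c \<in> borel_measurable borel"
    unfolding exp_series_def[abs_def] by (rule borel_measurable_continuous_onI[OF exponential_series(2)[OF c]])
  have "((\<lambda>\<alpha>. LINT x|lborel. f x * (c \<alpha> * cis (x \<bullet> \<alpha>))) has_sum (LINT x|lborel. f x * exp_series A c x)) A"
    by (rule integral_has_sum[OF f _ _ c S Sm]) (simp_all add: norm_mult)
  moreover have "(LINT x|lborel. f x * (c \<alpha> * cis (x \<bullet> \<alpha>))) = c \<alpha> * ftrans f \<alpha>" for \<alpha>
    unfolding ftrans_def by (simp only: mult.left_commute[of "f _"] integral_mult_right_zero)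
  ultimately show ?thesis by (simp only: mult.commute[of "f _"])
qed

text \<open>The exponential is split into two halves: one absorbs \<open>norm \<alpha> ^ k\<close>
  at Gevrey cost, the other keeps the sum over the lattice finite. This is the origin of
  \<open>r / 2\<close> and \<open>2 * s / r\<close>.\<close>

lemma exp_decay_moment_bound:
  fixes e :: "'n::finite \<Rightarrow> real^'n"
  assumes basis: "inj e" "independent (range e)" and r: "0 < r" and s: "0 < s"
    and c: "\<And>\<alpha>. \<alpha> \<in> dual_lattice e \<Longrightarrow> norm (c \<alpha>) \<le> C * exp (- r * norm \<alpha> powr (1 / s))"
  shows "(\<lambda>\<alpha>. norm (c \<alpha>) * norm \<alpha> ^ k) summable_on dual_lattice e"
    and "(\<Sum>\<^sub>\<infinity>\<alpha>\<in>dual_lattice e. norm (c \<alpha>) * norm \<alpha> ^ k) \<le>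
      C * (\<Sum>\<^sub>\<infinity>\<alpha>\<in>dual_lattice e. exp (- (r / 2) * norm \<alpha> powr (1 / s))) * ((2 * s / r) powr s) ^ k * fact k powr s"
proof -
  have "0 \<in> dual_lattice e" by (auto simp: dual_lattice_def intro!: exI[of _ 0])
  from order_trans[OF norm_ge_zero c[OF this]] have C: "0 \<le> C" by (simp add: zero_le_mult_iff)
  let ?E = "\<lambda>\<alpha>::real^'n. exp (- (r / 2) * norm \<alpha> powr (1 / s))"
  let ?G = "((2 * s / r) powr s) ^ k * fact k powr s"
  have sE: "?E summable_on dual_lattice e" by (rule exp_decay_summable[OF basis _ s]) (use r in simp)
  then have sG: "(\<lambda>\<alpha>. (C * ?G) * ?E \<alpha>) summable_on dual_lattice e" by (rule summable_on_cmult_right)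
  have le: "norm (c \<alpha>) * norm \<alpha> ^ k \<le> (C * ?G) * ?E \<alpha>" if "\<alpha> \<in> dual_lattice e" for \<alpha>
  proof -
    have "exp (- r * norm \<alpha> powr (1 / s)) = ?E \<alpha> * ?E \<alpha>" by (simp flip: exp_add)
    then have "norm (c \<alpha>) * norm \<alpha> ^ k \<le> (C * (?E \<alpha> * ?E \<alpha>)) * norm \<alpha> ^ k"
      using mult_right_mono[OF c[OF that], of "norm \<alpha> ^ k"] by simp
    also have "\<dots> = C * ?E \<alpha> * (norm \<alpha> ^ k * ?E \<alpha>)" by (simp only: mult_ac)
    also have "\<dots> \<le> C * ?E \<alpha> * (((s / (r / 2)) powr s) ^ k * fact k powr s)"
      by (intro mult_left_mono exp_to_gevrey) (use r s C in simp_all)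
    finally show ?thesis by (simp add: mult_ac)
  qed
  show sm: "(\<lambda>\<alpha>. norm (c \<alpha>) * norm \<alpha> ^ k) summable_on dual_lattice e"
    by (rule summable_on_comparison_test[OF sG le]) simp_all
  have "(\<Sum>\<^sub>\<infinity>\<alpha>\<in>dual_lattice e. norm (c \<alpha>) * norm \<alpha> ^ k) \<le> (\<Sum>\<^sub>\<infinity>\<alpha>\<in>dual_lattice e. (C * ?G) * ?E \<alpha>)"
    by (rule infsum_mono[OF sm sG le])
  also have "\<dots> = (C * ?G) * (\<Sum>\<^sub>\<infinity>\<alpha>\<in>dual_lattice e. ?E \<alpha>)"
    by (rule infsum_cmult_right) (use sE in simp)
  finally show "(\<Sum>\<^sub>\<infinity>\<alpha>\<in>dual_lattice e. norm (c \<alpha>) * norm \<alpha> ^ k) \<le>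
      C * (\<Sum>\<^sub>\<infinity>\<alpha>\<in>dual_lattice e. ?E \<alpha>) * ((2 * s / r) powr s) ^ k * fact k powr s"
    by (simp add: mult_ac)
qed

lemma exp_series_gevrey_bound:
  fixes e :: "'n::finite \<Rightarrow> real^'n"
  assumes basis: "inj e" "independent (range e)" and r: "0 < r" and s: "0 < s"
    and c: "\<And>\<alpha>. \<alpha> \<in> dual_lattice e \<Longrightarrow> norm (c \<alpha>) \<le> C * exp (- r * norm \<alpha> powr (1 / s))"
  shows "\<exists>D. \<forall>\<beta> x. norm (dmi \<beta> (exp_series (dual_lattice e) c) x)
    \<le> D * ((2 ^ CARD('n)) powr s * (2 * s / r) powr s) ^ mi_abs \<beta> * mi_fact \<beta> powr s"
proof -
  let ?A = "dual_lattice e"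
  note m = exp_decay_moment_bound[OF basis r s c]
  have "0 \<in> ?A" by (auto simp: dual_lattice_def intro!: exI[of _ 0])
  from order_trans[OF norm_ge_zero c[OF this]] have C: "0 \<le> C" by (simp add: zero_le_mult_iff)
  define D where "D = C * (\<Sum>\<^sub>\<infinity>\<alpha>\<in>?A. exp (- (r / 2) * norm \<alpha> powr (1 / s)))"
  have D: "0 \<le> D" unfolding D_def using C by (intro mult_nonneg_nonneg infsum_nonneg) auto
  have "norm (dmi \<beta> (exp_series ?A c) x) \<le> D * ((2 ^ CARD('n)) powr s * (2 * s / r) powr s) ^ mi_abs \<beta> * mi_fact \<beta> powr s" for \<beta> x
  proof -
    obtain xs :: "'n list" where xs: "mset xs = Abs_multiset \<beta>" using ex_mset by blast
    have cnt: "count (mset xs) = \<beta>" unfolding xs by (simp add: Abs_multiset_inverse)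
    have len: "length xs = mi_abs \<beta>" using mi_abs_count[of xs] by (simp add: cnt)
    note sm = exp_series_smooth[OF m(1)]
    have "dmi \<beta> (exp_series ?A c) x = exp_series ?A (derived_coeff xs c) x"
      using dlist_dmi[OF sm(2), of xs] sm(1)[of xs] by (simp add: cnt)
    also have "norm \<dots> \<le> (\<Sum>\<^sub>\<infinity>\<alpha>\<in>?A. norm (c \<alpha>) * norm \<alpha> ^ length xs)"
    proof (rule norm_infsum_le)
      have "(\<lambda>\<alpha>. norm (derived_coeff xs c \<alpha>)) summable_on ?A"
        by (rule summable_on_comparison_test[OF m(1)[of "length xs"]]) (simp_all add: norm_derived_coeff_le)
      then show "((\<lambda>\<alpha>. derived_coeff xs c \<alpha> * cis (x \<bullet> \<alpha>)) has_sum exp_series ?A (derived_coeff xs c) x) ?A"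
        unfolding exp_series_def by (rule exponential_series(1))
      show "((\<lambda>\<alpha>. norm (c \<alpha>) * norm \<alpha> ^ length xs) has_sum (\<Sum>\<^sub>\<infinity>\<alpha>\<in>?A. norm (c \<alpha>) * norm \<alpha> ^ length xs)) ?A"
        by (rule has_sum_infsum[OF m(1)])
    qed (simp add: norm_mult norm_derived_coeff_le)
    also have "\<dots> \<le> D * ((2 * s / r) powr s) ^ mi_abs \<beta> * fact (mi_abs \<beta>) powr s"
      using m(2)[of "length xs"] by (simp add: D_def len)
    also have "\<dots> \<le> D * ((2 * s / r) powr s) ^ mi_abs \<beta> * (((2 ^ CARD('n)) powr s) ^ mi_abs \<beta> * mi_fact \<beta> powr s)"
      using D s by (intro mult_left_mono fact_mi_abs_powr_le) simp_all
    finally show ?thesis by (simp add: power_mult_distrib mult_ac)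
  qed
  then show ?thesis by blast
qed

definition coeff_decay :: "bool \<Rightarrow> ('n::finite \<Rightarrow> real^'n) \<Rightarrow> real \<Rightarrow> (real^'n \<Rightarrow> complex) \<Rightarrow> bool" where
  "coeff_decay roum e s c \<longleftrightarrow>
    (if roum then \<exists>r>0. \<exists>C. \<forall>\<alpha>\<in>dual_lattice e. norm (c \<alpha>) \<le> C * exp (- r * norm \<alpha> powr (1 / s))
     else \<forall>r>0. \<exists>C. \<forall>\<alpha>\<in>dual_lattice e. norm (c \<alpha>) \<le> C * exp (- r * norm \<alpha> powr (1 / s)))"

lemma in_gevrey_per_if_coeff_decay:
  fixes e :: "'n::finite \<Rightarrow> real^'n"
  assumes basis: "inj e" "independent (range e)" and s: "0 < s" and s0: "0 < s0" and t0: "0 < t0"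
    and c: "coeff_decay roum e s c"
    and u: "\<And>\<psi>. \<psi> \<in> GS_test b s0 t0 \<Longrightarrow> ((\<lambda>\<alpha>. c \<alpha> * ftrans \<psi> \<alpha>) has_sum u \<psi>) (dual_lattice e)"
  shows "in_gevrey_per roum e s b s0 t0 u"
proof -
  let ?A = "dual_lattice e" and ?g = "exp_series (dual_lattice e) c"
  have "\<exists>r>0. \<exists>C. \<forall>\<alpha>\<in>?A. norm (c \<alpha>) \<le> C * exp (- r * norm \<alpha> powr (1 / s))"
    using c zero_less_one unfolding coeff_decay_def by (cases roum) (simp_all only: if_True if_False, blast)
  then obtain r C where r: "0 < r" "\<And>\<alpha>. \<alpha> \<in> ?A \<Longrightarrow> norm (c \<alpha>) \<le> C * exp (- r * norm \<alpha> powr (1 / s))" by blast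
  note sm = exp_series_smooth[OF exp_decay_moment_bound(1)[OF basis r(1) s r(2)]]
  have s0m: "(\<lambda>\<alpha>. norm (c \<alpha>)) summable_on ?A" using exp_decay_moment_bound(1)[OF basis r(1) s r(2), of 0] by simp
  let ?K = "(2 ^ CARD('n)) powr s :: real"
  have K: "?K > 0" by simp
  have "?g \<in> (if roum then gevrey s else gevrey0 s)"
  proof (cases roum)
    case True
    obtain D where D: "\<And>\<beta> x. norm (dmi \<beta> ?g x) \<le> D * (?K * (2 * s / r) powr s) ^ mi_abs \<beta> * mi_fact \<beta> powr s"
      using exp_series_gevrey_bound[OF basis r(1) s r(2)] by blast
    have "0 < ?K * (2 * s / r) powr s" using r s by simp
    then have "?g \<in> gevrey s" unfolding gevrey_def using sm(2) D by blast
    then show ?thesis using True by simp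
  next
    case False
    have "\<exists>D. \<forall>\<beta> x. norm (dmi \<beta> ?g x) \<le> D * h ^ mi_abs \<beta> * mi_fact \<beta> powr s" if h: "0 < h" for h
    proof -
      \<comment> \<open>Solves \<open>K * (2 s / q)^s = h\<close> for the rate \<open>q\<close>, so
        that decay at every rate yields every scale \<open>h\<close>.\<close>
      define q where "q = 2 * s / (h / ?K) powr (1 / s)"
      have q: "0 < q" using h s by (simp add: q_def)
      have "2 * s / q = (h / ?K) powr (1 / s)" using h s by (simp add: q_def)
      then have e: "?K * (2 * s / q) powr s = h" using h s by (simp add: powr_powr)
      obtain C' where "\<forall>\<alpha>\<in>?A. norm (c \<alpha>) \<le> C' * exp (- q * norm \<alpha> powr (1 / s))"
        using c False q unfolding coeff_decay_def by auto
      then show ?thesis using exp_series_gevrey_bound[OF basis q s, of c C'] unfolding e by blast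
    qed
    then have "?g \<in> gevrey0 s" unfolding gevrey0_def using sm(2) by blast
    then show ?thesis using False by simp
  qed
  moreover have "u \<psi> = (LINT x|lborel. ?g x * \<psi> x)" if "\<psi> \<in> GS_test b s0 t0" for \<psi>
    by (rule has_sum_unique[OF u[OF that] exp_series_pairing[OF s0m GS_test_integrable[OF that s0 t0]]])
  ultimately show ?thesis unfolding in_gevrey_per_def using exp_series_periodic by blast
qed

section \<open>Fourier coefficients of periodic functions\<close>

lemma periodic_dlist:
  assumes "periodic_fun e g"
  shows "periodic_fun e (dlist is g)"
  unfolding periodic_fun_def
proof (intro ballI allI)
  fix j x assume j: "j \<in> lattice e"
  have "(\<lambda>y. g (y - (- j))) = g" using assms j by (simp add: periodic_fun_def)
  then have "dlist is g x = dlist is (\<lambda>y. g (y - (- j))) x" by simp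
  also have "\<dots> = dlist is g (x + j)" unfolding dlist_translate by simp
  finally show "dlist is g (x + j) = dlist is g x" by simp
qed

lemma periodic_fun_profile:
  assumes "periodic_fun e g"
  shows "zperiodic (\<lambda>r. g (lmap e r))"
  unfolding zperiodic_def lmap_add
proof (intro allI)
  fix k r
  have "lmap e (zvec k) \<in> lattice e" by (simp add: lattice_eq)
  then show "g (lmap e r + lmap e (zvec k)) = g (lmap e r)" using assms by (simp add: periodic_fun_def)
qed

lemma continuous_profile: "continuous_on UNIV g \<Longrightarrow> continuous_on UNIV (\<lambda>r. g (lmap e r))"
  by (rule continuous_on_compose2[OF _ lmap_continuous]) (assumption, rule subset_UNIV)

definition per_coeff :: "('n::finite \<Rightarrow> real^'n) \<Rightarrow> (real^'n \<Rightarrow> complex) \<Rightarrow> real^'n \<Rightarrow> complex" where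
  "per_coeff e g \<alpha> = cube_integral (\<lambda>r. g (lmap e r) * cis (- (lmap e r \<bullet> \<alpha>)))"

lemma per_coeff_norm_le:
  assumes g: "continuous_on UNIV g" and M: "\<And>x. x \<in> lmap e ` cbox 0 1 \<Longrightarrow> norm (g x) \<le> M"
  shows "norm (per_coeff e g \<alpha>) \<le> M"
  unfolding per_coeff_def
proof (rule cube_integral_norm_le)
  show "(\<lambda>r. g (lmap e r) * cis (- (lmap e r \<bullet> \<alpha>))) \<in> borel_measurable borel"
    by (intro borel_measurable_continuous_onI continuous_intros continuous_profile g lmap_continuous)
  fix t :: "real^'a" assume "t \<in> ucube 0"
  then have "t \<in> cbox 0 1" using ucube_subset[of 0] by auto
  then show "norm (g (lmap e t) * cis (- (lmap e t \<bullet> \<alpha>))) \<le> M" using M by (simp add: norm_mult)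
qed

context
  fixes e :: "'n::finite \<Rightarrow> real^'n"
  assumes basis: "inj e" "independent (range e)"
begin

lemma periodic_fun_bounded:
  assumes "periodic_fun e g" "continuous_on UNIV g"
  shows "\<exists>M. \<forall>x. norm (g x) \<le> M"
proof -
  obtain M where M: "\<And>r. norm (g (lmap e r)) \<le> M"
    using zperiodic_bounded[OF periodic_fun_profile[OF assms(1)] continuous_profile[OF assms(2)]] by blast
  have "norm (g x) \<le> M" for x
  proof -
    obtain r where "x = lmap e r" using lmap_surj[OF basis] by blast
    then show ?thesis using M by simp
  qed
  then show ?thesis by blast
qed

text \<open>Moving \<open>g\<close> by \<tau> along axis \<open>i\<close> multiplies its coefficient
  by \<open>cis (\<tau> \<alpha>_i)\<close>; comparing derivatives at \<tau> = 0 gives the rule.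
  This suits a skew cell, whose faces need not be aligned with the axes.\<close>

lemma per_coeff_dpart:
  assumes g: "smooth g" "periodic_fun e g" and \<alpha>: "\<alpha> \<in> dual_lattice e"
  shows "per_coeff e (dpart i g) \<alpha> = (\<i> * of_real (\<alpha> $ i)) * per_coeff e g \<alpha>"
proof -
  let ?c = "\<lambda>r. cis (- (lmap e r \<bullet> \<alpha>))"
  let ?Q = "\<lambda>r. g (lmap e r) * ?c r"
  have gc: "continuous_on UNIV g" "continuous_on UNIV (dpart i g)"
    using smooth_continuous smooth_dpart g(1) by blast+
  have per': "periodic_fun e (dpart i g)" using periodic_dlist[OF g(2), of "[i]"] by simp
  obtain M0 where M0: "\<And>x. norm (g x) \<le> M0" using periodic_fun_bounded[OF g(2) gc(1)] by blast
  obtain M where M: "\<And>x. norm (dpart i g x) \<le> M" using periodic_fun_bounded[OF per' gc(2)] by blast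
  have M': "0 \<le> M" by (rule order_trans[OF norm_ge_zero M])
  \<comment> \<open>Axis directions need not be lattice directions; \<open>r0\<close> holds the
    coordinates of the axis vector in the basis.\<close>
  obtain r0 where r0: "axis i 1 = lmap e r0" using lmap_surj[OF basis] by blast
  have lm: "lmap e r + \<tau> *\<^sub>R axis i 1 = lmap e (r + \<tau> *\<^sub>R r0)" for r \<tau>
    unfolding r0 lmap_add by (simp add: linear_scale[OF lmap_linear])
  define F where "F \<tau> r = indicator (ucube 0) r *\<^sub>R (g (lmap e r + \<tau> *\<^sub>R axis i 1) * ?c r)" for \<tau> r
  define F' where "F' \<tau> r = indicator (ucube 0) r *\<^sub>R (dpart i g (lmap e r + \<tau> *\<^sub>R axis i 1) * ?c r)" for \<tau> r
  have cQ: "continuous_on UNIV ?Q" by (intro continuous_intros continuous_profile gc lmap_continuous)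
  have pQ: "zperiodic ?Q" by (rule zperiodic_mult[OF periodic_fun_profile[OF g(2)] zperiodic_dual_cis[OF \<alpha>]])
  have J: "(LINT r|lborel. F \<tau> r) = cis (\<tau> * \<alpha> $ i) * per_coeff e g \<alpha>" for \<tau>
  proof -
    have "g (lmap e r + \<tau> *\<^sub>R axis i 1) * ?c r = cis (\<tau> * \<alpha> $ i) * ?Q (r + \<tau> *\<^sub>R r0)" for r
    proof -
      have "- (lmap e r \<bullet> \<alpha>) = \<tau> * \<alpha> $ i + - (lmap e (r + \<tau> *\<^sub>R r0) \<bullet> \<alpha>)"
        unfolding lm[symmetric] by (simp add: inner_add_left inner_axis')
      then have "?c r = cis (\<tau> * \<alpha> $ i) * ?c (r + \<tau> *\<^sub>R r0)" by (simp only: cis_mult)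
      then show ?thesis unfolding lm by (simp only: mult.left_commute)
    qed
    then have "(LINT r|lborel. F \<tau> r) = (LINT r|lborel. cis (\<tau> * \<alpha> $ i) * (indicator (ucube 0) r *\<^sub>R ?Q (r + \<tau> *\<^sub>R r0)))"
      unfolding F_def by (intro Bochner_Integration.integral_cong refl) (simp only: mult_scaleR_right)
    also have "\<dots> = cis (\<tau> * \<alpha> $ i) * (LINT r|lborel. indicator (ucube 0) r *\<^sub>R ?Q (r + \<tau> *\<^sub>R r0))"
      by (rule integral_mult_right_zero)
    also have "(LINT r|lborel. indicator (ucube 0) r *\<^sub>R ?Q (r + \<tau> *\<^sub>R r0)) = cube_integral ?Q"
      by (rule cube_integral_shift[OF pQ cQ])
    finally show ?thesis unfolding per_coeff_def .
  qed
  have "((\<lambda>\<tau>. LINT r|lborel. F \<tau> r) has_vector_derivative (LINT r|lborel. F' 0 r)) (at 0)"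
  proof (rule has_vector_derivative_integral(1)[where G = "\<lambda>r. indicator (ucube 0) r *\<^sub>R M"])
    fix \<tau> :: real and r
    show "integrable lborel (F \<tau>)"
      unfolding F_def
    proof (rule integrable_ucube[where B = M0])
      show "(\<lambda>t. g (lmap e t + \<tau> *\<^sub>R axis i 1) * ?c t) \<in> borel_measurable borel"
        by (intro borel_measurable_continuous_onI continuous_intros continuous_on_compose2[OF gc(1)] lmap_continuous) simp
    qed (simp add: norm_mult M0)
    show "((\<lambda>\<tau>. F \<tau> r) has_vector_derivative F' \<tau> r) (at \<tau>)"
      unfolding F_def F'_def
      by (intro bounded_linear.has_vector_derivative[OF bounded_linear_scaleR_right]
        bounded_linear.has_vector_derivative[OF bounded_linear_mult_left] smooth_has_vector_derivative[OF g(1)])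
    show "norm (F' \<tau> r) \<le> indicator (ucube 0) r *\<^sub>R M"
      using M M' by (simp add: F'_def norm_mult indicator_def)
  next
    show "integrable lborel (\<lambda>r::real^'n. indicator (ucube 0) r *\<^sub>R M)"
      by (rule integrable_ucube[where B = M]) (use M' in simp_all)
  qed
  moreover have "(LINT r|lborel. F' 0 r) = per_coeff e (dpart i g) \<alpha>"
    by (simp add: F'_def per_coeff_def cube_integral_def)
  moreover have "((\<lambda>\<tau>. cis (\<tau> * \<alpha> $ i) * per_coeff e g \<alpha>) has_vector_derivative (\<i> * of_real (\<alpha> $ i)) * per_coeff e g \<alpha>) (at 0)"
  proof -
    have "((\<lambda>\<tau>. \<tau> * \<alpha> $ i) has_derivative (\<lambda>\<tau>. \<tau> * \<alpha> $ i)) (at 0)" by (auto intro!: derivative_eq_intros)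
    from has_derivative_cis[OF this]
    have "((\<lambda>\<tau>. cis (\<tau> * \<alpha> $ i)) has_vector_derivative \<i> * of_real (\<alpha> $ i)) (at 0)"
      unfolding has_vector_derivative_def by (simp add: scaleR_conv_of_real mult_ac)
    then show ?thesis by (rule bounded_linear.has_vector_derivative[OF bounded_linear_mult_left])
  qed
  ultimately show ?thesis unfolding J using vector_derivative_unique_at by metis
qed

lemma per_coeff_dlist_replicate:
  assumes g: "smooth g" "periodic_fun e g" and \<alpha>: "\<alpha> \<in> dual_lattice e"
  shows "per_coeff e (dlist (replicate k i) g) \<alpha> = (\<i> * of_real (\<alpha> $ i)) ^ k * per_coeff e g \<alpha>"
proof (induction k)
  case (Suc k)
  then show ?case using per_coeff_dpart[OF smooth_dlist[OF g(1)] periodic_dlist[OF g(2)] \<alpha>, of i "replicate k i"]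
    by simp
qed simp

text \<open>The coefficient sees \<open>g\<close> only on the compact image of the closed cube,
  where the Gevrey condition provides its constant; derivatives are again taken along the largest
  coordinate of \<alpha>.\<close>

lemma per_coeff_gevrey_decay:
  assumes g: "smooth g" "periodic_fun e g" and \<alpha>: "\<alpha> \<in> dual_lattice e" and s: "0 < s" and h: "0 < h"
    and C: "\<And>\<beta> x. x \<in> lmap e ` cbox 0 1 \<Longrightarrow> norm (dmi \<beta> g x) \<le> C * h ^ mi_abs \<beta> * mi_fact \<beta> powr s"
  shows "norm (per_coeff e g \<alpha>) \<le> (2 powr s * C) * exp (- (s / 2 * (1 / (real CARD('n) * h)) powr (1 / s)) * norm \<alpha> powr (1 / s))"
proof (rule gevrey_to_exp)
  let ?n = "real CARD('n)"
  have "lmap e 0 \<in> lmap e ` cbox 0 1" by (rule imageI) (simp add: mem_box_cart)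
  from C[OF this, of "\<lambda>_. 0"] have "norm (dmi (\<lambda>_. 0) g (lmap e 0)) \<le> C"
    by (simp add: mi_abs_def mi_fact_def)
  then show C0: "0 \<le> C" by (rule order_trans[OF norm_ge_zero])
  show "0 \<le> norm (per_coeff e g \<alpha>)" "0 \<le> norm \<alpha>" "0 < ?n * h" "0 < s" using h s by simp_all
  fix k
  obtain i where i: "norm \<alpha> ^ k \<le> ?n ^ k * \<bar>\<alpha> $ i\<bar> ^ k" using norm_power_le_component by blast
  have "norm (per_coeff e g \<alpha>) * \<bar>\<alpha> $ i\<bar> ^ k = norm (per_coeff e (dlist (replicate k i) g) \<alpha>)"
    unfolding per_coeff_dlist_replicate[OF g \<alpha>] by (simp add: norm_mult norm_power)
  also have "\<dots> \<le> C * h ^ k * fact k powr s"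
  proof (rule per_coeff_norm_le[OF smooth_continuous[OF smooth_dlist[OF g(1)]]])
    fix x assume x: "x \<in> lmap e ` cbox 0 1"
    let ?\<beta> = "count (mset (replicate k i))"
    have a: "mi_abs ?\<beta> = k" using mi_abs_count[of "replicate k i"] by simp
    have "norm (dlist (replicate k i) g x) \<le> C * h ^ k * mi_fact ?\<beta> powr s"
      using C[OF x, of ?\<beta>] unfolding dlist_dmi[OF g(1), symmetric] a .
    also have "\<dots> \<le> C * h ^ k * fact k powr s"
      using mi_fact_le[of ?\<beta>] mi_fact_ge_1[of ?\<beta>] C0 h s unfolding a
      by (intro mult_left_mono powr_mono2) simp_all
    finally show "norm (dlist (replicate k i) g x) \<le> C * h ^ k * fact k powr s" .
  qed
  finally have 1: "norm (per_coeff e g \<alpha>) * \<bar>\<alpha> $ i\<bar> ^ k \<le> C * h ^ k * fact k powr s" .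
  have "norm (per_coeff e g \<alpha>) * norm \<alpha> ^ k \<le> norm (per_coeff e g \<alpha>) * (?n ^ k * \<bar>\<alpha> $ i\<bar> ^ k)"
    by (rule mult_left_mono[OF i]) simp
  also have "\<dots> = ?n ^ k * (norm (per_coeff e g \<alpha>) * \<bar>\<alpha> $ i\<bar> ^ k)" by simp
  also have "\<dots> \<le> ?n ^ k * (C * h ^ k * fact k powr s)" by (rule mult_left_mono[OF 1]) simp
  also have "\<dots> = C * (?n * h) ^ k * fact k powr s" by (simp add: power_mult_distrib mult_ac)
  finally show "norm (per_coeff e g \<alpha>) * norm \<alpha> ^ k \<le> C * (?n * h) ^ k * fact k powr s" .
qed

lemma periodic_expansion:
  assumes g: "continuous_on UNIV g" "periodic_fun e g"
    and sm: "(\<lambda>\<alpha>. norm (per_coeff e g \<alpha>)) summable_on dual_lattice e"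
  shows "exp_series (dual_lattice e) (per_coeff e g) x = g x"
proof -
  obtain r where x: "x = lmap e r" using lmap_surj[OF basis] by blast
  have "(\<lambda>k. norm (per_coeff e g (dual_vec e k))) summable_on UNIV"
    by (subst summable_on_reindex_bij_betw[OF bij_betw_dual_vec[OF basis]]) (rule sm)
  then have "((\<lambda>k. per_coeff e g (dual_vec e k) * cis (r \<bullet> ((2 * pi) *\<^sub>R zvec k))) has_sum g (lmap e r)) UNIV"
    by (rule torus_inversion[OF periodic_fun_profile[OF g(2)] continuous_profile[OF g(1)], rotated])
      (simp only: per_coeff_def lmap_inner_dual_vec[OF basis])
  then have "((\<lambda>k. per_coeff e g (dual_vec e k) * cis (x \<bullet> dual_vec e k)) has_sum g x) UNIV"
    unfolding x lmap_inner_dual_vec[OF basis] .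
  then have "((\<lambda>\<alpha>. per_coeff e g \<alpha> * cis (x \<bullet> \<alpha>)) has_sum g x) (dual_lattice e)"
    by (subst (asm) has_sum_reindex_bij_betw[OF bij_betw_dual_vec[OF basis]])
  then show ?thesis unfolding exp_series_def by (rule infsumI)
qed

text \<open>The Gevrey bounds make the coefficients of the representing function decay; pairing its
  absolutely convergent expansion with a test function recovers the action of
  \<open>u\<close>.\<close>

lemma coeff_decay_if_in_gevrey_per:
  assumes s: "0 < s" and s0: "0 < s0" and t0: "0 < t0" and u: "in_gevrey_per roum e s b s0 t0 u"
  shows "\<exists>c. coeff_decay roum e s c \<and>
    (\<forall>\<psi>\<in>GS_test b s0 t0. ((\<lambda>\<alpha>. c \<alpha> * ftrans \<psi> \<alpha>) has_sum u \<psi>) (dual_lattice e))"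
proof -
  let ?A = "dual_lattice e" and ?n = "real CARD('n)"
  have n0: "0 < ?n" by simp
  obtain g where g: "g \<in> (if roum then gevrey s else gevrey0 s)" "periodic_fun e g"
    and ug: "\<And>\<psi>. \<psi> \<in> GS_test b s0 t0 \<Longrightarrow> u \<psi> = (LINT x|lborel. g x * \<psi> x)"
    using u unfolding in_gevrey_per_def by blast
  have sg: "smooth g" using g(1) by (auto simp: gevrey_def gevrey0_def split: if_splits)
  have K: "compact (lmap e ` cbox 0 1)" by (rule compact_continuous_image[OF lmap_continuous compact_cbox])
  have dec: "coeff_decay roum e s (per_coeff e g)"
  proof (cases roum)
    case True
    then have "g \<in> gevrey s" using g(1) by simp
    then have "\<exists>h>0. \<exists>C. \<forall>\<beta>. \<forall>x\<in>lmap e ` cbox 0 1. norm (dmi \<beta> g x) \<le> C * h ^ mi_abs \<beta> * mi_fact \<beta> powr s"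
      using K unfolding gevrey_def by blast
    then obtain h C where h: "0 < h" "\<And>\<beta> x. x \<in> lmap e ` cbox 0 1 \<Longrightarrow> norm (dmi \<beta> g x) \<le> C * h ^ mi_abs \<beta> * mi_fact \<beta> powr s"
      by blast
    have "0 < s / 2 * (1 / (?n * h)) powr (1 / s)" using s h n0 by simp
    with per_coeff_gevrey_decay[OF sg g(2) _ s h]
    have "\<exists>r>0. \<exists>C. \<forall>\<alpha>\<in>?A. norm (per_coeff e g \<alpha>) \<le> C * exp (- r * norm \<alpha> powr (1 / s))" by blast
    then show ?thesis unfolding coeff_decay_def using True by simp
  next
    case False
    have "\<exists>C. \<forall>\<alpha>\<in>?A. norm (per_coeff e g \<alpha>) \<le> C * exp (- r * norm \<alpha> powr (1 / s))" if r: "0 < r" for r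
    proof -
      \<comment> \<open>As for test functions, \<open>h\<close> solves the equation between scale
        and rate.\<close>
      define h where "h = (s / (2 * r)) powr s / ?n"
      have h: "0 < h" using s r n0 by (simp add: h_def)
      have "?n * h = (s / (2 * r)) powr s" using n0 by (simp add: h_def)
      then have "1 / (?n * h) = (2 * r / s) powr s" using s r by (simp add: powr_divide)
      then have e: "s / 2 * (1 / (?n * h)) powr (1 / s) = r" using s r by (simp add: powr_powr)
      have "g \<in> gevrey0 s" using g(1) False by simp
      then have "\<forall>h>0. \<exists>C. \<forall>\<beta>. \<forall>x\<in>lmap e ` cbox 0 1. norm (dmi \<beta> g x) \<le> C * h ^ mi_abs \<beta> * mi_fact \<beta> powr s"
        using K unfolding gevrey0_def by blast
      with h obtain C where "\<And>\<beta> x. x \<in> lmap e ` cbox 0 1 \<Longrightarrow> norm (dmi \<beta> g x) \<le> C * h ^ mi_abs \<beta> * mi_fact \<beta> powr s"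
        by blast
      from per_coeff_gevrey_decay[OF sg g(2) _ s h this] show ?thesis unfolding e by blast
    qed
    then show ?thesis unfolding coeff_decay_def using False by simp
  qed
  have "\<exists>r>0. \<exists>C. \<forall>\<alpha>\<in>?A. norm (per_coeff e g \<alpha>) \<le> C * exp (- r * norm \<alpha> powr (1 / s))"
    using dec zero_less_one unfolding coeff_decay_def by (cases roum) (simp_all only: if_True if_False, blast)
  then obtain r C where r: "0 < r" "\<And>\<alpha>. \<alpha> \<in> ?A \<Longrightarrow> norm (per_coeff e g \<alpha>) \<le> C * exp (- r * norm \<alpha> powr (1 / s))" by blast
  have sm: "(\<lambda>\<alpha>. norm (per_coeff e g \<alpha>)) summable_on ?A"
    using exp_decay_moment_bound(1)[OF basis r(1) s r(2), of 0] by simp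
  have "((\<lambda>\<alpha>. per_coeff e g \<alpha> * ftrans \<psi> \<alpha>) has_sum u \<psi>) ?A" if "\<psi> \<in> GS_test b s0 t0" for \<psi>
    using exp_series_pairing[OF sm GS_test_integrable[OF that s0 t0]]
    unfolding periodic_expansion[OF smooth_continuous[OF sg] g(2) sm] ug[OF that] .
  then show ?thesis using dec by blast
qed

end

section \<open>Short-time Fourier transforms and coefficients\<close>

lemma norm_stft:
  fixes u :: "(real^'n::finite \<Rightarrow> complex) \<Rightarrow> complex"
  shows "norm (stft \<phi> u x \<xi>) = (2 * pi) powr (- real CARD('n) / 2) * norm (u (stft_window \<phi> x \<xi>))"
  by (simp add: stft_def norm_mult)

definition coeff_growth :: "bool \<Rightarrow> ('n::finite \<Rightarrow> real^'n) \<Rightarrow> real \<Rightarrow> (real^'n \<Rightarrow> complex) \<Rightarrow> bool" where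
  "coeff_growth roum e s c \<longleftrightarrow>
    (if roum then (\<forall>\<epsilon>>0. \<exists>C. \<forall>\<alpha>\<in>dual_lattice e. norm (c \<alpha>) \<le> C * exp (\<epsilon> * norm \<alpha> powr (1 / s)))
     else (\<exists>\<epsilon>>0. \<exists>C. \<forall>\<alpha>\<in>dual_lattice e. norm (c \<alpha>) \<le> C * exp (\<epsilon> * norm \<alpha> powr (1 / s))))"

lemma in_gevrey_per_dual_iff:
  "in_gevrey_per_dual roum e s b s0 t0 u \<longleftrightarrow> (\<exists>c. coeff_growth roum e s c \<and>
     (\<forall>\<psi>\<in>GS_test b s0 t0. ((\<lambda>\<alpha>. c \<alpha> * ftrans \<psi> \<alpha>) has_sum u \<psi>) (dual_lattice e)))"
  unfolding in_gevrey_per_dual_def coeff_growth_def fourier_ftrans ..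

section \<open>From coefficients to the short-time Fourier transform\<close>

context
  fixes e :: "'n::finite \<Rightarrow> real^'n" and \<phi> :: "real^'n \<Rightarrow> complex" and u :: "(real^'n \<Rightarrow> complex) \<Rightarrow> complex"
    and c :: "real^'n \<Rightarrow> complex" and s :: real
  assumes basis: "inj e" "independent (range e)" and s: "0 < s" and \<phi>m: "\<phi> \<in> borel_measurable borel"
    and ser: "\<And>x \<xi>. ((\<lambda>\<alpha>. c \<alpha> * ftrans (stft_window \<phi> x \<xi>) \<alpha>) has_sum u (stft_window \<phi> x \<xi>)) (dual_lattice e)"
begin

lemma stft_le_series:
  assumes "\<And>\<alpha>. \<alpha> \<in> dual_lattice e \<Longrightarrow> norm (c \<alpha>) * norm (ftrans \<phi> (\<xi> - \<alpha>)) \<le> K * m \<alpha>" and "m summable_on dual_lattice e"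
  shows "norm (stft \<phi> u x \<xi>) \<le> (2 * pi) powr (- real CARD('n) / 2) * (K * infsum m (dual_lattice e))"
  unfolding norm_stft
proof (rule mult_left_mono)
  show "norm (u (stft_window \<phi> x \<xi>)) \<le> K * infsum m (dual_lattice e)"
    by (rule norm_infsum_le[OF ser has_sum_cmult_right[OF has_sum_infsum[OF assms(2)]]])
      (simp add: ftrans_window[OF \<phi>m] norm_mult assms(1))
qed simp

text \<open>Half of the decay of the window moves the growth of \<open>c\<close> from \<alpha> to
  \<xi>, hence the condition on \<epsilon> and \<rho>. The other half becomes polynomial decay in
  \<xi> - \<alpha>, turned into a summable weight in \<alpha> by
  \<open>1 + |\<alpha>| \<le> (1 + |\<xi>|) (1 + |\<xi> - \<alpha>|)\<close>. The remaining power of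
  \<open>1 + |\<xi>|\<close> is absorbed by a second exponential, which explains the factor 2 in the
  rate.\<close>

lemma stft_growth:
  assumes C: "0 \<le> C" "\<And>\<alpha>. \<alpha> \<in> dual_lattice e \<Longrightarrow> norm (c \<alpha>) \<le> C * exp (\<epsilon> * norm \<alpha> powr (1 / s))"
    and D: "0 < D" "\<And>\<eta>. norm (ftrans \<phi> \<eta>) \<le> D * exp (- \<rho> * norm \<eta> powr (1 / s))"
    and \<epsilon>: "0 < \<epsilon>" and \<rho>: "0 < \<rho>" "\<epsilon> * 2 powr (1 / s) \<le> \<rho> / 2"
  shows "\<exists>C>0. \<forall>x \<xi>. norm (stft \<phi> u x \<xi>) \<le> C * exp (2 * (\<epsilon> * 2 powr (1 / s)) * norm \<xi> powr (1 / s))"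
proof -
  let ?A = "dual_lattice e" and ?p = "1 / s" and ?m = "2 * CARD('n)"
  define k where "k = \<epsilon> * 2 powr ?p"
  have k: "0 < k" using \<epsilon> by (simp add: k_def)
  obtain C1 where C1: "C1 > 0" "\<And>x. 0 \<le> x \<Longrightarrow> exp (- (\<rho> / 2) * x powr ?p) \<le> C1 * (1 / (1 + x) ^ ?m)"
    using exp_le_inverse_power[of "\<rho> / 2" s ?m] \<rho> s by auto
  obtain C2 where C2: "C2 > 0" "\<And>x. 0 \<le> x \<Longrightarrow> exp (- k * x powr ?p) \<le> C2 * (1 / (1 + x) ^ ?m)"
    using exp_le_inverse_power[OF k s, of ?m] by blast
  let ?w = "\<lambda>\<alpha>::real^'n. 1 / (1 + norm \<alpha>) ^ ?m"
  have w0: "0 < (1 + norm \<alpha>) ^ ?m" for \<alpha> :: "real^'n" by (intro zero_less_power add_pos_nonneg) auto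
  have poly: "(1 + norm \<xi>) ^ ?m \<le> C2 * exp (k * norm \<xi> powr ?p)" for \<xi> :: "real^'n"
  proof -
    have "(1 + norm \<xi>) ^ ?m * exp (- k * norm \<xi> powr ?p) \<le> C2"
      using C2(2)[of "norm \<xi>"] w0[of \<xi>] by (simp add: field_simps)
    then have "(1 + norm \<xi>) ^ ?m * exp (- k * norm \<xi> powr ?p) * exp (k * norm \<xi> powr ?p) \<le> C2 * exp (k * norm \<xi> powr ?p)"
      by (rule mult_right_mono) simp
    then show ?thesis by (simp add: mult.assoc flip: exp_add)
  qed
  have bound: "norm (c \<alpha>) * norm (ftrans \<phi> (\<xi> - \<alpha>)) \<le> (C * D * C1 * C2 * exp (2 * k * norm \<xi> powr ?p)) * ?w \<alpha>"
    if \<alpha>: "\<alpha> \<in> ?A" for \<alpha> \<xi>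
  proof -
    let ?y = "norm (\<xi> - \<alpha>) powr ?p" and ?x = "norm \<xi> powr ?p"
    have sub: "norm \<alpha> powr ?p \<le> 2 powr ?p * (?x + ?y)"
      using norm_add_powr_le[of ?p \<xi> "\<alpha> - \<xi>"] s by (simp add: norm_minus_commute)
    have "\<epsilon> * norm \<alpha> powr ?p \<le> k * (?x + ?y)"
      using mult_left_mono[OF sub less_imp_le[OF \<epsilon>]] by (simp add: k_def mult.assoc)
    moreover have "k * ?y \<le> \<rho> / 2 * ?y" using \<rho>(2) unfolding k_def by (rule mult_right_mono) simp
    ultimately have "\<epsilon> * norm \<alpha> powr ?p + - \<rho> * ?y \<le> k * ?x + - (\<rho> / 2) * ?y" by (simp add: algebra_simps)
    then have E: "exp (\<epsilon> * norm \<alpha> powr ?p) * exp (- \<rho> * ?y) \<le> exp (k * ?x) * exp (- (\<rho> / 2) * ?y)"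
      unfolding exp_add[symmetric] exp_le_cancel_iff .
    have tri: "(1 + norm \<alpha>) ^ ?m \<le> (1 + norm \<xi>) ^ ?m * (1 + norm (\<xi> - \<alpha>)) ^ ?m"
    proof -
      have "norm \<alpha> \<le> norm \<xi> + norm (\<xi> - \<alpha>)" using norm_triangle_ineq[of \<xi> "\<alpha> - \<xi>"] by (simp add: norm_minus_commute)
      moreover have "0 \<le> norm \<xi> * norm (\<xi> - \<alpha>)" by simp
      moreover have "(1 + norm \<xi>) * (1 + norm (\<xi> - \<alpha>)) = 1 + norm \<xi> + norm (\<xi> - \<alpha>) + norm \<xi> * norm (\<xi> - \<alpha>)"
        by (simp only: distrib_left distrib_right mult_1_left mult_1_right add_ac)
      ultimately have "1 + norm \<alpha> \<le> (1 + norm \<xi>) * (1 + norm (\<xi> - \<alpha>))" by linarith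
      then show ?thesis unfolding power_mult_distrib[symmetric] by (rule power_mono) simp
    qed
    have W: "1 / (1 + norm (\<xi> - \<alpha>)) ^ ?m \<le> (1 + norm \<xi>) ^ ?m * ?w \<alpha>"
      using tri w0[of \<alpha>] w0[of "\<xi> - \<alpha>"] by (simp add: field_simps)
    have "norm (c \<alpha>) * norm (ftrans \<phi> (\<xi> - \<alpha>)) \<le> (C * exp (\<epsilon> * norm \<alpha> powr ?p)) * (D * exp (- \<rho> * ?y))"
      using C(1) by (intro mult_mono C(2)[OF \<alpha>] D(2)) simp_all
    also have "\<dots> = (C * D) * (exp (\<epsilon> * norm \<alpha> powr ?p) * exp (- \<rho> * ?y))" by (simp only: mult_ac)
    also have "\<dots> \<le> (C * D) * (exp (k * ?x) * exp (- (\<rho> / 2) * ?y))"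
      using C(1) D(1) by (intro mult_left_mono[OF E]) simp
    also have "\<dots> \<le> (C * D) * (exp (k * ?x) * (C1 * (1 / (1 + norm (\<xi> - \<alpha>)) ^ ?m)))"
      using C(1) D(1) by (intro mult_left_mono C1(2)) simp_all
    also have "\<dots> \<le> (C * D) * (exp (k * ?x) * (C1 * ((1 + norm \<xi>) ^ ?m * ?w \<alpha>)))"
      using C(1) D(1) C1(1) by (intro mult_left_mono W) simp_all
    also have "\<dots> \<le> (C * D) * (exp (k * ?x) * (C1 * ((C2 * exp (k * ?x)) * ?w \<alpha>)))"
      using C(1) D(1) C1(1) by (intro mult_left_mono mult_right_mono poly) simp_all
    also have "\<dots> = (C * D * C1 * C2 * (exp (k * ?x) * exp (k * ?x))) * ?w \<alpha>" by (simp only: mult_ac)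
    also have "exp (k * ?x) * exp (k * ?x) = exp (2 * k * ?x)" by (simp flip: exp_add)
    finally show ?thesis .
  qed
  define C' where "C' = (2 * pi) powr (- real CARD('n) / 2) * (C * D * C1 * C2 * infsum ?w ?A)"
  have "norm (stft \<phi> u x \<xi>) \<le> (\<bar>C'\<bar> + 1) * exp (2 * k * norm \<xi> powr ?p)" for x \<xi>
  proof -
    have "norm (stft \<phi> u x \<xi>) \<le> (2 * pi) powr (- real CARD('n) / 2) * ((C * D * C1 * C2 * exp (2 * k * norm \<xi> powr ?p)) * infsum ?w ?A)"
      by (rule stft_le_series[OF bound dual_lattice_summable[OF basis]])
    also have "\<dots> = C' * exp (2 * k * norm \<xi> powr ?p)" by (simp only: C'_def mult_ac)
    also have "\<dots> \<le> (\<bar>C'\<bar> + 1) * exp (2 * k * norm \<xi> powr ?p)" by (rule mult_right_mono) simp_all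
    finally show ?thesis .
  qed
  then show ?thesis unfolding k_def by (intro exI[of _ "\<bar>C'\<bar> + 1"]) simp
qed

text \<open>Half of the decay in \<alpha> is kept for the sum over the lattice. The other half, with
  the decay in \<xi> - \<alpha>, dominates \<open>|\<xi>|^(1/s)\<close> since \<xi> is the sum of
  \<alpha> and \<xi> - \<alpha>; this explains
  \<open>\<delta> / (2 * 2 powr (1 / s))\<close>.\<close>

lemma stft_decay:
  assumes C: "0 \<le> C" "\<And>\<alpha>. \<alpha> \<in> dual_lattice e \<Longrightarrow> norm (c \<alpha>) \<le> C * exp (- \<delta> * norm \<alpha> powr (1 / s))"
    and D: "0 < D" "\<And>\<eta>. norm (ftrans \<phi> \<eta>) \<le> D * exp (- \<delta> * norm \<eta> powr (1 / s))" and \<delta>: "0 < \<delta>"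
  shows "\<exists>C>0. \<forall>x \<xi>. norm (stft \<phi> u x \<xi>) \<le> C * exp (- (\<delta> / (2 * 2 powr (1 / s))) * norm \<xi> powr (1 / s))"
proof -
  let ?A = "dual_lattice e" and ?p = "1 / s"
  define k where "k = \<delta> / (2 * 2 powr ?p)"
  let ?w = "\<lambda>\<alpha>::real^'n. exp (- (\<delta> / 2) * norm \<alpha> powr ?p)"
  have sw: "?w summable_on ?A" by (rule exp_decay_summable[OF basis _ s]) (use \<delta> in simp)
  have bound: "norm (c \<alpha>) * norm (ftrans \<phi> (\<xi> - \<alpha>)) \<le> (C * D * exp (- k * norm \<xi> powr ?p)) * ?w \<alpha>"
    if \<alpha>: "\<alpha> \<in> ?A" for \<alpha> \<xi>
  proof -
    let ?y = "norm (\<xi> - \<alpha>) powr ?p" and ?x = "norm \<xi> powr ?p" and ?a = "norm \<alpha> powr ?p"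
    have sub: "?x \<le> 2 powr ?p * (?a + ?y)"
      using norm_add_powr_le[of ?p \<alpha> "\<xi> - \<alpha>"] s by simp
    have "k * ?x \<le> k * (2 powr ?p * (?a + ?y))" using \<delta> by (intro mult_left_mono[OF sub]) (simp add: k_def)
    also have "\<dots> = \<delta> / 2 * (?a + ?y)" by (simp add: k_def)
    finally have "k * ?x \<le> \<delta> / 2 * (?a + ?y)" .
    moreover have "0 \<le> \<delta> / 2 * ?y" using \<delta> by simp
    ultimately have "- \<delta> * ?a + - \<delta> * ?y \<le> - k * ?x + - (\<delta> / 2) * ?a" by (simp add: algebra_simps)
    then have E: "exp (- \<delta> * ?a) * exp (- \<delta> * ?y) \<le> exp (- k * ?x) * ?w \<alpha>"
      unfolding exp_add[symmetric] exp_le_cancel_iff .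
    have "norm (c \<alpha>) * norm (ftrans \<phi> (\<xi> - \<alpha>)) \<le> (C * exp (- \<delta> * ?a)) * (D * exp (- \<delta> * ?y))"
      using C(1) by (intro mult_mono C(2)[OF \<alpha>] D(2)) simp_all
    also have "\<dots> = (C * D) * (exp (- \<delta> * ?a) * exp (- \<delta> * ?y))" by (simp only: mult_ac)
    also have "\<dots> \<le> (C * D) * (exp (- k * ?x) * ?w \<alpha>)"
      using C(1) D(1) by (intro mult_left_mono[OF E]) simp
    finally show ?thesis by (simp only: mult_ac)
  qed
  define C' where "C' = (2 * pi) powr (- real CARD('n) / 2) * (C * D * infsum ?w ?A)"
  have "norm (stft \<phi> u x \<xi>) \<le> (\<bar>C'\<bar> + 1) * exp (- k * norm \<xi> powr ?p)" for x \<xi>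
  proof -
    have "norm (stft \<phi> u x \<xi>) \<le> (2 * pi) powr (- real CARD('n) / 2) * ((C * D * exp (- k * norm \<xi> powr ?p)) * infsum ?w ?A)"
      by (rule stft_le_series[OF bound sw])
    also have "\<dots> = C' * exp (- k * norm \<xi> powr ?p)" by (simp only: C'_def mult_ac)
    also have "\<dots> \<le> (\<bar>C'\<bar> + 1) * exp (- k * norm \<xi> powr ?p)" by (rule mult_right_mono) simp_all
    finally show ?thesis .
  qed
  then show ?thesis unfolding k_def by (intro exI[of _ "\<bar>C'\<bar> + 1"]) simp
qed

end

lemma exp_weight_mono:
  assumes "norm z \<le> C * exp (a * norm (x::'a::real_normed_vector) powr p)" "a \<le> a'"
  shows "norm z \<le> \<bar>C\<bar> * exp (a' * norm x powr p)"
proof -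
  have "C * exp (a * norm x powr p) \<le> \<bar>C\<bar> * exp (a' * norm x powr p)"
    using assms(2) by (intro mult_mono) (auto intro: mult_right_mono)
  with assms(1) show ?thesis by linarith
qed

context
  fixes e :: "'n::finite \<Rightarrow> real^'n" and \<phi> :: "real^'n \<Rightarrow> complex" and u :: "(real^'n \<Rightarrow> complex) \<Rightarrow> complex"
    and s s0 t0 :: real and b :: bool
  assumes basis: "inj e" "independent (range e)" and s: "0 < s" and s0: "0 < s0" and t0: "0 < t0"
    and win: "\<forall>x \<xi>. stft_window \<phi> x \<xi> \<in> GS_test b s0 t0" and nz: "\<phi> \<noteq> (\<lambda>_. 0)"
    and u: "dual_functional b s0 t0 u" and per: "periodic_dist e b s0 t0 u"
begin

lemma window_measurable: "\<phi> \<in> borel_measurable borel"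
proof -
  have "stft_window \<phi> 0 0 \<in> GS_test b s0 t0" using win by blast
  from window_GS_test[OF this s0 t0] show ?thesis by (rule smooth_measurable[OF GS_test_smooth])
qed

text \<open>The two cases differ in what is free: a window with some rate \<rho> leaves the growth
  \<epsilon> of \<open>c\<close> to be chosen, a window with every rate lets \<rho> be matched to
  the given \<epsilon>.\<close>

lemma coeff_growth_imp_stft_growth:
  assumes \<phi>: "\<phi> \<in> GS_test roum s t" and t: "0 < t"
    and ser: "\<forall>\<psi>\<in>GS_test b s0 t0. ((\<lambda>\<alpha>. c \<alpha> * ftrans \<psi> \<alpha>) has_sum u \<psi>) (dual_lattice e)"
    and g: "coeff_growth roum e s c"
  shows "if roum then \<forall>r>0. \<exists>C>0. \<forall>x \<xi>. norm (stft \<phi> u x \<xi>) \<le> C * exp (r * norm \<xi> powr (1 / s))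
    else \<exists>r>0. \<exists>C>0. \<forall>x \<xi>. norm (stft \<phi> u x \<xi>) \<le> C * exp (r * norm \<xi> powr (1 / s))"
proof -
  let ?k = "2 powr (1 / s)"
  have k: "0 < ?k" by simp
  have ser': "((\<lambda>\<alpha>. c \<alpha> * ftrans (stft_window \<phi> x \<xi>) \<alpha>) has_sum u (stft_window \<phi> x \<xi>)) (dual_lattice e)" for x \<xi>
    using ser win by blast
  have *: "\<exists>C>0. \<forall>x \<xi>. norm (stft \<phi> u x \<xi>) \<le> C * exp (2 * (\<epsilon> * ?k) * norm \<xi> powr (1 / s))"
    if \<epsilon>: "0 < \<epsilon>" "\<epsilon> * ?k \<le> \<rho> / 2" "0 < \<rho>" and D: "0 < D" "\<forall>\<eta>. norm (ftrans \<phi> \<eta>) \<le> D * exp (- \<rho> * norm \<eta> powr (1 / s))"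
      and C: "\<forall>\<alpha>\<in>dual_lattice e. norm (c \<alpha>) \<le> C * exp (\<epsilon> * norm \<alpha> powr (1 / s))" for \<epsilon> \<rho> C D
  proof (rule stft_growth[OF basis s window_measurable ser', where C = "\<bar>C\<bar>" and D = D and \<rho> = \<rho>])
    show "norm (c \<alpha>) \<le> \<bar>C\<bar> * exp (\<epsilon> * norm \<alpha> powr (1 / s))" if "\<alpha> \<in> dual_lattice e" for \<alpha>
      by (rule exp_weight_mono[OF C[rule_format, OF that]]) simp
    show "norm (ftrans \<phi> \<eta>) \<le> D * exp (- \<rho> * norm \<eta> powr (1 / s))" for \<eta> using D(2) by blast
  qed (use \<epsilon> D in simp_all)
  show ?thesis
  proof (cases roum)
    case True
    have "\<exists>r>0. \<exists>C>0. \<forall>\<eta>. norm (ftrans \<phi> \<eta>) \<le> C * exp (- r * norm \<eta> powr (1 / s))"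
      using ftrans_exp_decay[OF s t \<phi>] True by simp
    then obtain \<rho> D where D: "0 < \<rho>" "0 < D" "\<forall>\<eta>. norm (ftrans \<phi> \<eta>) \<le> D * exp (- \<rho> * norm \<eta> powr (1 / s))" by blast
    have "\<exists>C>0. \<forall>x \<xi>. norm (stft \<phi> u x \<xi>) \<le> C * exp (r * norm \<xi> powr (1 / s))" if r: "0 < r" for r
    proof -
      \<comment> \<open>Small enough for the target rate \<open>r\<close> and for the decay rate of
        the window at once.\<close>
      define \<epsilon> where "\<epsilon> = min (r / 2) (\<rho> / 2) / ?k"
      have \<epsilon>: "0 < \<epsilon>" "\<epsilon> * ?k \<le> \<rho> / 2" "2 * (\<epsilon> * ?k) \<le> r" using r D(1) k by (simp_all add: \<epsilon>_def)
      have "\<forall>\<epsilon>>0. \<exists>C. \<forall>\<alpha>\<in>dual_lattice e. norm (c \<alpha>) \<le> C * exp (\<epsilon> * norm \<alpha> powr (1 / s))"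
        using g True by (simp add: coeff_growth_def)
      with \<epsilon>(1) obtain C where "\<forall>\<alpha>\<in>dual_lattice e. norm (c \<alpha>) \<le> C * exp (\<epsilon> * norm \<alpha> powr (1 / s))" by blast
      from *[OF \<epsilon>(1,2) D this] obtain C' where C': "0 < C'" "\<And>x \<xi>. norm (stft \<phi> u x \<xi>) \<le> C' * exp (2 * (\<epsilon> * ?k) * norm \<xi> powr (1 / s))"
        by blast
      from exp_weight_mono[OF C'(2) \<epsilon>(3)] C'(1) show ?thesis by (intro exI[of _ "\<bar>C'\<bar>"]) simp
    qed
    then show ?thesis using True by simp
  next
    case False
    then have "\<exists>\<epsilon>>0. \<exists>C. \<forall>\<alpha>\<in>dual_lattice e. norm (c \<alpha>) \<le> C * exp (\<epsilon> * norm \<alpha> powr (1 / s))"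
      using g by (simp add: coeff_growth_def)
    then obtain \<epsilon> C where \<epsilon>: "0 < \<epsilon>" and C: "\<forall>\<alpha>\<in>dual_lattice e. norm (c \<alpha>) \<le> C * exp (\<epsilon> * norm \<alpha> powr (1 / s))" by blast
    \<comment> \<open>The least rate allowed by \<open>stft_growth\<close>, available since the
      window decays at every rate.\<close>
    define \<rho> where "\<rho> = 2 * (\<epsilon> * ?k)"
    have \<rho>: "0 < \<rho>" "\<epsilon> * ?k \<le> \<rho> / 2" using \<epsilon> k by (simp_all add: \<rho>_def)
    have "\<forall>r>0. \<exists>C>0. \<forall>\<eta>. norm (ftrans \<phi> \<eta>) \<le> C * exp (- r * norm \<eta> powr (1 / s))"
      using ftrans_exp_decay[OF s t \<phi>] False by simp
    with \<rho>(1) obtain D where D: "0 < D" "\<forall>\<eta>. norm (ftrans \<phi> \<eta>) \<le> D * exp (- \<rho> * norm \<eta> powr (1 / s))" by blast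
    from *[OF \<epsilon> \<rho>(2,1) D C] have "\<exists>C>0. \<forall>x \<xi>. norm (stft \<phi> u x \<xi>) \<le> C * exp (\<rho> * norm \<xi> powr (1 / s))"
      unfolding \<rho>_def .
    then show ?thesis using False \<rho>(1) by auto
  qed
qed

lemma coeff_decay_imp_stft_decay:
  assumes \<phi>: "\<phi> \<in> GS_test roum s t" and t: "0 < t"
    and ser: "\<forall>\<psi>\<in>GS_test b s0 t0. ((\<lambda>\<alpha>. c \<alpha> * ftrans \<psi> \<alpha>) has_sum u \<psi>) (dual_lattice e)"
    and g: "coeff_decay roum e s c"
  shows "if roum then \<exists>r>0. \<exists>C>0. \<forall>x \<xi>. norm (stft \<phi> u x \<xi>) \<le> C * exp (- r * norm \<xi> powr (1 / s))
    else \<forall>r>0. \<exists>C>0. \<forall>x \<xi>. norm (stft \<phi> u x \<xi>) \<le> C * exp (- r * norm \<xi> powr (1 / s))"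
proof -
  let ?k = "2 powr (1 / s)"
  have k: "0 < ?k" by simp
  have ser': "((\<lambda>\<alpha>. c \<alpha> * ftrans (stft_window \<phi> x \<xi>) \<alpha>) has_sum u (stft_window \<phi> x \<xi>)) (dual_lattice e)" for x \<xi>
    using ser win by blast
  have *: "\<exists>C>0. \<forall>x \<xi>. norm (stft \<phi> u x \<xi>) \<le> C * exp (- (\<delta> / (2 * ?k)) * norm \<xi> powr (1 / s))"
    if \<delta>: "0 < \<delta>" "\<delta> \<le> \<rho>" "\<delta> \<le> r" and D: "0 < D" "\<forall>\<eta>. norm (ftrans \<phi> \<eta>) \<le> D * exp (- \<rho> * norm \<eta> powr (1 / s))"
      and C: "\<forall>\<alpha>\<in>dual_lattice e. norm (c \<alpha>) \<le> C * exp (- r * norm \<alpha> powr (1 / s))" for \<delta> \<rho> r C D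
  proof (rule stft_decay[OF basis s window_measurable ser', where C = "\<bar>C\<bar>" and D = "\<bar>D\<bar>"])
    show "norm (c \<alpha>) \<le> \<bar>C\<bar> * exp (- \<delta> * norm \<alpha> powr (1 / s))" if "\<alpha> \<in> dual_lattice e" for \<alpha>
      by (rule exp_weight_mono[OF C[rule_format, OF that]]) (use \<delta> in simp)
    show "norm (ftrans \<phi> \<eta>) \<le> \<bar>D\<bar> * exp (- \<delta> * norm \<eta> powr (1 / s))" for \<eta>
      by (rule exp_weight_mono[OF D(2)[rule_format]]) (use \<delta> in simp)
  qed (use \<delta> D in simp_all)
  show ?thesis
  proof (cases roum)
    case True
    have "\<exists>r>0. \<exists>C>0. \<forall>\<eta>. norm (ftrans \<phi> \<eta>) \<le> C * exp (- r * norm \<eta> powr (1 / s))"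
      using ftrans_exp_decay[OF s t \<phi>] True by simp
    then obtain \<rho> D where D: "0 < \<rho>" "0 < D" "\<forall>\<eta>. norm (ftrans \<phi> \<eta>) \<le> D * exp (- \<rho> * norm \<eta> powr (1 / s))" by blast
    have "\<exists>r>0. \<exists>C. \<forall>\<alpha>\<in>dual_lattice e. norm (c \<alpha>) \<le> C * exp (- r * norm \<alpha> powr (1 / s))"
      using g True by (simp add: coeff_decay_def)
    then obtain r C where C: "0 < r" "\<forall>\<alpha>\<in>dual_lattice e. norm (c \<alpha>) \<le> C * exp (- r * norm \<alpha> powr (1 / s))" by blast
    have \<delta>: "0 < min \<rho> r" "min \<rho> r \<le> \<rho>" "min \<rho> r \<le> r" using C(1) D(1) by simp_all
    have "0 < min \<rho> r / (2 * ?k)" using \<delta> k by simp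
    with *[OF \<delta> D(2,3) C(2)] have "\<exists>r>0. \<exists>C>0. \<forall>x \<xi>. norm (stft \<phi> u x \<xi>) \<le> C * exp (- r * norm \<xi> powr (1 / s))" by blast
    then show ?thesis using True by simp
  next
    case False
    have "\<exists>C>0. \<forall>x \<xi>. norm (stft \<phi> u x \<xi>) \<le> C * exp (- r * norm \<xi> powr (1 / s))" if r: "0 < r" for r
    proof -
      \<comment> \<open>Compensates in advance the loss \<open>1 / (2 * 2 powr (1 / s))\<close> of
        \<open>stft_decay\<close>.\<close>
      define \<delta> where "\<delta> = r * (2 * ?k)"
      have \<delta>: "0 < \<delta>" using r k by (simp add: \<delta>_def)
      have e: "\<delta> / (2 * ?k) = r" by (simp add: \<delta>_def)
      have "\<forall>r>0. \<exists>C>0. \<forall>\<eta>. norm (ftrans \<phi> \<eta>) \<le> C * exp (- r * norm \<eta> powr (1 / s))"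
        using ftrans_exp_decay[OF s t \<phi>] False by simp
      with \<delta> obtain D where D: "0 < D" "\<forall>\<eta>. norm (ftrans \<phi> \<eta>) \<le> D * exp (- \<delta> * norm \<eta> powr (1 / s))" by blast
      have "\<forall>r>0. \<exists>C. \<forall>\<alpha>\<in>dual_lattice e. norm (c \<alpha>) \<le> C * exp (- r * norm \<alpha> powr (1 / s))"
        using g False by (simp add: coeff_decay_def)
      with \<delta> obtain C where C: "\<forall>\<alpha>\<in>dual_lattice e. norm (c \<alpha>) \<le> C * exp (- \<delta> * norm \<alpha> powr (1 / s))" by blast
      from *[OF \<delta> order_refl order_refl D C] show ?thesis unfolding e .
    qed
    then show ?thesis using False by simp
  qed
qed

text \<open>The coefficients are fixed before the rate, so one family serves growth and decay at all
  rates. The shift by \<eta> costs a constant and the factor \<open>2 powr (1 / s)\<close> in the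
  rate.\<close>

lemma coeff_bounds_of_stft:
  "\<exists>c. (\<forall>\<psi>\<in>GS_test b s0 t0. ((\<lambda>\<alpha>. c \<alpha> * ftrans \<psi> \<alpha>) has_sum u \<psi>) (dual_lattice e)) \<and>
    (\<forall>r>0. (\<exists>C>0. \<forall>x \<xi>. norm (stft \<phi> u x \<xi>) \<le> C * exp (r * norm \<xi> powr (1 / s))) \<longrightarrow>
      (\<exists>C. \<forall>\<alpha>\<in>dual_lattice e. norm (c \<alpha>) \<le> C * exp ((r * 2 powr (1 / s)) * norm \<alpha> powr (1 / s)))) \<and>
    (\<forall>r>0. (\<exists>C>0. \<forall>x \<xi>. norm (stft \<phi> u x \<xi>) \<le> C * exp (- r * norm \<xi> powr (1 / s))) \<longrightarrow>
      (\<exists>C. \<forall>\<alpha>\<in>dual_lattice e. norm (c \<alpha>) \<le> C * exp (- (r / 2 powr (1 / s)) * norm \<alpha> powr (1 / s))))"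
proof -
  let ?p = "1 / s" and ?k = "2 powr (1 / s)"
  have k: "0 < ?k" by simp
  obtain c \<eta> K where ser: "\<forall>\<psi>\<in>GS_test b s0 t0. ((\<lambda>\<alpha>. c \<alpha> * ftrans \<psi> \<alpha>) has_sum u \<psi>) (dual_lattice e)"
    and cK: "\<And>\<alpha> B. \<alpha> \<in> dual_lattice e \<Longrightarrow> (\<And>x. norm (stft \<phi> u x (\<alpha> + \<eta>)) \<le> B) \<Longrightarrow> norm (c \<alpha>) \<le> K * B"
    using fourier_expansion[OF basis s0 t0 u per win nz] by blast
  have growth: "\<exists>C. \<forall>\<alpha>\<in>dual_lattice e. norm (c \<alpha>) \<le> C * exp ((r * ?k) * norm \<alpha> powr ?p)"
    if r: "0 < r" and C: "0 < C" "\<forall>x \<xi>. norm (stft \<phi> u x \<xi>) \<le> C * exp (r * norm \<xi> powr ?p)" for r C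
  proof -
    have "norm (c \<alpha>) \<le> (\<bar>K\<bar> * C * exp ((r * ?k) * norm \<eta> powr ?p)) * exp ((r * ?k) * norm \<alpha> powr ?p)"
      if \<alpha>: "\<alpha> \<in> dual_lattice e" for \<alpha>
    proof -
      have "norm (c \<alpha>) \<le> K * (C * exp (r * norm (\<alpha> + \<eta>) powr ?p))" by (rule cK[OF \<alpha>]) (use C in blast)
      also have "\<dots> \<le> \<bar>K\<bar> * (C * exp (r * norm (\<alpha> + \<eta>) powr ?p))" using C(1) by (intro mult_right_mono) simp_all
      also have "\<dots> \<le> \<bar>K\<bar> * (C * (exp ((r * ?k) * norm \<eta> powr ?p) * exp ((r * ?k) * norm \<alpha> powr ?p)))"
      proof -
        have "norm (\<alpha> + \<eta>) powr ?p \<le> ?k * (norm \<alpha> powr ?p + norm \<eta> powr ?p)" using s by (intro norm_add_powr_le) simp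
        from mult_left_mono[OF this less_imp_le[OF r]]
        have "r * norm (\<alpha> + \<eta>) powr ?p \<le> (r * ?k) * norm \<eta> powr ?p + (r * ?k) * norm \<alpha> powr ?p" by (simp add: algebra_simps)
        then show ?thesis unfolding exp_add[symmetric] using C(1) by (intro mult_left_mono) simp_all
      qed
      finally show ?thesis by (simp only: mult_ac)
    qed
    then show ?thesis by blast
  qed
  have decay: "\<exists>C. \<forall>\<alpha>\<in>dual_lattice e. norm (c \<alpha>) \<le> C * exp (- (r / ?k) * norm \<alpha> powr ?p)"
    if r: "0 < r" and C: "0 < C" "\<forall>x \<xi>. norm (stft \<phi> u x \<xi>) \<le> C * exp (- r * norm \<xi> powr ?p)" for r C
  proof -
    have "norm (c \<alpha>) \<le> (\<bar>K\<bar> * C * exp (r * norm \<eta> powr ?p)) * exp (- (r / ?k) * norm \<alpha> powr ?p)"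
      if \<alpha>: "\<alpha> \<in> dual_lattice e" for \<alpha>
    proof -
      have "norm (c \<alpha>) \<le> K * (C * exp (- r * norm (\<alpha> + \<eta>) powr ?p))" by (rule cK[OF \<alpha>]) (use C in blast)
      also have "\<dots> \<le> \<bar>K\<bar> * (C * exp (- r * norm (\<alpha> + \<eta>) powr ?p))" using C(1) by (intro mult_right_mono) simp_all
      also have "\<dots> \<le> \<bar>K\<bar> * (C * (exp (r * norm \<eta> powr ?p) * exp (- (r / ?k) * norm \<alpha> powr ?p)))"
      proof -
        \<comment> \<open>Decay calls for a lower bound of \<open>norm (\<alpha> + \<eta>)\<close>,
          so \<alpha> is written as the sum of \<alpha> + \<eta> and -\<eta>.\<close>
        have "norm \<alpha> powr ?p \<le> ?k * (norm (\<alpha> + \<eta>) powr ?p + norm \<eta> powr ?p)"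
          using norm_add_powr_le[of ?p "\<alpha> + \<eta>" "- \<eta>"] s by simp
        from mult_left_mono[OF this, of "r / ?k"] r
        have "(r / ?k) * norm \<alpha> powr ?p \<le> r * (norm (\<alpha> + \<eta>) powr ?p + norm \<eta> powr ?p)" by simp
        then have "- r * norm (\<alpha> + \<eta>) powr ?p \<le> r * norm \<eta> powr ?p + - (r / ?k) * norm \<alpha> powr ?p" by (simp add: algebra_simps)
        then show ?thesis unfolding exp_add[symmetric] using C(1) by (intro mult_left_mono) simp_all
      qed
      finally show ?thesis by (simp only: mult_ac)
    qed
    then show ?thesis by blast
  qed
  show ?thesis
    by (rule exI[of _ c]) (use ser growth decay in blast)
qed

text \<open>The flag \<open>roum\<close> selects the class of the window and of the Gevrey space,
  whereas \<open>b\<close> selects the space on which \<open>u\<close> acts. Membership of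
  \<open>u\<close> brings its own coefficients, to which the bounds on \<open>stft\<close> apply;
  the converse uses the coefficients of the Fourier expansion.\<close>

lemma gevrey_stft_characterization:
  assumes \<phi>: "\<phi> \<in> GS_test roum s t" and t: "0 < t"
  shows "in_gevrey_per_dual roum e s b s0 t0 u \<longleftrightarrow>
      (if roum then \<forall>r>0. \<exists>C>0. \<forall>x \<xi>. norm (stft \<phi> u x \<xi>) \<le> C * exp (r * norm \<xi> powr (1 / s))
       else \<exists>r>0. \<exists>C>0. \<forall>x \<xi>. norm (stft \<phi> u x \<xi>) \<le> C * exp (r * norm \<xi> powr (1 / s)))"
    (is "_ \<longleftrightarrow> ?G")
    and "in_gevrey_per roum e s b s0 t0 u \<longleftrightarrow>
      (if roum then \<exists>r>0. \<exists>C>0. \<forall>x \<xi>. norm (stft \<phi> u x \<xi>) \<le> C * exp (- r * norm \<xi> powr (1 / s))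
       else \<forall>r>0. \<exists>C>0. \<forall>x \<xi>. norm (stft \<phi> u x \<xi>) \<le> C * exp (- r * norm \<xi> powr (1 / s)))"
    (is "_ \<longleftrightarrow> ?D")
proof -
  let ?k = "2 powr (1 / s)"
  have k: "0 < ?k" by simp
  obtain c where ser: "\<forall>\<psi>\<in>GS_test b s0 t0. ((\<lambda>\<alpha>. c \<alpha> * ftrans \<psi> \<alpha>) has_sum u \<psi>) (dual_lattice e)"
    and growth: "\<And>r. 0 < r \<Longrightarrow> \<exists>C>0. \<forall>x \<xi>. norm (stft \<phi> u x \<xi>) \<le> C * exp (r * norm \<xi> powr (1 / s)) \<Longrightarrow>
      \<exists>C. \<forall>\<alpha>\<in>dual_lattice e. norm (c \<alpha>) \<le> C * exp ((r * ?k) * norm \<alpha> powr (1 / s))"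
    and decay: "\<And>r. 0 < r \<Longrightarrow> \<exists>C>0. \<forall>x \<xi>. norm (stft \<phi> u x \<xi>) \<le> C * exp (- r * norm \<xi> powr (1 / s)) \<Longrightarrow>
      \<exists>C. \<forall>\<alpha>\<in>dual_lattice e. norm (c \<alpha>) \<le> C * exp (- (r / ?k) * norm \<alpha> powr (1 / s))"
    using coeff_bounds_of_stft by blast
  show "in_gevrey_per_dual roum e s b s0 t0 u \<longleftrightarrow> ?G"
  proof
    assume "in_gevrey_per_dual roum e s b s0 t0 u"
    then show ?G unfolding in_gevrey_per_dual_iff using coeff_growth_imp_stft_growth[OF \<phi> t] by blast
  next
    assume G: ?G
    have "coeff_growth roum e s c"
    proof (cases roum)
      case True
      have "\<exists>C. \<forall>\<alpha>\<in>dual_lattice e. norm (c \<alpha>) \<le> C * exp (\<epsilon> * norm \<alpha> powr (1 / s))" if \<epsilon>: "0 < \<epsilon>" for \<epsilon>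
      proof -
        \<comment> \<open>The rate is divided beforehand by the loss in \<open>growth\<close>, which
          is possible as every rate is available.\<close>
        have r: "0 < \<epsilon> / ?k" using \<epsilon> k by simp
        have "\<forall>r>0. \<exists>C>0. \<forall>x \<xi>. norm (stft \<phi> u x \<xi>) \<le> C * exp (r * norm \<xi> powr (1 / s))" using G True by simp
        with r have "\<exists>C>0. \<forall>x \<xi>. norm (stft \<phi> u x \<xi>) \<le> C * exp ((\<epsilon> / ?k) * norm \<xi> powr (1 / s))" by blast
        from growth[OF r this] show ?thesis by simp
      qed
      then show ?thesis using True by (simp add: coeff_growth_def)
    next
      case False
      then have "\<exists>r>0. \<exists>C>0. \<forall>x \<xi>. norm (stft \<phi> u x \<xi>) \<le> C * exp (r * norm \<xi> powr (1 / s))" using G by simp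
      then obtain r where r: "0 < r" "\<exists>C>0. \<forall>x \<xi>. norm (stft \<phi> u x \<xi>) \<le> C * exp (r * norm \<xi> powr (1 / s))" by blast
      have "0 < r * ?k" using r(1) k by simp
      with growth[OF r] have "\<exists>\<epsilon>>0. \<exists>C. \<forall>\<alpha>\<in>dual_lattice e. norm (c \<alpha>) \<le> C * exp (\<epsilon> * norm \<alpha> powr (1 / s))" by blast
      then show ?thesis using False by (simp add: coeff_growth_def)
    qed
    then show "in_gevrey_per_dual roum e s b s0 t0 u" unfolding in_gevrey_per_dual_iff using ser by blast
  qed
  show "in_gevrey_per roum e s b s0 t0 u \<longleftrightarrow> ?D"
  proof
    assume "in_gevrey_per roum e s b s0 t0 u"
    from coeff_decay_if_in_gevrey_per[OF basis s s0 t0 this]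
    show ?D using coeff_decay_imp_stft_decay[OF \<phi> t] by blast
  next
    assume D: ?D
    have "coeff_decay roum e s c"
    proof (cases roum)
      case True
      then have "\<exists>r>0. \<exists>C>0. \<forall>x \<xi>. norm (stft \<phi> u x \<xi>) \<le> C * exp (- r * norm \<xi> powr (1 / s))" using D by simp
      then obtain r where r: "0 < r" "\<exists>C>0. \<forall>x \<xi>. norm (stft \<phi> u x \<xi>) \<le> C * exp (- r * norm \<xi> powr (1 / s))" by blast
      have "0 < r / ?k" using r(1) k by simp
      with decay[OF r] have "\<exists>r>0. \<exists>C. \<forall>\<alpha>\<in>dual_lattice e. norm (c \<alpha>) \<le> C * exp (- r * norm \<alpha> powr (1 / s))" by blast
      then show ?thesis using True by (simp add: coeff_decay_def)
    next
      case False
      have "\<exists>C. \<forall>\<alpha>\<in>dual_lattice e. norm (c \<alpha>) \<le> C * exp (- q * norm \<alpha> powr (1 / s))" if q: "0 < q" for q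
      proof -
        have r: "0 < q * ?k" using q k by simp
        have "\<forall>r>0. \<exists>C>0. \<forall>x \<xi>. norm (stft \<phi> u x \<xi>) \<le> C * exp (- r * norm \<xi> powr (1 / s))" using D False by simp
        with r have "\<exists>C>0. \<forall>x \<xi>. norm (stft \<phi> u x \<xi>) \<le> C * exp (- (q * ?k) * norm \<xi> powr (1 / s))" by blast
        from decay[OF r this] show ?thesis by simp
      qed
      then show ?thesis using False by (simp add: coeff_decay_def)
    qed
    then show "in_gevrey_per roum e s b s0 t0 u"
      by (rule in_gevrey_per_if_coeff_decay[OF basis s s0 t0]) (use ser in blast)
  qed
qed

end

theorem theorem3p4:
  fixes e :: "'n::finite \<Rightarrow> real^'n"
    and s t s0 t0 :: real and b :: bool
    and \<phi> :: "real^'n \<Rightarrow> complex"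
    and u :: "(real^'n \<Rightarrow> complex) \<Rightarrow> complex"
  assumes basis: "inj e" "independent (range e)"
    and s_pos: "s > 0" and t_pos: "t > 0"
    and phi_nz: "\<phi> \<noteq> (\<lambda>_. 0)"
    and s0_pos: "s0 > 0" and t0_pos: "t0 > 0"
    and dist: "GS_dual b s0 t0 u"
    and per: "periodic_dist e b s0 t0 u"
    and stft_def: "\<forall>x \<xi>. stft_window \<phi> x \<xi> \<in> GS_test b s0 t0"
  shows
   "(\<phi> \<in> GS_S s t \<longrightarrow>
      (in_gevrey_per_dual True e s b s0 t0 u \<longleftrightarrow>
         (\<forall>r>0. \<exists>C>0. \<forall>x \<xi>. norm (stft \<phi> u x \<xi>) \<le> C * exp (r * norm \<xi> powr (1 / s)))) \<and>
      (in_gevrey_per True e s b s0 t0 u \<longleftrightarrow>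
         (\<exists>r>0. \<exists>C>0. \<forall>x \<xi>. norm (stft \<phi> u x \<xi>) \<le> C * exp (- r * norm \<xi> powr (1 / s))))) \<and>
    (\<phi> \<in> GS_Sigma s t \<longrightarrow>
      (in_gevrey_per_dual False e s b s0 t0 u \<longleftrightarrow>
         (\<exists>r>0. \<exists>C>0. \<forall>x \<xi>. norm (stft \<phi> u x \<xi>) \<le> C * exp (r * norm \<xi> powr (1 / s)))) \<and>
      (in_gevrey_per False e s b s0 t0 u \<longleftrightarrow>
         (\<forall>r>0. \<exists>C>0. \<forall>x \<xi>. norm (stft \<phi> u x \<xi>) \<le> C * exp (- r * norm \<xi> powr (1 / s)))))"
proof -
  have u: "dual_functional b s0 t0 u" by (rule GS_dual_imp_dual_functional[OF dist s0_pos t0_pos])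
  note main = gevrey_stft_characterization[OF basis s_pos s0_pos t0_pos stft_def phi_nz u per _ t_pos]
  show ?thesis
  proof (intro conjI impI)
    assume "\<phi> \<in> GS_S s t"
    then have \<phi>: "\<phi> \<in> GS_test True s t" by (simp add: GS_test_def)
    show "in_gevrey_per_dual True e s b s0 t0 u \<longleftrightarrow>
        (\<forall>r>0. \<exists>C>0. \<forall>x \<xi>. norm (stft \<phi> u x \<xi>) \<le> C * exp (r * norm \<xi> powr (1 / s)))"
      by (rule main(1)[OF \<phi>, unfolded if_True])
    show "in_gevrey_per True e s b s0 t0 u \<longleftrightarrow>
        (\<exists>r>0. \<exists>C>0. \<forall>x \<xi>. norm (stft \<phi> u x \<xi>) \<le> C * exp (- r * norm \<xi> powr (1 / s)))"
      by (rule main(2)[OF \<phi>, unfolded if_True])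
  next
    assume "\<phi> \<in> GS_Sigma s t"
    then have \<phi>: "\<phi> \<in> GS_test False s t" by (simp add: GS_test_def)
    show "in_gevrey_per_dual False e s b s0 t0 u \<longleftrightarrow>
        (\<exists>r>0. \<exists>C>0. \<forall>x \<xi>. norm (stft \<phi> u x \<xi>) \<le> C * exp (r * norm \<xi> powr (1 / s)))"
      by (rule main(1)[OF \<phi>, unfolded if_False])
    show "in_gevrey_per False e s b s0 t0 u \<longleftrightarrow>
        (\<forall>r>0. \<exists>C>0. \<forall>x \<xi>. norm (stft \<phi> u x \<xi>) \<le> C * exp (- r * norm \<xi> powr (1 / s)))"
      by (rule main(2)[OF \<phi>, unfolded if_False])
  qed
qed

end
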